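(* Let $n\ge1$, let $a_0\ge0$, and let $a:(0,\infty)\to\mathbb R$ be bounded on every set $[\epsilon,\infty)$, $\epsilon>0$, and integrable on $(0,1)$. Put $A_\infty=a_0+\int_0^\infty a(r)\,dr$, with $0<A_\infty<\infty$. Assume that $u_0\in L^1(\mathbb R^n)\cap H^s(\mathbb R^n)$ for some $s\ge0$, and that for some $\alpha>0$ the Laplace transform $\tilde a$ can be extended to the half plane $\{z\in\mathbb C:\Re z\ge-\alpha\}$, and either $a_0>0$ and $a_0+\Re\,\tilde a(i\omega)>0$ for all $\omega\in\mathbb R$, or $\Re\,\tilde a(-\alpha+i\omega)\ge0$ for all $\omega\in\mathbb R$. Let $u\in C([0,\infty),H^s(\mathbb R^n))$ be the unique distributional solution of $$u_t=a_0\Delta u+\int_0^ta(t-r)\Delta u(\cdot,r)\,dr,\qquad u(\cdot,0)=u_0 .$$ Then, as $t\to\infty$, $$\|u(\cdot,t)-w(\cdot,t)\|_{H^s}=o\big(t^{-n/4}\big),$$ where, with $U_0=\int_{\mathbb R^n}u_0(x)\,dx$, $$w(x,t)=U_0\,(4A_\infty\pi t)^{-n/2}\exp\!\big(-|x|^2/(4A_\infty t)\big)$$ is the solution of the heat equation $w_t=A_\infty\Delta w$, $w(\cdot,0)=U_0\delta_0$.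
   Context: $\tilde a(z)=\int_0^\infty e^{-zt}a(t)\,dt$ is the Laplace transform. Fourier transform: $\hat f(\xi)=\int_{\mathbb R^n}e^{-ix\cdot\xi}f(x)\,dx$. The solution $u$: its Fourier transform is $\hat u(\xi,t)=z(|\xi|^2,t)\hat u_0(\xi)$, where, with $A(t)=a_0+\int_0^ta(r)\,dr$, for $\lambda\ge0$ the function $z(\lambda,\cdot)$ is the solution of $z(\lambda,t)+\lambda\int_0^tA(t-r)z(\lambda,r)\,dr=1$.
   Formalization: The extension of the Laplace transform to Re z ≥ -α is taken to be analytic inside, continuous up to the boundary and bounded (automatic if the integral converges absolutely there); for an arbitrary, unbounded analytic continuation the claim fails. *)

theory Defs
  imports "HOL-Analysis.Analysis" "HOL-Library.Landau_Symbols"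
begin

section \<open>Laplace transform\<close>

definition laplace :: "(real \<Rightarrow> real) \<Rightarrow> complex \<Rightarrow> complex" where
  "laplace a z = (LINT t:{0<..}|lborel. exp (- z * of_real t) * of_real (a t))"

text \<open>
  \<open>F\<close> extends the Laplace transform of \<open>a\<close> to the closed half plane \<open>Re z \<ge> - \<alpha>\<close>: it is analytic
  inside, continuous up to the boundary and bounded. Boundedness holds in particular when the
  integral defining the transform converges absolutely on the closed half plane. It cannot
  be dropped: the kernels \<open>\<epsilon> (1 + t) powr (- p) * sin (t powr q)\<close> with \<open>p, q > 1\<close> have entire, but
  rapidly growing, transforms, and their high-frequency modes decay only algebraically.
\<close>
definition laplace_extension :: "real \<Rightarrow> (real \<Rightarrow> real) \<Rightarrow> (complex \<Rightarrow> complex) \<Rightarrow> bool" where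
  "laplace_extension \<alpha> a F \<longleftrightarrow>
     F holomorphic_on {z. Re z > - \<alpha>} \<and>
     continuous_on {z. Re z \<ge> - \<alpha>} F \<and>
     bounded (F ` {z. Re z \<ge> - \<alpha>}) \<and>
     (\<forall>z. Re z > 0 \<longrightarrow> F z = laplace a z)"


section \<open>Fourier transform and Sobolev spaces\<close>

definition fourier :: "('a::euclidean_space \<Rightarrow> complex) \<Rightarrow> 'a \<Rightarrow> complex" where
  "fourier f \<xi> = (LINT x|lborel. exp (- \<i> * of_real (x \<bullet> \<xi>)) * f x)"

definition square_integrable :: "('a::euclidean_space \<Rightarrow> complex) \<Rightarrow> bool" where
  "square_integrable f \<longleftrightarrow>
     f \<in> borel_measurable lborel \<and> integrable lborel (\<lambda>x. (cmod (f x))\<^sup>2)"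

text \<open>
  The Fourier--Plancherel transform of a square integrable \<open>f\<close>: the limit in \<open>L\<^sup>2\<close> of the Fourier
  integrals over balls. It is determined up to null sets, whence a relation. The integral is the
  extended nonnegative one, so that convergence to 0 entails finiteness.
\<close>
definition is_fourier_L2 :: "('a::euclidean_space \<Rightarrow> complex) \<Rightarrow> ('a \<Rightarrow> complex) \<Rightarrow> bool" where
  "is_fourier_L2 f F \<longleftrightarrow>
     square_integrable f \<and> square_integrable F \<and>
     ((\<lambda>R::real. \<integral>\<^sup>+\<xi>. ennreal ((cmod (fourier (\<lambda>x. indicator (ball 0 R) x * f x) \<xi> - F \<xi>))\<^sup>2) \<partial>lborel)
        \<longlongrightarrow> 0) at_top"

definition sobolev :: "real \<Rightarrow> ('a::euclidean_space \<Rightarrow> complex) set" where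
  "sobolev s = {f. \<exists>F. is_fourier_L2 f F \<and>
     integrable lborel (\<lambda>\<xi>. (1 + (norm \<xi>)\<^sup>2) powr s * (cmod (F \<xi>))\<^sup>2)}"

text \<open>Meaningful on \<open>sobolev s\<close>, where it does not depend on the chosen version of the transform.\<close>
definition sobolev_norm :: "real \<Rightarrow> ('a::euclidean_space \<Rightarrow> complex) \<Rightarrow> real" where
  "sobolev_norm s f =
     sqrt (LINT \<xi>|lborel. (1 + (norm \<xi>)\<^sup>2) powr s * (cmod ((SOME F. is_fourier_L2 f F) \<xi>))\<^sup>2)"

text \<open>
  \<open>u \<in> C([0,\<infinity>), H\<^sup>s)\<close>; each \<open>u t\<close> is an arbitrary representative of its class modulo null sets.
\<close>
definition continuous_into_sobolev :: "real \<Rightarrow> (real \<Rightarrow> 'a::euclidean_space \<Rightarrow> complex) \<Rightarrow> bool" where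
  "continuous_into_sobolev s u \<longleftrightarrow>
     (\<forall>t\<ge>0. u t \<in> sobolev s) \<and>
     (\<forall>t\<^sub>0\<ge>0. ((\<lambda>t. sobolev_norm s (\<lambda>x. u t x - u t\<^sub>0 x)) \<longlongrightarrow> 0) (at t\<^sub>0 within {0..}))"


section \<open>Distributional solutions\<close>

definition directional_deriv ::
    "'a::euclidean_space \<Rightarrow> ('a \<Rightarrow> 'b::real_normed_vector) \<Rightarrow> 'a \<Rightarrow> 'b" where
  "directional_deriv v f x = frechet_derivative f (at x) v"

primrec times_cont_diff :: "nat \<Rightarrow> ('a::euclidean_space \<Rightarrow> 'b::real_normed_vector) \<Rightarrow> bool" where
  "times_cont_diff 0 f \<longleftrightarrow> continuous_on UNIV f"
| "times_cont_diff (Suc k) f \<longleftrightarrow>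
     (\<forall>x. f differentiable (at x)) \<and> (\<forall>v. times_cont_diff k (directional_deriv v f))"

definition smooth :: "('a::euclidean_space \<Rightarrow> 'b::real_normed_vector) \<Rightarrow> bool" where
  "smooth f \<longleftrightarrow> (\<forall>k. times_cont_diff k f)"

definition laplacian :: "('a::euclidean_space \<Rightarrow> complex) \<Rightarrow> 'a \<Rightarrow> complex" where
  "laplacian f x = (\<Sum>b\<in>Basis. directional_deriv b (directional_deriv b f) x)"

definition test_function :: "(real \<times> 'a::euclidean_space \<Rightarrow> complex) \<Rightarrow> bool" where
  "test_function \<phi> \<longleftrightarrow>
     smooth \<phi> \<and> (\<exists>K. compact K \<and> K \<subseteq> {0<..} \<times> UNIV \<and> (\<forall>p. p \<notin> K \<longrightarrow> \<phi> p = 0))"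

definition pairing :: "('a::euclidean_space \<Rightarrow> complex) \<Rightarrow> ('a \<Rightarrow> complex) \<Rightarrow> complex" where
  "pairing f \<psi> = (LINT x|lborel. f x * \<psi> x)"

text \<open>
  \<open>u\<^sub>t = a\<^sub>0 \<Delta>u + \<integral>\<^sub>0\<^sup>t a(t - r) \<Delta>u(r) dr\<close> in the sense of distributions on \<open>(0,\<infinity>) \<times> \<real>\<^sup>n\<close>, and
  \<open>u(0) = u\<^sub>0\<close>. The memory integral is one of distribution-valued functions, that is, it is paired with
  a test function under the integral sign; with the spatial integrals inside, only the classes of the
  \<open>u t\<close> modulo null sets enter, and no joint measurability of the representatives is required.
\<close>
definition distributional_solution ::
    "real \<Rightarrow> (real \<Rightarrow> real) \<Rightarrow> ('a::euclidean_space \<Rightarrow> complex) \<Rightarrow> (real \<Rightarrow> 'a \<Rightarrow> complex) \<Rightarrow> bool" where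
  "distributional_solution a\<^sub>0 a u\<^sub>0 u \<longleftrightarrow>
     (AE x in lborel. u 0 x = u\<^sub>0 x) \<and>
     (\<forall>\<phi>. test_function \<phi> \<longrightarrow>
        - (LINT t:{0<..}|lborel. pairing (u t) (\<lambda>x. vector_derivative (\<lambda>\<tau>. \<phi> (\<tau>, x)) (at t))) =
        (LINT t:{0<..}|lborel.
           of_real a\<^sub>0 * pairing (u t) (laplacian (\<lambda>x. \<phi> (t, x))) +
           (LINT r:{0<..<t}|lborel.
              of_real (a (t - r)) * pairing (u r) (laplacian (\<lambda>x. \<phi> (t, x))))))"


section \<open>Gaussian profile\<close>

definition heat_profile ::
    "real \<Rightarrow> complex \<Rightarrow> real \<Rightarrow> 'a::euclidean_space \<Rightarrow> complex" where
  "heat_profile A U t x =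
     U * of_real ((4 * A * pi * t) powr (- real DIM('a) / 2) * exp (- (norm x)\<^sup>2 / (4 * A * t)))"

end

theory Submission
  imports Defs "HOL-Probability.Probability" "HOL-Complex_Analysis.Complex_Analysis" "HOL-Real_Asymp.Real_Asymp"
begin

text \<open>
  Testing the equation with products of a time cutoff and a truncated band-limited function turns it
  into a Volterra equation for each frequency: the transform of \<open>u(t)\<close> is \<open>z(|\<xi>|\<^sup>2, t)\<close> times that of
  \<open>u\<^sub>0\<close>, as a Gronwall argument on bounded frequencies gives uniqueness. The key is the decay
  \<open>(min \<mu> 1 * t) ^ N * |z(\<mu>, t)| \<le> K\<close>, uniform in \<open>\<mu>\<close>. Up to scaling, the Laplace transform of
  \<open>z(\<mu>, \<cdot>)\<close> is a resolvent \<open>1 / (\<zeta> + P(\<zeta>))\<close>, where \<open>P\<close> is a multiple of \<open>a\<^sub>0\<close> plus the transform of \<open>a\<close>.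
  The hypotheses (with the Schwarz--Pick lemma in the second case) make \<open>Re P\<close> positive and dominate
  the derivatives of \<open>P\<close>. The real part of the resolvent is then positive with integral exactly \<open>\<pi>\<close>
  over each vertical line, and it controls the derivatives of the resolvent in \<open>L\<^sup>1\<close>, that is,
  \<open>t ^ N * z\<close>. Low frequencies are treated by the scaling \<open>\<xi> = \<eta> / sqrt t\<close> and dominated
  convergence, since \<open>z(|\<eta>|\<^sup>2 / t, t)\<close> tends to \<open>exp (- A_inf * |\<eta>|\<^sup>2)\<close>; at high frequencies \<open>z\<close>
  decays faster than any power of \<open>t\<close>.
\<close>

section \<open>Integrals on Euclidean spaces\<close>

text \<open>The obstacle is uniformity as \<open>\<mu>\<close> tends to 0 and to infinity. Time is
  rescaled by \<open>m = min \<mu> 1\<close>; with \<open>\<kappa> = \<mu> / m\<close> the symbol is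
  P(z) = \<kappa> p(m z), where p is \<open>a0\<close> plus the transform of \<open>a\<close>, and
  one of the two factors is always 1. Since P is unbounded in \<open>\<kappa>\<close>, no final
  constant may depend on a bound for P. What survives the scaling is an estimate of each derivative
  of p by a multiple of Re p, which is homogeneous in \<open>\<kappa>\<close>. It bounds a
  derivative of the resolvent G by (1 + Re P) |G|^2, and this is comparable to Re G = (Re z + Re P)
  |G|^2 wherever Re P is bounded below. At least one derivative must be taken, because G itself
  decays only like 1/|z| and is not absolutely integrable on vertical lines. If
  \<open>a0 = 0\<close>, Re P may tend to 0 at high frequencies. Schwarz-Pick for conjugate points
  then bounds |Im p| by |Im z| Re p / \<alpha>, so that Im P cannot cancel Im z when Re P is
  small.\<close>

lemma lborel_integral_affine:
  fixes f :: "'a::euclidean_space \<Rightarrow> 'b::{banach, second_countable_topology}"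
  assumes c: "c \<noteq> 0" and f[measurable]: "f \<in> borel_measurable borel"
  shows "(LINT x|lborel. f x) = \<bar>c\<bar> ^ DIM('a) *\<^sub>R (LINT x|lborel. f (t + c *\<^sub>R x))"
  by (subst lborel_affine[OF c, of t]) (simp add: integral_density integral_distr)

lemma lborel_integrable_affine:
  fixes f :: "'a::euclidean_space \<Rightarrow> 'b::{banach, second_countable_topology}"
  assumes c: "c \<noteq> 0" and f: "integrable lborel f"
  shows "integrable lborel (\<lambda>x. f (t + c *\<^sub>R x))"
proof -
  have [measurable]: "f \<in> borel_measurable borel" using f by auto
  from f have "integrable lborel (\<lambda>x. \<bar>c\<bar> ^ DIM('a) *\<^sub>R f (t + c *\<^sub>R x))"
    by (subst (asm) lborel_affine[OF c, of t])
      (simp add: integrable_density integrable_distr_eq)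
  from integrable_scaleR_right[OF this, of "inverse (\<bar>c\<bar> ^ DIM('a))"] show ?thesis
    using c by simp
qed

lemma
  fixes f :: "'a::euclidean_space \<Rightarrow> real \<Rightarrow> 'b::{real_normed_field, banach, second_countable_topology}"
  assumes f: "\<And>b. b \<in> Basis \<Longrightarrow> integrable lborel (f b)"
  shows integrable_prod_Basis: "integrable lborel (\<lambda>x::'a. \<Prod>b\<in>Basis. f b (x \<bullet> b))" (is ?A)
    and integral_prod_Basis: "(LINT x::'a|lborel. (\<Prod>b\<in>Basis. f b (x \<bullet> b))) = (\<Prod>b\<in>Basis. (LINT t|lborel. f b t))" (is ?B)
proof -
  interpret product_sigma_finite "\<lambda>_::'a. lborel :: real measure" ..
  have [measurable]: "\<And>b. b \<in> Basis \<Longrightarrow> f b \<in> borel_measurable borel" using f by auto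
  have m[measurable]: "(\<lambda>x::'a. \<Prod>b\<in>Basis. f b (x \<bullet> b)) \<in> borel_measurable borel"
    by measurable
  have *: "(\<Prod>b\<in>Basis. f b ((\<Sum>c\<in>Basis. g c *\<^sub>R c) \<bullet> b)) = (\<Prod>b\<in>Basis. f b (g b))" for g :: "'a \<Rightarrow> real"
    by (intro prod.cong refl) simp
  show ?A
    by (subst lborel_eq) (auto simp: integrable_distr_eq * intro!: product_integrable_prod f)
  show ?B
    by (subst lborel_eq) (auto simp: integral_distr * intro!: product_integral_prod f)
qed

lemma norm_sq_Basis: "(norm (x::'a::euclidean_space))\<^sup>2 = (\<Sum>b\<in>Basis. (x \<bullet> b)\<^sup>2)"
  unfolding power2_norm_eq_inner by (subst euclidean_inner) (simp add: power2_eq_square)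

text \<open>The characteristic function of the standard normal law, rescaled:
  \<open>k = sqrt (2 * c)\<close> is the factor for which the normal density at \<open>k * x\<close>
  is a multiple of exp(-c x^2).\<close>

lemma gaussian_1d:
  assumes c: "c > 0"
  shows "integrable lborel (\<lambda>x::real. exp (- \<i> * of_real (x * t)) * of_real (exp (- c * x\<^sup>2)))"
    and "(LINT x::real|lborel. exp (- \<i> * of_real (x * t)) * of_real (exp (- c * x\<^sup>2))) =
      of_real (sqrt (pi / c) * exp (- t\<^sup>2 / (4 * c)))"
proof -
  define k where "k = sqrt (2 * c)"
  have k: "k > 0" "k\<^sup>2 = 2 * c" using c by (auto simp: k_def)
  define F where "F = (\<lambda>x::real. iexp (- t / k * x) * of_real (std_normal_density x))"
  have i1: "integrable lborel (\<lambda>x. std_normal_density x *\<^sub>R iexp (- t / k * x))"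
    by (rule Bochner_Integration.integrable_bound[OF integrable_normal_density[of 1 0]])
      (auto simp: norm_mult)
  have iF: "integrable lborel F"
    using i1 unfolding F_def by (simp add: scaleR_conv_of_real mult.commute)
  have "char std_normal_distribution (- t / k) = (LINT x|lborel. std_normal_density x *\<^sub>R iexp (- t / k * x))"
    unfolding char_def
    by (subst integral_density) auto
  hence vF: "(LINT x|lborel. F x) = of_real (exp (- (t / k)\<^sup>2 / 2))"
    by (simp add: char_std_normal_distribution F_def scaleR_conv_of_real mult.commute)
  have eq: "exp (- \<i> * of_real (x * t)) * of_real (exp (- c * x\<^sup>2)) = of_real (sqrt (2 * pi)) * F (0 + k * x)" for x
    using k by (simp add: F_def std_normal_density_def power_mult_distrib) (simp add: mult.commute)
  show "integrable lborel (\<lambda>x::real. exp (- \<i> * of_real (x * t)) * of_real (exp (- c * x\<^sup>2)))"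
    unfolding eq by (intro integrable_mult_right lborel_integrable_real_affine iF) (use k in auto)
  have "(LINT x|lborel. F (0 + k * x)) = of_real (1 / k) * (LINT x|lborel. F x)"
    using lborel_integral_real_affine[of k F 0] k by (simp add: scaleR_conv_of_real)
  hence "(LINT x::real|lborel. exp (- \<i> * of_real (x * t)) * of_real (exp (- c * x\<^sup>2))) =
     of_real (sqrt (2 * pi) * (1/k) * exp (- (t / k)\<^sup>2 / 2))"
    unfolding eq by (simp add: vF)
  also have "sqrt (2 * pi) * (1/k) = sqrt (pi / c)"
    by (simp add: k_def real_sqrt_divide real_sqrt_mult)
  also have "- (t / k)\<^sup>2 / 2 = - t\<^sup>2 / (4 * c)"
    using k by (simp add: power_divide)
  finally show "(LINT x::real|lborel. exp (- \<i> * of_real (x * t)) * of_real (exp (- c * x\<^sup>2))) =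
      of_real (sqrt (pi / c) * exp (- t\<^sup>2 / (4 * c)))" .
qed

lemma
  fixes \<xi> :: "'a::euclidean_space"
  assumes c: "c > 0"
  shows integrable_gaussian_complex: "integrable lborel (\<lambda>x::'a. complex_of_real (exp (- c * (norm x)\<^sup>2)))" (is ?A)
    and fourier_gaussian: "fourier (\<lambda>x::'a. of_real (exp (- c * (norm x)\<^sup>2))) \<xi> =
      of_real (sqrt (pi / c) ^ DIM('a) * exp (- (norm \<xi>)\<^sup>2 / (4 * c)))" (is ?B)
proof -
  have eq: "exp (- \<i> * of_real (x \<bullet> \<xi>)) * complex_of_real (exp (- c * (norm x)\<^sup>2)) =
     (\<Prod>b\<in>Basis. exp (- \<i> * of_real ((x \<bullet> b) * (\<xi> \<bullet> b))) * of_real (exp (- c * (x \<bullet> b)\<^sup>2)))" for x \<xi> :: 'a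
  proof -
    have "exp (- \<i> * of_real (x \<bullet> \<xi>)) = (\<Prod>b\<in>Basis. exp (- \<i> * of_real ((x \<bullet> b) * (\<xi> \<bullet> b))))"
      by (subst euclidean_inner) (simp add: sum_distrib_left exp_sum[symmetric] sum_negf)
    moreover have "complex_of_real (exp (- c * (norm x)\<^sup>2)) = (\<Prod>b\<in>Basis. of_real (exp (- c * (x \<bullet> b)\<^sup>2)))"
      unfolding of_real_prod[symmetric] of_real_eq_iff norm_sq_Basis
      by (simp add: sum_distrib_left exp_sum flip: sum_negf)
    ultimately show ?thesis by (simp add: prod.distrib)
  qed
  \<comment> \<open>At frequency 0 the character is 1, so the factorisation \<open>eq\<close> also
    covers the bare Gaussian.\<close>
  show ?A
    using integrable_prod_Basis[where f="\<lambda>b t. exp (- \<i> * of_real (t * ((0::'a) \<bullet> b))) * of_real (exp (- c * t\<^sup>2))"]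
      gaussian_1d(1)[OF c, of 0] eq[of _ 0] by auto
  have "fourier (\<lambda>x::'a. of_real (exp (- c * (norm x)\<^sup>2))) \<xi> =
     (LINT x|lborel. (\<Prod>b\<in>Basis. exp (- \<i> * of_real ((x \<bullet> b) * (\<xi> \<bullet> b))) * of_real (exp (- c * (x \<bullet> b)\<^sup>2))))"
    unfolding fourier_def eq ..
  also have "\<dots> = (\<Prod>b\<in>Basis. of_real (sqrt (pi / c) * exp (- (\<xi> \<bullet> b)\<^sup>2 / (4 * c))))"
    by (subst integral_prod_Basis[where f="\<lambda>b t. exp (- \<i> * of_real (t * (\<xi> \<bullet> b))) * of_real (exp (- c * t\<^sup>2))"])
      (rule gaussian_1d(1)[OF c], intro prod.cong refl gaussian_1d(2)[OF c])
  also have "\<dots> = of_real (sqrt (pi / c) ^ DIM('a) * (\<Prod>b\<in>Basis. exp (- (\<xi> \<bullet> b)\<^sup>2 / (4 * c))))"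
    by (simp add: prod.distrib del: of_real_exp)
  also have "(\<Prod>b\<in>Basis. exp (- (\<xi> \<bullet> b)\<^sup>2 / (4 * c))) = exp (- (norm \<xi>)\<^sup>2 / (4 * c))"
    by (subst norm_sq_Basis) (simp add: exp_sum[symmetric] sum_divide_distrib sum_negf)
  finally show ?B .
qed

lemma integrable_gaussian:
  assumes "c > 0" shows "integrable lborel (\<lambda>x::'a::euclidean_space. exp (- c * (norm x)\<^sup>2))"
  using integrable_gaussian_complex[OF assms, where 'a='a] by (simp only: complex_of_real_integrable_eq)

lemma integral_gaussian:
  assumes "c > 0"
  shows "(LINT x::'a::euclidean_space|lborel. exp (- c * (norm x)\<^sup>2)) = sqrt (pi / c) ^ DIM('a)"
proof -
  have "complex_of_real (LINT x::'a::euclidean_space|lborel. exp (- c * (norm x)\<^sup>2)) = of_real (sqrt (pi / c) ^ DIM('a))"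
    using fourier_gaussian[OF assms, of "0::'a"] unfolding fourier_def
    by (simp add: integral_complex_of_real del: of_real_exp of_real_power)
  thus ?thesis by (simp only: of_real_eq_iff)
qed

section \<open>The Fourier integral\<close>

lemma integrable_fourier:
  assumes "integrable lborel f"
  shows "integrable lborel (\<lambda>x. exp (- \<i> * of_real (x \<bullet> \<xi>)) * f x)"
proof -
  have [measurable]: "f \<in> borel_measurable borel" using assms by auto
  show ?thesis
    by (rule Bochner_Integration.integrable_bound[OF assms]) (auto simp: norm_mult)
qed

lemma norm_fourier_le: "cmod (fourier f \<xi>) \<le> (LINT x|lborel. cmod (f x))"
  unfolding fourier_def
  by (rule order_trans[OF integral_norm_bound]) (simp add: norm_mult)

lemma continuous_fourier:
  assumes "integrable lborel f"
  shows "continuous_on UNIV (fourier f)"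
proof (rule continuous_at_imp_continuous_on, intro ballI)
  fix \<xi>
  have [measurable]: "f \<in> borel_measurable borel" using assms by auto
  show "isCont (fourier f) \<xi>"
    unfolding fourier_def continuous_at_sequentially comp_def
  proof (intro allI impI)
    fix X assume X: "X \<longlonglongrightarrow> \<xi>"
    show "(\<lambda>n. LINT x|lborel. exp (- \<i> * of_real (x \<bullet> X n)) * f x) \<longlonglongrightarrow>
       (LINT x|lborel. exp (- \<i> * of_real (x \<bullet> \<xi>)) * f x)"
      by (rule integral_dominated_convergence[where w="\<lambda>x. cmod (f x)"])
         (use assms X in \<open>auto simp: norm_mult intro!: tendsto_intros\<close>)
  qed
qed

lemma borel_measurable_fourier[measurable]:
  assumes "integrable lborel f"
  shows "fourier f \<in> borel_measurable borel"
  using continuous_fourier[OF assms] by (rule borel_measurable_continuous_onI)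

lemma fourier_diff:
  assumes "integrable lborel f" "integrable lborel g"
  shows "fourier (\<lambda>x. f x - g x) \<xi> = fourier f \<xi> - fourier g \<xi>"
  unfolding fourier_def right_diff_distrib
  by (rule Bochner_Integration.integral_diff[OF integrable_fourier[OF assms(1)] integrable_fourier[OF assms(2)]])

lemma fourier_cnj: "fourier (\<lambda>x. cnj (f x)) (- \<xi>) = cnj (fourier f \<xi>)"
proof -
  have "exp (- \<i> * of_real (x \<bullet> - \<xi>)) * cnj (f x) = cnj (exp (- \<i> * of_real (x \<bullet> \<xi>)) * f x)" for x
    by (simp add: exp_cnj)
  thus ?thesis
    unfolding fourier_def by (simp only: Bochner_Integration.integral_cnj)
qed

text \<open>The multiplication formula, by Fubini; the Parseval identities below, damped and
  undamped, all go back to it.\<close>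

lemma fourier_exchange:
  assumes f: "integrable lborel f" and k: "integrable lborel k"
  shows "(LINT \<xi>|lborel. fourier f \<xi> * k \<xi>) = (LINT x|lborel. f x * fourier k x)"
proof -
  have [measurable]: "f \<in> borel_measurable borel" "k \<in> borel_measurable borel" using f k by auto
  have *: "integrable (lborel \<Otimes>\<^sub>M lborel) (\<lambda>(\<xi>, x). exp (- \<i> * of_real (x \<bullet> \<xi>)) * f x * k \<xi>)"
  proof (rule lborel_pair.Fubini_integrable)
    show "(\<lambda>(\<xi>, x). exp (- \<i> * of_real (x \<bullet> \<xi>)) * f x * k \<xi>) \<in> borel_measurable (lborel \<Otimes>\<^sub>M lborel)"
      by measurable
    show "integrable lborel (\<lambda>\<xi>. LINT x|lborel. cmod (case (\<xi>, x) of (\<xi>, x) \<Rightarrow> exp (- \<i> * of_real (x \<bullet> \<xi>)) * f x * k \<xi>))"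
      using k by (simp add: norm_mult)
    show "AE \<xi> in lborel. integrable lborel (\<lambda>x. case (\<xi>, x) of (\<xi>, x) \<Rightarrow> exp (- \<i> * of_real (x \<bullet> \<xi>)) * f x * k \<xi>)"
      unfolding prod.case by (intro AE_I2 integrable_mult_left integrable_fourier f)
  qed
  have "(LINT \<xi>|lborel. fourier f \<xi> * k \<xi>) = (LINT \<xi>|lborel. LINT x|lborel. exp (- \<i> * of_real (x \<bullet> \<xi>)) * f x * k \<xi>)"
    unfolding fourier_def by simp
  also have "\<dots> = (LINT x|lborel. LINT \<xi>|lborel. exp (- \<i> * of_real (x \<bullet> \<xi>)) * f x * k \<xi>)"
    using lborel_pair.Fubini_integral[OF *] by simp
  also have "\<dots> = (LINT x|lborel. f x * fourier k x)"
    unfolding fourier_def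
    by (subst integral_mult_right_zero[symmetric])
       (simp add: inner_commute mult_ac)
  finally show ?thesis .
qed

section \<open>Gaussian mollification and Fourier inversion\<close>

definition gauss_kernel :: "real \<Rightarrow> 'a::euclidean_space \<Rightarrow> real" where
  "gauss_kernel \<epsilon> x = sqrt (pi / \<epsilon>) ^ DIM('a) * exp (- (norm x)\<^sup>2 / (4 * \<epsilon>))"

lemma gauss_kernel_nonneg: "\<epsilon> > 0 \<Longrightarrow> gauss_kernel \<epsilon> x \<ge> 0"
  by (simp add: gauss_kernel_def)

lemma gauss_kernel_minus: "gauss_kernel \<epsilon> (x - y) = gauss_kernel \<epsilon> (y - x)"
  by (simp add: gauss_kernel_def norm_minus_commute)

lemma borel_measurable_gauss_kernel[measurable]: "gauss_kernel \<epsilon> \<in> borel_measurable borel"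
  unfolding gauss_kernel_def[abs_def] by measurable

text \<open>The kernel is the transform of exp(-\<epsilon> |\<xi>|^2). Its mass is a power of 2 pi
  instead of 1 because the transform carries no normalising factor; this is the source of the powers
  of 2 pi in the inversion and Parseval formulas.\<close>

lemma
  assumes "\<epsilon> > 0"
  shows integrable_gauss_kernel: "integrable lborel (gauss_kernel \<epsilon> :: 'a::euclidean_space \<Rightarrow> real)"
    and integral_gauss_kernel: "(LINT x|lborel. gauss_kernel \<epsilon> (x::'a)) = (2 * pi) ^ DIM('a)"
proof -
  have e: "1 / (4 * \<epsilon>) > 0" using assms by simp
  have eq: "gauss_kernel \<epsilon> = (\<lambda>x::'a. sqrt (pi / \<epsilon>) ^ DIM('a) * exp (- (1 / (4 * \<epsilon>)) * (norm x)\<^sup>2))"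
    by (simp add: gauss_kernel_def fun_eq_iff)
  show "integrable lborel (gauss_kernel \<epsilon> :: 'a::euclidean_space \<Rightarrow> real)"
    unfolding eq by (intro integrable_mult_right integrable_gaussian e)
  have "sqrt (pi / \<epsilon>) * sqrt (pi / (1 / (4 * \<epsilon>))) = sqrt ((2 * pi)\<^sup>2)"
    unfolding real_sqrt_mult[symmetric] using assms by (simp add: power2_eq_square)
  also have "\<dots> = 2 * pi" by (subst real_sqrt_abs) simp
  finally have *: "sqrt (pi / \<epsilon>) * sqrt (pi / (1 / (4 * \<epsilon>))) = 2 * pi" .
  show "(LINT x|lborel. gauss_kernel \<epsilon> (x::'a)) = (2 * pi) ^ DIM('a)"
    unfolding eq integral_mult_right_zero integral_gaussian[OF e] power_mult_distrib[symmetric] * ..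
qed

lemma integrable_mult_bounded:
  fixes f g :: "'a \<Rightarrow> complex"
  assumes f: "integrable M f" and [measurable]: "g \<in> borel_measurable M" and b: "\<And>x. cmod (g x) \<le> B"
  shows "integrable M (\<lambda>x. f x * g x)"
proof -
  have "0 \<le> B" using b[of undefined] norm_ge_zero order_trans by blast
  have [measurable]: "f \<in> borel_measurable M" using f by auto
  show ?thesis
  proof (rule Bochner_Integration.integrable_bound[of _ "\<lambda>x. B * cmod (f x)"])
    show "AE x in M. norm (f x * g x) \<le> norm (B * cmod (f x))"
      using b \<open>0 \<le> B\<close> by (intro AE_I2) (simp add: norm_mult abs_mult mult.commute[of B] mult_left_mono)
  qed (use f in auto)
qed

lemma integrable_fourier_gauss:
  assumes h: "integrable lborel h" and e: "\<epsilon> > 0"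
  shows "integrable lborel (\<lambda>\<xi>. fourier h (- \<xi>) * of_real (exp (- \<epsilon> * (norm \<xi>)\<^sup>2)))"
proof -
  have [measurable]: "fourier h \<in> borel_measurable borel" by (rule borel_measurable_fourier[OF h])
  show ?thesis
    by (subst mult.commute, rule integrable_mult_bounded[OF integrable_gaussian_complex[OF e]])
       (auto intro: norm_fourier_le)
qed

text \<open>\<open>fourier h\<close> may fail to be integrable, so the double transform is damped by
  a Gaussian. A reflection and the exchange formula then move the inner transform onto the modulated
  Gaussian \<open>k\<close>, whose transform is the kernel centred at \<open>x\<close>.\<close>

lemma fourier_fourier_gauss:
  fixes h :: "'a::euclidean_space \<Rightarrow> complex"
  assumes h: "integrable lborel h" and e: "\<epsilon> > 0"
  shows "fourier (\<lambda>\<xi>. fourier h (- \<xi>) * of_real (exp (- \<epsilon> * (norm \<xi>)\<^sup>2))) x =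
    (LINT y|lborel. h y * of_real (gauss_kernel \<epsilon> (y - x)))"
proof -
  have [measurable]: "fourier h \<in> borel_measurable borel" by (rule borel_measurable_fourier[OF h])
  define k where "k \<xi> = exp (\<i> * of_real (\<xi> \<bullet> x)) * complex_of_real (exp (- \<epsilon> * (norm \<xi>)\<^sup>2))" for \<xi> :: 'a
  have k: "integrable lborel k"
    using integrable_fourier[OF integrable_gaussian_complex[OF e], of "- x"] by (simp add: k_def[abs_def])
  have "fourier (\<lambda>\<xi>. fourier h (- \<xi>) * of_real (exp (- \<epsilon> * (norm \<xi>)\<^sup>2))) x =
     (LINT \<xi>|lborel. exp (- \<i> * of_real (\<xi> \<bullet> x)) * (fourier h (- \<xi>) * of_real (exp (- \<epsilon> * (norm \<xi>)\<^sup>2))))"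
    unfolding fourier_def ..
  also have "\<dots> = (LINT \<xi>|lborel. fourier h \<xi> * k \<xi>)"
    by (subst lborel_integral_affine[of "-1" _ 0])
       (auto simp: k_def mult_ac)
  also have "\<dots> = (LINT y|lborel. h y * fourier k y)"
    by (rule fourier_exchange[OF h k])
  also have "fourier k = (\<lambda>y. of_real (gauss_kernel \<epsilon> (y - x)))"
  proof
    fix y
    have "fourier k y = fourier (\<lambda>\<xi>. of_real (exp (- \<epsilon> * (norm \<xi>)\<^sup>2))) (y - x)"
      unfolding fourier_def k_def
      by (simp add: inner_diff_right right_diff_distrib exp_add[symmetric] mult.assoc[symmetric] del: of_real_exp)
    thus "fourier k y = of_real (gauss_kernel \<epsilon> (y - x))"
      by (simp only: fourier_gaussian[OF e] gauss_kernel_def)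
  qed
  finally show ?thesis .
qed

lemma parseval_gauss:
  fixes f h :: "'a::euclidean_space \<Rightarrow> complex"
  assumes f: "integrable lborel f" and h: "integrable lborel h" and e: "\<epsilon> > 0"
  shows "(LINT \<xi>|lborel. fourier f \<xi> * (fourier h (- \<xi>) * of_real (exp (- \<epsilon> * (norm \<xi>)\<^sup>2)))) =
    (LINT x|lborel. f x * (LINT y|lborel. h y * of_real (gauss_kernel \<epsilon> (y - x))))"
  unfolding fourier_exchange[OF f integrable_fourier_gauss[OF h e]] fourier_fourier_gauss[OF h e] ..

text \<open>Approximate identity. The substitution y = x + s v, with \<open>s n\<close> the width of
  the kernel, replaces the shrinking kernel by the fixed weight exp(-|v|^2), so that boundedness of
  \<open>h\<close> and continuity at \<open>x\<close> suffice for dominated convergence.\<close>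

lemma mollify_tendsto:
  fixes h :: "'a::euclidean_space \<Rightarrow> complex"
  assumes h[measurable]: "h \<in> borel_measurable borel" and b: "\<And>y. cmod (h y) \<le> B" and c: "isCont h x"
  shows "(\<lambda>n. LINT y|lborel. h y * of_real (gauss_kernel (inverse (real (Suc n))) (y - x))) \<longlonglongrightarrow> (2 * pi) ^ DIM('a) * h x"
proof -
  let ?g = "\<lambda>v::'a. exp (- 1 * (norm v)\<^sup>2)"
  define s where "s n = 2 * sqrt (inverse (real (Suc n)))" for n
  have s0: "s n > 0" for n by (simp add: s_def)
  have slim: "s \<longlonglongrightarrow> 0"
    unfolding s_def using tendsto_mult[OF tendsto_const[of 2] tendsto_real_sqrt[OF LIMSEQ_inverse_real_of_nat]] by simp
  have eq: "(LINT y|lborel. h y * of_real (gauss_kernel (inverse (real (Suc n))) (y - x))) =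
     (2 * sqrt pi) ^ DIM('a) * (LINT v|lborel. h (x + s n *\<^sub>R v) * of_real (?g v))" for n
  proof -
    define d where "d = inverse (real (Suc n))"
    have d: "d > 0" by (simp add: d_def)
    have s2: "s n = 2 * sqrt d" by (simp add: s_def d_def)
    have sd: "s n * sqrt (pi / d) = 2 * sqrt pi"
      using d by (simp add: s2 real_sqrt_divide)
    have k: "gauss_kernel d (s n *\<^sub>R v) = sqrt (pi / d) ^ DIM('a) * ?g v" for v :: 'a
      using d by (simp add: gauss_kernel_def s2 power_mult_distrib)
    have "(LINT y|lborel. h y * of_real (gauss_kernel d (y - x))) =
       s n ^ DIM('a) *\<^sub>R (LINT v|lborel. h (x + s n *\<^sub>R v) * of_real (gauss_kernel d (s n *\<^sub>R v)))"
      by (subst lborel_integral_affine[of "s n" _ x]) (use s0[of n] in auto)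
    also have "\<dots> = s n ^ DIM('a) *\<^sub>R (LINT v|lborel. of_real (sqrt (pi / d) ^ DIM('a)) * (h (x + s n *\<^sub>R v) * of_real (?g v)))"
      unfolding k by (simp add: mult_ac)
    also have "\<dots> = of_real ((s n * sqrt (pi / d)) ^ DIM('a)) * (LINT v|lborel. h (x + s n *\<^sub>R v) * of_real (?g v))"
      unfolding integral_mult_right_zero by (simp add: scaleR_conv_of_real power_mult_distrib)
    finally have *: "(LINT y|lborel. h y * of_real (gauss_kernel d (y - x))) =
      of_real ((s n * sqrt (pi / d)) ^ DIM('a)) * (LINT v|lborel. h (x + s n *\<^sub>R v) * of_real (?g v))" .
    have "of_real ((s n * sqrt (pi / d)) ^ DIM('a)) = complex_of_real ((2 * sqrt pi) ^ DIM('a))"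
      unfolding sd ..
    with * show ?thesis unfolding d_def by argo
  qed
  have "(\<lambda>n. LINT v|lborel. h (x + s n *\<^sub>R v) * of_real (?g v)) \<longlonglongrightarrow> (LINT v|lborel. h x * of_real (?g v))"
  proof (rule integral_dominated_convergence[where w="\<lambda>v. B * ?g v"])
    show "integrable lborel (\<lambda>v::'a. B * ?g v)" by (intro integrable_mult_right integrable_gaussian) simp
    show "AE v in lborel. (\<lambda>n. h (x + s n *\<^sub>R v) * of_real (?g v)) \<longlonglongrightarrow> h x * of_real (?g v)"
    proof (intro AE_I2 tendsto_mult tendsto_const)
      fix v
      have "(\<lambda>n. x + s n *\<^sub>R v) \<longlonglongrightarrow> x + 0 *\<^sub>R v" by (intro tendsto_intros slim)
      thus "(\<lambda>n. h (x + s n *\<^sub>R v)) \<longlonglongrightarrow> h x" using isCont_tendsto_compose[OF c] by simp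
    qed
    show "AE v in lborel. cmod (h (x + s n *\<^sub>R v) * of_real (?g v)) \<le> B * ?g v" for n
      using b by (auto simp: norm_mult intro!: mult_right_mono)
  qed measurable
  hence "(\<lambda>n. (2 * sqrt pi) ^ DIM('a) * (LINT v|lborel. h (x + s n *\<^sub>R v) * of_real (?g v))) \<longlonglongrightarrow>
     (2 * sqrt pi) ^ DIM('a) * (LINT v|lborel. h x * of_real (?g v))"
    by (intro tendsto_intros)
  moreover have "(LINT v::'a|lborel. h x * of_real (?g v)) = h x * of_real (sqrt pi ^ DIM('a))"
    unfolding integral_mult_right_zero integral_complex_of_real integral_gaussian[OF zero_less_one] by simp
  moreover have "(2 * sqrt pi) ^ DIM('a) * (h x * of_real (sqrt pi ^ DIM('a))) = (2 * pi) ^ DIM('a) * h x"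
  proof -
    have "(2 * complex_of_real (sqrt pi)) ^ DIM('a) * (h x * of_real (sqrt pi ^ DIM('a))) =
       (2 * complex_of_real (sqrt pi * sqrt pi)) ^ DIM('a) * h x"
      unfolding of_real_power of_real_mult power_mult_distrib by (simp only: mult_ac)
    thus ?thesis by simp
  qed
  ultimately show ?thesis
    unfolding eq by metis
qed

lemma exp_damping_tendsto: "(\<lambda>n. of_real (exp (- inverse (real (Suc n)) * c))) \<longlonglongrightarrow> (1::complex)"
proof -
  have "(\<lambda>n. complex_of_real (exp (- inverse (real (Suc n)) * c))) \<longlonglongrightarrow> of_real (exp (- 0 * c))"
    by (intro tendsto_intros LIMSEQ_inverse_real_of_nat)
  thus ?thesis by simp
qed

text \<open>The damped double transform is evaluated in two ways as the damping disappears: by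
  dominated convergence it tends to the inversion integral, and as a mollification of
  \<open>h\<close> it tends to a multiple of \<open>h x\<close>.\<close>

lemma fourier_inversion:
  fixes h :: "'a::euclidean_space \<Rightarrow> complex"
  assumes h: "integrable lborel h" and b: "\<And>y. cmod (h y) \<le> B" and c: "isCont h x"
    and hh: "integrable lborel (fourier h)"
  shows "(2 * pi) ^ DIM('a) * h x = (LINT \<xi>|lborel. exp (\<i> * of_real (x \<bullet> \<xi>)) * fourier h \<xi>)"
proof -
  have [measurable]: "h \<in> borel_measurable borel" "fourier h \<in> borel_measurable borel" using h hh by auto
  have m: "integrable lborel (\<lambda>\<xi>. fourier h (- \<xi>))"
    using lborel_integrable_affine[OF _ hh, of "-1" 0] by simp
  have "(\<lambda>n. fourier (\<lambda>\<xi>. fourier h (- \<xi>) * of_real (exp (- inverse (real (Suc n)) * (norm \<xi>)\<^sup>2))) x)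
     \<longlonglongrightarrow> (LINT \<xi>|lborel. exp (- \<i> * of_real (\<xi> \<bullet> x)) * (fourier h (- \<xi>) * 1))"
    unfolding fourier_def[of "\<lambda>\<xi>. fourier h (- \<xi>) * _ \<xi>"]
  proof (rule integral_dominated_convergence[where w="\<lambda>\<xi>. cmod (fourier h (- \<xi>))"])
    show "AE \<xi> in lborel. (\<lambda>n. exp (- \<i> * of_real (\<xi> \<bullet> x)) * (fourier h (- \<xi>) * of_real (exp (- inverse (real (Suc n)) * (norm \<xi>)\<^sup>2)))) \<longlonglongrightarrow> exp (- \<i> * of_real (\<xi> \<bullet> x)) * (fourier h (- \<xi>) * 1)"
      by (intro AE_I2 tendsto_mult tendsto_const exp_damping_tendsto)
  qed (use m in \<open>auto simp: norm_mult intro!: mult_left_le\<close>)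
  moreover have "(\<lambda>n. fourier (\<lambda>\<xi>. fourier h (- \<xi>) * of_real (exp (- inverse (real (Suc n)) * (norm \<xi>)\<^sup>2))) x)
     \<longlonglongrightarrow> (2 * pi) ^ DIM('a) * h x"
    by (subst fourier_fourier_gauss[OF h], simp, rule mollify_tendsto[OF _ b c]) measurable
  ultimately have "(2 * pi) ^ DIM('a) * h x = (LINT \<xi>|lborel. exp (- \<i> * of_real (\<xi> \<bullet> x)) * fourier h (- \<xi>))"
    using LIMSEQ_unique by fastforce
  also have "\<dots> = (LINT \<xi>|lborel. exp (\<i> * of_real (x \<bullet> \<xi>)) * fourier h \<xi>)"
    by (subst lborel_integral_affine[of "-1" _ 0]) (auto simp: inner_commute)
  finally show ?thesis .
qed

section \<open>Square integrable functions\<close>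

definition l2norm :: "('a::euclidean_space \<Rightarrow> complex) \<Rightarrow> real" where
  "l2norm f = sqrt (LINT x|lborel. (cmod (f x))\<^sup>2)"

lemma l2norm_nonneg[simp]: "0 \<le> l2norm f"
  by (simp add: l2norm_def)

lemma l2norm_sq: "(l2norm f)\<^sup>2 = (LINT x|lborel. (cmod (f x))\<^sup>2)"
  by (simp add: l2norm_def)

lemma square_integrable_measurable: "square_integrable f \<Longrightarrow> f \<in> borel_measurable borel"
  by (simp add: square_integrable_def)

lemma norm_diff_sq_le: "(cmod (a - b))\<^sup>2 \<le> 2 * (cmod a)\<^sup>2 + 2 * (cmod b)\<^sup>2"
proof -
  have "(cmod (a - b))\<^sup>2 \<le> (cmod a + cmod b)\<^sup>2" by (intro power_mono norm_triangle_ineq4) simp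
  also have "\<dots> \<le> 2 * (cmod a)\<^sup>2 + 2 * (cmod b)\<^sup>2"
    using zero_le_power2[of "cmod a - cmod b"] by (simp add: power2_sum power2_diff)
  finally show ?thesis .
qed

lemma square_integrable_bound:
  assumes g: "square_integrable g" and [measurable]: "f \<in> borel_measurable borel"
    and b: "AE x in lborel. cmod (f x) \<le> C * cmod (g x)"
  shows "square_integrable f"
  unfolding square_integrable_def
proof
  have [measurable]: "g \<in> borel_measurable borel" using g by (rule square_integrable_measurable)
  show "integrable lborel (\<lambda>x. (cmod (f x))\<^sup>2)"
  proof (rule Bochner_Integration.integrable_bound[of _ "\<lambda>x. C\<^sup>2 * (cmod (g x))\<^sup>2"])
    show "integrable lborel (\<lambda>x. C\<^sup>2 * (cmod (g x))\<^sup>2)" using g by (auto simp: square_integrable_def)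
    show "AE x in lborel. norm ((cmod (f x))\<^sup>2) \<le> norm (C\<^sup>2 * (cmod (g x))\<^sup>2)"
      using b by eventually_elim (auto simp flip: power_mult_distrib intro: power_mono)
  qed measurable
qed simp

lemma square_integrable_diff:
  assumes f: "square_integrable f" and g: "square_integrable g"
  shows "square_integrable (\<lambda>x. f x - g x)"
  unfolding square_integrable_def
proof
  have [measurable]: "f \<in> borel_measurable borel" "g \<in> borel_measurable borel"
    using f g by (auto intro: square_integrable_measurable)
  show "(\<lambda>x. f x - g x) \<in> borel_measurable lborel" by simp
  show "integrable lborel (\<lambda>x. (cmod (f x - g x))\<^sup>2)"
    by (rule Bochner_Integration.integrable_bound[of _ "\<lambda>x. 2 * (cmod (f x))\<^sup>2 + 2 * (cmod (g x))\<^sup>2"])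
       (use f g norm_diff_sq_le in \<open>auto simp: square_integrable_def\<close>)
qed

lemma
  assumes f: "square_integrable f" and g: "square_integrable g"
  shows square_integrable_mult: "integrable lborel (\<lambda>x. f x * g x)"
    and l2norm_Cauchy_Schwarz: "cmod (LINT x|lborel. f x * g x) \<le> l2norm f * l2norm g"
proof -
  have [measurable]: "f \<in> borel_measurable borel" "g \<in> borel_measurable borel"
    using f g by (auto intro: square_integrable_measurable)
  have i: "integrable lborel (\<lambda>x. (cmod (f x))\<^sup>2)" "integrable lborel (\<lambda>x. (cmod (g x))\<^sup>2)"
    using f g by (auto simp: square_integrable_def)
  show int: "integrable lborel (\<lambda>x. f x * g x)"
  proof (rule Bochner_Integration.integrable_bound[of _ "\<lambda>x. (cmod (f x))\<^sup>2 + (cmod (g x))\<^sup>2"])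
    show "AE x in lborel. norm (f x * g x) \<le> norm ((cmod (f x))\<^sup>2 + (cmod (g x))\<^sup>2)"
    proof (intro AE_I2)
      fix x
      have "2 * (cmod (f x) * cmod (g x)) \<le> (cmod (f x))\<^sup>2 + (cmod (g x))\<^sup>2"
        using zero_le_power2[of "cmod (f x) - cmod (g x)"] by (simp add: power2_diff)
      moreover have "0 \<le> cmod (f x) * cmod (g x)" by simp
      ultimately have "cmod (f x) * cmod (g x) \<le> (cmod (f x))\<^sup>2 + (cmod (g x))\<^sup>2" by linarith
      thus "norm (f x * g x) \<le> norm ((cmod (f x))\<^sup>2 + (cmod (g x))\<^sup>2)" by (simp add: norm_mult)
    qed
  qed (use i in auto)
  have "ennreal ((LINT x|lborel. cmod (f x * g x))\<^sup>2) = (\<integral>\<^sup>+x. ennreal (cmod (f x)) * ennreal (cmod (g x)) \<partial>lborel)\<^sup>2"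
    by (subst ennreal_power[symmetric], simp, subst nn_integral_eq_integral[symmetric])
       (use integrable_norm[OF int] in \<open>auto simp: norm_mult ennreal_mult\<close>)
  also have "\<dots> \<le> (\<integral>\<^sup>+x. (ennreal (cmod (f x)))\<^sup>2 \<partial>lborel) * (\<integral>\<^sup>+x. (ennreal (cmod (g x)))\<^sup>2 \<partial>lborel)"
    by (rule Cauchy_Schwarz_nn_integral) auto
  also have "\<dots> = ennreal ((LINT x|lborel. (cmod (f x))\<^sup>2) * (LINT x|lborel. (cmod (g x))\<^sup>2))"
    by (simp add: ennreal_power nn_integral_eq_integral i ennreal_mult)
  finally have "(LINT x|lborel. cmod (f x * g x))\<^sup>2 \<le> (l2norm f * l2norm g)\<^sup>2"
    by (simp add: power_mult_distrib l2norm_sq)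
  hence "(LINT x|lborel. cmod (f x * g x)) \<le> l2norm f * l2norm g"
    by (rule power2_le_imp_le) simp
  thus "cmod (LINT x|lborel. f x * g x) \<le> l2norm f * l2norm g"
    by (rule order_trans[OF integral_norm_bound])
qed

lemma borel_measurable_indicator_ball[measurable]:
  "(\<lambda>x::'a::euclidean_space. indicator (ball 0 R) x :: complex) \<in> borel_measurable borel"
  by (rule borel_measurable_indicator) simp

lemma integrable_bounded_support:
  fixes f :: "'a::euclidean_space \<Rightarrow> complex"
  assumes f: "square_integrable f"
  shows "integrable lborel (\<lambda>x. indicator (ball 0 R) x * f x)"
proof -
  have [measurable]: "f \<in> borel_measurable borel" using f by (rule square_integrable_measurable)
  have "square_integrable (\<lambda>x::'a. indicator (ball 0 R) x :: complex)"
  proof -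
    have "integrable lborel (\<lambda>x::'a. indicator (ball 0 R) x :: real)"
      using emeasure_bounded_finite[OF bounded_ball[of "0::'a" R]] by (intro integrable_real_indicator) auto
    moreover have "(\<lambda>x::'a. (cmod (indicator (ball 0 R) x))\<^sup>2) = indicator (ball 0 R)"
      by (auto simp: indicator_def)
    ultimately show ?thesis unfolding square_integrable_def by simp
  qed
  from square_integrable_mult[OF this f] show ?thesis .
qed

lemma square_integrable_indicator:
  assumes f: "square_integrable f"
  shows "square_integrable (\<lambda>x. indicator (ball 0 R) x * f x)"
proof -
  have [measurable]: "f \<in> borel_measurable borel" using f by (rule square_integrable_measurable)
  show ?thesis
    by (rule square_integrable_bound[OF f, of _ 1]) (auto simp: indicator_def)
qed

section \<open>The Plancherel inequality and the transform on square integrable functions\<close>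

lemma norm_integral_le_nn_integral:
  "ennreal (norm (LINT x|M. f x)) \<le> (\<integral>\<^sup>+x. ennreal (norm (f x)) \<partial>M)"
  \<comment> \<open>If \<open>f\<close> is not integrable, its Bochner integral is 0 by
    convention.\<close>
  by (cases "integrable M f") (auto simp: integral_norm_bound_ennreal not_integrable_integral_eq)

lemma nn_integral_gauss_kernel_shift:
  fixes x :: "'a::euclidean_space"
  assumes "\<epsilon> > 0"
  shows "(\<integral>\<^sup>+y. ennreal (gauss_kernel \<epsilon> (y - x)) \<partial>lborel) = ennreal ((2 * pi) ^ DIM('a))"
proof -
  have "(\<integral>\<^sup>+y. ennreal (gauss_kernel \<epsilon> (y - x)) \<partial>lborel) = (\<integral>\<^sup>+y. ennreal (gauss_kernel \<epsilon> y) \<partial>distr lborel borel ((+) (- x)))"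
    by (subst nn_integral_distr) auto
  also have "\<dots> = (\<integral>\<^sup>+y. ennreal (gauss_kernel \<epsilon> (y::'a)) \<partial>lborel)"
    by (subst lborel_distr_plus) simp
  also have "\<dots> = ennreal ((2 * pi) ^ DIM('a))"
    by (subst nn_integral_eq_integral)
       (use assms in \<open>auto simp: integrable_gauss_kernel gauss_kernel_nonneg integral_gauss_kernel\<close>)
  finally show ?thesis .
qed

text \<open>A Schur test. Damped Parseval writes the integral of |fourier f|^2 as a double integral
  of f(x) times the conjugate of f(y) against the Gaussian kernel. The product is at most half the
  sum of the squares, and the symmetric kernel has the same mass in either variable, so the bound
  does not depend on the damping, which Fatou's lemma finally removes.\<close>

lemma fourier_L2_bound:
  fixes f :: "'a::euclidean_space \<Rightarrow> complex"
  assumes f: "integrable lborel f" and f2: "square_integrable f"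
  shows "(\<integral>\<^sup>+\<xi>. ennreal ((cmod (fourier f \<xi>))\<^sup>2) \<partial>lborel) \<le> ennreal ((2 * pi) ^ DIM('a) * (l2norm f)\<^sup>2)"
proof -
  have [measurable]: "f \<in> borel_measurable borel" "fourier f \<in> borel_measurable borel"
    using f borel_measurable_fourier by auto
  let ?B = "ennreal ((2 * pi) ^ DIM('a) * (l2norm f)\<^sup>2)"
  let ?e = "\<lambda>n. inverse (real (Suc n))"
  have damped: "(\<integral>\<^sup>+\<xi>. ennreal ((cmod (fourier f \<xi>))\<^sup>2 * exp (- \<epsilon> * (norm \<xi>)\<^sup>2)) \<partial>lborel) \<le> ?B" if e: "\<epsilon> > 0" for \<epsilon>
  proof -
    have L2: "(\<integral>\<^sup>+x. ennreal ((cmod (f x))\<^sup>2) \<partial>lborel) = ennreal ((l2norm f)\<^sup>2)"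
      using f2 by (simp add: l2norm_sq nn_integral_eq_integral square_integrable_def)
    have int: "integrable lborel (\<lambda>\<xi>. (cmod (fourier f \<xi>))\<^sup>2 * exp (- \<epsilon> * (norm \<xi>)\<^sup>2))"
    proof (rule Bochner_Integration.integrable_bound[of _ "\<lambda>\<xi>. (LINT x|lborel. cmod (f x))\<^sup>2 * exp (- \<epsilon> * (norm \<xi>)\<^sup>2)"])
      show "integrable lborel (\<lambda>\<xi>::'a. (LINT x|lborel. cmod (f x))\<^sup>2 * exp (- \<epsilon> * (norm \<xi>)\<^sup>2))"
        by (intro integrable_mult_right integrable_gaussian e)
    qed (auto simp: abs_mult intro!: power_mono norm_fourier_le)
    \<comment> \<open>In the damped Parseval identity \<open>h\<close> is the conjugate of
      \<open>f\<close>: by \<open>fourier_cnj\<close> the reflected transform is the conjugate of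
      \<open>fourier f\<close>, and the integrand becomes nonnegative.\<close>
    have "(LINT \<xi>|lborel. fourier f \<xi> * (fourier (\<lambda>x. cnj (f x)) (- \<xi>) * of_real (exp (- \<epsilon> * (norm \<xi>)\<^sup>2)))) =
       of_real (LINT \<xi>|lborel. (cmod (fourier f \<xi>))\<^sup>2 * exp (- \<epsilon> * (norm \<xi>)\<^sup>2))"
      unfolding integral_complex_of_real[symmetric] fourier_cnj mult.assoc[symmetric] complex_norm_square[symmetric]
      by (simp del: of_real_exp)
    hence "(LINT \<xi>|lborel. (cmod (fourier f \<xi>))\<^sup>2 * exp (- \<epsilon> * (norm \<xi>)\<^sup>2)) \<le>
       cmod (LINT \<xi>|lborel. fourier f \<xi> * (fourier (\<lambda>x. cnj (f x)) (- \<xi>) * of_real (exp (- \<epsilon> * (norm \<xi>)\<^sup>2))))"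
      by (simp del: of_real_mult of_real_exp)
    also have "\<dots> = cmod (LINT x|lborel. f x * (LINT y|lborel. cnj (f y) * of_real (gauss_kernel \<epsilon> (y - x))))"
      by (subst parseval_gauss[OF f _ e]) (use f in auto)
    finally have "(\<integral>\<^sup>+\<xi>. ennreal ((cmod (fourier f \<xi>))\<^sup>2 * exp (- \<epsilon> * (norm \<xi>)\<^sup>2)) \<partial>lborel)
        \<le> ennreal (cmod (LINT x|lborel. f x * (LINT y|lborel. cnj (f y) * of_real (gauss_kernel \<epsilon> (y - x)))))"
      by (subst nn_integral_eq_integral[OF int]) (auto intro: ennreal_leI)
    also have "\<dots> \<le> (\<integral>\<^sup>+x. ennreal (cmod (f x * (LINT y|lborel. cnj (f y) * of_real (gauss_kernel \<epsilon> (y - x))))) \<partial>lborel)"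
      by (rule norm_integral_le_nn_integral)
    also have "\<dots> \<le> (\<integral>\<^sup>+x. \<integral>\<^sup>+y. ennreal ((cmod (f x))\<^sup>2 / 2) * ennreal (gauss_kernel \<epsilon> (y - x)) + ennreal ((cmod (f y))\<^sup>2 / 2) * ennreal (gauss_kernel \<epsilon> (y - x)) \<partial>lborel \<partial>lborel)"
    proof (rule nn_integral_mono)
      fix x
      have "ennreal (cmod (f x * (LINT y|lborel. cnj (f y) * of_real (gauss_kernel \<epsilon> (y - x)))))
        \<le> (\<integral>\<^sup>+y. ennreal (cmod (f x * (cnj (f y) * of_real (gauss_kernel \<epsilon> (y - x))))) \<partial>lborel)"
        by (subst Bochner_Integration.integral_mult_right_zero[symmetric]) (rule norm_integral_le_nn_integral)
      also have "\<dots> \<le> (\<integral>\<^sup>+y. ennreal ((cmod (f x))\<^sup>2 / 2) * ennreal (gauss_kernel \<epsilon> (y - x)) + ennreal ((cmod (f y))\<^sup>2 / 2) * ennreal (gauss_kernel \<epsilon> (y - x)) \<partial>lborel)"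
      proof (rule nn_integral_mono)
        fix y
        have "cmod (f x) * cmod (f y) \<le> (cmod (f x))\<^sup>2 / 2 + (cmod (f y))\<^sup>2 / 2"
          using zero_le_power2[of "cmod (f x) - cmod (f y)"] by (simp add: power2_diff)
        hence "cmod (f x) * cmod (f y) * gauss_kernel \<epsilon> (y - x) \<le> ((cmod (f x))\<^sup>2 / 2 + (cmod (f y))\<^sup>2 / 2) * gauss_kernel \<epsilon> (y - x)"
          by (rule mult_right_mono) (rule gauss_kernel_nonneg[OF e])
        thus "ennreal (cmod (f x * (cnj (f y) * of_real (gauss_kernel \<epsilon> (y - x))))) \<le> ennreal ((cmod (f x))\<^sup>2 / 2) * ennreal (gauss_kernel \<epsilon> (y - x)) + ennreal ((cmod (f y))\<^sup>2 / 2) * ennreal (gauss_kernel \<epsilon> (y - x))"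
          using gauss_kernel_nonneg[OF e, of "y - x"]
          by (subst (1 2) ennreal_mult[symmetric], simp, simp, simp, simp, subst ennreal_plus[symmetric])
             (auto simp: norm_mult algebra_simps simp del: ennreal_plus intro!: ennreal_leI)
      qed
      finally show "ennreal (cmod (f x * (LINT y|lborel. cnj (f y) * of_real (gauss_kernel \<epsilon> (y - x)))))
        \<le> (\<integral>\<^sup>+y. ennreal ((cmod (f x))\<^sup>2 / 2) * ennreal (gauss_kernel \<epsilon> (y - x)) + ennreal ((cmod (f y))\<^sup>2 / 2) * ennreal (gauss_kernel \<epsilon> (y - x)) \<partial>lborel)" .
    qed
    also have "\<dots> = (\<integral>\<^sup>+x. \<integral>\<^sup>+y. ennreal ((cmod (f x))\<^sup>2 / 2) * ennreal (gauss_kernel \<epsilon> (y - x)) \<partial>lborel \<partial>lborel) +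
        (\<integral>\<^sup>+x. \<integral>\<^sup>+y. ennreal ((cmod (f y))\<^sup>2 / 2) * ennreal (gauss_kernel \<epsilon> (y - x)) \<partial>lborel \<partial>lborel)"
      by (simp add: nn_integral_add del: times_divide_eq_left times_divide_eq_right)
    also have "(\<integral>\<^sup>+x. \<integral>\<^sup>+y. ennreal ((cmod (f y))\<^sup>2 / 2) * ennreal (gauss_kernel \<epsilon> (y - x)) \<partial>lborel \<partial>lborel) =
        (\<integral>\<^sup>+y. \<integral>\<^sup>+x. ennreal ((cmod (f y))\<^sup>2 / 2) * ennreal (gauss_kernel \<epsilon> (y - x)) \<partial>lborel \<partial>lborel)"
      by (rule lborel_pair.Fubini') measurable
    also have "\<dots> = (\<integral>\<^sup>+x. \<integral>\<^sup>+y. ennreal ((cmod (f x))\<^sup>2 / 2) * ennreal (gauss_kernel \<epsilon> (y - x)) \<partial>lborel \<partial>lborel)"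
      by (subst gauss_kernel_minus) simp
    also have "\<dots> = (\<integral>\<^sup>+x. ennreal ((cmod (f x))\<^sup>2 / 2) * ennreal ((2 * pi) ^ DIM('a)) \<partial>lborel)"
      by (simp add: nn_integral_cmult nn_integral_gauss_kernel_shift[OF e])
    also have "\<dots> + \<dots> = (\<integral>\<^sup>+x. ennreal ((2 * pi) ^ DIM('a)) * ennreal ((cmod (f x))\<^sup>2) \<partial>lborel)"
      by (subst nn_integral_add[symmetric]) (auto simp: ennreal_mult[symmetric] ennreal_plus[symmetric] simp del: ennreal_plus intro!: nn_integral_cong)
    also have "\<dots> = ?B"
      by (simp add: nn_integral_cmult L2 ennreal_mult)
    finally show ?thesis .
  qed
  have lim: "(\<lambda>n. ennreal ((cmod (fourier f \<xi>))\<^sup>2 * exp (- ?e n * (norm \<xi>)\<^sup>2))) \<longlonglongrightarrow> ennreal ((cmod (fourier f \<xi>))\<^sup>2)" for \<xi>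
  proof -
    have "(\<lambda>n. (cmod (fourier f \<xi>))\<^sup>2 * exp (- ?e n * (norm \<xi>)\<^sup>2)) \<longlonglongrightarrow> (cmod (fourier f \<xi>))\<^sup>2 * exp (- 0 * (norm \<xi>)\<^sup>2)"
      by (intro tendsto_intros LIMSEQ_inverse_real_of_nat)
    thus ?thesis by (intro tendsto_ennrealI) simp
  qed
  have "(\<integral>\<^sup>+\<xi>. ennreal ((cmod (fourier f \<xi>))\<^sup>2) \<partial>lborel) = (\<integral>\<^sup>+\<xi>. liminf (\<lambda>n. ennreal ((cmod (fourier f \<xi>))\<^sup>2 * exp (- ?e n * (norm \<xi>)\<^sup>2))) \<partial>lborel)"
    by (intro nn_integral_cong lim_imp_Liminf[symmetric] lim) simp
  also have "\<dots> \<le> liminf (\<lambda>n. \<integral>\<^sup>+\<xi>. ennreal ((cmod (fourier f \<xi>))\<^sup>2 * exp (- ?e n * (norm \<xi>)\<^sup>2)) \<partial>lborel)"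
    by (rule nn_integral_liminf) measurable
  also have "\<dots> \<le> ?B"
    by (intro Liminf_le always_eventually allI damped sequentially_bot) simp_all
  finally show ?thesis .
qed

lemma square_integrable_fourier:
  assumes f: "integrable lborel f" and f2: "square_integrable f"
  shows "square_integrable (fourier f)"
proof -
  have [measurable]: "fourier f \<in> borel_measurable borel" using f borel_measurable_fourier by auto
  have "(\<integral>\<^sup>+\<xi>. ennreal ((cmod (fourier f \<xi>))\<^sup>2) \<partial>lborel) < \<infinity>"
    using fourier_L2_bound[OF assms] ennreal_less_top le_less_trans infinity_ennreal_def by metis
  thus ?thesis
    unfolding square_integrable_def by (auto intro!: integrableI_bounded)
qed

lemma l2norm_fourier_le:
  fixes f :: "'a::euclidean_space \<Rightarrow> complex"
  assumes f: "integrable lborel f" and f2: "square_integrable f"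
  shows "l2norm (fourier f) \<le> sqrt ((2 * pi) ^ DIM('a)) * l2norm f"
proof -
  have "ennreal ((l2norm (fourier f))\<^sup>2) = (\<integral>\<^sup>+\<xi>. ennreal ((cmod (fourier f \<xi>))\<^sup>2) \<partial>lborel)"
    using square_integrable_fourier[OF assms]
    by (simp add: l2norm_sq nn_integral_eq_integral square_integrable_def)
  also have "\<dots> \<le> ennreal ((2 * pi) ^ DIM('a) * (l2norm f)\<^sup>2)" by (rule fourier_L2_bound[OF assms])
  finally have "(l2norm (fourier f))\<^sup>2 \<le> (2 * pi) ^ DIM('a) * (l2norm f)\<^sup>2" by simp
  also have "\<dots> = (sqrt ((2 * pi) ^ DIM('a)) * l2norm f)\<^sup>2" by (simp add: power_mult_distrib)
  finally show ?thesis by (rule power2_le_imp_le) simp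
qed

text \<open>For integrable \<open>f\<close> the Fourier integral itself is an L2 transform: the
  error made on a ball is the transform of the discarded tail, which the Plancherel inequality
  bounds by the L2 norm of that tail.\<close>

lemma is_fourier_L2_fourier:
  fixes f :: "'a::euclidean_space \<Rightarrow> complex"
  assumes f: "integrable lborel f" and f2: "square_integrable f"
  shows "is_fourier_L2 f (fourier f)"
  unfolding is_fourier_L2_def
proof (intro conjI f2 square_integrable_fourier assms)
  have [measurable]: "f \<in> borel_measurable borel" using f by auto
  let ?d = "\<lambda>R x. indicator (ball 0 R) x * f x - f x"
  have "((\<lambda>R. LINT x|lborel. (cmod (?d R x))\<^sup>2) \<longlongrightarrow> (LINT x::'a|lborel. 0)) at_top"
  proof (rule integral_dominated_convergence_at_top[where w="\<lambda>x. (cmod (f x))\<^sup>2"])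
    show "AE x in lborel. ((\<lambda>R. (cmod (?d R x))\<^sup>2) \<longlongrightarrow> 0) at_top"
    proof (intro AE_I2 tendsto_eventually)
      fix x :: 'a
      show "\<forall>\<^sub>F R in at_top. (cmod (?d R x))\<^sup>2 = 0"
        using eventually_gt_at_top[of "norm x"] by eventually_elim (auto simp: indicator_def)
    qed
    show "\<forall>\<^sub>F R in at_top. AE x in lborel. norm ((cmod (?d R x))\<^sup>2) \<le> (cmod (f x))\<^sup>2"
      by (intro always_eventually allI AE_I2) (auto simp: indicator_def)
    show "(\<lambda>x. (cmod (?d R x))\<^sup>2) \<in> borel_measurable lborel" for R by measurable
  qed (use f2 in \<open>auto simp: square_integrable_def\<close>)
  hence "((\<lambda>R. ennreal ((2 * pi) ^ DIM('a) * (LINT x|lborel. (cmod (?d R x))\<^sup>2))) \<longlongrightarrow> ennreal ((2 * pi) ^ DIM('a) * 0)) at_top"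
    by (intro tendsto_ennrealI tendsto_mult tendsto_const) simp
  hence lim: "((\<lambda>R. ennreal ((2 * pi) ^ DIM('a) * (l2norm (?d R))\<^sup>2)) \<longlongrightarrow> 0) at_top"
    by (simp add: l2norm_sq)
  show "((\<lambda>R. \<integral>\<^sup>+\<xi>. ennreal ((cmod (fourier (\<lambda>x. indicator (ball 0 R) x * f x) \<xi> - fourier f \<xi>))\<^sup>2) \<partial>lborel) \<longlongrightarrow> 0) at_top"
  proof (rule tendsto_sandwich[OF _ _ tendsto_const lim])
    show "\<forall>\<^sub>F R in at_top. (\<integral>\<^sup>+\<xi>. ennreal ((cmod (fourier (\<lambda>x. indicator (ball 0 R) x * f x) \<xi> - fourier f \<xi>))\<^sup>2) \<partial>lborel)
        \<le> ennreal ((2 * pi) ^ DIM('a) * (l2norm (?d R))\<^sup>2)"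
    proof (intro always_eventually allI)
      fix R :: real
      have i: "integrable lborel (\<lambda>x. indicator (ball 0 R) x * f x)" by (rule integrable_bounded_support[OF f2])
      have "integrable lborel (?d R)" using i f by auto
      from fourier_L2_bound[OF this square_integrable_diff[OF square_integrable_indicator[OF f2] f2]]
      show "(\<integral>\<^sup>+\<xi>. ennreal ((cmod (fourier (\<lambda>x. indicator (ball 0 R) x * f x) \<xi> - fourier f \<xi>))\<^sup>2) \<partial>lborel)
        \<le> ennreal ((2 * pi) ^ DIM('a) * (l2norm (?d R))\<^sup>2)"
        by (simp add: fourier_diff[OF i f])
    qed
  qed auto
qed

text \<open>Truncated Fourier integrals see only the class of a function modulo null sets, so
  \<open>F\<close> and \<open>G\<close> are L2 limits of the same functions.\<close>

lemma is_fourier_L2_unique: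
  assumes F: "is_fourier_L2 f F" and G: "is_fourier_L2 g G" and fg: "AE x in lborel. f x = g x"
  shows "AE \<xi> in lborel. F \<xi> = G \<xi>"
proof -
  have [measurable]: "f \<in> borel_measurable borel" "g \<in> borel_measurable borel" "F \<in> borel_measurable borel" "G \<in> borel_measurable borel"
    using F G by (auto simp: is_fourier_L2_def square_integrable_measurable)
  let ?\<phi> = "\<lambda>R. fourier (\<lambda>x. indicator (ball 0 R) x * f x)"
  have \<phi>: "?\<phi> R = fourier (\<lambda>x. indicator (ball 0 R) x * g x)" for R
  proof
    fix \<xi>
    show "?\<phi> R \<xi> = fourier (\<lambda>x. indicator (ball 0 R) x * g x) \<xi>"
      unfolding fourier_def
    proof (rule integral_cong_AE)
      show "AE x in lborel. exp (- \<i> * of_real (x \<bullet> \<xi>)) * (indicator (ball 0 R) x * f x) = exp (- \<i> * of_real (x \<bullet> \<xi>)) * (indicator (ball 0 R) x * g x)"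
        using fg by eventually_elim simp
    qed measurable
  qed
  have [measurable]: "?\<phi> R \<in> borel_measurable borel" for R
    using F by (intro borel_measurable_fourier integrable_bounded_support) (simp add: is_fourier_L2_def)
  let ?I = "\<lambda>F R. \<integral>\<^sup>+\<xi>. ennreal ((cmod (?\<phi> R \<xi> - F \<xi>))\<^sup>2) \<partial>lborel"
  have le: "(\<integral>\<^sup>+\<xi>. ennreal ((cmod (F \<xi> - G \<xi>))\<^sup>2) \<partial>lborel) \<le> 2 * ?I F R + 2 * ?I G R" for R
  proof -
    have "ennreal ((cmod (F \<xi> - G \<xi>))\<^sup>2) \<le> 2 * ennreal ((cmod (?\<phi> R \<xi> - F \<xi>))\<^sup>2) + 2 * ennreal ((cmod (?\<phi> R \<xi> - G \<xi>))\<^sup>2)" for \<xi>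
    proof -
      have "(cmod (F \<xi> - G \<xi>))\<^sup>2 \<le> 2 * (cmod (?\<phi> R \<xi> - F \<xi>))\<^sup>2 + 2 * (cmod (?\<phi> R \<xi> - G \<xi>))\<^sup>2"
        using norm_diff_sq_le[of "?\<phi> R \<xi> - G \<xi>" "?\<phi> R \<xi> - F \<xi>"] by (simp add: norm_minus_commute)
      hence "ennreal ((cmod (F \<xi> - G \<xi>))\<^sup>2) \<le> ennreal (2 * (cmod (?\<phi> R \<xi> - F \<xi>))\<^sup>2 + 2 * (cmod (?\<phi> R \<xi> - G \<xi>))\<^sup>2)"
        by (rule ennreal_leI)
      thus ?thesis by (simp add: ennreal_plus ennreal_mult)
    qed
    hence "(\<integral>\<^sup>+\<xi>. ennreal ((cmod (F \<xi> - G \<xi>))\<^sup>2) \<partial>lborel) \<le>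
       (\<integral>\<^sup>+\<xi>. 2 * ennreal ((cmod (?\<phi> R \<xi> - F \<xi>))\<^sup>2) + 2 * ennreal ((cmod (?\<phi> R \<xi> - G \<xi>))\<^sup>2) \<partial>lborel)"
      by (intro nn_integral_mono)
    also have "\<dots> = 2 * ?I F R + 2 * ?I G R"
      by (simp add: nn_integral_add nn_integral_cmult)
    finally show ?thesis .
  qed
  have "((\<lambda>R. 2 * ?I F R + 2 * ?I G R) \<longlongrightarrow> 2 * 0 + 2 * 0) at_top"
    using F G \<phi> by (intro tendsto_add ennreal_tendsto_cmult) (auto simp: is_fourier_L2_def)
  hence "(\<integral>\<^sup>+\<xi>. ennreal ((cmod (F \<xi> - G \<xi>))\<^sup>2) \<partial>lborel) \<le> 0"
    using le by (intro tendsto_lowerbound[where F="at_top::real filter"]) auto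
  hence "AE \<xi> in lborel. ennreal ((cmod (F \<xi> - G \<xi>))\<^sup>2) = 0"
    by (subst (asm) le_zero_eq, subst (asm) nn_integral_0_iff_AE) auto
  thus ?thesis by eventually_elim auto
qed

lemma is_fourier_L2_diff:
  assumes F: "is_fourier_L2 f F" and G: "is_fourier_L2 g G"
  shows "is_fourier_L2 (\<lambda>x. f x - g x) (\<lambda>\<xi>. F \<xi> - G \<xi>)"
  unfolding is_fourier_L2_def
proof (intro conjI)
  have [measurable]: "f \<in> borel_measurable borel" "g \<in> borel_measurable borel" "F \<in> borel_measurable borel" "G \<in> borel_measurable borel"
    and sf: "square_integrable f" and sg: "square_integrable g"
    using F G by (auto simp: is_fourier_L2_def square_integrable_measurable)
  show "square_integrable (\<lambda>x. f x - g x)" "square_integrable (\<lambda>\<xi>. F \<xi> - G \<xi>)"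
    using F G by (auto intro: square_integrable_diff simp: is_fourier_L2_def)
  let ?f = "\<lambda>R. fourier (\<lambda>x. indicator (ball 0 R) x * f x)" and ?g = "\<lambda>R. fourier (\<lambda>x. indicator (ball 0 R) x * g x)"
  note if' = integrable_bounded_support[OF sf] and ig = integrable_bounded_support[OF sg]
  have [measurable]: "?f R \<in> borel_measurable borel" "?g R \<in> borel_measurable borel" for R
    by (auto intro!: borel_measurable_fourier if' ig)
  let ?I = "\<lambda>F \<phi> R. \<integral>\<^sup>+\<xi>. ennreal ((cmod (\<phi> R \<xi> - F \<xi>))\<^sup>2) \<partial>lborel"
  have lim: "((\<lambda>R. 2 * ?I F ?f R + 2 * ?I G ?g R) \<longlongrightarrow> 0) at_top"
  proof -
    have "((\<lambda>R. 2 * ?I F ?f R + 2 * ?I G ?g R) \<longlongrightarrow> 2 * 0 + 2 * 0) at_top"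
      using F G by (intro tendsto_add ennreal_tendsto_cmult) (auto simp: is_fourier_L2_def)
    thus ?thesis by simp
  qed
  show "((\<lambda>R. \<integral>\<^sup>+\<xi>. ennreal ((cmod (fourier (\<lambda>x. indicator (ball 0 R) x * (f x - g x)) \<xi> - (F \<xi> - G \<xi>)))\<^sup>2) \<partial>lborel) \<longlongrightarrow> 0) at_top"
  proof (rule tendsto_sandwich[OF _ _ tendsto_const lim])
    show "\<forall>\<^sub>F R in at_top. (\<integral>\<^sup>+\<xi>. ennreal ((cmod (fourier (\<lambda>x. indicator (ball 0 R) x * (f x - g x)) \<xi> - (F \<xi> - G \<xi>)))\<^sup>2) \<partial>lborel)
        \<le> 2 * ?I F ?f R + 2 * ?I G ?g R"
    proof (intro always_eventually allI)
      fix R :: real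
      have eq: "fourier (\<lambda>x. indicator (ball 0 R) x * (f x - g x)) \<xi> = ?f R \<xi> - ?g R \<xi>" for \<xi>
        using fourier_diff[OF if' ig] by (simp add: algebra_simps)
      have "ennreal ((cmod (?f R \<xi> - ?g R \<xi> - (F \<xi> - G \<xi>)))\<^sup>2) \<le> 2 * ennreal ((cmod (?f R \<xi> - F \<xi>))\<^sup>2) + 2 * ennreal ((cmod (?g R \<xi> - G \<xi>))\<^sup>2)" for \<xi>
      proof -
        have "(cmod (?f R \<xi> - ?g R \<xi> - (F \<xi> - G \<xi>)))\<^sup>2 \<le> 2 * (cmod (?f R \<xi> - F \<xi>))\<^sup>2 + 2 * (cmod (?g R \<xi> - G \<xi>))\<^sup>2"
          using norm_diff_sq_le[of "?f R \<xi> - F \<xi>" "?g R \<xi> - G \<xi>"] by (simp add: algebra_simps)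
        hence "ennreal ((cmod (?f R \<xi> - ?g R \<xi> - (F \<xi> - G \<xi>)))\<^sup>2) \<le> ennreal (2 * (cmod (?f R \<xi> - F \<xi>))\<^sup>2 + 2 * (cmod (?g R \<xi> - G \<xi>))\<^sup>2)"
          by (rule ennreal_leI)
        thus ?thesis by (simp add: ennreal_plus ennreal_mult)
      qed
      hence "(\<integral>\<^sup>+\<xi>. ennreal ((cmod (?f R \<xi> - ?g R \<xi> - (F \<xi> - G \<xi>)))\<^sup>2) \<partial>lborel) \<le>
        (\<integral>\<^sup>+\<xi>. 2 * ennreal ((cmod (?f R \<xi> - F \<xi>))\<^sup>2) + 2 * ennreal ((cmod (?g R \<xi> - G \<xi>))\<^sup>2) \<partial>lborel)"
        by (intro nn_integral_mono)
      also have "\<dots> = 2 * ?I F ?f R + 2 * ?I G ?g R"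
        by (simp add: nn_integral_add nn_integral_cmult)
      finally show "(\<integral>\<^sup>+\<xi>. ennreal ((cmod (fourier (\<lambda>x. indicator (ball 0 R) x * (f x - g x)) \<xi> - (F \<xi> - G \<xi>)))\<^sup>2) \<partial>lborel)
        \<le> 2 * ?I F ?f R + 2 * ?I G ?g R" unfolding eq .
    qed
  qed auto
qed

text \<open>Replaces the version picked by \<open>SOME\<close> by any transform at hand; Sobolev
  norms are evaluated through this.\<close>

lemma sobolev_norm_eq:
  assumes "is_fourier_L2 f F"
  shows "sobolev_norm s f = sqrt (LINT \<xi>|lborel. (1 + (norm \<xi>)\<^sup>2) powr s * (cmod (F \<xi>))\<^sup>2)"
proof -
  let ?G = "SOME F. is_fourier_L2 f F"
  have G: "is_fourier_L2 f ?G" using assms by (rule someI[of "is_fourier_L2 f"])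
  have [measurable]: "?G \<in> borel_measurable borel" "F \<in> borel_measurable borel"
    using G assms by (auto simp: is_fourier_L2_def square_integrable_measurable)
  have "AE \<xi> in lborel. ?G \<xi> = F \<xi>" by (rule is_fourier_L2_unique[OF G assms]) simp
  hence "(LINT \<xi>|lborel. (1 + (norm \<xi>)\<^sup>2) powr s * (cmod (?G \<xi>))\<^sup>2) = (LINT \<xi>|lborel. (1 + (norm \<xi>)\<^sup>2) powr s * (cmod (F \<xi>))\<^sup>2)"
    by (intro integral_cong_AE) auto
  thus ?thesis unfolding sobolev_norm_def by simp
qed

section \<open>Pairings evaluated on the Fourier side\<close>

lemma is_fourier_L2_LIMSEQ:
  fixes f :: "'a::euclidean_space \<Rightarrow> complex"
  assumes F: "is_fourier_L2 f F" and \<kappa>: "square_integrable \<kappa>"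
  shows "(\<lambda>n. LINT \<xi>|lborel. fourier (\<lambda>x. indicator (ball 0 (real n)) x * f x) \<xi> * \<kappa> \<xi>) \<longlonglongrightarrow> (LINT \<xi>|lborel. F \<xi> * \<kappa> \<xi>)"
proof -
  have sf: "square_integrable f" and sF: "square_integrable F" using F by (auto simp: is_fourier_L2_def)
  let ?\<phi> = "\<lambda>n::nat. fourier (\<lambda>x. indicator (ball 0 (real n)) x * f x)"
  have s\<phi>: "square_integrable (?\<phi> n)" for n
    by (intro square_integrable_fourier integrable_bounded_support square_integrable_indicator sf)
  have sd: "square_integrable (\<lambda>\<xi>. ?\<phi> n \<xi> - F \<xi>)" for n by (rule square_integrable_diff[OF s\<phi> sF])
  have "((\<lambda>R. \<integral>\<^sup>+\<xi>. ennreal ((cmod (fourier (\<lambda>x. indicator (ball 0 R) x * f x) \<xi> - F \<xi>))\<^sup>2) \<partial>lborel) \<longlongrightarrow> 0) at_top"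
    using F by (simp add: is_fourier_L2_def)
  from filterlim_compose[OF this filterlim_real_sequentially]
  have "(\<lambda>n. \<integral>\<^sup>+\<xi>. ennreal ((cmod (?\<phi> n \<xi> - F \<xi>))\<^sup>2) \<partial>lborel) \<longlonglongrightarrow> 0" .
  also have "(\<lambda>n. \<integral>\<^sup>+\<xi>. ennreal ((cmod (?\<phi> n \<xi> - F \<xi>))\<^sup>2) \<partial>lborel) = (\<lambda>n. ennreal ((l2norm (\<lambda>\<xi>. ?\<phi> n \<xi> - F \<xi>))\<^sup>2))"
    using sd by (simp add: l2norm_sq nn_integral_eq_integral square_integrable_def)
  finally have "(\<lambda>n. (l2norm (\<lambda>\<xi>. ?\<phi> n \<xi> - F \<xi>))\<^sup>2) \<longlonglongrightarrow> 0"
    using tendsto_ennreal_iff[of "\<lambda>n. (l2norm (\<lambda>\<xi>. ?\<phi> n \<xi> - F \<xi>))\<^sup>2" sequentially 0] by simp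
  from tendsto_real_sqrt[OF this] have l: "(\<lambda>n. l2norm (\<lambda>\<xi>. ?\<phi> n \<xi> - F \<xi>)) \<longlonglongrightarrow> 0" by simp
  have "(\<lambda>n. (LINT \<xi>|lborel. ?\<phi> n \<xi> * \<kappa> \<xi>) - (LINT \<xi>|lborel. F \<xi> * \<kappa> \<xi>)) \<longlonglongrightarrow> 0"
  proof (rule Lim_null_comparison)
    show "\<forall>\<^sub>F n in sequentially. norm ((LINT \<xi>|lborel. ?\<phi> n \<xi> * \<kappa> \<xi>) - (LINT \<xi>|lborel. F \<xi> * \<kappa> \<xi>)) \<le> l2norm (\<lambda>\<xi>. ?\<phi> n \<xi> - F \<xi>) * l2norm \<kappa>"
    proof (intro always_eventually allI)
      fix n
      have "(LINT \<xi>|lborel. ?\<phi> n \<xi> * \<kappa> \<xi>) - (LINT \<xi>|lborel. F \<xi> * \<kappa> \<xi>) = (LINT \<xi>|lborel. (?\<phi> n \<xi> - F \<xi>) * \<kappa> \<xi>)"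
        by (simp add: left_diff_distrib Bochner_Integration.integral_diff square_integrable_mult s\<phi> sF \<kappa>)
      thus "norm ((LINT \<xi>|lborel. ?\<phi> n \<xi> * \<kappa> \<xi>) - (LINT \<xi>|lborel. F \<xi> * \<kappa> \<xi>)) \<le> l2norm (\<lambda>\<xi>. ?\<phi> n \<xi> - F \<xi>) * l2norm \<kappa>"
        using l2norm_Cauchy_Schwarz[OF sd \<kappa>] by simp
    qed
    show "(\<lambda>n. l2norm (\<lambda>\<xi>. ?\<phi> n \<xi> - F \<xi>) * l2norm \<kappa>) \<longlonglongrightarrow> 0"
      using tendsto_mult[OF l tendsto_const[of "l2norm \<kappa>"]] by simp
  qed
  thus ?thesis by (simp add: LIM_zero_iff)
qed

lemma pairing_indicator_LIMSEQ:
  assumes f: "square_integrable f" and \<psi>: "square_integrable \<psi>"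
  shows "(\<lambda>n. LINT x|lborel. indicator (ball 0 (real n)) x * f x * \<psi> x) \<longlonglongrightarrow> pairing f \<psi>"
  unfolding pairing_def
proof (rule integral_dominated_convergence[where w="\<lambda>x. cmod (f x * \<psi> x)"])
  have [measurable]: "f \<in> borel_measurable borel" "\<psi> \<in> borel_measurable borel" using f \<psi> by (auto intro: square_integrable_measurable)
  show "integrable lborel (\<lambda>x. cmod (f x * \<psi> x))" by (intro integrable_norm square_integrable_mult f \<psi>)
  show "AE x in lborel. (\<lambda>n. indicator (ball 0 (real n)) x * f x * \<psi> x) \<longlonglongrightarrow> f x * \<psi> x"
  proof (intro AE_I2 tendsto_eventually)
    fix x :: 'a
    obtain N :: nat where "norm x < real N" using reals_Archimedean2 by blast
    thus "\<forall>\<^sub>F n in sequentially. indicator (ball 0 (real n)) x * f x * \<psi> x = f x * \<psi> x"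
      by (intro eventually_sequentiallyI[of N]) (auto simp: indicator_def)
  qed
  show "(\<lambda>x. f x * \<psi> x) \<in> borel_measurable lborel" "(\<lambda>x. indicator (ball 0 (real n)) x * f x * \<psi> x) \<in> borel_measurable lborel" for n
    by measurable
qed (auto simp: indicator_def)

text \<open>The multiplication formula carried over to square integrable \<open>f\<close> by
  truncation to balls. It serves test functions that are given as Fourier transforms.\<close>

lemma pairing_fourier:
  assumes F: "is_fourier_L2 f F" and \<kappa>: "integrable lborel \<kappa>" "square_integrable \<kappa>"
  shows "pairing f (fourier \<kappa>) = pairing F \<kappa>"
proof -
  have sf: "square_integrable f" using F by (auto simp: is_fourier_L2_def)
  have "(\<lambda>n. LINT \<xi>|lborel. fourier (\<lambda>x. indicator (ball 0 (real n)) x * f x) \<xi> * \<kappa> \<xi>) \<longlonglongrightarrow> pairing F \<kappa>"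
    unfolding pairing_def by (rule is_fourier_L2_LIMSEQ[OF F \<kappa>(2)])
  moreover have "(\<lambda>n. LINT x|lborel. indicator (ball 0 (real n)) x * f x * fourier \<kappa> x) \<longlonglongrightarrow> pairing f (fourier \<kappa>)"
    by (rule pairing_indicator_LIMSEQ[OF sf square_integrable_fourier[OF \<kappa>]])
  ultimately show ?thesis
    by (subst (asm) fourier_exchange[OF integrable_bounded_support[OF sf] \<kappa>(1)]) (rule LIMSEQ_unique)
qed

lemma square_integrable_reflect:
  assumes "square_integrable \<kappa>" shows "square_integrable (\<lambda>\<xi>. \<kappa> (- \<xi>))"
proof -
  have [measurable]: "\<kappa> \<in> borel_measurable borel" using assms by (rule square_integrable_measurable)
  show ?thesis
    using assms lborel_integrable_affine[of "-1" "\<lambda>x. (cmod (\<kappa> x))\<^sup>2" 0] by (simp add: square_integrable_def)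
qed

lemma l2norm_reflect:
  assumes "square_integrable \<kappa>" shows "l2norm (\<lambda>\<xi>. \<kappa> (- \<xi>)) = l2norm \<kappa>"
proof -
  have [measurable]: "\<kappa> \<in> borel_measurable borel" using assms by (rule square_integrable_measurable)
  show ?thesis
    unfolding l2norm_def by (subst (2) lborel_integral_affine[of "-1" _ 0]) auto
qed

text \<open>Both transforms are square integrable, so their product dominates the damped integrands
  on the Fourier side. On the other side the mollifications of \<open>h\<close> are bounded by
  \<open>B\<close> times the mass of the kernel and converge at every point by continuity.\<close>

lemma parseval_continuous:
  fixes f h :: "'a::euclidean_space \<Rightarrow> complex"
  assumes f: "integrable lborel f" "square_integrable f"
    and h: "integrable lborel h" "square_integrable h" and b: "\<And>y. cmod (h y) \<le> B" and c: "continuous_on UNIV h"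
  shows "(LINT \<xi>|lborel. fourier f \<xi> * fourier h (- \<xi>)) = (2 * pi) ^ DIM('a) * (LINT x|lborel. f x * h x)"
proof -
  let ?e = "\<lambda>n. inverse (real (Suc n))"
  have [measurable]: "f \<in> borel_measurable borel" "h \<in> borel_measurable borel" using f h by auto
  have [measurable]: "fourier f \<in> borel_measurable borel" "fourier h \<in> borel_measurable borel"
    using f h borel_measurable_fourier by auto
  have i: "integrable lborel (\<lambda>\<xi>. fourier f \<xi> * fourier h (- \<xi>))"
    by (intro square_integrable_mult square_integrable_reflect square_integrable_fourier f h)
  have 1: "(\<lambda>n. LINT \<xi>|lborel. fourier f \<xi> * (fourier h (- \<xi>) * of_real (exp (- ?e n * (norm \<xi>)\<^sup>2)))) \<longlonglongrightarrow>
     (LINT \<xi>|lborel. fourier f \<xi> * (fourier h (- \<xi>) * 1))"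
  proof (rule integral_dominated_convergence[where w="\<lambda>\<xi>. cmod (fourier f \<xi> * fourier h (- \<xi>))"])
    show "AE \<xi> in lborel. (\<lambda>n. fourier f \<xi> * (fourier h (- \<xi>) * of_real (exp (- ?e n * (norm \<xi>)\<^sup>2)))) \<longlonglongrightarrow> fourier f \<xi> * (fourier h (- \<xi>) * 1)"
      by (intro AE_I2 tendsto_mult tendsto_const exp_damping_tendsto)
    show "integrable lborel (\<lambda>\<xi>. cmod (fourier f \<xi> * fourier h (- \<xi>)))" by (rule integrable_norm[OF i])
  qed (auto simp: norm_mult mult.assoc[symmetric] intro!: mult_left_le)
  have 2: "(\<lambda>n. LINT x|lborel. f x * (LINT y|lborel. h y * of_real (gauss_kernel (?e n) (y - x)))) \<longlonglongrightarrow>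
     (LINT x|lborel. f x * ((2 * pi) ^ DIM('a) * h x))"
  proof (rule integral_dominated_convergence[where w="\<lambda>x. cmod (f x) * (B * (2 * pi) ^ DIM('a))"])
    show "integrable lborel (\<lambda>x. cmod (f x) * (B * (2 * pi) ^ DIM('a)))" using f by auto
    show "AE x in lborel. (\<lambda>n. f x * (LINT y|lborel. h y * of_real (gauss_kernel (?e n) (y - x)))) \<longlonglongrightarrow> f x * ((2 * pi) ^ DIM('a) * h x)"
      using c by (intro AE_I2 tendsto_mult tendsto_const mollify_tendsto[OF _ b]) (auto simp: continuous_on_eq_continuous_at)
    show "AE x in lborel. norm (f x * (LINT y|lborel. h y * of_real (gauss_kernel (?e n) (y - x)))) \<le> cmod (f x) * (B * (2 * pi) ^ DIM('a))" for n
    proof (intro AE_I2)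
      fix x
      define ee where "ee = ?e n"
      have e: "ee > 0" by (simp add: ee_def)
      have "0 \<le> B" using b[of 0] norm_ge_zero order_trans by blast
      have "ennreal (cmod (LINT y|lborel. h y * of_real (gauss_kernel (ee) (y - x)))) \<le> (\<integral>\<^sup>+y. ennreal (cmod (h y * of_real (gauss_kernel (ee) (y - x)))) \<partial>lborel)"
        by (rule norm_integral_le_nn_integral)
      also have "\<dots> \<le> (\<integral>\<^sup>+y. ennreal B * ennreal (gauss_kernel (ee) (y - x)) \<partial>lborel)"
      proof (rule nn_integral_mono)
        fix y
        have "cmod (h y * of_real (gauss_kernel ee (y - x))) \<le> B * gauss_kernel ee (y - x)"
          using b[of y] gauss_kernel_nonneg[OF e, of "y - x"] by (simp add: norm_mult mult_right_mono)
        thus "ennreal (cmod (h y * of_real (gauss_kernel ee (y - x)))) \<le> ennreal B * ennreal (gauss_kernel ee (y - x))"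
          using gauss_kernel_nonneg[OF e, of "y - x"] \<open>0 \<le> B\<close> by (simp add: ennreal_leI flip: ennreal_mult)
      qed
      also have "\<dots> = ennreal (B * (2 * pi) ^ DIM('a))"
        using \<open>0 \<le> B\<close> by (subst nn_integral_cmult) (auto simp: nn_integral_gauss_kernel_shift[OF e] ennreal_mult simp del: of_nat_Suc)
      finally have "cmod (LINT y|lborel. h y * of_real (gauss_kernel (ee) (y - x))) \<le> B * (2 * pi) ^ DIM('a)"
        using \<open>0 \<le> B\<close> by (subst (asm) ennreal_le_iff) auto
      thus "norm (f x * (LINT y|lborel. h y * of_real (gauss_kernel (?e n) (y - x)))) \<le> cmod (f x) * (B * (2 * pi) ^ DIM('a))"
        unfolding ee_def[symmetric] by (simp add: norm_mult mult_left_mono)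
    qed
  qed measurable
  have "(LINT \<xi>|lborel. fourier f \<xi> * (fourier h (- \<xi>) * 1)) = (LINT x|lborel. f x * ((2 * pi) ^ DIM('a) * h x))"
    by (rule LIMSEQ_unique[OF 1]) (subst parseval_gauss[OF f(1) h(1)], simp, rule 2)
  also have "\<dots> = (2 * pi) ^ DIM('a) * (LINT x|lborel. f x * h x)"
    unfolding integral_mult_right_zero[symmetric] by (simp add: mult_ac)
  finally show ?thesis by simp
qed

lemma pairing_continuous:
  fixes f h :: "'a::euclidean_space \<Rightarrow> complex"
  assumes F: "is_fourier_L2 f F"
    and h: "integrable lborel h" "square_integrable h" and b: "\<And>y. cmod (h y) \<le> B" and c: "continuous_on UNIV h"
  shows "(2 * pi) ^ DIM('a) * pairing f h = pairing F (\<lambda>\<xi>. fourier h (- \<xi>))"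
proof -
  have sf: "square_integrable f" using F by (auto simp: is_fourier_L2_def)
  have "(\<lambda>n. LINT \<xi>|lborel. fourier (\<lambda>x. indicator (ball 0 (real n)) x * f x) \<xi> * fourier h (- \<xi>)) \<longlonglongrightarrow> pairing F (\<lambda>\<xi>. fourier h (- \<xi>))"
    unfolding pairing_def
    by (rule is_fourier_L2_LIMSEQ[OF F square_integrable_reflect[OF square_integrable_fourier[OF h]]])
  moreover have "(\<lambda>n. (2 * pi) ^ DIM('a) * (LINT x|lborel. indicator (ball 0 (real n)) x * f x * h x)) \<longlonglongrightarrow> (2 * pi) ^ DIM('a) * pairing f h"
    by (intro tendsto_intros pairing_indicator_LIMSEQ[OF sf h(2)])
  moreover have "(LINT \<xi>|lborel. fourier (\<lambda>x. indicator (ball 0 (real n)) x * f x) \<xi> * fourier h (- \<xi>)) =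
      (2 * pi) ^ DIM('a) * (LINT x|lborel. indicator (ball 0 (real n)) x * f x * h x)" for n
    by (rule parseval_continuous[OF integrable_bounded_support[OF sf] square_integrable_indicator[OF sf] h b c])
  ultimately show ?thesis
    by (simp only:) (rule LIMSEQ_unique)
qed

text \<open>Controls a pairing with \<open>f\<close> by the L2 norm of its transform, the quantity
  in which continuity in time is expressed below.\<close>

lemma is_fourier_L2_pairing_bound:
  fixes f h :: "'a::euclidean_space \<Rightarrow> complex"
  assumes F: "is_fourier_L2 f F"
    and h: "integrable lborel h" "square_integrable h" and b: "\<And>y. cmod (h y) \<le> B" and c: "continuous_on UNIV h"
  shows "cmod (pairing f h) \<le> l2norm F * l2norm h"
proof -
  have sF: "square_integrable F" using F by (auto simp: is_fourier_L2_def)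
  define K where "K = (2 * pi) ^ DIM('a)"
  have K: "K \<ge> 1" unfolding K_def using pi_gt3 by (intro one_le_power) auto
  \<comment> \<open>The argument yields the constant 1 / sqrt K; as K is at least 1, it is weakened
    to 1.\<close>
  have K1: "sqrt K \<le> K" using K real_sqrt_le_mono[of K "K * K"] by (simp add: mult_le_cancel_left1)
  note sh = square_integrable_fourier[OF h]
  have "K * cmod (pairing f h) = cmod (pairing F (\<lambda>\<xi>. fourier h (- \<xi>)))"
    using arg_cong[OF pairing_continuous[OF F h b c], of cmod] K by (simp add: norm_mult norm_power K_def)
  also have "\<dots> \<le> l2norm F * l2norm (\<lambda>\<xi>. fourier h (- \<xi>))"
    unfolding pairing_def by (rule l2norm_Cauchy_Schwarz[OF sF square_integrable_reflect[OF sh]])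
  also have "\<dots> = l2norm F * l2norm (fourier h)" by (simp add: l2norm_reflect[OF sh])
  also have "\<dots> \<le> l2norm F * (sqrt K * l2norm h)"
    unfolding K_def by (intro mult_left_mono l2norm_fourier_le[OF h]) simp
  also have "\<dots> \<le> l2norm F * (K * l2norm h)"
    by (intro mult_left_mono mult_right_mono K1) simp_all
  finally have "K * cmod (pairing f h) \<le> K * (l2norm F * l2norm h)" by (simp add: mult_ac)
  thus ?thesis using K by simp
qed

section \<open>Functions with nonnegative real part on a half plane\<close>

lemma open_halfplane_Re: "open {z. Re z > b}" and convex_halfplane_Re: "convex {z. Re z > b}"
  by (auto simp: open_halfspace_Re_gt convex_halfspace_Re_gt)

text \<open>A point \<open>w\<close> of the half plane is closer to \<open>v\<close> than to the
  mirror image of \<open>v\<close> in the imaginary axis. Hence the Moebius map that sends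
  \<open>v\<close> to 0 and this mirror image to infinity takes the half plane into the unit
  disc.\<close>

lemma halfplane_moebius_less:
  assumes "Re w > 0" "Re v > 0"
  shows "cmod (w - v) < cmod (w + cnj v)"
proof -
  have "(cmod (w - v))\<^sup>2 < (cmod (w + cnj v))\<^sup>2"
    using assms unfolding cmod_power2 by (simp add: power2_eq_square algebra_simps)
  thus ?thesis by (rule power2_less_imp_less) simp
qed

text \<open>Schwarz's lemma for \<open>f\<close> transported to the disc: \<open>\<psi>\<close> maps
  the disc to the half plane with 0 going to \<open>v\<close>, and the Moebius map applied after
  \<open>f\<close> sends \<open>f v\<close> to 0. The inequality is written without quotients so
  that it survives the limit in which real parts vanish.\<close>

lemma Schwarz_Pick_halfplane_strict:
  assumes hol: "f holomorphic_on {z. Re z > 0}" and pos: "\<And>z. Re z > 0 \<Longrightarrow> Re (f z) > 0"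
    and w: "Re w > 0" and v: "Re v > 0"
  shows "cmod (f w - f v) * cmod (w + cnj v) \<le> cmod (w - v) * cmod (f w + cnj (f v))"
proof -
  define \<psi> where "\<psi> \<zeta> = (v + \<zeta> * cnj v) / (1 - \<zeta>)" for \<zeta>
  define h where "h \<zeta> = (f (\<psi> \<zeta>) - f v) / (f (\<psi> \<zeta>) + cnj (f v))" for \<zeta>
  have \<psi>pos: "Re (\<psi> \<zeta>) > 0" if "cmod \<zeta> < 1" for \<zeta>
  proof -
    have ne: "1 - \<zeta> \<noteq> 0" using that by auto
    have "Re ((v + \<zeta> * cnj v) * cnj (1 - \<zeta>)) = Re v * (1 - (cmod \<zeta>)\<^sup>2)"
      unfolding cmod_power2 by (simp add: algebra_simps power2_eq_square)
    moreover have "(cmod \<zeta>)\<^sup>2 < 1" using that by (simp add: power_less_one_iff)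
    ultimately have "Re ((v + \<zeta> * cnj v) * cnj (1 - \<zeta>)) > 0" using v by simp
    thus ?thesis unfolding \<psi>_def using ne by (subst complex_div_cnj) (simp add: zero_less_divide_iff)
  qed
  have ne: "f (\<psi> \<zeta>) + cnj (f v) \<noteq> 0" if "cmod \<zeta> < 1" for \<zeta>
    using pos[OF \<psi>pos[OF that]] pos[OF v] by (auto simp: complex_eq_iff)
  have holh: "h holomorphic_on ball 0 1"
    unfolding h_def
  proof (intro holomorphic_intros)
    have "\<psi> holomorphic_on ball 0 1" unfolding \<psi>_def by (intro holomorphic_intros) auto
    hence "f \<circ> \<psi> holomorphic_on ball 0 1"
      using \<psi>pos by (intro holomorphic_on_compose_gen[OF _ hol]) auto
    thus "(\<lambda>\<zeta>. f (\<psi> \<zeta>)) holomorphic_on ball 0 1" by (simp add: o_def)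
    thus "(\<lambda>\<zeta>. f (\<psi> \<zeta>)) holomorphic_on ball 0 1" .
  qed (use ne in auto)
  have "\<psi> 0 = v" by (simp add: \<psi>_def)
  hence h0: "h 0 = 0" by (simp add: h_def)
  have h1: "cmod (h \<zeta>) < 1" if "cmod \<zeta> < 1" for \<zeta>
    using halfplane_moebius_less[OF pos[OF \<psi>pos[OF that]] pos[OF v]] ne[OF that]
    by (simp add: h_def norm_divide divide_less_eq)
  define \<zeta> where "\<zeta> = (w - v) / (w + cnj v)"
  have ne2: "w + cnj v \<noteq> 0" using w v by (auto simp: complex_eq_iff)
  have \<zeta>1: "cmod \<zeta> < 1"
    using halfplane_moebius_less[OF w v] ne2 by (simp add: \<zeta>_def norm_divide divide_less_eq)
  have "\<psi> \<zeta> = w"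
  proof -
    have "v + cnj v \<noteq> 0" using v by (auto simp: complex_eq_iff)
    have a: "1 - \<zeta> = (v + cnj v) / (w + cnj v)" using ne2 by (simp add: \<zeta>_def field_simps)
    have b: "v + \<zeta> * cnj v = w * (v + cnj v) / (w + cnj v)" using ne2 by (simp add: \<zeta>_def field_simps)
    show ?thesis unfolding \<psi>_def a b using \<open>v + cnj v \<noteq> 0\<close> ne2 by simp
  qed
  with Schwarz_Lemma(1)[OF holh h0 h1 \<zeta>1] have "cmod ((f w - f v) / (f w + cnj (f v))) \<le> cmod ((w - v) / (w + cnj v))"
    by (simp add: h_def \<zeta>_def)
  moreover have "f w + cnj (f v) \<noteq> 0" using ne[OF \<zeta>1] \<open>\<psi> \<zeta> = w\<close> by simp
  ultimately show ?thesis using ne2 by (simp add: norm_divide field_simps)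
qed

text \<open>The strict version applies to f + e for every e > 0, after a translation by
  \<open>b\<close>; then e tends to 0.\<close>

lemma Schwarz_Pick_halfplane:
  assumes hol: "f holomorphic_on {z. Re z > b}" and pos: "\<And>z. Re z > b \<Longrightarrow> Re (f z) \<ge> 0"
    and w: "Re w > b" and v: "Re v > b"
  shows "cmod (f w - f v) * cmod (w + cnj v - 2 * of_real b) \<le> cmod (w - v) * cmod (f w + cnj (f v))"
proof -
  have *: "cmod (f w - f v) * cmod (w + cnj v - 2 * of_real b) \<le> cmod (w - v) * cmod (f w + cnj (f v) + 2 * of_real e)" if "e > 0" for e :: real
  proof -
    have "(\<lambda>z. f (z + of_real b) + of_real e) holomorphic_on {z. Re z > 0}"
    proof (intro holomorphic_intros)
      have "f \<circ> (\<lambda>z. z + of_real b) holomorphic_on {z. Re z > 0}"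
        by (rule holomorphic_on_compose_gen[OF _ hol]) (auto intro!: holomorphic_intros)
      thus "(\<lambda>z. f (z + of_real b)) holomorphic_on {z. Re z > 0}" by (simp add: o_def)
    qed
    moreover have "Re (f (z + of_real b) + of_real e) > 0" if "Re z > 0" for z
      using pos[of "z + of_real b"] that \<open>e > 0\<close> by simp
    ultimately show ?thesis
      using Schwarz_Pick_halfplane_strict[of "\<lambda>z. f (z + of_real b) + of_real e" "w - of_real b" "v - of_real b"] w v
      by (simp add: algebra_simps)
  qed
  have lim: "((\<lambda>e. cmod (w - v) * cmod (f w + cnj (f v) + 2 * of_real e)) \<longlongrightarrow> cmod (w - v) * cmod (f w + cnj (f v) + 2 * of_real 0)) (at_right 0)"
    by (intro tendsto_intros)
  have "cmod (f w - f v) * cmod (w + cnj v - 2 * of_real b) \<le> cmod (w - v) * cmod (f w + cnj (f v) + 2 * of_real 0)"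
    by (rule tendsto_lowerbound[OF lim]) (auto intro!: eventually_at_right_less[THEN eventually_mono] *)
  thus ?thesis by simp
qed

text \<open>On the disc of radius \<open>d / 2\<close> about \<open>z\<close> the Schwarz-Pick
  quotient |w - z| / |w + cnj z - 2 b| is at most 1/3. So 3 |f w - f z| is at most |f w + cnj (f
  z)|, hence at most |f w - f z| + 2 Re (f z), which gives |f w - f z| \<le> Re (f z). Cauchy's
  inequality is then applied to f - f z, which has the same derivatives of positive order as
  f.\<close>

lemma higher_deriv_bound_halfplane:
  assumes hol: "f holomorphic_on {z. Re z > b}" and pos: "\<And>z. Re z > b \<Longrightarrow> Re (f z) \<ge> 0"
    and z: "Re z \<ge> b + d" and d: "d > 0" and k: "k \<ge> 1"
  shows "cmod ((deriv ^^ k) f z) \<le> fact k * Re (f z) / (d / 2) ^ k"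
proof -
  have sub: "cball z (d / 2) \<subseteq> {w. Re w > b}"
  proof
    fix w assume "w \<in> cball z (d / 2)"
    hence "\<bar>Re (z - w)\<bar> \<le> d / 2" using abs_Re_le_cmod[of "z - w"] by (simp add: dist_norm)
    hence "Re z - Re w \<le> d / 2" by (simp only: minus_complex.simps abs_le_iff)
    thus "w \<in> {w. Re w > b}" using z d by simp
  qed
  have zb: "Re z > b" using z d by simp
  have *: "cmod (f w - f z) \<le> Re (f z)" if w: "w \<in> cball z (d / 2)" for w
  proof -
    have wb: "Re w > b" using sub w by auto
    have dw: "cmod (w - z) \<le> d / 2" using w by (simp add: dist_norm norm_minus_commute)
    have "Re w \<ge> Re z - d / 2" using abs_Re_le_cmod[of "w - z"] dw by simp
    hence "3 * (d / 2) \<le> Re (w + cnj z - 2 * of_real b)" using z by simp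
    hence "3 * cmod (w - z) \<le> cmod (w + cnj z - 2 * of_real b)"
      using complex_Re_le_cmod[of "w + cnj z - 2 * of_real b"] dw by linarith
    hence "cmod (f w - f z) * (3 * cmod (w - z)) \<le> cmod (f w - f z) * cmod (w + cnj z - 2 * of_real b)"
      by (rule mult_left_mono) simp
    also have "\<dots> \<le> cmod (w - z) * cmod (f w + cnj (f z))"
      by (rule Schwarz_Pick_halfplane[OF hol pos wb zb])
    finally have "cmod (w - z) * (3 * cmod (f w - f z)) \<le> cmod (w - z) * cmod (f w + cnj (f z))" by (simp add: mult_ac)
    hence "w = z \<or> 3 * cmod (f w - f z) \<le> cmod (f w + cnj (f z))"
      using mult_le_cancel_left_pos[of "cmod (w - z)"] by (metis norm_eq_zero right_minus_eq zero_less_norm_iff)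
    moreover have "cmod (f w + cnj (f z)) \<le> cmod (f w - f z) + 2 * Re (f z)"
    proof -
      have "f w + cnj (f z) = (f w - f z) + of_real (2 * Re (f z))" by (simp add: complex_eq_iff)
      hence "cmod (f w + cnj (f z)) \<le> cmod (f w - f z) + cmod (of_real (2 * Re (f z)))"
        by (simp only: norm_triangle_ineq)
      thus ?thesis using pos[OF zb] by simp
    qed
    ultimately show ?thesis using pos[OF zb] by auto
  qed
  have hol2: "f holomorphic_on cball z (d / 2)" using holomorphic_on_subset[OF hol sub] .
  have "cmod ((deriv ^^ k) (\<lambda>w. f w - f z) z) \<le> fact k * Re (f z) / (d / 2) ^ k"
  proof (rule Cauchy_inequality)
    show "(\<lambda>w. f w - f z) holomorphic_on ball z (d / 2)"
      using holomorphic_on_subset[OF hol2 ball_subset_cball] by (intro holomorphic_intros)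
    show "continuous_on (cball z (d / 2)) (\<lambda>w. f w - f z)"
      using holomorphic_on_imp_continuous_on[OF hol2] by (intro continuous_intros)
  qed (use * d in \<open>auto simp: dist_norm\<close>)
  also have "(deriv ^^ k) (\<lambda>w. f w - f z) z = (deriv ^^ k) f z"
  proof -
    have "(deriv ^^ k) (\<lambda>w. f w - f z) z = (deriv ^^ k) f z - (deriv ^^ k) (\<lambda>w. f z) z"
      by (rule higher_deriv_diff[OF hol _ open_halfplane_Re]) (use zb in \<open>auto intro!: holomorphic_intros\<close>)
    thus ?thesis using k by (simp add: higher_deriv_const)
  qed
  finally show ?thesis .
qed

text \<open>A Phragmen-Lindelof argument. The function \<open>h\<close> is bounded and has modulus
  at most 1 on the boundary line. Dividing its k-th power by z - b + 1 makes the maximum principle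
  applicable on a large half disc; this gives |h z|^k \<le> |z - b + 1| for all \<open>k\<close>,
  which is impossible if |h z| > 1.\<close>

lemma Re_ge_from_boundary:
  assumes hol: "f holomorphic_on {z. Re z > b}" and cont: "continuous_on {z. Re z \<ge> b} f"
    and bdd: "bounded (f ` {z. Re z \<ge> b})" and bdry: "\<And>\<omega>. Re (f (Complex b \<omega>)) \<ge> c"
    and z: "Re z \<ge> b"
  shows "Re (f z) \<ge> c"
proof -
  obtain B where B: "\<And>z. Re z \<ge> b \<Longrightarrow> cmod (f z) \<le> B" using bdd by (auto simp: bounded_iff)
  define h where "h z = exp (of_real c - f z)" for z
  have h_norm: "cmod (h z) = exp (c - Re (f z))" for z by (simp add: h_def)
  define M where "M = exp (c + B)"
  have hM: "cmod (h z) \<le> M" if "Re z \<ge> b" for z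
    using abs_Re_le_cmod[of "f z"] B[OF that] by (simp add: h_norm M_def)
  have M0: "M > 0" by (simp add: M_def)
  have key: "cmod (h z) ^ k \<le> cmod (z - of_real b + 1)" for k
  proof -
    \<comment> \<open>On the arc |h|^k is at most M^k \<le> R - 1, which the modulus of the
      denominator of \<open>g\<close> exceeds or equals; the last summand places \<open>z\<close>
      inside the half disc.\<close>
    define R where "R = M ^ k + 1 + cmod (z - of_real b)"
    define S where "S = {z. Re z \<ge> b} \<inter> cball (of_real b) R"
    define g where "g z = h z ^ k / (z - of_real b + 1)" for z
    have ne: "w - of_real b + 1 \<noteq> 0" if "Re w \<ge> b" for w using that by (auto simp: complex_eq_iff)
    have n1: "cmod (w - of_real b + 1) \<ge> 1" if "Re w \<ge> b" for w
      using complex_Re_le_cmod[of "w - of_real b + 1"] that by simp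
    have clS: "closed S" unfolding S_def by (intro closed_Int closed_halfspace_Re_ge closed_cball)
    have int: "interior S \<subseteq> {z. Re z > b}"
    proof -
      have "interior S \<subseteq> interior {z. Re z \<ge> b}" unfolding S_def by (intro interior_mono) auto
      also have "\<dots> = {z. Re z > b}" using interior_halfspace_ge[of "1::complex" b] by (simp add: inner_complex_def)
      finally show ?thesis .
    qed
    have "cmod (g z) \<le> 1"
    proof (rule maximum_modulus_frontier[of g S])
      show "g holomorphic_on interior S"
        unfolding g_def h_def using int ne
        by (intro holomorphic_intros holomorphic_on_subset[OF hol]) (auto dest!: subsetD)
      show "continuous_on (closure S) g"
        unfolding closure_closed[OF clS] g_def h_def using ne
        by (intro continuous_intros continuous_on_subset[OF cont]) (auto simp: S_def)
      show "bounded S" unfolding S_def by (intro bounded_Int) auto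
      have "R \<ge> cmod (z - of_real b)" using M0 by (simp add: R_def)
      thus "z \<in> S" using z by (simp add: S_def dist_norm norm_minus_commute)
      fix w assume w: "w \<in> frontier S"
      hence "w \<in> S" using clS frontier_subset_closed by blast
      hence wb: "Re w \<ge> b" and wR: "cmod (w - of_real b) \<le> R" by (auto simp: S_def dist_norm norm_minus_commute)
      have "Re w = b \<or> cmod (w - of_real b) = R"
      proof (rule ccontr)
        assume "\<not> ?thesis"
        hence "w \<in> {z. Re z > b} \<inter> ball (of_real b) R" using wb wR by (auto simp: dist_norm norm_minus_commute)
        moreover have "{z. Re z > b} \<inter> ball (of_real b) R \<subseteq> interior S"
          by (rule interior_maximal) (auto simp: S_def open_halfspace_Re_gt)
        ultimately show False using w by (auto simp: frontier_def)
      qed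
      thus "cmod (g w) \<le> 1"
      proof
        assume "Re w = b"
        hence "w = Complex b (Im w)" by (simp add: complex_eq_iff)
        hence "cmod (h w) \<le> 1" using bdry[of "Im w"] by (simp add: h_norm)
        hence "cmod (h w) ^ k \<le> 1" by (simp add: power_le_one)
        thus ?thesis using n1[OF wb] ne[OF wb] by (simp add: g_def norm_divide norm_power divide_le_eq)
      next
        assume R: "cmod (w - of_real b) = R"
        have "cmod (h w) ^ k \<le> M ^ k" by (intro power_mono hM wb) simp
        also have "\<dots> \<le> R - 1" by (simp add: R_def)
        also have "\<dots> \<le> cmod (w - of_real b + 1)"
          using norm_triangle_ineq2[of "w - of_real b" "-1"] R by simp
        finally show ?thesis using ne[OF wb] by (simp add: g_def norm_divide norm_power divide_le_eq)
      qed
    qed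
    thus ?thesis using ne[OF z] by (simp add: g_def norm_divide norm_power divide_le_eq)
  qed
  have "cmod (h z) \<le> 1"
  proof (rule ccontr)
    assume "\<not> cmod (h z) \<le> 1"
    then obtain k where "cmod (z - of_real b + 1) < cmod (h z) ^ k" using real_arch_pow[of "cmod (h z)"] by auto
    thus False using key[of k] by simp
  qed
  thus ?thesis by (simp add: h_norm)
qed

section \<open>Integrals along vertical lines\<close>

lemma integrable_inverse_1_plus_square': "integrable lborel (\<lambda>x::real. 1 / (1 + x\<^sup>2))"
  and integral_inverse_1_plus_square: "(LINT x|lborel. 1 / (1 + x\<^sup>2)) = pi"
  using integrable_inverse_1_plus_square LBINT_inverse_1_plus_square
  by (simp_all add: set_integrable_def interval_lebesgue_integral_def set_lebesgue_integral_def
      einterval_def inverse_eq_divide)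

text \<open>Quadratic decay along vertical lines, uniform on strips away from the imaginary axis:
  enough for integrability on each line and for the horizontal sides of a rectangle to vanish when a
  contour is shifted.\<close>

definition line_bounded :: "(complex \<Rightarrow> complex) \<Rightarrow> bool" where
  "line_bounded H \<longleftrightarrow> H holomorphic_on {z. Re z > 0} \<and>
     (\<forall>x y. 0 < x \<longrightarrow> x \<le> y \<longrightarrow> (\<exists>C. \<forall>z. x \<le> Re z \<and> Re z \<le> y \<longrightarrow> cmod (H z) \<le> C / (1 + (Im z)\<^sup>2)))"

lemma continuous_on_vertical:
  assumes "H holomorphic_on {z. Re z > 0}" "x > 0"
  shows "continuous_on A (\<lambda>\<omega>. H (Complex x \<omega>))"
proof -
  have "continuous_on A (\<lambda>\<omega>. of_real x + \<i> * of_real \<omega>)" by (intro continuous_intros)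
  hence "continuous_on A (\<lambda>\<omega>. Complex x \<omega>)" by (simp add: Complex_eq)
  thus ?thesis
    using assms by (intro continuous_on_compose2[OF holomorphic_on_imp_continuous_on[OF assms(1)]]) auto
qed

lemma line_bounded_integrable:
  assumes H: "line_bounded H" and x: "x > 0"
  shows "integrable lborel (\<lambda>\<omega>. H (Complex x \<omega>))"
proof -
  have "\<exists>C. \<forall>z. x \<le> Re z \<and> Re z \<le> x \<longrightarrow> cmod (H z) \<le> C / (1 + (Im z)\<^sup>2)"
    using H x by (simp add: line_bounded_def)
  then obtain C where C: "\<And>z. Re z = x \<Longrightarrow> cmod (H z) \<le> C / (1 + (Im z)\<^sup>2)"
    by auto
  have [measurable]: "(\<lambda>\<omega>. H (Complex x \<omega>)) \<in> borel_measurable borel"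
    using H x by (intro borel_measurable_continuous_onI continuous_on_vertical) (auto simp: line_bounded_def)
  show ?thesis
  proof (rule Bochner_Integration.integrable_bound[of _ "\<lambda>\<omega>. C * (1 / (1 + \<omega>\<^sup>2))"])
    show "integrable lborel (\<lambda>\<omega>. C * (1 / (1 + \<omega>\<^sup>2)))"
      by (intro integrable_mult_right integrable_inverse_1_plus_square')
    show "AE \<omega> in lborel. norm (H (Complex x \<omega>)) \<le> norm (C * (1 / (1 + \<omega>\<^sup>2)))"
    proof (intro AE_I2)
      fix \<omega>
      have "cmod (H (Complex x \<omega>)) \<le> C * (1 / (1 + \<omega>\<^sup>2))" using C[of "Complex x \<omega>"] by simp
      also have "\<dots> \<le> norm (C * (1 / (1 + \<omega>\<^sup>2)))" by (simp only: real_norm_def abs_ge_self)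
      finally show "norm (H (Complex x \<omega>)) \<le> norm (C * (1 / (1 + \<omega>\<^sup>2)))" .
    qed
  qed simp
qed

lemma integral_truncated_LIMSEQ:
  assumes "integrable lborel (f :: real \<Rightarrow> complex)"
  shows "(\<lambda>n. LINT \<omega>|lborel. indicator {- real n..real n} \<omega> *\<^sub>R f \<omega>) \<longlonglongrightarrow> (LINT \<omega>|lborel. f \<omega>)"
proof (rule integral_dominated_convergence[where w="\<lambda>x. cmod (f x)"])
  show "AE x in lborel. (\<lambda>n. indicator {- real n..real n} x *\<^sub>R f x) \<longlonglongrightarrow> f x"
  proof (intro AE_I2 tendsto_eventually)
    fix x :: real
    obtain N :: nat where "\<bar>x\<bar> < real N" using reals_Archimedean2 by blast
    thus "\<forall>\<^sub>F n in sequentially. indicator {- real n..real n} x *\<^sub>R f x = f x"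
      by (intro eventually_sequentiallyI[of N]) (auto simp: indicator_def)
  qed
qed (use assms in \<open>auto simp: indicator_def\<close>)

text \<open>Cauchy's theorem for a long rectangle, by means of a primitive \<open>\<Phi>\<close>.
  Truncated line integrals are differences of \<open>\<Phi>\<close> at their end points, and between
  the two lines \<open>\<Phi>\<close> varies at height r by at most C |x - y| / (1 + r^2).\<close>

lemma line_integral_shift:
  assumes H: "line_bounded H" and x: "x > 0" and y: "y > 0"
  shows "(LINT \<omega>|lborel. H (Complex x \<omega>)) = (LINT \<omega>|lborel. H (Complex y \<omega>))"
proof -
  have hol: "H holomorphic_on {z. Re z > 0}" using H by (simp add: line_bounded_def)
  obtain \<Phi> where \<Phi>: "\<And>z. Re z > 0 \<Longrightarrow> (\<Phi> has_field_derivative H z) (at z within {z. Re z > 0})"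
    using holomorphic_convex_primitive'[OF convex_halfplane_Re open_halfplane_Re hol] by auto
  have \<Phi>': "(\<Phi> has_field_derivative H z) (at z)" if "Re z > 0" for z
    using \<Phi>[OF that] that at_within_open[OF _ open_halfplane_Re] by auto
  have "\<exists>C. \<forall>z. min x y \<le> Re z \<and> Re z \<le> max x y \<longrightarrow> cmod (H z) \<le> C / (1 + (Im z)\<^sup>2)"
    using H x y unfolding line_bounded_def by (metis min_less_iff_conj max.cobounded1 min.cobounded1 order_trans)
  then obtain C where C: "\<And>z. min x y \<le> Re z \<Longrightarrow> Re z \<le> max x y \<Longrightarrow> cmod (H z) \<le> C / (1 + (Im z)\<^sup>2)"
    by blast
  have ftc: "(LINT \<omega>|lborel. indicator {-r..r} \<omega> *\<^sub>R H (Complex x \<omega>)) = - \<i> * (\<Phi> (Complex x r) - \<Phi> (Complex x (- r)))"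
    if "r \<ge> 0" "x > 0" for r x :: real
  proof -
    have "(LINT \<omega>|lborel. indicator {-r..r} \<omega> *\<^sub>R H (Complex x \<omega>)) = (- \<i> * \<Phi> (Complex x r)) - (- \<i> * \<Phi> (Complex x (- r)))"
    proof (rule integral_FTC_Icc)
      fix \<omega> :: real
      have 1: "((\<lambda>\<omega>. Complex x \<omega>) has_vector_derivative \<i>) (at \<omega> within {-r..r})"
        unfolding Complex_eq by (auto intro!: derivative_eq_intros)
      have "((\<Phi> \<circ> (\<lambda>\<omega>. Complex x \<omega>)) has_vector_derivative (\<i> * H (Complex x \<omega>))) (at \<omega> within {-r..r})"
        by (rule field_vector_diff_chain_within[OF 1]) (rule has_field_derivative_at_within, rule \<Phi>', simp add: that)
      from has_vector_derivative_mult_right[OF this, of "- \<i>"]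
      show "((\<lambda>\<omega>. - \<i> * \<Phi> (Complex x \<omega>)) has_vector_derivative H (Complex x \<omega>)) (at \<omega> within {-r..r})"
        by (simp add: o_def)
    qed (use that in \<open>auto intro!: continuous_on_vertical[OF hol]\<close>)
    thus ?thesis by (simp add: algebra_simps)
  qed
  let ?d = "\<lambda>n. (LINT \<omega>|lborel. indicator {- real n..real n} \<omega> *\<^sub>R H (Complex x \<omega>)) - (LINT \<omega>|lborel. indicator {- real n..real n} \<omega> *\<^sub>R H (Complex y \<omega>))"
  have diff: "cmod (\<Phi> (Complex x r) - \<Phi> (Complex y r)) \<le> C / (1 + r\<^sup>2) * \<bar>x - y\<bar>" for r
  proof -
    have "cmod (\<Phi> (Complex x r) - \<Phi> (Complex y r)) \<le> C / (1 + r\<^sup>2) * cmod (Complex x r - Complex y r)"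
    proof (rule field_differentiable_bound[where S="{z. min x y \<le> Re z \<and> Re z \<le> max x y \<and> Im z = r}" and f'=H])
      have "{z. min x y \<le> Re z \<and> Re z \<le> max x y \<and> Im z = r} = {z. min x y \<le> Re z} \<inter> {z. Re z \<le> max x y} \<inter> {z. r \<le> Im z} \<inter> {z. Im z \<le> r}"
        by auto
      thus "convex {z. min x y \<le> Re z \<and> Re z \<le> max x y \<and> Im z = r}"
        by (simp add: convex_Int convex_halfspace_Re_ge convex_halfspace_Re_le convex_halfspace_Im_ge convex_halfspace_Im_le del: min_le_iff_disj le_max_iff_disj)
      show "(\<Phi> has_field_derivative H z) (at z within {z. min x y \<le> Re z \<and> Re z \<le> max x y \<and> Im z = r})"
        if "z \<in> {z. min x y \<le> Re z \<and> Re z \<le> max x y \<and> Im z = r}" for z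
        by (rule has_field_derivative_at_within, rule \<Phi>') (use that x y in auto)
      show "cmod (H z) \<le> C / (1 + r\<^sup>2)" if "z \<in> {z. min x y \<le> Re z \<and> Re z \<le> max x y \<and> Im z = r}" for z
        using C[of z] that by auto
    qed auto
    also have "cmod (Complex x r - Complex y r) = \<bar>x - y\<bar>" by (simp add: complex_diff cmod_def)
    finally show ?thesis .
  qed
  have "?d \<longlonglongrightarrow> 0"
  proof (rule Lim_null_comparison)
    show "\<forall>\<^sub>F n in sequentially. norm (?d n) \<le> 2 * C * \<bar>x - y\<bar> * (1 / (1 + (real n)\<^sup>2))"
    proof (intro always_eventually allI)
      fix n
      have "?d n = - \<i> * ((\<Phi> (Complex x n) - \<Phi> (Complex y n)) - (\<Phi> (Complex x (- n)) - \<Phi> (Complex y (- n))))"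
        by (simp add: ftc x y algebra_simps)
      hence "norm (?d n) \<le> cmod (\<Phi> (Complex x n) - \<Phi> (Complex y n)) + cmod (\<Phi> (Complex x (- n)) - \<Phi> (Complex y (- n)))"
        by (simp add: norm_mult norm_triangle_ineq4)
      also have "\<dots> \<le> 2 * C * \<bar>x - y\<bar> * (1 / (1 + (real n)\<^sup>2))"
        using diff[of "real n"] diff[of "- real n"] by simp
      finally show "norm (?d n) \<le> 2 * C * \<bar>x - y\<bar> * (1 / (1 + (real n)\<^sup>2))" .
    qed
    show "(\<lambda>n. 2 * C * \<bar>x - y\<bar> * (1 / (1 + (real n)\<^sup>2))) \<longlonglongrightarrow> 0" by real_asymp
  qed
  moreover have "?d \<longlonglongrightarrow> (LINT \<omega>|lborel. H (Complex x \<omega>)) - (LINT \<omega>|lborel. H (Complex y \<omega>))"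
    by (intro tendsto_diff integral_truncated_LIMSEQ line_bounded_integrable H x y)
  ultimately show ?thesis using LIMSEQ_unique by fastforce
qed

section \<open>Resolvents\<close>

text \<open>The constants \<open>c\<close> and \<open>C\<close> are shared by a whole family of
  symbols, whereas the bound B is hidden under a quantifier because it grows with the scaling
  factor; uniform estimates may use only \<open>c\<close> and \<open>C\<close>. The last clause
  keeps the denominator z + P(z) away from 0 near the imaginary axis: either its real part is
  bounded below, or its modulus is comparable to |Im z|.\<close>

definition resolvent_symbol :: "real \<Rightarrow> (nat \<Rightarrow> real) \<Rightarrow> (complex \<Rightarrow> complex) \<Rightarrow> bool" where
  "resolvent_symbol c C P \<longleftrightarrow> P holomorphic_on {z. Re z > 0} \<and>
     (\<exists>B. \<forall>z. Re z > 0 \<longrightarrow> cmod (P z) \<le> B) \<and>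
     (\<forall>z. Re z > 0 \<longrightarrow> Re (P z) \<ge> 0) \<and>
     (\<forall>k\<ge>1. \<forall>z. Re z > 0 \<longrightarrow> cmod ((deriv ^^ k) P z) \<le> C k * (1 + Re (P z))) \<and>
     (\<forall>z. 0 < Re z \<and> Re z \<le> 1 \<longrightarrow> Re (P z) \<ge> c \<or> \<bar>Im z\<bar> \<ge> 1 \<and> cmod (z + P z) \<ge> c * \<bar>Im z\<bar>)"

definition resolvent :: "(complex \<Rightarrow> complex) \<Rightarrow> complex \<Rightarrow> complex" where
  "resolvent P z = 1 / (z + P z)"

lemma resolvent_symbolD:
  assumes "resolvent_symbol c C P"
  shows "P holomorphic_on {z. Re z > 0}"
    and "\<exists>B\<ge>0. \<forall>z. Re z > 0 \<longrightarrow> cmod (P z) \<le> B"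
    and "Re z > 0 \<Longrightarrow> Re (P z) \<ge> 0"
    and "k \<ge> 1 \<Longrightarrow> Re z > 0 \<Longrightarrow> cmod ((deriv ^^ k) P z) \<le> C k * (1 + Re (P z))"
    and "0 < Re z \<Longrightarrow> Re z \<le> 1 \<Longrightarrow> Re (P z) \<ge> c \<or> \<bar>Im z\<bar> \<ge> 1 \<and> cmod (z + P z) \<ge> c * \<bar>Im z\<bar>"
proof -
  obtain B where "\<forall>z. Re z > 0 \<longrightarrow> cmod (P z) \<le> B" using assms by (auto simp: resolvent_symbol_def)
  hence "\<forall>z. Re z > 0 \<longrightarrow> cmod (P z) \<le> max B 0" by (simp add: le_max_iff_disj)
  thus "\<exists>B\<ge>0. \<forall>z. Re z > 0 \<longrightarrow> cmod (P z) \<le> B" by (intro exI[of _ "max B 0"]) simp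
qed (use assms in \<open>auto simp: resolvent_symbol_def\<close>)

lemma
  assumes P: "resolvent_symbol c C P" and z: "Re z > 0"
  shows resolvent_denom_nz: "z + P z \<noteq> 0"
    and resolvent_denom_ge_Re: "Re (P z) \<le> cmod (z + P z)"
proof -
  have "Re (z + P z) > 0" using resolvent_symbolD(3)[OF P z] z by simp
  thus "z + P z \<noteq> 0" by (metis less_irrefl zero_complex.simps(1))
  show "Re (P z) \<le> cmod (z + P z)" using complex_Re_le_cmod[of "z + P z"] z by simp
qed

lemma resolvent_holomorphic:
  assumes P: "resolvent_symbol c C P" shows "resolvent P holomorphic_on {z. Re z > 0}"
  unfolding resolvent_def[abs_def]
  using resolvent_denom_nz[OF P] by (intro holomorphic_intros resolvent_symbolD(1)[OF P]) auto

text \<open>In terms of the resolvent G: (1 + Re P) |G| is at most 2 / c, however large P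
  is.\<close>

lemma resolvent_denom_lower:
  assumes P: "resolvent_symbol c C P" and c: "0 < c" "c \<le> 1" and z: "Re z > 0"
  shows "c / 2 * (1 + Re (P z)) \<le> cmod (z + P z)"
proof -
  have P0: "Re (P z) \<ge> 0" by (rule resolvent_symbolD(3)[OF P z])
  have R: "Re (P z) \<le> cmod (z + P z)" by (rule resolvent_denom_ge_Re[OF P z])
  have cP: "c * Re (P z) \<le> 1 * Re (P z)" using c P0 by (intro mult_right_mono) auto
  show ?thesis
  proof (cases "Re z \<le> 1")
    case False
    hence "1 + Re (P z) \<le> cmod (z + P z)" using complex_Re_le_cmod[of "z + P z"] by simp
    moreover have "c / 2 * (1 + Re (P z)) \<le> 1 * (1 + Re (P z))" using c P0 by (intro mult_right_mono) auto
    ultimately show ?thesis by simp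
  next
    case True
    from resolvent_symbolD(5)[OF P z True] show ?thesis
    proof
      assume "c \<le> Re (P z)"
      thus ?thesis using R cP by (simp add: field_simps)
    next
      assume a: "1 \<le> \<bar>Im z\<bar> \<and> c * \<bar>Im z\<bar> \<le> cmod (z + P z)"
      hence "c * 1 \<le> c * \<bar>Im z\<bar>" using c by (intro mult_left_mono) auto
      hence "c \<le> cmod (z + P z)" using a by simp
      thus ?thesis using R cP by (simp add: field_simps)
    qed
  qed
qed

text \<open>Leibniz's rule for the identity (z + P) G = 1, solved for the term in which all
  derivatives fall on G. In each remaining term the denominator is differentiated at least once,
  which supplies 1 + Re P, and G carries a lower derivative. Dividing by z + P supplies the second
  factor |G|.\<close>

lemma resolvent_higher_deriv_step:
  assumes P: "resolvent_symbol c C P" and z: "Re z > 0" and N: "N \<ge> 1"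
    and D: "\<And>m. m < N \<Longrightarrow> cmod ((deriv ^^ m) (resolvent P) z) \<le> D m * cmod (resolvent P z)"
  shows "cmod ((deriv ^^ N) (resolvent P) z) \<le>
    (\<Sum>i=1..N. of_nat (N choose i) * (1 + C i) * D (N - i)) * (1 + Re (P z)) * (cmod (resolvent P z))\<^sup>2"
proof -
  let ?S = "{z. Re z > 0}" and ?G = "resolvent P"
  note holP = resolvent_symbolD(1)[OF P] and holG = resolvent_holomorphic[OF P]
  have holQ: "(\<lambda>z. z + P z) holomorphic_on ?S" by (intro holomorphic_intros holP)
  have P0: "Re (P z) \<ge> 0" by (rule resolvent_symbolD(3)[OF P z])
  have Q: "cmod ((deriv ^^ i) (\<lambda>z. z + P z) z) \<le> (1 + C i) * (1 + Re (P z))" if "i \<ge> 1" for i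
  proof -
    have "(deriv ^^ i) (\<lambda>z. z + P z) z = (deriv ^^ i) (\<lambda>z. z) z + (deriv ^^ i) P z"
      by (rule higher_deriv_add[OF _ holP open_halfplane_Re]) (use z in \<open>auto intro: holomorphic_intros\<close>)
    also have "(deriv ^^ i) (\<lambda>z. z) z = (if i = 1 then 1 else 0)" using that by simp
    finally have "cmod ((deriv ^^ i) (\<lambda>z. z + P z) z) \<le> 1 + cmod ((deriv ^^ i) P z)"
      by (auto intro: order_trans[OF norm_triangle_ineq])
    also have "\<dots> \<le> 1 + C i * (1 + Re (P z))" using resolvent_symbolD(4)[OF P that z] by simp
    also have "\<dots> \<le> (1 + C i) * (1 + Re (P z))" using P0 by (simp add: algebra_simps)
    finally show ?thesis .
  qed
  have "(deriv ^^ N) (\<lambda>w. (w + P w) * ?G w) z = (deriv ^^ N) (\<lambda>w. 1) z"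
  proof (rule higher_deriv_transform_within_open[OF _ _ open_halfplane_Re])
    show "(w + P w) * ?G w = 1" if "w \<in> ?S" for w
      using resolvent_denom_nz[OF P, of w] that by (simp add: resolvent_def)
  qed (use z in \<open>auto intro!: holomorphic_intros holP holG\<close>)
  hence "0 = (\<Sum>i=0..N. of_nat (N choose i) * (deriv ^^ i) (\<lambda>z. z + P z) z * (deriv ^^ (N - i)) ?G z)"
    using N z by (subst (asm) higher_deriv_mult[OF holQ holG open_halfplane_Re]) (auto simp: higher_deriv_const)
  also have "\<dots> = (z + P z) * (deriv ^^ N) ?G z + (\<Sum>i=1..N. of_nat (N choose i) * (deriv ^^ i) (\<lambda>z. z + P z) z * (deriv ^^ (N - i)) ?G z)"
    by (simp add: sum.atLeast_Suc_atMost)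
  finally have "(z + P z) * (deriv ^^ N) ?G z = - (\<Sum>i=1..N. of_nat (N choose i) * (deriv ^^ i) (\<lambda>z. z + P z) z * (deriv ^^ (N - i)) ?G z)"
    by (simp add: eq_neg_iff_add_eq_0)
  hence "?G z * ((z + P z) * (deriv ^^ N) ?G z) = - ?G z * (\<Sum>i=1..N. of_nat (N choose i) * (deriv ^^ i) (\<lambda>z. z + P z) z * (deriv ^^ (N - i)) ?G z)"
    by simp
  moreover have "?G z * ((z + P z) * (deriv ^^ N) ?G z) = (deriv ^^ N) ?G z"
    using resolvent_denom_nz[OF P z] by (simp add: resolvent_def)
  ultimately have "cmod ((deriv ^^ N) ?G z) = cmod (?G z) * cmod (\<Sum>i=1..N. of_nat (N choose i) * (deriv ^^ i) (\<lambda>z. z + P z) z * (deriv ^^ (N - i)) ?G z)"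
    by (simp add: norm_mult)
  also have "\<dots> \<le> cmod (?G z) * (\<Sum>i=1..N. of_nat (N choose i) * ((1 + C i) * (1 + Re (P z))) * (D (N - i) * cmod (?G z)))"
  proof (intro mult_left_mono sum_norm_le)
    fix i assume i: "i \<in> {1..N}"
    have "cmod ((deriv ^^ i) (\<lambda>z. z + P z) z) * cmod ((deriv ^^ (N - i)) ?G z) \<le> (1 + C i) * (1 + Re (P z)) * (D (N - i) * cmod (?G z))"
      using i Q[of i] D[of "N - i"] by (intro mult_mono) (auto intro: order_trans[OF norm_ge_zero])
    hence "of_nat (N choose i) * (cmod ((deriv ^^ i) (\<lambda>z. z + P z) z) * cmod ((deriv ^^ (N - i)) ?G z)) \<le> of_nat (N choose i) * ((1 + C i) * (1 + Re (P z)) * (D (N - i) * cmod (?G z)))"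
      by (rule mult_left_mono) simp
    thus "cmod (of_nat (N choose i) * (deriv ^^ i) (\<lambda>z. z + P z) z * (deriv ^^ (N - i)) ?G z) \<le> of_nat (N choose i) * ((1 + C i) * (1 + Re (P z))) * (D (N - i) * cmod (?G z))"
      by (simp add: norm_mult mult_ac)
  qed simp
  also have "\<dots> = (\<Sum>i=1..N. of_nat (N choose i) * (1 + C i) * D (N - i)) * (1 + Re (P z)) * (cmod (resolvent P z))\<^sup>2"
    by (simp add: sum_distrib_left sum_distrib_right power2_eq_square mult_ac)
  finally show ?thesis .
qed

text \<open>The induction over the order runs with the weaker bound by D |G|, which follows from the
  stated one because (1 + Re P) |G| \<le> 2 / c. The form with |G|^2 is kept for the last step,
  since it can be compared with Re G.\<close>

lemma resolvent_higher_deriv_bound: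
  assumes c: "0 < c" "c \<le> 1" and N: "N \<ge> 1"
  shows "\<exists>E. \<forall>P z. resolvent_symbol c C P \<longrightarrow> Re z > 0 \<longrightarrow>
    cmod ((deriv ^^ N) (resolvent P) z) \<le> E * (1 + Re (P z)) * (cmod (resolvent P z))\<^sup>2"
proof -
  have step: "\<exists>E. \<forall>P z. resolvent_symbol c C P \<longrightarrow> Re z > 0 \<longrightarrow>
      cmod ((deriv ^^ N) (resolvent P) z) \<le> E * (1 + Re (P z)) * (cmod (resolvent P z))\<^sup>2"
    if D: "\<forall>m<N. \<exists>D. \<forall>P z. resolvent_symbol c C P \<longrightarrow> Re z > 0 \<longrightarrow>
      cmod ((deriv ^^ m) (resolvent P) z) \<le> D * cmod (resolvent P z)" and N: "N \<ge> 1" for N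
  proof -
    from D obtain D where "\<forall>m<N. \<forall>P z. resolvent_symbol c C P \<longrightarrow> Re z > 0 \<longrightarrow>
      cmod ((deriv ^^ m) (resolvent P) z) \<le> D m * cmod (resolvent P z)" by metis
    thus ?thesis
      by (intro exI[of _ "\<Sum>i=1..N. of_nat (N choose i) * (1 + C i) * D (N - i)"] allI impI resolvent_higher_deriv_step N) auto
  qed
  have "\<exists>D. \<forall>P z. resolvent_symbol c C P \<longrightarrow> Re z > 0 \<longrightarrow>
      cmod ((deriv ^^ m) (resolvent P) z) \<le> D * cmod (resolvent P z)" for m
  proof (induction m rule: less_induct)
    case (less m)
    show ?case
    proof (cases "m = 0")
      case True
      thus ?thesis by (intro exI[of _ 1]) simp
    next
      case False
      with less have "\<exists>E. \<forall>P z. resolvent_symbol c C P \<longrightarrow> Re z > 0 \<longrightarrow>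
        cmod ((deriv ^^ m) (resolvent P) z) \<le> E * (1 + Re (P z)) * (cmod (resolvent P z))\<^sup>2" by (intro step) auto
      then obtain E where E: "\<And>P z. resolvent_symbol c C P \<Longrightarrow> Re z > 0 \<Longrightarrow>
        cmod ((deriv ^^ m) (resolvent P) z) \<le> E * (1 + Re (P z)) * (cmod (resolvent P z))\<^sup>2" by blast
      show ?thesis
      proof (intro exI[of _ "\<bar>E\<bar> * (2 / c)"] allI impI)
        fix P z assume P: "resolvent_symbol c C P" and z: "Re z > 0"
        let ?g = "cmod (resolvent P z)"
        have "(1 + Re (P z)) * ?g \<le> 2 / c"
          using resolvent_denom_lower[OF P c z] resolvent_denom_nz[OF P z] c
          by (simp add: resolvent_def norm_divide field_simps)
        have "cmod ((deriv ^^ m) (resolvent P) z) \<le> E * ((1 + Re (P z)) * ?g\<^sup>2)" using E[OF P z] by (simp add: mult_ac)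
        also have "\<dots> \<le> \<bar>E\<bar> * ((1 + Re (P z)) * ?g\<^sup>2)"
          using resolvent_symbolD(3)[OF P z] by (intro mult_right_mono) auto
        also have "\<dots> = \<bar>E\<bar> * ((1 + Re (P z)) * ?g) * ?g" by (simp add: power2_eq_square)
        also have "\<dots> \<le> \<bar>E\<bar> * (2 / c) * ?g"
          by (intro mult_right_mono mult_left_mono) (use \<open>(1 + Re (P z)) * ?g \<le> 2 / c\<close> in auto)
        finally show "cmod ((deriv ^^ m) (resolvent P) z) \<le> \<bar>E\<bar> * (2 / c) * ?g" .
      qed
    qed
  qed
  thus ?thesis using step[OF _ N] by blast
qed

text \<open>This bound depends on \<open>B\<close> and is therefore not uniform over the family; it
  only guarantees integrability and the right to shift contours.\<close>

lemma resolvent_denom_linear: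
  assumes P: "resolvent_symbol c C P" and B: "\<And>z. Re z > 0 \<Longrightarrow> cmod (P z) \<le> B" and x: "x > 0" and z: "Re z \<ge> x"
  shows "x / (1 + x + B) * (1 + \<bar>Im z\<bar>) \<le> cmod (z + P z)"
proof -
  have z0: "Re z > 0" using x z by simp
  have B0: "B \<ge> 0" using B[OF z0] norm_ge_zero order_trans by metis
  have 1: "x \<le> cmod (z + P z)"
    using complex_Re_le_cmod[of "z + P z"] resolvent_symbolD(3)[OF P z0] z by simp
  have 2: "\<bar>Im z\<bar> - B \<le> cmod (z + P z)"
    using norm_triangle_ineq2[of z "- P z"] B[OF z0] abs_Im_le_cmod[of z] by simp
  have "x * (1 + \<bar>Im z\<bar>) \<le> cmod (z + P z) * (1 + x + B)"
  proof (cases "\<bar>Im z\<bar> \<le> x + B")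
    case True
    thus ?thesis using 1 x B0 by (intro mult_mono) auto
  next
    case False
    have "x * (1 + \<bar>Im z\<bar>) \<le> (\<bar>Im z\<bar> - B) * (1 + x + B)"
    proof -
      have "(\<bar>Im z\<bar> - B) * (1 + x + B) - x * (1 + \<bar>Im z\<bar>) = (\<bar>Im z\<bar> - (x + B)) * (1 + B)"
        by (simp add: algebra_simps)
      moreover have "\<dots> \<ge> 0" using False B0 by simp
      ultimately show ?thesis by simp
    qed
    also have "\<dots> \<le> cmod (z + P z) * (1 + x + B)" using 2 x B0 by (intro mult_right_mono) auto
    finally show ?thesis .
  qed
  thus ?thesis using x B0 by (simp add: field_simps)
qed

lemma one_plus_sq_le: "1 + (x::real)\<^sup>2 \<le> (1 + \<bar>x\<bar>)\<^sup>2"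
  by (simp add: power2_sum)

lemma resolvent_sq_bound:
  assumes P: "resolvent_symbol c C P" and B: "\<And>z. Re z > 0 \<Longrightarrow> cmod (P z) \<le> B" and x: "x > 0" and z: "Re z \<ge> x"
  shows "(cmod (resolvent P z))\<^sup>2 \<le> (1 / (x / (1 + x + B)))\<^sup>2 / (1 + (Im z)\<^sup>2)"
proof -
  have z0: "Re z > 0" using x z by simp
  have B0: "B \<ge> 0" using B[OF z0] norm_ge_zero order_trans by metis
  define q where "q = x / (1 + x + B)"
  have q: "q > 0" using x B0 by (simp add: q_def)
  have "q\<^sup>2 * (1 + (Im z)\<^sup>2) \<le> q\<^sup>2 * (1 + \<bar>Im z\<bar>)\<^sup>2"
    using one_plus_sq_le[of "Im z"] by (intro mult_left_mono) auto
  also have "\<dots> = (q * (1 + \<bar>Im z\<bar>))\<^sup>2" by (simp add: power_mult_distrib)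
  also have "\<dots> \<le> (cmod (z + P z))\<^sup>2"
    unfolding q_def by (intro power_mono resolvent_denom_linear[OF P B x z]) (use x B0 in auto)
  finally have "q\<^sup>2 * (1 + (Im z)\<^sup>2) \<le> (cmod (z + P z))\<^sup>2" .
  moreover have "1 + (Im z)\<^sup>2 > 0" by (simp add: add_pos_nonneg)
  ultimately have "1 / (cmod (z + P z))\<^sup>2 \<le> 1 / (q\<^sup>2 * (1 + (Im z)\<^sup>2))"
    using q by (intro divide_left_mono mult_pos_pos) (auto simp: resolvent_denom_nz[OF P z0])
  thus ?thesis
    unfolding q_def[symmetric] resolvent_def norm_divide power_divide by simp
qed

text \<open>A derivative of positive order carries |G|^2, hence decays quadratically along vertical
  lines; G itself decays only to first order.\<close>

lemma line_bounded_resolvent_deriv: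
  assumes P: "resolvent_symbol c C P" and c: "0 < c" "c \<le> 1" and N: "N \<ge> 1"
  shows "line_bounded (\<lambda>z. exp (z * of_real t) * (deriv ^^ N) (resolvent P) z)"
  unfolding line_bounded_def
proof (intro conjI allI impI)
  show "(\<lambda>z. exp (z * of_real t) * (deriv ^^ N) (resolvent P) z) holomorphic_on {z. Re z > 0}"
    by (intro holomorphic_intros holomorphic_higher_deriv resolvent_holomorphic[OF P] open_halfplane_Re)
next
  fix x y :: real assume x: "0 < x" "x \<le> y"
  obtain B where B: "B \<ge> 0" "\<And>z. Re z > 0 \<Longrightarrow> cmod (P z) \<le> B" using resolvent_symbolD(2)[OF P] by auto
  obtain E where E: "\<And>z. Re z > 0 \<Longrightarrow>
    cmod ((deriv ^^ N) (resolvent P) z) \<le> E * (1 + Re (P z)) * (cmod (resolvent P z))\<^sup>2"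
    using resolvent_higher_deriv_bound[OF c N, of C] P by metis
  let ?q = "(1 / (x / (1 + x + B)))\<^sup>2"
  show "\<exists>K. \<forall>z. x \<le> Re z \<and> Re z \<le> y \<longrightarrow> cmod (exp (z * of_real t) * (deriv ^^ N) (resolvent P) z) \<le> K / (1 + (Im z)\<^sup>2)"
  proof (intro exI[of _ "exp (y * \<bar>t\<bar>) * (\<bar>E\<bar> * (1 + B) * ?q)"] allI impI)
    fix z assume z: "x \<le> Re z \<and> Re z \<le> y"
    hence z0: "Re z > 0" using x by simp
    have "Re (P z) \<le> B" using B(2)[OF z0] complex_Re_le_cmod order_trans by blast
    have "cmod ((deriv ^^ N) (resolvent P) z) \<le> E * (1 + Re (P z)) * (cmod (resolvent P z))\<^sup>2" by (rule E[OF z0])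
    also have "\<dots> \<le> \<bar>E\<bar> * (1 + B) * (?q / (1 + (Im z)\<^sup>2))"
      using resolvent_symbolD(3)[OF P z0] \<open>Re (P z) \<le> B\<close> B resolvent_sq_bound[OF P B(2) x(1), of z] z
      by (intro mult_mono) auto
    finally have 1: "cmod ((deriv ^^ N) (resolvent P) z) \<le> \<bar>E\<bar> * (1 + B) * (?q / (1 + (Im z)\<^sup>2))" .
    have "Re z * t \<le> Re z * \<bar>t\<bar>" using z0 by (intro mult_left_mono) auto
    also have "\<dots> \<le> y * \<bar>t\<bar>" using z by (intro mult_right_mono) auto
    finally have "Re z * t \<le> y * \<bar>t\<bar>" .
    hence 2: "cmod (exp (z * of_real t)) \<le> exp (y * \<bar>t\<bar>)" by simp
    have "cmod (exp (z * of_real t) * (deriv ^^ N) (resolvent P) z) \<le> exp (y * \<bar>t\<bar>) * (\<bar>E\<bar> * (1 + B) * (?q / (1 + (Im z)\<^sup>2)))"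
      unfolding norm_mult by (intro mult_mono 1 2) auto
    thus "cmod (exp (z * of_real t) * (deriv ^^ N) (resolvent P) z) \<le> exp (y * \<bar>t\<bar>) * (\<bar>E\<bar> * (1 + B) * ?q) / (1 + (Im z)\<^sup>2)"
      by simp
  qed
qed

lemma integral_inverse_shifted:
  assumes "a > 0"
  shows "integrable lborel (\<lambda>\<omega>::real. a / (a\<^sup>2 + \<omega>\<^sup>2))" "(LINT \<omega>|lborel. a / (a\<^sup>2 + \<omega>\<^sup>2)) = pi"
proof -
  have eq: "a / (a\<^sup>2 + \<omega>\<^sup>2) = (1 / a) * (1 / (1 + (0 + (1 / a) * \<omega>)\<^sup>2))" for \<omega>
    using assms by (simp add: field_simps power2_eq_square)
  show "integrable lborel (\<lambda>\<omega>::real. a / (a\<^sup>2 + \<omega>\<^sup>2))"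
    unfolding eq using assms
    by (intro integrable_mult_right lborel_integrable_real_affine[where f="\<lambda>x. 1 / (1 + x\<^sup>2)"] integrable_inverse_1_plus_square') auto
  have "(LINT \<omega>|lborel. 1 / (1 + (0 + (1 / a) * \<omega>)\<^sup>2)) = a * pi"
    using lborel_integral_real_affine[of "1 / a" "\<lambda>x. 1 / (1 + x\<^sup>2)" 0] assms integral_inverse_1_plus_square by (simp add: field_simps)
  hence "(LINT \<omega>|lborel. (1 / a) * (1 / (1 + (0 + (1 / a) * \<omega>)\<^sup>2))) = (1 / a) * (a * pi)"
    by (simp only: integral_mult_right_zero)
  thus "(LINT \<omega>|lborel. a / (a\<^sup>2 + \<omega>\<^sup>2)) = pi" unfolding eq using assms by simp
qed

text \<open>
  The resolvent differs from \<open>1 / (z + 1)\<close> by \<open>O(|z| powr -2)\<close>; the integral of the difference over a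
  vertical line does not depend on the line and vanishes as the line recedes to the right.
\<close>

lemma integral_Re_resolvent:
  assumes P: "resolvent_symbol c C P" and x: "x > 0"
  shows "integrable lborel (\<lambda>\<omega>. Re (resolvent P (Complex x \<omega>)))"
    and "(LINT \<omega>|lborel. Re (resolvent P (Complex x \<omega>))) = pi"
proof -
  define H where "H z = resolvent P z - 1 / (z + 1)" for z
  obtain B where B: "B \<ge> 0" "\<And>z. Re z > 0 \<Longrightarrow> cmod (P z) \<le> B" using resolvent_symbolD(2)[OF P] by auto
  have nz: "z + 1 \<noteq> 0" if "Re z > 0" for z using that by (auto simp: complex_eq_iff)
  have H_eq: "H z = (1 - P z) / ((z + P z) * (z + 1))" if "Re z > 0" for z
    using resolvent_denom_nz[OF P that] nz[OF that] by (simp add: H_def resolvent_def field_simps)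
  have H_le: "cmod (H z) \<le> (1 + B) / (cmod (z + P z) * cmod (z + 1))" if "Re z > 0" for z
    unfolding H_eq[OF that] norm_divide norm_mult
    by (intro divide_right_mono order_trans[OF norm_triangle_ineq4]) (use B(2)[OF that] in auto)
  have z1: "(1 + \<bar>Im z\<bar>) / 2 \<le> cmod (z + 1)" if "Re z > 0" for z
    using complex_Re_le_cmod[of "z + 1"] abs_Im_le_cmod[of "z + 1"] that by simp
  have lbH: "line_bounded H"
    unfolding line_bounded_def
  proof (intro conjI allI impI)
    show "H holomorphic_on {z. Re z > 0}"
      unfolding H_def using nz by (intro holomorphic_intros resolvent_holomorphic[OF P]) auto
    fix x y :: real assume x: "0 < x" "x \<le> y"
    define q where "q = x / (1 + x + B)"
    have q: "q > 0" using x B by (simp add: q_def)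
    show "\<exists>K. \<forall>z. x \<le> Re z \<and> Re z \<le> y \<longrightarrow> cmod (H z) \<le> K / (1 + (Im z)\<^sup>2)"
    proof (intro exI[of _ "2 * (1 + B) / q"] allI impI)
      fix z assume z: "x \<le> Re z \<and> Re z \<le> y"
      hence z0: "Re z > 0" using x by simp
      have "q * (1 + (Im z)\<^sup>2) / 2 \<le> (q * (1 + \<bar>Im z\<bar>)) * ((1 + \<bar>Im z\<bar>) / 2)"
        using one_plus_sq_le[of "Im z"] q by (simp add: power2_eq_square)
      also have "\<dots> \<le> cmod (z + P z) * cmod (z + 1)"
        using resolvent_denom_linear[OF P B(2) x(1), of z] z z1[OF z0] q by (intro mult_mono) (auto simp: q_def)
      finally have "q * (1 + (Im z)\<^sup>2) / 2 \<le> cmod (z + P z) * cmod (z + 1)" .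
      moreover have "0 < q * (1 + (Im z)\<^sup>2) / 2" using q by (simp add: add_pos_nonneg)
      ultimately have "(1 + B) / (cmod (z + P z) * cmod (z + 1)) \<le> (1 + B) / (q * (1 + (Im z)\<^sup>2) / 2)"
        using B by (intro divide_left_mono mult_pos_pos) (auto simp: resolvent_denom_nz[OF P z0] nz[OF z0])
      thus "cmod (H z) \<le> 2 * (1 + B) / q / (1 + (Im z)\<^sup>2)"
        using H_le[OF z0] by (simp add: mult_ac)
    qed
  qed
  \<comment> \<open>For Re z \<ge> 2 B + 1 one has |P| \<le> |z| / 2, so the quadratic decay holds
    with a constant that is the same on all lines further to the right.\<close>
  have far: "cmod (H z) \<le> 2 * (1 + B) / ((Re z)\<^sup>2 + (Im z)\<^sup>2)" if z: "Re z \<ge> 2 * B + 1" for z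
  proof -
    have z0: "Re z > 0" using z B by simp
    have "2 * B \<le> cmod z" using complex_Re_le_cmod[of z] z by simp
    hence 1: "cmod z / 2 \<le> cmod (z + P z)" using norm_triangle_ineq2[of z "- P z"] B(2)[OF z0] by simp
    have "(cmod z)\<^sup>2 \<le> (cmod (z + 1))\<^sup>2" unfolding cmod_power2 using z0 by (simp add: power2_sum)
    hence 2: "cmod z \<le> cmod (z + 1)" by (rule power2_le_imp_le) simp
    have zpos: "cmod z > 0" using z0 by auto
    have "cmod z / 2 * cmod z \<le> cmod (z + P z) * cmod (z + 1)" by (intro mult_mono 1 2) auto
    hence "(1 + B) / (cmod (z + P z) * cmod (z + 1)) \<le> (1 + B) / (cmod z / 2 * cmod z)"
      using B zpos by (intro divide_left_mono mult_pos_pos) (auto simp: resolvent_denom_nz[OF P z0] nz[OF z0])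
    also have "\<dots> = 2 * (1 + B) / (cmod z)\<^sup>2" by (simp add: power2_eq_square)
    finally show ?thesis using H_le[OF z0] by (simp add: cmod_power2)
  qed
  have "(LINT \<omega>|lborel. H (Complex x \<omega>)) = 0"
  proof -
    define X where "X n = 2 * B + 1 + real n" for n
    have X: "X n > 0" "X n \<ge> 2 * B + 1" "X n \<ge> 1" "X n \<ge> real n" for n using B by (auto simp: X_def)
    have "(\<lambda>n. LINT \<omega>|lborel. H (Complex (X n) \<omega>)) \<longlonglongrightarrow> (LINT \<omega>::real|lborel. 0)"
    proof (rule integral_dominated_convergence[where w="\<lambda>\<omega>. 2 * (1 + B) * (1 / (1 + \<omega>\<^sup>2))"])
      show "integrable lborel (\<lambda>\<omega>::real. 2 * (1 + B) * (1 / (1 + \<omega>\<^sup>2)))"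
        by (intro integrable_mult_right integrable_inverse_1_plus_square')
      show "(\<lambda>\<omega>. H (Complex (X n) \<omega>)) \<in> borel_measurable lborel" for n
        using line_bounded_integrable[OF lbH X(1)] by auto
      show "AE \<omega> in lborel. norm (H (Complex (X n) \<omega>)) \<le> 2 * (1 + B) * (1 / (1 + \<omega>\<^sup>2))" for n
      proof (intro AE_I2)
        fix \<omega> :: real
        have "1 \<le> (X n)\<^sup>2" using X(3)[of n] by (simp add: one_le_power)
        hence "2 * (1 + B) / ((X n)\<^sup>2 + \<omega>\<^sup>2) \<le> 2 * (1 + B) / (1 + \<omega>\<^sup>2)"
          using B by (intro divide_left_mono) (auto intro!: mult_pos_pos add_pos_nonneg)
        thus "norm (H (Complex (X n) \<omega>)) \<le> 2 * (1 + B) * (1 / (1 + \<omega>\<^sup>2))"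
          using far[of "Complex (X n) \<omega>"] X(2)[of n] by simp
      qed
      show "AE \<omega> in lborel. (\<lambda>n. H (Complex (X n) \<omega>)) \<longlonglongrightarrow> 0"
      proof (intro AE_I2)
        fix \<omega> :: real
        show "(\<lambda>n. H (Complex (X n) \<omega>)) \<longlonglongrightarrow> 0"
        proof (rule Lim_null_comparison)
          show "(\<lambda>n. 2 * (1 + B) / (X n)\<^sup>2) \<longlonglongrightarrow> 0" unfolding X_def by real_asymp
          show "\<forall>\<^sub>F n in sequentially. norm (H (Complex (X n) \<omega>)) \<le> 2 * (1 + B) / (X n)\<^sup>2"
          proof (intro always_eventually allI)
            fix n
            have "0 < (X n)\<^sup>2" using X(1)[of n] by simp
            hence "2 * (1 + B) / ((X n)\<^sup>2 + \<omega>\<^sup>2) \<le> 2 * (1 + B) / (X n)\<^sup>2"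
              using B by (intro divide_left_mono) (auto intro!: mult_pos_pos add_pos_nonneg)
            thus "norm (H (Complex (X n) \<omega>)) \<le> 2 * (1 + B) / (X n)\<^sup>2"
              using far[of "Complex (X n) \<omega>"] X(2)[of n] by simp
          qed
        qed
      qed
    qed simp_all
    also have "(\<lambda>n. LINT \<omega>|lborel. H (Complex (X n) \<omega>)) = (\<lambda>n. LINT \<omega>|lborel. H (Complex x \<omega>))"
      by (intro ext line_integral_shift[OF lbH] X x)
    finally show ?thesis by (simp add: LIMSEQ_const_iff)
  qed
  hence ReH: "(LINT \<omega>|lborel. Re (H (Complex x \<omega>))) = 0"
    using integral_Re[OF line_bounded_integrable[OF lbH x]] by simp
  have iReH: "integrable lborel (\<lambda>\<omega>. Re (H (Complex x \<omega>)))"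
    by (rule integrable_Re[OF line_bounded_integrable[OF lbH x]])
  \<comment> \<open>On a vertical line the real part of 1 / (z + 1) is a Poisson kernel, of integral
    pi; all of the stated value comes from it.\<close>
  have eq: "Re (resolvent P (Complex x \<omega>)) = Re (H (Complex x \<omega>)) + (x + 1) / ((x + 1)\<^sup>2 + \<omega>\<^sup>2)" for \<omega>
  proof -
    have "Complex x \<omega> + 1 = Complex (x + 1) \<omega>" by (simp add: complex_eq_iff)
    thus ?thesis by (simp add: H_def Re_divide)
  qed
  have x1: "x + 1 > 0" using x by simp
  show "integrable lborel (\<lambda>\<omega>. Re (resolvent P (Complex x \<omega>)))"
    unfolding eq by (intro Bochner_Integration.integrable_add iReH integral_inverse_shifted x1)
  show "(LINT \<omega>|lborel. Re (resolvent P (Complex x \<omega>))) = pi"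
    unfolding eq
    by (subst Bochner_Integration.integral_add[OF iReH integral_inverse_shifted(1)[OF x1]])
       (simp add: ReH integral_inverse_shifted(2)[OF x1])
qed

text \<open>The heart of the uniformity. Since Re G = (x + Re P) |G|^2, the majorant (1 + Re P)
  |G|^2 is at most (2 / c) Re G wherever Re P \<ge> c, and the integral of Re G is pi for every
  symbol and every line. Where Re P < c, the last clause for symbols bounds |G|^2 directly by a
  multiple of 1 / (1 + \<omega>^2).\<close>

lemma resolvent_deriv_L1_bound:
  assumes c: "0 < c" "c \<le> 1" and N: "N \<ge> 1"
  shows "\<exists>K. \<forall>P x. resolvent_symbol c C P \<longrightarrow> 0 < x \<longrightarrow> x \<le> 1 \<longrightarrow>
    (LINT \<omega>|lborel. cmod ((deriv ^^ N) (resolvent P) (Complex x \<omega>))) \<le> K"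
proof -
  obtain E where E: "\<And>P z. resolvent_symbol c C P \<Longrightarrow> Re z > 0 \<Longrightarrow>
    cmod ((deriv ^^ N) (resolvent P) z) \<le> E * (1 + Re (P z)) * (cmod (resolvent P z))\<^sup>2"
    using resolvent_higher_deriv_bound[OF c N, of C] by metis
  show ?thesis
  proof (intro exI[of _ "\<bar>E\<bar> * (2 / c) * pi + \<bar>E\<bar> * (4 / c\<^sup>2) * pi"] allI impI)
    fix P and x :: real assume P: "resolvent_symbol c C P" and x: "0 < x" "x \<le> 1"
    have *: "cmod ((deriv ^^ N) (resolvent P) (Complex x \<omega>)) \<le>
       \<bar>E\<bar> * (2 / c) * Re (resolvent P (Complex x \<omega>)) + \<bar>E\<bar> * (4 / c\<^sup>2) * (1 / (1 + \<omega>\<^sup>2))" for \<omega>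
    proof -
      let ?z = "Complex x \<omega>"
      let ?g = "cmod (resolvent P ?z)"
      have z: "Re ?z > 0" using x by simp
      have P0: "Re (P ?z) \<ge> 0" by (rule resolvent_symbolD(3)[OF P z])
      have Re_eq: "Re (resolvent P ?z) = (x + Re (P ?z)) * ?g\<^sup>2"
      proof -
        have "Re (1 / w) = Re w * (cmod (1 / w))\<^sup>2" for w
          by (simp add: Re_divide norm_divide power_divide cmod_power2)
        from this[of "?z + P ?z"] show ?thesis by (simp add: resolvent_def)
      qed
      have Re0: "Re (resolvent P ?z) \<ge> 0" unfolding Re_eq using P0 x by simp
      have w0: "1 / (1 + \<omega>\<^sup>2) \<ge> 0" by simp
      have "(1 + Re (P ?z)) * ?g\<^sup>2 \<le> 2 / c * Re (resolvent P ?z) + 4 / c\<^sup>2 * (1 / (1 + \<omega>\<^sup>2))"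
      proof (cases "Re (P ?z) \<ge> c")
        case True
        have "1 + Re (P ?z) \<le> 2 / c * Re (P ?z)"
        proof -
          have "c * Re (P ?z) \<le> 1 * Re (P ?z)" using c P0 by (intro mult_right_mono) auto
          moreover have "(1 + Re (P ?z)) * c = c + c * Re (P ?z)" by (simp add: algebra_simps)
          ultimately have "(1 + Re (P ?z)) * c \<le> 2 * Re (P ?z)" using True by linarith
          hence "1 + Re (P ?z) \<le> (2 * Re (P ?z)) / c" by (simp only: pos_le_divide_eq[OF c(1)])
          thus ?thesis by simp
        qed
        also have "\<dots> \<le> 2 / c * (x + Re (P ?z))" using c x by (intro mult_left_mono) auto
        finally have "(1 + Re (P ?z)) * ?g\<^sup>2 \<le> 2 / c * (x + Re (P ?z)) * ?g\<^sup>2" by (rule mult_right_mono) simp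
        hence "(1 + Re (P ?z)) * ?g\<^sup>2 \<le> 2 / c * Re (resolvent P ?z)" unfolding Re_eq by (simp only: mult.assoc)
        moreover have "4 / c\<^sup>2 * (1 / (1 + \<omega>\<^sup>2)) \<ge> 0" by simp
        ultimately show ?thesis by linarith
      next
        case False
        hence w: "\<bar>\<omega>\<bar> \<ge> 1" "cmod (?z + P ?z) \<ge> c * \<bar>\<omega>\<bar>" using resolvent_symbolD(5)[OF P z] x by auto
        have "(c * \<bar>\<omega>\<bar>)\<^sup>2 \<le> (cmod (?z + P ?z))\<^sup>2" using w c by (intro power_mono) auto
        hence cw: "c\<^sup>2 * \<omega>\<^sup>2 \<le> (cmod (?z + P ?z))\<^sup>2" by (simp add: power_mult_distrib)
        have w2: "1 \<le> \<omega>\<^sup>2" using power_mono[OF w(1), of 2] by simp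
        have "c\<^sup>2 * (1 + \<omega>\<^sup>2) \<le> c\<^sup>2 * (2 * \<omega>\<^sup>2)" using w2 by (intro mult_left_mono) auto
        also have "\<dots> \<le> 2 * (cmod (?z + P ?z))\<^sup>2" using cw by simp
        finally have le: "c\<^sup>2 * (1 + \<omega>\<^sup>2) \<le> 2 * (cmod (?z + P ?z))\<^sup>2" .
        have "?g\<^sup>2 = 2 / (2 * (cmod (?z + P ?z))\<^sup>2)"
          by (simp add: resolvent_def norm_divide power_divide)
        also have "\<dots> \<le> 2 / (c\<^sup>2 * (1 + \<omega>\<^sup>2))"
          using le c resolvent_denom_nz[OF P z] add_pos_nonneg[of 1 "\<omega>\<^sup>2"]
          by (intro divide_left_mono mult_pos_pos) auto
        finally have "?g\<^sup>2 \<le> 2 / c\<^sup>2 * (1 / (1 + \<omega>\<^sup>2))" by simp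
        moreover have "1 + Re (P ?z) \<le> 2" using False c by simp
        ultimately have "(1 + Re (P ?z)) * ?g\<^sup>2 \<le> 2 * (2 / c\<^sup>2 * (1 / (1 + \<omega>\<^sup>2)))"
          using P0 by (intro mult_mono) auto
        moreover have "2 / c * Re (resolvent P ?z) \<ge> 0" using c Re0 by simp
        ultimately show ?thesis by simp
      qed
      hence "\<bar>E\<bar> * ((1 + Re (P ?z)) * ?g\<^sup>2) \<le> \<bar>E\<bar> * (2 / c * Re (resolvent P ?z) + 4 / c\<^sup>2 * (1 / (1 + \<omega>\<^sup>2)))"
        by (rule mult_left_mono) simp
      moreover have "E * ((1 + Re (P ?z)) * ?g\<^sup>2) \<le> \<bar>E\<bar> * ((1 + Re (P ?z)) * ?g\<^sup>2)"
        using P0 by (intro mult_right_mono) auto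
      ultimately show ?thesis using E[OF P z] by (simp add: algebra_simps)
    qed
    note i1 = integral_Re_resolvent[OF P x(1)]
    have i: "integrable lborel (\<lambda>\<omega>. \<bar>E\<bar> * (2 / c) * Re (resolvent P (Complex x \<omega>)) + \<bar>E\<bar> * (4 / c\<^sup>2) * (1 / (1 + \<omega>\<^sup>2)))"
      by (intro Bochner_Integration.integrable_add integrable_mult_right i1 integrable_inverse_1_plus_square')
    have "(LINT \<omega>|lborel. cmod ((deriv ^^ N) (resolvent P) (Complex x \<omega>))) \<le>
       (LINT \<omega>|lborel. \<bar>E\<bar> * (2 / c) * Re (resolvent P (Complex x \<omega>)) + \<bar>E\<bar> * (4 / c\<^sup>2) * (1 / (1 + \<omega>\<^sup>2)))"
      by (rule integral_mono'[OF i *]) (rule order_trans[OF norm_ge_zero *])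
    also have "\<dots> = \<bar>E\<bar> * (2 / c) * pi + \<bar>E\<bar> * (4 / c\<^sup>2) * pi"
      unfolding Bochner_Integration.integral_add[OF integrable_mult_right[OF i1(1)] integrable_mult_right[OF integrable_inverse_1_plus_square']]
        integral_mult_right_zero i1(2) integral_inverse_1_plus_square ..
    finally show "(LINT \<omega>|lborel. cmod ((deriv ^^ N) (resolvent P) (Complex x \<omega>))) \<le> \<bar>E\<bar> * (2 / c) * pi + \<bar>E\<bar> * (4 / c\<^sup>2) * pi" .
  qed
qed

section \<open>Laplace transforms\<close>

lemma power_le_fact_exp:
  assumes "(t::real) \<ge> 0" shows "t ^ k \<le> fact k * exp t"
proof -
  have "(\<Sum>n\<in>{k}. t ^ n /\<^sub>R fact n) \<le> (\<Sum>n. t ^ n /\<^sub>R fact n)"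
    by (rule sum_le_suminf[OF summable_exp_generic]) (use assms in auto)
  hence "t ^ k / fact k \<le> exp t" by (simp add: exp_def divide_inverse mult.commute)
  thus ?thesis by (simp add: field_simps)
qed

lemma integrable_exp_halfline:
  assumes "b > 0" shows "integrable lborel (\<lambda>t::real. indicator {0<..} t * exp (- b * t))"
  using integrable_I0i_exp_mscale[OF assms] by (simp add: set_integrable_def mult.commute)

lemma integrable_power_exp_halfline:
  assumes "b > 0" shows "integrable lborel (\<lambda>t::real. indicator {0<..} t * (t ^ k * exp (- b * t)))"
proof (rule Bochner_Integration.integrable_bound[of _ "\<lambda>t. fact k * (2 / b) ^ k * (indicator {0<..} t * exp (- (b / 2) * t))"])
  show "integrable lborel (\<lambda>t. fact k * (2 / b) ^ k * (indicator {0<..} t * exp (- (b / 2) * t)))"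
    using assms by (intro integrable_mult_right integrable_exp_halfline) simp
  show "AE t in lborel. norm (indicator {0<..} t * (t ^ k * exp (- b * t))) \<le> norm (fact k * (2 / b) ^ k * (indicator {0<..} t * exp (- (b / 2) * t)))"
  proof (intro AE_I2)
    fix t :: real
    show "norm (indicator {0<..} t * (t ^ k * exp (- b * t))) \<le> norm (fact k * (2 / b) ^ k * (indicator {0<..} t * exp (- (b / 2) * t)))"
    proof (cases "t > 0")
      case True
      have "(b / 2 * t) ^ k \<le> fact k * exp (b / 2 * t)" using True assms by (intro power_le_fact_exp) simp
      hence "(2 / b) ^ k * (b / 2 * t) ^ k * exp (- b * t) \<le> (2 / b) ^ k * (fact k * exp (b / 2 * t)) * exp (- b * t)"
        using assms by (intro mult_right_mono mult_left_mono) auto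
      also have "\<dots> = fact k * (2 / b) ^ k * (exp (b / 2 * t) * exp (- b * t))" by simp
      also have "exp (b / 2 * t) * exp (- b * t) = exp (- (b / 2) * t)" by (simp flip: exp_add)
      also have "(2 / b) ^ k * (b / 2 * t) ^ k = t ^ k" using assms by (simp flip: power_mult_distrib)
      finally show ?thesis using True assms by (simp add: abs_mult)
    qed simp
  qed
qed measurable

text \<open>The k-th derivative of the Laplace transform of \<open>g\<close>, differentiated under
  the integral sign.\<close>

definition laplace_moment :: "(real \<Rightarrow> complex) \<Rightarrow> nat \<Rightarrow> complex \<Rightarrow> complex" where
  "laplace_moment g k z = (LINT t|lborel. (- of_real t) ^ k * exp (- z * of_real t) * g t)"

text \<open>The second-order remainder of exp(-w t) costs a factor t^2 exp(\<delta> t). As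
  \<open>\<delta>\<close> is half the distance of Re z from \<open>x0\<close>, the moment of order k
  + 2 is still finite at Re z - \<delta>.\<close>

lemma laplace_moment_has_derivative:
  assumes [measurable]: "g \<in> borel_measurable borel" and supp: "\<And>t. t \<le> 0 \<Longrightarrow> g t = 0"
    and int: "\<And>x k. x > x0 \<Longrightarrow> integrable lborel (\<lambda>t. \<bar>t\<bar> ^ k * exp (- x * t) * cmod (g t))"
    and z: "Re z > x0"
  shows "(laplace_moment g k has_field_derivative laplace_moment g (Suc k) z) (at z)"
proof -
  define \<delta> where "\<delta> = (Re z - x0) / 2"
  have \<delta>: "\<delta> > 0" using z by (simp add: \<delta>_def)
  define K where "K = (LINT t|lborel. \<bar>t\<bar> ^ (k + 2) * exp (- (Re z - \<delta>) * t) * cmod (g t))"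
  have iK: "integrable lborel (\<lambda>t. \<bar>t\<bar> ^ (k + 2) * exp (- (Re z - \<delta>) * t) * cmod (g t))"
    by (rule int) (use z in \<open>simp add: \<delta>_def field_simps\<close>)
  have i: "integrable lborel (\<lambda>t. (- of_real t) ^ k * exp (- w * of_real t) * g t)" if "Re w > x0" for w k
    by (rule Bochner_Integration.integrable_bound[OF int[OF that, of k]]) (auto simp: norm_mult norm_power)
  have bound: "cmod (laplace_moment g k (z + w) - laplace_moment g k z - w * laplace_moment g (Suc k) z) \<le> (cmod w)\<^sup>2 * K"
    if w: "cmod w < \<delta>" for w
  proof -
    have "Re (z + w) > x0" using abs_Re_le_cmod[of w] w z by (simp add: \<delta>_def field_simps abs_le_iff)
    note i' = i[OF this, of k] i[OF z, of k] i[OF z, of "Suc k"]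
    have eq: "laplace_moment g k (z + w) - laplace_moment g k z - w * laplace_moment g (Suc k) z =
       (LINT t|lborel. ((- of_real t) ^ k * exp (- (z + w) * of_real t) * g t - (- of_real t) ^ k * exp (- z * of_real t) * g t) - w * ((- of_real t) ^ Suc k * exp (- z * of_real t) * g t))"
      unfolding laplace_moment_def
      by (subst Bochner_Integration.integral_diff, intro Bochner_Integration.integrable_diff i', intro integrable_mult_right i',
          subst Bochner_Integration.integral_diff[OF i'(1,2)], simp only: integral_mult_right_zero)
    show ?thesis
      unfolding eq
    proof (rule order_trans[OF integral_norm_bound])
      have "(LINT t|lborel. norm (((- of_real t) ^ k * exp (- (z + w) * of_real t) * g t - (- of_real t) ^ k * exp (- z * of_real t) * g t) - w * ((- of_real t) ^ Suc k * exp (- z * of_real t) * g t)))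
         \<le> (LINT t|lborel. (cmod w)\<^sup>2 * (\<bar>t\<bar> ^ (k + 2) * exp (- (Re z - \<delta>) * t) * cmod (g t)))"
      proof (rule integral_mono')
        show "integrable lborel (\<lambda>t. (cmod w)\<^sup>2 * (\<bar>t\<bar> ^ (k + 2) * exp (- (Re z - \<delta>) * t) * cmod (g t)))"
          by (intro integrable_mult_right iK)
        fix t :: real
        show "norm (((- of_real t) ^ k * exp (- (z + w) * of_real t) * g t - (- of_real t) ^ k * exp (- z * of_real t) * g t) - w * ((- of_real t) ^ Suc k * exp (- z * of_real t) * g t))
          \<le> (cmod w)\<^sup>2 * (\<bar>t\<bar> ^ (k + 2) * exp (- (Re z - \<delta>) * t) * cmod (g t))"
        proof (cases "t > 0")
          case False thus ?thesis by (simp add: supp)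
        next
          case True
          define v where "v = - w * of_real t"
          have "exp (- (z + w) * of_real t) = exp (- z * of_real t) * exp v"
            by (simp add: v_def algebra_simps flip: exp_add)
          hence "((- of_real t) ^ k * exp (- (z + w) * of_real t) * g t - (- of_real t) ^ k * exp (- z * of_real t) * g t) - w * ((- of_real t) ^ Suc k * exp (- z * of_real t) * g t)
            = (- of_real t) ^ k * exp (- z * of_real t) * g t * (exp v - (1 + v))"
            by (simp add: v_def algebra_simps)
          moreover have "cmod (exp v - (1 + v)) \<le> exp (\<delta> * t) * ((cmod w)\<^sup>2 * t\<^sup>2)"
          proof -
            have "cmod (exp v - (1 + v)) \<le> exp \<bar>Re v\<bar> * (cmod v)\<^sup>2" using Taylor_exp[of v 1] by (simp add: power2_eq_square)
            also have "\<bar>Re v\<bar> \<le> \<delta> * t" using abs_Re_le_cmod[of w] w True by (auto simp: v_def abs_mult intro!: mult_right_mono)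
            hence "exp \<bar>Re v\<bar> * (cmod v)\<^sup>2 \<le> exp (\<delta> * t) * (cmod v)\<^sup>2" by (intro mult_right_mono) auto
            also have "(cmod v)\<^sup>2 = (cmod w)\<^sup>2 * t\<^sup>2" by (simp add: v_def norm_mult power_mult_distrib)
            finally show ?thesis .
          qed
          ultimately have "norm (((- of_real t) ^ k * exp (- (z + w) * of_real t) * g t - (- of_real t) ^ k * exp (- z * of_real t) * g t) - w * ((- of_real t) ^ Suc k * exp (- z * of_real t) * g t))
             \<le> (t ^ k * exp (- Re z * t) * cmod (g t)) * (exp (\<delta> * t) * ((cmod w)\<^sup>2 * t\<^sup>2))"
            using True by (auto simp: norm_mult norm_power intro!: mult_left_mono)
          also have "\<dots> = (cmod w)\<^sup>2 * (t ^ (k + 2) * (exp (- Re z * t) * exp (\<delta> * t)) * cmod (g t))"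
            by (simp add: power_add power2_eq_square mult_ac)
          also have "exp (- Re z * t) * exp (\<delta> * t) = exp (- (Re z - \<delta>) * t)"
            by (simp add: algebra_simps flip: exp_add)
          finally show ?thesis using True by simp
        qed
      qed simp
      thus "(LINT t|lborel. norm (((- of_real t) ^ k * exp (- (z + w) * of_real t) * g t - (- of_real t) ^ k * exp (- z * of_real t) * g t) - w * ((- of_real t) ^ Suc k * exp (- z * of_real t) * g t)))
        \<le> (cmod w)\<^sup>2 * K"
        by (simp only: K_def integral_mult_right_zero)
    qed
  qed
  show ?thesis
    unfolding DERIV_def
  proof (rule Lim_transform2)
    show "((\<lambda>h. laplace_moment g (Suc k) z) \<longlongrightarrow> laplace_moment g (Suc k) z) (at 0)" by simp
    show "((\<lambda>h. laplace_moment g (Suc k) z - (laplace_moment g k (z + h) - laplace_moment g k z) / h) \<longlongrightarrow> 0) (at 0)"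
    proof (rule Lim_null_comparison)
      have "\<forall>\<^sub>F h in at (0::complex). cmod h < \<delta>"
        using \<delta> by (auto simp: eventually_at dist_norm)
      thus "\<forall>\<^sub>F h in at 0. norm (laplace_moment g (Suc k) z - (laplace_moment g k (z + h) - laplace_moment g k z) / h) \<le> cmod h * K"
        using eventually_neq_at_within[of 0]
      proof eventually_elim
        case (elim h)
        have "laplace_moment g (Suc k) z - (laplace_moment g k (z + h) - laplace_moment g k z) / h =
          - (laplace_moment g k (z + h) - laplace_moment g k z - h * laplace_moment g (Suc k) z) / h"
          using elim by (simp add: field_simps)
        hence "norm (laplace_moment g (Suc k) z - (laplace_moment g k (z + h) - laplace_moment g k z) / h) =
          cmod (laplace_moment g k (z + h) - laplace_moment g k z - h * laplace_moment g (Suc k) z) / cmod h"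
          by (simp only: norm_divide norm_minus_cancel)
        also have "\<dots> \<le> (cmod h)\<^sup>2 * K / cmod h" by (intro divide_right_mono bound elim) simp
        also have "\<dots> = cmod h * K" using elim by (simp add: power2_eq_square)
        finally show ?case .
      qed
      have "((\<lambda>h. cmod h * K) \<longlongrightarrow> cmod 0 * K) (at 0)" by (intro tendsto_intros)
      thus "((\<lambda>h. cmod h * K) \<longlongrightarrow> 0) (at 0)" by simp
    qed
  qed
qed

text \<open>Multiplying \<open>f\<close> by t^N amounts to differentiating its transform N times.
  Fourier inversion is carried out on a line to the right of \<open>x0\<close>, where the transform
  converges absolutely. The resulting contour integral involves only \<open>resolvent P\<close>,
  which is holomorphic on the whole half plane, so the line can be moved left to where exp(z t)
  stays bounded.\<close>

lemma resolvent_decay: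
  assumes P: "resolvent_symbol c C P" and c: "0 < c" "c \<le> 1" and N: "N \<ge> 1"
    and f: "continuous_on {0<..} f" and fb: "\<And>t. t > 0 \<Longrightarrow> cmod (f t) \<le> M * exp (x0 * t)" and x0: "x0 \<ge> 0"
    and lap: "\<And>z. Re z > x0 \<Longrightarrow> (LINT t|lborel. exp (- z * of_real t) * (indicator {0<..} t * f t)) = resolvent P z"
    and K: "\<And>x. 0 < x \<Longrightarrow> x \<le> 1 \<Longrightarrow> (LINT \<omega>|lborel. cmod ((deriv ^^ N) (resolvent P) (Complex x \<omega>))) \<le> K"
    and t: "t > 0"
  shows "t ^ N * cmod (f t) \<le> exp 1 * K"
proof -
  define g where "g t = indicator {0<..} t * f t" for t :: real
  have "(\<lambda>t. indicator {0<..} t *\<^sub>R f t) \<in> borel_measurable borel"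
    by (rule borel_measurable_continuous_on_indicator[OF _ f]) simp
  moreover have "(\<lambda>t. indicator {0<..} t *\<^sub>R f t) = g" by (auto simp: g_def fun_eq_iff indicator_def)
  ultimately have g_meas[measurable]: "g \<in> borel_measurable borel" by simp
  have M: "M \<ge> 0"
  proof -
    have "0 \<le> M * exp (x0 * 1)" using fb[of 1] norm_ge_zero[of "f 1"] by (meson order_trans zero_less_one)
    thus ?thesis by (simp add: zero_le_mult_iff)
  qed
  have supp: "g t = 0" if "t \<le> 0" for t using that by (simp add: g_def)
  have int: "integrable lborel (\<lambda>t. \<bar>t\<bar> ^ k * exp (- x * t) * cmod (g t))" if x: "x > x0" for x k
  proof (rule Bochner_Integration.integrable_bound[of _ "\<lambda>t. M * (indicator {0<..} t * (t ^ k * exp (- (x - x0) * t)))"])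
    show "integrable lborel (\<lambda>t. M * (indicator {0<..} t * (t ^ k * exp (- (x - x0) * t))))"
      using x by (intro integrable_mult_right integrable_power_exp_halfline) simp
    show "AE t in lborel. norm (\<bar>t\<bar> ^ k * exp (- x * t) * cmod (g t)) \<le> norm (M * (indicator {0<..} t * (t ^ k * exp (- (x - x0) * t))))"
    proof (intro AE_I2)
      fix t :: real
      show "norm (\<bar>t\<bar> ^ k * exp (- x * t) * cmod (g t)) \<le> norm (M * (indicator {0<..} t * (t ^ k * exp (- (x - x0) * t))))"
      proof (cases "t > 0")
        case True
        have "t ^ k * exp (- x * t) * cmod (f t) \<le> t ^ k * exp (- x * t) * (M * exp (x0 * t))"
          using True by (intro mult_left_mono fb) auto
        also have "\<dots> = M * (t ^ k * exp (- (x - x0) * t))"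
          by (simp add: algebra_simps flip: exp_add)
        finally show ?thesis using True M by (simp add: g_def abs_mult)
      qed (simp add: g_def)
    qed
  qed measurable
  have L0: "laplace_moment g 0 z = resolvent P z" if "Re z > x0" for z
    using lap[OF that] by (simp add: laplace_moment_def g_def)
  have LN: "(deriv ^^ k) (resolvent P) z = laplace_moment g k z" if "Re z > x0" for z k
    using that
  proof (induction k arbitrary: z)
    case 0 thus ?case by (simp add: L0)
  next
    case (Suc k)
    have "((deriv ^^ k) (resolvent P) has_field_derivative laplace_moment g (Suc k) z) (at z)"
    proof (rule has_field_derivative_transform_within_open[OF _ open_halfplane_Re[of x0]])
      show "(laplace_moment g k has_field_derivative laplace_moment g (Suc k) z) (at z)"
        by (rule laplace_moment_has_derivative[OF g_meas supp int Suc.prems])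
    qed (use Suc in auto)
    thus ?case by (simp add: DERIV_imp_deriv)
  qed
  \<comment> \<open>One unit to the right of the growth rate, exp(-x t) times the bound on
    \<open>f\<close> is M exp(-t), which absorbs t^N and makes \<open>h\<close> bounded and
    integrable.\<close>
  define x where "x = x0 + 1"
  have x: "x > x0" "x > 0" using x0 by (auto simp: x_def)
  define h where "h t = of_real (t ^ N * exp (- x * t)) * g t" for t :: real
  have h_norm: "cmod (h t) = \<bar>t\<bar> ^ N * exp (- x * t) * cmod (g t)" for t
    by (simp add: h_def norm_mult norm_power del: of_real_mult of_real_power)
       (simp add: abs_mult power_abs)
  have [measurable]: "h \<in> borel_measurable borel" unfolding h_def[abs_def] by measurable
  have ih: "integrable lborel h"
    by (rule Bochner_Integration.integrable_bound[OF int[OF x(1), of N]]) (auto simp: h_norm)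
  have hb: "cmod (h s) \<le> M * fact N" for s
  proof (cases "s > 0")
    case True
    have "cmod (h s) \<le> s ^ N * exp (- x * s) * (M * exp (x0 * s))"
      unfolding h_norm using True fb[OF True] by (auto simp: g_def intro!: mult_left_mono)
    also have "\<dots> = M * (s ^ N * exp (- s))"
      by (simp add: x_def algebra_simps flip: exp_add)
    also have "s ^ N * exp (- s) \<le> fact N * exp s * exp (- s)"
      using power_le_fact_exp[of s N] True by (intro mult_right_mono) auto
    also have "fact N * exp s * exp (- s) = fact N" by (simp add: mult.assoc flip: exp_add)
    finally show ?thesis using M by (simp add: mult_left_mono)
  qed (use M in \<open>simp add: h_norm supp\<close>)
  \<comment> \<open>The sign comes from the factors -t produced by differentiating exp(-z
    t).\<close>
  have fh: "fourier h \<omega> = (-1) ^ N * (deriv ^^ N) (resolvent P) (Complex x \<omega>)" for \<omega>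
  proof -
    have "(deriv ^^ N) (resolvent P) (Complex x \<omega>) = (LINT t|lborel. (-1) ^ N * (exp (- \<i> * of_real (t * \<omega>)) * h t))"
      unfolding LN[of "Complex x \<omega>", simplified, OF x(1)] laplace_moment_def
    proof (intro Bochner_Integration.integral_cong refl)
      fix t :: real
      have "- Complex x \<omega> * of_real t = - \<i> * of_real (t * \<omega>) + of_real (- x * t)" by (simp add: complex_eq_iff)
      hence "exp (- Complex x \<omega> * of_real t) = exp (- \<i> * of_real (t * \<omega>)) * of_real (exp (- x * t))"
        by (simp only: exp_add exp_of_real)
      moreover have "(- complex_of_real t) ^ N = (-1) ^ N * of_real t ^ N" by (rule power_minus)
      ultimately have "(- of_real t) ^ N * exp (- Complex x \<omega> * of_real t) * g t =
        ((-1) ^ N * of_real t ^ N) * (exp (- \<i> * of_real (t * \<omega>)) * of_real (exp (- x * t))) * g t" by (simp only:)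
      also have "\<dots> = (-1) ^ N * (exp (- \<i> * of_real (t * \<omega>)) * h t)"
        by (simp only: h_def of_real_mult of_real_power mult_ac)
      finally show "(- of_real t) ^ N * exp (- Complex x \<omega> * of_real t) * g t = (-1) ^ N * (exp (- \<i> * of_real (t * \<omega>)) * h t)" .
    qed
    also have "\<dots> = (-1) ^ N * fourier h \<omega>"
      unfolding fourier_def by (simp add: inner_real_def)
    finally show ?thesis by simp
  qed
  have lb0: "integrable lborel (\<lambda>\<omega>. (deriv ^^ N) (resolvent P) (Complex x \<omega>))" if "x > 0" for x
    using line_bounded_integrable[OF line_bounded_resolvent_deriv[OF P c N, of 0] that] by simp
  have fh_int: "integrable lborel (fourier h)"
    unfolding fh[abs_def] by (intro integrable_mult_right lb0 x)
  have cont_h: "isCont h t"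
  proof -
    have "isCont f t" using f t by (simp add: continuous_on_eq_continuous_at)
    hence "isCont (\<lambda>t. of_real (t ^ N * exp (- x * t)) * f t) t" by (intro continuous_intros)
    moreover have "\<forall>\<^sub>F s in nhds t. h s = of_real (s ^ N * exp (- x * s)) * f s"
      using eventually_nhds_in_open[of "{0<..}" t] t by (auto elim!: eventually_mono simp: h_def g_def)
    ultimately show ?thesis by (simp add: isCont_cong)
  qed
  define H where "H z = exp (z * of_real t) * (deriv ^^ N) (resolvent P) z" for z
  have lbH: "line_bounded H" unfolding H_def by (rule line_bounded_resolvent_deriv[OF P c N])
  have "(2 * pi) * h t = (LINT \<omega>|lborel. exp (\<i> * of_real (t * \<omega>)) * fourier h \<omega>)"
    using fourier_inversion[OF ih hb cont_h fh_int] by (simp add: inner_real_def)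
  also have "\<dots> = (LINT \<omega>|lborel. ((-1) ^ N * of_real (exp (- x * t))) * H (Complex x \<omega>))"
  proof (intro Bochner_Integration.integral_cong refl)
    fix \<omega> :: real
    have "of_real (- x * t) + Complex x \<omega> * of_real t = \<i> * of_real (t * \<omega>)" by (simp add: complex_eq_iff)
    hence "complex_of_real (exp (- x * t)) * exp (Complex x \<omega> * of_real t) = exp (\<i> * of_real (t * \<omega>))"
      by (simp only: exp_add[symmetric] exp_of_real[symmetric])
    note e = this
    show "exp (\<i> * of_real (t * \<omega>)) * fourier h \<omega> = ((-1) ^ N * of_real (exp (- x * t))) * H (Complex x \<omega>)"
      unfolding fh H_def e[symmetric] by (simp only: mult_ac)
  qed
  also have "\<dots> = ((-1) ^ N * of_real (exp (- x * t))) * (LINT \<omega>|lborel. H (Complex x \<omega>))"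
    by (rule integral_mult_right_zero)
  finally have eq: "(2 * pi) * h t = ((-1) ^ N * of_real (exp (- x * t))) * (LINT \<omega>|lborel. H (Complex x \<omega>))" .
  \<comment> \<open>The new line satisfies y t \<le> 1, so exp(y t) is at most exp 1, and y \<le> 1,
    so the uniform L1 bound applies there.\<close>
  define y where "y = min 1 (1 / t)"
  have y: "0 < y" "y \<le> 1" "y * t \<le> 1" using t by (auto simp: y_def min_def field_simps)
  have "2 * pi * cmod (h t) = cmod ((2 * pi) * h t)" by (simp add: norm_mult)
  also have "\<dots> = exp (- x * t) * cmod (LINT \<omega>|lborel. H (Complex x \<omega>))"
    unfolding eq by (simp add: norm_mult norm_power)
  also have "(LINT \<omega>|lborel. H (Complex x \<omega>)) = (LINT \<omega>|lborel. H (Complex y \<omega>))"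
    by (rule line_integral_shift[OF lbH x(2) y(1)])
  finally have 1: "2 * pi * cmod (h t) = exp (- x * t) * cmod (LINT \<omega>|lborel. H (Complex y \<omega>))" .
  have "cmod (LINT \<omega>|lborel. H (Complex y \<omega>)) \<le> (LINT \<omega>|lborel. cmod (H (Complex y \<omega>)))"
    by (rule integral_norm_bound)
  also have "\<dots> \<le> (LINT \<omega>|lborel. exp 1 * cmod ((deriv ^^ N) (resolvent P) (Complex y \<omega>)))"
    by (rule integral_mono') (use y lb0[OF y(1)] in \<open>auto simp: H_def norm_mult intro!: mult_right_mono\<close>)
  also have "\<dots> \<le> exp 1 * K" using K[OF y(1,2)] by simp
  finally have 2: "cmod (LINT \<omega>|lborel. H (Complex y \<omega>)) \<le> exp 1 * K" .
  have "cmod (h t) = exp (- x * t) * (t ^ N * cmod (f t))"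
    unfolding h_norm using t by (simp add: g_def mult_ac)
  with 1 have "exp (- x * t) * (2 * pi * (t ^ N * cmod (f t))) = exp (- x * t) * cmod (LINT \<omega>|lborel. H (Complex y \<omega>))"
    by (simp add: mult_ac)
  hence "2 * pi * (t ^ N * cmod (f t)) \<le> exp 1 * K" using 2 by simp
  moreover have "1 * (t ^ N * cmod (f t)) \<le> 2 * pi * (t ^ N * cmod (f t))"
    using pi_gt3 t by (intro mult_right_mono) auto
  ultimately show ?thesis by simp
qed

section \<open>The Riemann--Lebesgue lemma\<close>

lemma norm_exp_i_diff_le: "cmod (exp (- \<i> * of_real a) - exp (- \<i> * of_real b)) \<le> \<bar>a - b\<bar>"
proof -
  have "exp (- \<i> * of_real a) - exp (- \<i> * of_real b) = exp (- \<i> * of_real b) * (iexp (b - a) - 1)"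
    by (simp add: algebra_simps flip: exp_add)
  hence "cmod (exp (- \<i> * of_real a) - exp (- \<i> * of_real b)) = cmod (iexp (b - a) - 1)"
    by (simp add: norm_mult)
  also have "\<dots> \<le> \<bar>b - a\<bar>" using iexp_approx1[of "b - a" 0] by simp
  finally show ?thesis by simp
qed

text \<open>A Lipschitz function in \<open>L\<^sup>2\<close> vanishes at infinity.\<close>

lemma Riemann_Lebesgue_bounded:
  fixes g :: "real \<Rightarrow> complex"
  assumes [measurable]: "g \<in> borel_measurable borel" and gb: "\<And>t. cmod (g t) \<le> B"
    and supp: "\<And>t. \<bar>t\<bar> > B \<Longrightarrow> g t = 0" and e: "e > 0"
  shows "\<exists>R. \<forall>\<omega>. \<bar>\<omega>\<bar> \<ge> R \<longrightarrow> cmod (fourier g \<omega>) < e"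
proof -
let ?h = "\<lambda>n \<omega>. indicator {\<omega>. real n \<le> \<bar>\<omega>\<bar>} \<omega> * (cmod (fourier g \<omega>))\<^sup>2"
  have B0: "B \<ge> 0" using gb[of 0] norm_ge_zero order_trans by metis
  have ind: "integrable lborel (\<lambda>t. K * indicator {-B..B} t :: real)" for K
    by (intro integrable_mult_right integrable_real_indicator) (auto simp: emeasure_lborel_Icc_eq)
  have i1: "integrable lborel g"
    by (rule Bochner_Integration.integrable_bound[OF ind[of B]])
       (use gb supp B0 in \<open>auto simp: indicator_def abs_le_iff intro!: AE_I2\<close>, (metis abs_of_nonneg abs_le_iff not_le norm_zero)?)
  have i2: "square_integrable g"
    unfolding square_integrable_def
  proof
    show "integrable lborel (\<lambda>x. (cmod (g x))\<^sup>2)"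
    proof (rule Bochner_Integration.integrable_bound[OF ind[of "B\<^sup>2"]])
      show "AE x in lborel. norm ((cmod (g x))\<^sup>2) \<le> norm (B\<^sup>2 * indicator {-B..B} x)"
      proof (intro AE_I2)
        fix x :: real
        show "norm ((cmod (g x))\<^sup>2) \<le> norm (B\<^sup>2 * indicator {-B..B} x)"
          using power_mono[OF gb[of x], of 2] supp[of x] by (cases "\<bar>x\<bar> > B") (auto simp: indicator_def)
      qed
    qed simp
  qed simp
  define L where "L = (LINT t|lborel. \<bar>t\<bar> * cmod (g t)) + 1"
  have iL: "integrable lborel (\<lambda>t. \<bar>t\<bar> * cmod (g t))"
  proof (rule Bochner_Integration.integrable_bound[of _ "\<lambda>t. B * cmod (g t)"])
    show "AE x in lborel. norm (\<bar>x\<bar> * cmod (g x)) \<le> norm (B * cmod (g x))"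
    proof (intro AE_I2)
      fix x :: real
      show "norm (\<bar>x\<bar> * cmod (g x)) \<le> norm (B * cmod (g x))"
        using supp[of x] B0 by (cases "\<bar>x\<bar> > B") (auto simp: abs_mult intro!: mult_right_mono)
    qed
  qed (use i1 in auto)
  have L: "L \<ge> 1" unfolding L_def by simp
  have lip: "cmod (fourier g a - fourier g b) \<le> L * \<bar>a - b\<bar>" for a b
  proof -
    have "fourier g a - fourier g b = (LINT t|lborel. (exp (- \<i> * of_real (t \<bullet> a)) - exp (- \<i> * of_real (t \<bullet> b))) * g t)"
      unfolding fourier_def left_diff_distrib
      by (rule Bochner_Integration.integral_diff[symmetric]) (rule integrable_fourier[OF i1])+
    also have "cmod \<dots> \<le> (LINT t|lborel. cmod ((exp (- \<i> * of_real (t \<bullet> a)) - exp (- \<i> * of_real (t \<bullet> b))) * g t))"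
      by (rule integral_norm_bound)
    also have "\<dots> \<le> (LINT t|lborel. \<bar>a - b\<bar> * (\<bar>t\<bar> * cmod (g t)))"
    proof (rule integral_mono')
      show "integrable lborel (\<lambda>t. \<bar>a - b\<bar> * (\<bar>t\<bar> * cmod (g t)))" by (intro integrable_mult_right iL)
      fix t :: real
      have "cmod (exp (- \<i> * of_real (t \<bullet> a)) - exp (- \<i> * of_real (t \<bullet> b))) \<le> \<bar>a - b\<bar> * \<bar>t\<bar>"
      proof -
        have "\<bar>t \<bullet> a - t \<bullet> b\<bar> = \<bar>a - b\<bar> * \<bar>t\<bar>"
          unfolding inner_diff_right[symmetric] by (simp add: inner_real_def abs_mult)
        thus ?thesis using norm_exp_i_diff_le[of "t \<bullet> a" "t \<bullet> b"] by simp
      qed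
      thus "cmod ((exp (- \<i> * of_real (t \<bullet> a)) - exp (- \<i> * of_real (t \<bullet> b))) * g t) \<le> \<bar>a - b\<bar> * (\<bar>t\<bar> * cmod (g t))"
        unfolding norm_mult mult.assoc[symmetric] by (rule mult_right_mono) simp
    qed simp
    also have "\<dots> = \<bar>a - b\<bar> * (L - 1)" by (simp add: L_def)
    also have "\<dots> \<le> L * \<bar>a - b\<bar>" by (simp add: algebra_simps)
    finally show ?thesis .
  qed
  have s: "square_integrable (fourier g)" by (rule square_integrable_fourier[OF i1 i2])
  have [measurable]: "fourier g \<in> borel_measurable borel" using s by (rule square_integrable_measurable)
  \<comment> \<open>Over a length \<open>r\<close> the transform changes by at most e/2. A value of
    modulus at least \<open>e\<close> therefore contributes at least r (e/2)^2 to the square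
    integral, more than the tail beyond \<open>n\<close> contains.\<close>
  define r where "r = e / (2 * L)"
  have r: "r > 0" using e L by (simp add: r_def)
  have "(\<lambda>n. LINT \<omega>|lborel. ?h n \<omega>) \<longlonglongrightarrow> (LINT \<omega>::real|lborel. 0)"
  proof (rule integral_dominated_convergence[where w="\<lambda>\<omega>. (cmod (fourier g \<omega>))\<^sup>2"])
    show "integrable lborel (\<lambda>\<omega>. (cmod (fourier g \<omega>))\<^sup>2)" using s by (simp add: square_integrable_def)
    show "AE \<omega> in lborel. (\<lambda>n. ?h n \<omega>) \<longlonglongrightarrow> 0"
    proof (intro AE_I2 tendsto_eventually)
      fix \<omega> :: real
      obtain N :: nat where "\<bar>\<omega>\<bar> < real N" using reals_Archimedean2 by blast
      thus "\<forall>\<^sub>F n in sequentially. ?h n \<omega> = 0"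
        by (intro eventually_sequentiallyI[of N]) (auto simp: indicator_def)
    qed
  qed (auto simp: indicator_def)
  moreover have "0 < r * (e / 2)\<^sup>2" using r e by simp
  ultimately have "\<forall>\<^sub>F n in sequentially. (LINT \<omega>|lborel. ?h n \<omega>) < r * (e / 2)\<^sup>2"
    by (intro order_tendstoD(2)) auto
  then obtain n where n: "(LINT \<omega>|lborel. ?h n \<omega>) < r * (e / 2)\<^sup>2"
    by (auto simp: eventually_sequentially)
  show ?thesis
  proof (intro exI[of _ "real n + r"] allI impI, rule ccontr)
    fix \<omega> :: real assume \<omega>: "real n + r \<le> \<bar>\<omega>\<bar>" and ne: "\<not> cmod (fourier g \<omega>) < e"
    have "r * (e / 2)\<^sup>2 = (LINT x|lborel. (e / 2)\<^sup>2 * indicator {\<omega>..\<omega> + r} x)"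
      using r by (simp add: mult.commute)
    also have "\<dots> \<le> (LINT \<omega>|lborel. ?h n \<omega>)"
    proof (rule integral_mono')
      show "integrable lborel (\<lambda>\<omega>. ?h n \<omega>)"
        by (rule Bochner_Integration.integrable_bound[of _ "\<lambda>\<omega>. (cmod (fourier g \<omega>))\<^sup>2"])
           (use s in \<open>auto simp: square_integrable_def indicator_def\<close>)
      fix x :: real
      show "(e / 2)\<^sup>2 * indicator {\<omega>..\<omega> + r} x \<le> indicator {\<omega>. real n \<le> \<bar>\<omega>\<bar>} x * (cmod (fourier g x))\<^sup>2"
      proof (cases "x \<in> {\<omega>..\<omega> + r}")
        case True
        hence "real n \<le> \<bar>x\<bar>" using \<omega> by auto
        have "L * \<bar>\<omega> - x\<bar> \<le> L * r" using True L by (intro mult_left_mono) auto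
        also have "L * r = e / 2" using L by (simp add: r_def)
        finally have "cmod (fourier g \<omega>) - cmod (fourier g x) \<le> e / 2"
          using lip[of \<omega> x] norm_triangle_ineq2[of "fourier g \<omega>" "fourier g x"] by linarith
        hence "e / 2 \<le> cmod (fourier g x)" using ne by simp
        hence "(e / 2)\<^sup>2 \<le> (cmod (fourier g x))\<^sup>2" using e by (intro power_mono) auto
        thus ?thesis using True \<open>real n \<le> \<bar>x\<bar>\<close> by simp
      qed simp
    qed simp
    finally show False using n by simp
  qed
qed

text \<open>Reduction to bounded functions of bounded support: truncating values and argument
  changes \<open>f\<close> little in L1, hence changes its transform little in the uniform
  norm.\<close>

lemma Riemann_Lebesgue:
  fixes f :: "real \<Rightarrow> complex"
  assumes f: "integrable lborel f" and e: "e > 0"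
  shows "\<exists>R. \<forall>\<omega>. \<bar>\<omega>\<bar> \<ge> R \<longrightarrow> cmod (fourier f \<omega>) < e"
proof -
  have [measurable]: "f \<in> borel_measurable borel" using f by auto
  define g where "g n t = (if cmod (f t) \<le> real n \<and> \<bar>t\<bar> \<le> real n then f t else 0)" for n and t :: real
  have g_meas[measurable]: "g n \<in> borel_measurable borel" for n unfolding g_def[abs_def] by measurable
  have ig: "integrable lborel (g n)" for n
    by (rule Bochner_Integration.integrable_bound[OF f]) (auto simp: g_def)
  have "(\<lambda>n. LINT t|lborel. cmod (f t - g n t)) \<longlonglongrightarrow> (LINT t::real|lborel. 0)"
  proof (rule integral_dominated_convergence[where w="\<lambda>t. cmod (f t)"])
    show "AE t in lborel. (\<lambda>n. cmod (f t - g n t)) \<longlonglongrightarrow> 0"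
    proof (intro AE_I2 tendsto_eventually)
      fix t :: real
      obtain N :: nat where "max \<bar>t\<bar> (cmod (f t)) < real N" using reals_Archimedean2 by blast
      thus "\<forall>\<^sub>F n in sequentially. cmod (f t - g n t) = 0"
        by (intro eventually_sequentiallyI[of N]) (auto simp: g_def)
    qed
  qed (use f in \<open>auto simp: g_def\<close>)
  hence "\<forall>\<^sub>F n in sequentially. (LINT t|lborel. cmod (f t - g n t)) < e / 2"
    using e by (intro order_tendstoD(2)) auto
  then obtain n where n: "(LINT t|lborel. cmod (f t - g n t)) < e / 2" by (auto simp: eventually_sequentially)
  have "\<exists>R. \<forall>\<omega>. \<bar>\<omega>\<bar> \<ge> R \<longrightarrow> cmod (fourier (g n) \<omega>) < e / 2"
    by (rule Riemann_Lebesgue_bounded[OF g_meas, of n "real n"]) (use e in \<open>auto simp: g_def\<close>)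
  then obtain R where R: "\<And>\<omega>. \<bar>\<omega>\<bar> \<ge> R \<Longrightarrow> cmod (fourier (g n) \<omega>) < e / 2"
    by blast
  show ?thesis
  proof (intro exI[of _ R] allI impI)
    fix \<omega> :: real assume "R \<le> \<bar>\<omega>\<bar>"
    have "cmod (fourier f \<omega> - fourier (g n) \<omega>) \<le> (LINT t|lborel. cmod (f t - g n t))"
      unfolding fourier_diff[OF f ig, symmetric] by (rule norm_fourier_le)
    thus "cmod (fourier f \<omega>) < e"
      using n R[OF \<open>R \<le> \<bar>\<omega>\<bar>\<close>] norm_triangle_ineq2[of "fourier f \<omega>" "fourier (g n) \<omega>"] by linarith
  qed
qed

section \<open>The symbol of the equation\<close>

lemma laplace_cnj: "laplace a (cnj z) = cnj (laplace a z)"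
proof -
  have "indicator {0<..} t *\<^sub>R (exp (- cnj z * of_real t) * of_real (a t)) =
      cnj (indicator {0<..} t *\<^sub>R (exp (- z * of_real t) * of_real (a t)))" for t
    by (simp add: exp_cnj)
  thus ?thesis
    unfolding laplace_def set_lebesgue_integral_def by (simp only: Bochner_Integration.integral_cnj)
qed

text \<open>The derivative estimate is homogeneous in \<open>\<kappa>\<close>, and the factor m^k
  from the chain rule is at most 1. For the last clause, if Re P \<ge> \<alpha>/2 the first
  alternative holds. Otherwise the hypothesis on Im p, which is again homogeneous, gives |Im P|
  \<le> |Im z| / 2, so at least half of Im z survives in z + P. This explains the two constants
  \<open>\<alpha> / 2\<close> and 1/2 in the minimum.\<close>

lemma resolvent_symbol_scaled:
  assumes hol: "p holomorphic_on {z. Re z > 0}" and B: "\<And>z. Re z > 0 \<Longrightarrow> cmod (p z) \<le> B"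
    and nonneg: "\<And>z. Re z > 0 \<Longrightarrow> Re (p z) \<ge> 0"
    and deriv: "\<And>k z. k \<ge> 1 \<Longrightarrow> Re z > 0 \<Longrightarrow> cmod ((deriv ^^ k) p z) \<le> C k * Re (p z)"
    and C: "\<And>k. C k \<ge> 0" and \<alpha>: "\<alpha> > 0"
    and alt: "\<And>z. Re z > 0 \<Longrightarrow> Re z \<le> 1 \<Longrightarrow> Re (p z) \<ge> c \<or> \<bar>Im z\<bar> > 1 \<and> \<bar>Im (p z)\<bar> \<le> \<bar>Im z\<bar> / \<alpha> * Re (p z)"
    and \<kappa>: "\<kappa> \<ge> 1" and m: "0 < m" "m \<le> 1" and c: "c > 0"
  shows "resolvent_symbol (min c (min (\<alpha> / 2) (1 / 2))) C (\<lambda>z. of_real \<kappa> * p (of_real m * z))"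
  unfolding resolvent_symbol_def
proof (intro conjI allI impI)
  let ?S = "{z. Re z > 0}" and ?P = "\<lambda>z. of_real \<kappa> * p (of_real m * z)"
  have mz: "Re (of_real m * z) > 0" if "Re z > 0" for z using that m by simp
  have hol': "(\<lambda>z. p (of_real m * z)) holomorphic_on ?S"
  proof -
    have "p \<circ> (\<lambda>z. of_real m * z) holomorphic_on ?S"
      using mz by (intro holomorphic_on_compose_gen[OF _ hol] holomorphic_intros) auto
    thus ?thesis by (simp add: o_def)
  qed
  show "?P holomorphic_on ?S" by (intro holomorphic_intros hol')
  show "\<exists>B. \<forall>z. Re z > 0 \<longrightarrow> cmod (?P z) \<le> B"
    by (intro exI[of _ "\<kappa> * B"]) (use B mz \<kappa> in \<open>auto simp: norm_mult intro!: mult_left_mono\<close>)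
  show "0 \<le> Re (?P z)" if "Re z > 0" for z using nonneg[OF mz[OF that]] \<kappa> by simp
  show "cmod ((deriv ^^ k) ?P z) \<le> C k * (1 + Re (?P z))" if k: "1 \<le> k" and z: "0 < Re z" for k z
  proof -
    have "(deriv ^^ k) ?P z = of_real \<kappa> * (deriv ^^ k) (\<lambda>z. p (of_real m * z)) z"
      by (rule higher_deriv_cmult[OF hol' _ open_halfplane_Re]) (use z in auto)
    also have "(deriv ^^ k) (\<lambda>z. p (of_real m * z)) z = of_real m ^ k * (deriv ^^ k) p (of_real m * z)"
      by (rule higher_deriv_compose_linear[OF hol open_halfplane_Re open_halfplane_Re]) (use z m in auto)
    finally have "cmod ((deriv ^^ k) ?P z) = \<kappa> * (m ^ k * cmod ((deriv ^^ k) p (of_real m * z)))"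
      using \<kappa> m by (simp add: norm_mult norm_power)
    also have "\<dots> \<le> \<kappa> * (1 * (C k * Re (p (of_real m * z))))"
      using \<kappa> m by (intro mult_left_mono mult_mono deriv k mz z) (auto intro: power_le_one)
    also have "\<dots> = C k * Re (?P z)" by simp
    also have "\<dots> \<le> C k * (1 + Re (?P z))" using C by (intro mult_left_mono) auto
    finally show ?thesis .
  qed
  fix z assume z: "0 < Re z \<and> Re z \<le> 1"
  let ?w = "of_real m * z" and ?c = "min c (min (\<alpha> / 2) (1 / 2))"
  have w: "Re ?w > 0" "Re ?w \<le> 1"
  proof -
    show "Re ?w > 0" using z m by simp
    have "m * Re z \<le> 1 * 1" using z m by (intro mult_mono) auto
    thus "Re ?w \<le> 1" by simp
  qed
  show "?c \<le> Re (?P z) \<or> 1 \<le> \<bar>Im z\<bar> \<and> ?c * \<bar>Im z\<bar> \<le> cmod (z + ?P z)"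
  proof (cases "c \<le> Re (p ?w)")
    case True
    have "1 * Re (p ?w) \<le> \<kappa> * Re (p ?w)" using \<kappa> nonneg[OF w(1)] by (intro mult_right_mono) auto
    hence "c \<le> Re (?P z)" using True by simp
    thus ?thesis by (simp add: min_le_iff_disj)
  next
    case False
    with alt[OF w] have a: "\<bar>Im ?w\<bar> > 1" "\<bar>Im (p ?w)\<bar> \<le> \<bar>Im ?w\<bar> / \<alpha> * Re (p ?w)" by auto
    have Imw: "\<bar>Im ?w\<bar> \<le> \<bar>Im z\<bar>"
      using m mult_right_mono[of m 1 "\<bar>Im z\<bar>"] by (simp add: abs_mult)
    show ?thesis
    proof (cases "\<alpha> / 2 \<le> Re (?P z)")
      case True thus ?thesis by (simp add: min_le_iff_disj)
    next
      case small: False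
      have "\<bar>Im (?P z)\<bar> = \<kappa> * \<bar>Im (p ?w)\<bar>" using \<kappa> by (simp add: abs_mult)
      also have "\<dots> \<le> \<kappa> * (\<bar>Im ?w\<bar> / \<alpha> * Re (p ?w))" using \<kappa> by (intro mult_left_mono a) auto
      also have "\<dots> \<le> \<kappa> * (\<bar>Im z\<bar> / \<alpha> * Re (p ?w))"
        using \<kappa> \<alpha> nonneg[OF w(1)] by (intro mult_left_mono mult_right_mono divide_right_mono Imw) auto
      also have "\<dots> = \<bar>Im z\<bar> / \<alpha> * Re (?P z)" by simp
      also have "\<dots> \<le> \<bar>Im z\<bar> / \<alpha> * (\<alpha> / 2)" using small \<alpha> by (intro mult_left_mono) auto
      also have "\<dots> = \<bar>Im z\<bar> / 2" using \<alpha> by simp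
      finally have "\<bar>Im z\<bar> / 2 \<le> \<bar>Im (z + ?P z)\<bar>"
        using abs_triangle_ineq2[of "Im z" "- Im (?P z)"] by (simp only: plus_complex.simps abs_minus_cancel diff_minus_eq_add)
      also have "\<dots> \<le> cmod (z + ?P z)" by (rule abs_Im_le_cmod)
      finally have "\<bar>Im z\<bar> / 2 \<le> cmod (z + ?P z)" .
      moreover have "?c * \<bar>Im z\<bar> \<le> 1 / 2 * \<bar>Im z\<bar>" by (intro mult_right_mono) auto
      ultimately show ?thesis using a(1) Imw by simp
    qed
  qed
qed

text \<open>Along a vertical line the Laplace transform is the Fourier transform of exp(-x t) a(t)
  on the half line.\<close>

lemma laplace_vertical_decay:
  assumes int: "set_integrable lborel {0<..} (\<lambda>t. exp (- x * t) * a t)" and e: "e > 0"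
  shows "\<exists>R. \<forall>\<omega>. \<bar>\<omega>\<bar> \<ge> R \<longrightarrow> cmod (laplace a (Complex x \<omega>)) < e"
proof -
  define f where "f t = complex_of_real (indicator {0<..} t * (exp (- x * t) * a t))" for t
  have f: "integrable lborel f"
    using int by (simp add: f_def[abs_def] set_integrable_def del: of_real_mult)
  have "laplace a (Complex x \<omega>) = fourier f \<omega>" for \<omega>
    unfolding laplace_def fourier_def set_lebesgue_integral_def
  proof (intro Bochner_Integration.integral_cong refl)
    fix t :: real
    have "- Complex x \<omega> * of_real t = - \<i> * of_real (t * \<omega>) + of_real (- x * t)" by (simp add: complex_eq_iff)
    hence "exp (- Complex x \<omega> * of_real t) = exp (- \<i> * of_real (t * \<omega>)) * of_real (exp (- x * t))"
      by (simp only: exp_add exp_of_real)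
    thus "indicator {0<..} t *\<^sub>R (exp (- Complex x \<omega> * of_real t) * of_real (a t)) = exp (- \<i> * of_real (t \<bullet> \<omega>)) * f t"
      by (simp add: f_def scaleR_conv_of_real inner_real_def)
  qed
  thus ?thesis using Riemann_Lebesgue[OF f e] by simp
qed

text \<open>Pointwise positivity on the imaginary axis is made uniform. On the axis F need not be an
  absolutely convergent integral, so the Riemann-Lebesgue lemma is applied on a nearby line Re z = x
  and carried back by a bound on the derivative of F, which Cauchy's inequality supplies thanks to
  the margin \<alpha>. Far out the value is then at least a0/2; on the remaining compact interval a
  positive minimum is attained.\<close>

lemma symbol_positive_boundary:
  assumes a0: "a0 > 0" and ext: "laplace_extension \<alpha> a F" and \<alpha>: "\<alpha> > 0"
    and int: "\<And>x. x > 0 \<Longrightarrow> set_integrable lborel {0<..} (\<lambda>t. exp (- x * t) * a t)"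
    and pos: "\<And>\<omega>. a0 + Re (F (\<i> * of_real \<omega>)) > 0"
  shows "\<exists>c>0. \<forall>\<omega>. a0 + Re (F (\<i> * of_real \<omega>)) \<ge> c"
proof -
  have hol: "F holomorphic_on {z. Re z > - \<alpha>}" and cont: "continuous_on {z. Re z \<ge> - \<alpha>} F"
    and lap: "\<And>z. Re z > 0 \<Longrightarrow> F z = laplace a z"
    using ext by (auto simp: laplace_extension_def)
  obtain B where B: "\<And>z. Re z \<ge> - \<alpha> \<Longrightarrow> cmod (F z) \<le> B" using ext by (auto simp: laplace_extension_def bounded_iff)
  have B0: "B \<ge> 0" using B[of 0] \<alpha> norm_ge_zero order_trans by (metis less_eq_real_def neg_le_0_iff_le zero_complex.simps(1))
  define B1 where "B1 = B / (\<alpha> / 2)"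
  have B1: "B1 \<ge> 0" using B0 \<alpha> by (simp add: B1_def)
  have dF: "cmod (deriv F z) \<le> B1" if z: "Re z \<ge> 0" for z
  proof -
    have sub: "cball z (\<alpha> / 2) \<subseteq> {w. Re w > - \<alpha>}"
    proof
      fix w assume "w \<in> cball z (\<alpha> / 2)"
      hence "Re (z - w) \<le> \<alpha> / 2" using complex_Re_le_cmod[of "z - w"] by (simp add: dist_norm)
      thus "w \<in> {w. Re w > - \<alpha>}" using z \<alpha> by simp
    qed
    have h: "F holomorphic_on cball z (\<alpha> / 2)" using holomorphic_on_subset[OF hol sub] .
    have "cmod ((deriv ^^ 1) F z) \<le> fact 1 * B / (\<alpha> / 2) ^ 1"
    proof (rule Cauchy_inequality)
      show "F holomorphic_on ball z (\<alpha> / 2)" using holomorphic_on_subset[OF h ball_subset_cball] .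
      show "continuous_on (cball z (\<alpha> / 2)) F" using h by (rule holomorphic_on_imp_continuous_on)
      show "cmod (F w) \<le> B" if "cmod (z - w) = \<alpha> / 2" for w
        using sub that by (intro B) (auto simp: dist_norm subset_iff intro: less_imp_le)
    qed (use \<alpha> in simp)
    thus ?thesis by (simp add: B1_def)
  qed
  \<comment> \<open>Chosen so that passing from the line Re z = x to the axis changes F by at most
    a0/4; together with the decay below a0/4 on that line, half of \<open>a0\<close> is
    left.\<close>
  define x where "x = a0 / (4 * (B1 + 1))"
  have x: "x > 0" using a0 B1 by (simp add: x_def)
  have B1x: "B1 * x \<le> a0 / 4"
  proof -
    have "B1 * x \<le> (B1 + 1) * x" using x by simp
    also have "\<dots> = a0 / 4" using B1 add_nonneg_pos[OF B1 zero_less_one] by (simp add: x_def field_simps)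
    finally show ?thesis .
  qed
  have near: "cmod (F (Complex x \<omega>) - F (Complex 0 \<omega>)) \<le> B1 * x" for \<omega>
  proof -
    have "cmod (F (Complex x \<omega>) - F (Complex 0 \<omega>)) \<le> B1 * cmod (Complex x \<omega> - Complex 0 \<omega>)"
    proof (rule field_differentiable_bound[where S="{z. Re z \<ge> 0}" and f'="deriv F"])
      show "(F has_field_derivative deriv F z) (at z within {z. Re z \<ge> 0})" if "z \<in> {z. Re z \<ge> 0}" for z
        by (rule has_field_derivative_at_within, rule holomorphic_derivI[OF hol open_halfplane_Re]) (use that \<alpha> in auto)
    qed (use dF x in \<open>auto simp: convex_halfspace_Re_ge\<close>)
    also have "cmod (Complex x \<omega> - Complex 0 \<omega>) = x" using x by (simp add: complex_diff cmod_def)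
    finally show ?thesis .
  qed
  obtain R where R: "\<And>\<omega>. \<bar>\<omega>\<bar> \<ge> R \<Longrightarrow> cmod (laplace a (Complex x \<omega>)) < a0 / 4"
    using laplace_vertical_decay[OF int[OF x], of "a0 / 4"] a0 by auto
  have far: "a0 + Re (F (Complex 0 \<omega>)) \<ge> a0 / 2" if "\<bar>\<omega>\<bar> \<ge> R" for \<omega>
  proof -
    have "cmod (F (Complex x \<omega>)) < a0 / 4" using R[OF that] lap[of "Complex x \<omega>"] x by simp
    hence "cmod (F (Complex 0 \<omega>)) \<le> a0 / 2"
      using near[of \<omega>] B1x norm_triangle_ineq2[of "F (Complex 0 \<omega>)" "F (Complex x \<omega>)"] by (simp add: norm_minus_commute)
    thus ?thesis using abs_Re_le_cmod[of "F (Complex 0 \<omega>)"] by linarith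
  qed
  have "continuous_on {- \<bar>R\<bar>..\<bar>R\<bar>} (\<lambda>\<omega>. a0 + Re (F (\<i> * of_real \<omega>)))"
    by (intro continuous_intros continuous_on_compose2[OF cont]) (use \<alpha> in auto)
  hence "\<exists>\<omega>0\<in>{- \<bar>R\<bar>..\<bar>R\<bar>}. \<forall>\<omega>\<in>{- \<bar>R\<bar>..\<bar>R\<bar>}. a0 + Re (F (\<i> * of_real \<omega>0)) \<le> a0 + Re (F (\<i> * of_real \<omega>))"
    by (intro continuous_attains_inf) auto
  then obtain \<omega>0 where "\<And>\<omega>. \<omega> \<in> {- \<bar>R\<bar>..\<bar>R\<bar>} \<Longrightarrow> a0 + Re (F (\<i> * of_real \<omega>0)) \<le> a0 + Re (F (\<i> * of_real \<omega>))"
    by blast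
  note min = this
  have inner: "a0 + Re (F (\<i> * of_real \<omega>0)) \<le> a0 + Re (F (\<i> * of_real \<omega>))" if "\<bar>\<omega>\<bar> \<le> \<bar>R\<bar>" for \<omega>
    by (rule min) (use that in \<open>simp add: abs_le_iff\<close>)
  have cx: "\<i> * of_real \<omega> = Complex 0 \<omega>" for \<omega> by (simp add: complex_eq_iff)
  show ?thesis
  proof (intro exI[of _ "min (a0 / 2) (a0 + Re (F (\<i> * of_real \<omega>0)))"] conjI allI)
    fix \<omega>
    show "min (a0 / 2) (a0 + Re (F (\<i> * of_real \<omega>0))) \<le> a0 + Re (F (\<i> * of_real \<omega>))"
    proof (cases "\<bar>\<omega>\<bar> \<le> \<bar>R\<bar>")
      case True
      thus ?thesis using inner[OF True] by (simp add: min_le_iff_disj)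
    next
      case False
      hence "\<bar>\<omega>\<bar> \<ge> R" by simp
      from far[OF this] show ?thesis unfolding cx by (simp add: min_le_iff_disj)
    qed
  qed (use a0 pos in auto)
qed

text \<open>Under the first alternative Re p has a positive lower bound on the closed half plane,
  and Cauchy's estimates divided by it give the derivative bounds. Under the second, Re p may tend
  to 0, so everything is derived from Re p \<ge> 0 on the larger half plane by Schwarz-Pick, and a
  lower bound for Re p is available only on compact sets.\<close>

lemma resolvent_symbol_family:
  assumes a0: "a0 \<ge> 0" and ext: "laplace_extension \<alpha> a F" and \<alpha>: "\<alpha> > 0"
    and int: "\<And>x. x > 0 \<Longrightarrow> set_integrable lborel {0<..} (\<lambda>t. exp (- x * t) * a t)"
    and A: "of_real a0 + F 0 = of_real A" "A > 0"
    and cond: "(a0 > 0 \<and> (\<forall>\<omega>::real. a0 + Re (F (\<i> * of_real \<omega>)) > 0)) \<or>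
         (\<forall>\<omega>::real. Re (F (- of_real \<alpha> + \<i> * of_real \<omega>)) \<ge> 0)"
  shows "\<exists>c C. 0 < c \<and> c \<le> 1 \<and> (\<forall>\<kappa> m. \<kappa> \<ge> 1 \<longrightarrow> 0 < m \<longrightarrow> m \<le> 1 \<longrightarrow>
    resolvent_symbol c C (\<lambda>z. of_real \<kappa> * (of_real a0 + F (of_real m * z))))"
proof -
  define p where "p z = of_real a0 + F z" for z
  have hol: "F holomorphic_on {z. Re z > - \<alpha>}" and cont: "continuous_on {z. Re z \<ge> - \<alpha>} F"
    and bdd: "bounded (F ` {z. Re z \<ge> - \<alpha>})"
    and lap: "\<And>z. Re z > 0 \<Longrightarrow> F z = laplace a z"
    using ext by (auto simp: laplace_extension_def)
  have holp: "p holomorphic_on {z. Re z > - \<alpha>}" unfolding p_def by (intro holomorphic_intros hol)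
  have holp0: "p holomorphic_on {z. Re z > 0}" by (rule holomorphic_on_subset[OF holp]) (use \<alpha> in auto)
  have contp: "continuous_on {z. Re z \<ge> - \<alpha>} p" unfolding p_def by (intro continuous_intros cont)
  obtain B where B: "\<And>z. Re z \<ge> - \<alpha> \<Longrightarrow> cmod (F z) \<le> B" using bdd by (auto simp: bounded_iff)
  have Bp: "cmod (p z) \<le> a0 + B" if "Re z \<ge> - \<alpha>" for z
    using B[OF that] a0 norm_triangle_ineq[of "of_real a0" "F z"] by (simp add: p_def)
  have "\<exists>c C. c > 0 \<and> (\<forall>k. C k \<ge> 0) \<and> (\<forall>z. Re z > 0 \<longrightarrow> Re (p z) \<ge> 0) \<and>
     (\<forall>k\<ge>1. \<forall>z. Re z > 0 \<longrightarrow> cmod ((deriv ^^ k) p z) \<le> C k * Re (p z)) \<and>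
     (\<forall>z. Re z > 0 \<longrightarrow> Re z \<le> 1 \<longrightarrow> Re (p z) \<ge> c \<or> \<bar>Im z\<bar> > 1 \<and> \<bar>Im (p z)\<bar> \<le> \<bar>Im z\<bar> / \<alpha> * Re (p z))"
    using cond
  proof
    assume c1: "a0 > 0 \<and> (\<forall>\<omega>::real. a0 + Re (F (\<i> * of_real \<omega>)) > 0)"
    then obtain c where c: "c > 0" "\<And>\<omega>. a0 + Re (F (\<i> * of_real \<omega>)) \<ge> c"
      using symbol_positive_boundary[OF _ ext \<alpha> int] by blast
    have cx: "Complex 0 \<omega> = \<i> * of_real \<omega>" for \<omega> by (simp add: complex_eq_iff)
    have ge: "Re (p z) \<ge> c" if "Re z \<ge> 0" for z
    proof (rule Re_ge_from_boundary[OF holp0 _ _ _ that])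
      show "continuous_on {z. 0 \<le> Re z} p" by (rule continuous_on_subset[OF contp]) (use \<alpha> in auto)
      show "bounded (p ` {z. 0 \<le> Re z})"
        unfolding bounded_iff by (intro exI[of _ "a0 + B"] ballI) (use Bp \<alpha> in auto)
      show "c \<le> Re (p (Complex 0 \<omega>))" for \<omega> using c(2)[of \<omega>] by (simp add: p_def cx)
    qed
    have B0: "a0 + B \<ge> 0" using order_trans[OF norm_ge_zero Bp[of 0]] \<alpha> by simp
    \<comment> \<open>The final division by \<open>c\<close> turns Cauchy's absolute bound into a
      multiple of Re p.\<close>
    define C where "C k = fact k * (a0 + B) / (\<alpha> / 2) ^ k / c" for k
    have C: "C k \<ge> 0" for k using B0 \<alpha> c by (simp add: C_def)
    have "cmod ((deriv ^^ k) p z) \<le> C k * Re (p z)" if "Re z > 0" for k z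
    proof -
      have sub: "cball z (\<alpha> / 2) \<subseteq> {w. Re w > - \<alpha>}"
      proof
        fix w assume "w \<in> cball z (\<alpha> / 2)"
        hence "Re (z - w) \<le> \<alpha> / 2" using complex_Re_le_cmod[of "z - w"] by (simp add: dist_norm)
        thus "w \<in> {w. Re w > - \<alpha>}" using that \<alpha> by simp
      qed
      have h: "p holomorphic_on cball z (\<alpha> / 2)" using holomorphic_on_subset[OF holp sub] .
      have "cmod ((deriv ^^ k) p z) \<le> fact k * (a0 + B) / (\<alpha> / 2) ^ k"
      proof (rule Cauchy_inequality)
        show "p holomorphic_on ball z (\<alpha> / 2)" using holomorphic_on_subset[OF h ball_subset_cball] .
        show "continuous_on (cball z (\<alpha> / 2)) p" using h by (rule holomorphic_on_imp_continuous_on)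
        show "cmod (p w) \<le> a0 + B" if "cmod (z - w) = \<alpha> / 2" for w
          using sub that by (intro Bp) (auto simp: dist_norm subset_iff intro: less_imp_le)
      qed (use \<alpha> in simp)
      also have "\<dots> = C k * c" using c by (simp add: C_def)
      also have "\<dots> \<le> C k * Re (p z)" using ge[of z] that C by (intro mult_left_mono) auto
      finally show ?thesis .
    qed
    moreover have "Re (p z) \<ge> 0" if "Re z > 0" for z using ge[of z] that c by simp
    ultimately show ?thesis using c C ge
      by (intro exI[of _ c] exI[of _ C]) auto
  next
    assume c2: "\<forall>\<omega>::real. Re (F (- of_real \<alpha> + \<i> * of_real \<omega>)) \<ge> 0"
    have cx: "Complex (- \<alpha>) \<omega> = - of_real \<alpha> + \<i> * of_real \<omega>" for \<omega> by (simp add: complex_eq_iff)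
    have "Re (F z) \<ge> 0" if "Re z \<ge> - \<alpha>" for z
      by (rule Re_ge_from_boundary[OF hol cont bdd _ that]) (use c2 in \<open>simp add: cx\<close>)
    hence nonneg: "Re (p z) \<ge> 0" if "Re z > - \<alpha>" for z using that a0 by (simp add: p_def)
    note SP = Schwarz_Pick_halfplane[OF holp nonneg]
    \<comment> \<open>If Re (p v) = 0, then cnj (p v) = - p v, and Schwarz-Pick for the points 0 and
      v has |p 0 - p v| on both sides with a larger factor on the left. This forces p 0 = p v,
      although Re (p 0) = A > 0.\<close>
    have pos: "Re (p v) > 0" if v: "Re v > - \<alpha>" for v
    proof (rule ccontr)
      assume "\<not> Re (p v) > 0"
      hence 0: "Re (p v) = 0" using nonneg[OF v] by simp
      hence cnj: "cnj (p v) = - p v" by (simp add: complex_eq_iff)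
      have "cmod (p 0 - p v) * cmod (0 + cnj v - 2 * of_real (- \<alpha>)) \<le> cmod (0 - v) * cmod (p 0 - p v)"
        using SP[of 0 v] v \<alpha> by (simp add: cnj)
      hence "cmod (p 0 - p v) * cmod (cnj v + 2 * of_real \<alpha>) \<le> cmod (p 0 - p v) * cmod v" by (simp add: mult.commute)
      moreover have "cmod v < cmod (cnj v + 2 * of_real \<alpha>)"
      proof -
        have "(cmod (cnj v + 2 * of_real \<alpha>))\<^sup>2 - (cmod v)\<^sup>2 = 4 * \<alpha> * (Re v + \<alpha>)"
          unfolding cmod_power2 by (simp add: power2_eq_square algebra_simps)
        also have "\<dots> > 0" using v \<alpha> by simp
        finally have "(cmod v)\<^sup>2 < (cmod (cnj v + 2 * of_real \<alpha>))\<^sup>2" by simp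
        thus ?thesis by (rule power2_less_imp_less) simp
      qed
      ultimately have "p 0 = p v"
        by (metis linorder_not_less mult_strict_left_mono norm_ge_zero norm_eq_zero order_le_less right_minus_eq)
      moreover have "Re (p 0) = A" using A(1) by (simp add: p_def)
      ultimately show False using 0 A(2) by simp
    qed
    define C where "C k = fact k / (\<alpha> / 2) ^ k" for k
    have C: "C k \<ge> 0" for k using \<alpha> by (simp add: C_def)
    have der: "cmod ((deriv ^^ k) p z) \<le> C k * Re (p z)" if "k \<ge> 1" "Re z > 0" for k z
      using higher_deriv_bound_halfplane[OF holp nonneg, where d=\<alpha> and z=z and k=k] that \<alpha> by (simp add: C_def)
    \<comment> \<open>Schwarz-Pick for \<open>z\<close> and its conjugate. The kernel is real, so p
      commutes with conjugation to the right of the imaginary axis, and both differences become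
      purely imaginary.\<close>
    have arg: "\<bar>Im (p z)\<bar> \<le> \<bar>Im z\<bar> / \<alpha> * Re (p z)" if z: "Re z > 0" for z
    proof -
      have pc: "p (cnj z) = cnj (p z)" using z by (simp add: p_def lap laplace_cnj)
      have d: "w - cnj w = of_real (2 * Im w) * \<i>" for w by (simp add: complex_eq_iff)
      have "cmod (p z - cnj (p z)) * cmod (2 * (z + of_real \<alpha>)) \<le> cmod (z - cnj z) * cmod (2 * p z)"
        using SP[of z "cnj z"] z \<alpha> by (simp add: pc algebra_simps)
      hence "\<bar>Im (p z)\<bar> * cmod (z + of_real \<alpha>) \<le> \<bar>Im z\<bar> * cmod (p z)"
        unfolding d norm_mult by simp
      hence "(\<bar>Im (p z)\<bar> * cmod (z + of_real \<alpha>))\<^sup>2 \<le> (\<bar>Im z\<bar> * cmod (p z))\<^sup>2"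
        by (intro power_mono) auto
      hence "(Im (p z))\<^sup>2 * (Re z + \<alpha>)\<^sup>2 \<le> (Im z)\<^sup>2 * (Re (p z))\<^sup>2"
        unfolding power_mult_distrib cmod_power2 by (simp add: algebra_simps)
      hence "(\<bar>Im (p z)\<bar> * (Re z + \<alpha>))\<^sup>2 \<le> (\<bar>Im z\<bar> * Re (p z))\<^sup>2" by (simp add: power_mult_distrib)
      hence "\<bar>Im (p z)\<bar> * (Re z + \<alpha>) \<le> \<bar>Im z\<bar> * Re (p z)"
        by (rule power2_le_imp_le) (use nonneg[of z] z \<alpha> in simp)
      moreover have "\<bar>Im (p z)\<bar> * \<alpha> \<le> \<bar>Im (p z)\<bar> * (Re z + \<alpha>)" using z by (intro mult_left_mono) auto
      ultimately have "\<bar>Im (p z)\<bar> * \<alpha> \<le> \<bar>Im z\<bar> * Re (p z)" by simp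
      thus ?thesis using \<alpha> by (simp add: pos_le_divide_eq)
    qed
    \<comment> \<open>Low frequencies: positivity of Re p on this compact box yields the constant.
      For |Im z| > 1 the bound \<open>arg\<close> takes over.\<close>
    let ?K = "cbox (Complex 0 (-1)) (Complex 1 1)"
    have "continuous_on ?K (\<lambda>z. Re (p z))"
      by (intro continuous_intros continuous_on_subset[OF contp]) (use \<alpha> in \<open>auto simp: in_cbox_complex_iff\<close>)
    moreover have "0 \<in> ?K" by (simp add: in_cbox_complex_iff)
    ultimately obtain z0 where z0: "z0 \<in> ?K" "\<And>z. z \<in> ?K \<Longrightarrow> Re (p z0) \<le> Re (p z)"
      using continuous_attains_inf[of ?K "\<lambda>z. Re (p z)"] by (auto simp: compact_cbox)
    have "Re (p z0) > 0" using z0(1) \<alpha> by (intro pos) (auto simp: in_cbox_complex_iff)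
    moreover have "Re (p z) \<ge> Re (p z0) \<or> \<bar>Im z\<bar> > 1 \<and> \<bar>Im (p z)\<bar> \<le> \<bar>Im z\<bar> / \<alpha> * Re (p z)"
      if "Re z > 0" "Re z \<le> 1" for z
    proof (cases "\<bar>Im z\<bar> \<le> 1")
      case True
      hence "z \<in> ?K" using that by (auto simp: in_cbox_complex_iff)
      thus ?thesis using z0(2) by simp
    qed (use arg[OF that(1)] in auto)
    ultimately show ?thesis using C der nonneg \<alpha>
      by (intro exI[of _ "Re (p z0)"] exI[of _ C]) auto
  qed
  then obtain c C where *: "c > 0" "\<And>k. C k \<ge> 0" "\<And>z. Re z > 0 \<Longrightarrow> Re (p z) \<ge> 0"
     "\<And>k z. k \<ge> 1 \<Longrightarrow> Re z > 0 \<Longrightarrow> cmod ((deriv ^^ k) p z) \<le> C k * Re (p z)"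
     "\<And>z. Re z > 0 \<Longrightarrow> Re z \<le> 1 \<Longrightarrow> Re (p z) \<ge> c \<or> \<bar>Im z\<bar> > 1 \<and> \<bar>Im (p z)\<bar> \<le> \<bar>Im z\<bar> / \<alpha> * Re (p z)"
    by blast
  show ?thesis
  proof (intro exI[of _ "min c (min (\<alpha> / 2) (1 / 2))"] exI[of _ C] conjI allI impI)
    fix \<kappa> m :: real assume "1 \<le> \<kappa>" "0 < m" "m \<le> 1"
    moreover have "cmod (p z) \<le> a0 + B" if "Re z > 0" for z using Bp[of z] that \<alpha> by simp
    ultimately show "resolvent_symbol (min c (min (\<alpha> / 2) (1 / 2))) C (\<lambda>z. of_real \<kappa> * (of_real a0 + F (of_real m * z)))"
      using resolvent_symbol_scaled[OF holp0 _ *(3,4,2) \<alpha> *(5) _ _ _ *(1)] unfolding p_def by blast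
  qed (use *(1) \<alpha> in auto)
qed

section \<open>Volterra equations\<close>

lemma integrable_translate:
  assumes "integrable lborel f"
  shows "integrable lborel (\<lambda>t::real. f (t - r) :: complex)" "(LINT t|lborel. f (t - r)) = (LINT t|lborel. f t)"
  using lborel_integrable_real_affine[OF assms, of 1 "- r"] lborel_integral_real_affine[of 1 f "- r"] by simp_all

lemma integrable_convolution_pair:
  fixes f g :: "real \<Rightarrow> complex"
  assumes f: "integrable lborel f" and g: "integrable lborel g"
  shows "integrable (lborel \<Otimes>\<^sub>M lborel) (\<lambda>(r, t). f (t - r) * g r)"
proof (rule lborel_pair.Fubini_integrable)
  have [measurable]: "f \<in> borel_measurable borel" "g \<in> borel_measurable borel" using f g by auto
  show "(\<lambda>(r, t). f (t - r) * g r) \<in> borel_measurable (lborel \<Otimes>\<^sub>M lborel)" by measurable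
  have "(LINT t|lborel. cmod (f (t - r))) = (LINT t|lborel. cmod (f t))" for r
    using lborel_integral_real_affine[of 1 "\<lambda>t. cmod (f t)" "- r"] by simp
  thus "integrable lborel (\<lambda>r. LINT t|lborel. cmod (case (r, t) of (r, t) \<Rightarrow> f (t - r) * g r))"
    using g by (simp add: norm_mult)
  show "AE r in lborel. integrable lborel (\<lambda>t. case (r, t) of (r, t) \<Rightarrow> f (t - r) * g r)"
    unfolding prod.case by (intro AE_I2 integrable_mult_left integrable_translate f)
qed

lemma integral_convolution:
  fixes f g :: "real \<Rightarrow> complex"
  assumes f: "integrable lborel f" and g: "integrable lborel g"
  shows "(LINT t|lborel. LINT r|lborel. f (t - r) * g r) = (LINT t|lborel. f t) * (LINT t|lborel. g t)"
proof -
  have "(LINT t|lborel. LINT r|lborel. f (t - r) * g r) = (LINT r|lborel. LINT t|lborel. f (t - r) * g r)"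
    by (rule lborel_pair.Fubini_integral[OF integrable_convolution_pair[OF f g]])
  also have "\<dots> = (LINT r|lborel. (LINT t|lborel. f t) * g r)"
    by (simp add: integrable_translate[OF f])
  finally show ?thesis by simp
qed

definition volterra :: "(real \<Rightarrow> real) \<Rightarrow> (real \<Rightarrow> real) \<Rightarrow> real \<Rightarrow> real" where
  "volterra A g t = (LINT r|lborel. indicator {0<..<t} r * (A (t - r) * g r))"

lemma integrable_indicator_Ioo: "integrable lborel (indicator {a<..<b::real} :: real \<Rightarrow> real)"
  by (cases "a \<le> b") auto

lemma integrable_bounded_interval:
  fixes g :: "real \<Rightarrow> real"
  assumes [measurable]: "g \<in> borel_measurable borel" and b: "\<And>r. 0 < r \<Longrightarrow> r < t \<Longrightarrow> \<bar>g r\<bar> \<le> B"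
  shows "integrable lborel (\<lambda>r. indicator {0<..<t} r * g r)"
proof (rule Bochner_Integration.integrable_bound[of _ "\<lambda>r. B * indicator {0<..<t} r"])
  show "integrable lborel (\<lambda>r. B * indicator {0<..<t} r)"
    by (intro integrable_mult_right integrable_indicator_Ioo)
  show "AE r in lborel. norm (indicator {0<..<t} r * g r) \<le> norm (B * indicator {0<..<t} r)"
    using b by (auto simp: indicator_def intro!: AE_I2 order_trans[OF _ abs_ge_self])
qed measurable

lemma volterra_continuous:
  assumes A: "continuous_on UNIV A" and Ab: "\<And>t. \<bar>A t\<bar> \<le> M" and [measurable]: "g \<in> borel_measurable borel"
    and gb: "\<And>T. \<exists>B. \<forall>r. 0 < r \<longrightarrow> r < T \<longrightarrow> \<bar>g r\<bar> \<le> B"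
  shows "continuous_on UNIV (volterra A g)"
proof (rule continuous_at_imp_continuous_on, intro ballI)
  fix t :: real
  have [measurable]: "A \<in> borel_measurable borel" using A by (rule borel_measurable_continuous_onI)
  show "isCont (volterra A g) t"
    unfolding continuous_at_sequentially comp_def
  proof (intro allI impI)
    fix X :: "nat \<Rightarrow> real" assume X: "X \<longlonglongrightarrow> t"
    then obtain T where T: "\<And>n. X n < T"
    proof -
      have "Bseq X" using X by (intro convergent_imp_Bseq convergentI)
      then obtain K where "\<And>n. norm (X n) \<le> K" by (auto simp: Bseq_def)
      hence "X n < K + 1" for n using abs_le_D1[of "X n" K] by (simp add: real_norm_def add_strict_increasing2)
      thus ?thesis using that by blast
    qed
    obtain B where B: "\<And>r. 0 < r \<Longrightarrow> r < T \<Longrightarrow> \<bar>g r\<bar> \<le> B" using gb[of T] by auto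
    show "(\<lambda>n. volterra A g (X n)) \<longlonglongrightarrow> volterra A g t"
      unfolding volterra_def
    proof (rule integral_dominated_convergence[where w="\<lambda>r. indicator {0<..<T} r * (M * \<bar>g r\<bar>)"])
      show "integrable lborel (\<lambda>r. indicator {0<..<T} r * (M * \<bar>g r\<bar>))"
        using integrable_mult_right[OF integrable_bounded_interval[of "\<lambda>r. \<bar>g r\<bar>" T B], of M] B by (simp add: mult_ac)
      \<comment> \<open>The indicators of the moving intervals converge at every point except
        possibly r = t, a null set.\<close>
      show "AE r in lborel. (\<lambda>n. indicator {0<..<X n} r * (A (X n - r) * g r)) \<longlonglongrightarrow> indicator {0<..<t} r * (A (t - r) * g r)"
      proof (rule AE_mp[OF AE_lborel_singleton[of t]], intro AE_I2 impI)
        fix r :: real assume "r \<noteq> t"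
        have "(\<lambda>n. indicator {0<..<X n} r :: real) \<longlonglongrightarrow> indicator {0<..<t} r"
        proof (cases "r < t")
          case True
          hence "\<forall>\<^sub>F n in sequentially. r < X n" using X by (rule order_tendstoD(1)[rotated])
          thus ?thesis using True by (intro tendsto_eventually) (auto elim!: eventually_mono simp: indicator_def)
        next
          case False
          hence "\<forall>\<^sub>F n in sequentially. X n < r" using X \<open>r \<noteq> t\<close> by (intro order_tendstoD(2)) auto
          thus ?thesis using False by (intro tendsto_eventually) (auto elim!: eventually_mono simp: indicator_def)
        qed
        moreover have "(\<lambda>n. A (X n - r)) \<longlonglongrightarrow> A (t - r)"
          using A by (intro isCont_tendsto_compose[of _ A] tendsto_intros X) (auto simp: continuous_on_eq_continuous_at)
        ultimately show "(\<lambda>n. indicator {0<..<X n} r * (A (X n - r) * g r)) \<longlonglongrightarrow> indicator {0<..<t} r * (A (t - r) * g r)"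
          by (intro tendsto_intros)
      qed
      show "AE r in lborel. norm (indicator {0<..<X n} r * (A (X n - r) * g r)) \<le> indicator {0<..<T} r * (M * \<bar>g r\<bar>)" for n
        using T[of n] Ab order_trans[OF abs_ge_zero Ab[of 0]] by (intro AE_I2) (auto simp: indicator_def abs_mult intro!: mult_right_mono)
    qed measurable
  qed
qed

text \<open>Integrating a bound K r^k gains the factor t / (k + 1). Iterated, this produces the
  factorials that make the Neumann series converge for every \<open>\<mu>\<close>.\<close>

lemma volterra_power_bound:
  assumes [measurable]: "A \<in> borel_measurable borel" "g \<in> borel_measurable borel"
    and Ab: "\<And>t. \<bar>A t\<bar> \<le> M" and gb: "\<And>r. r \<ge> 0 \<Longrightarrow> \<bar>g r\<bar> \<le> K * r ^ k" and t: "t \<ge> 0"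
  shows "\<bar>volterra A g t\<bar> \<le> M * K * t ^ Suc k / Suc k"
proof -
  have M: "M \<ge> 0" using Ab[of 0] abs_ge_zero order_trans by blast
  have "\<bar>volterra A g t\<bar> \<le> (LINT r|lborel. \<bar>indicator {0<..<t} r * (A (t - r) * g r)\<bar>)"
    unfolding volterra_def using integral_norm_bound[of lborel "\<lambda>r. indicator {0<..<t} r * (A (t - r) * g r)"] by simp
  also have "\<dots> \<le> (LINT r|lborel. M * K * (r ^ k * indicator {0..t} r))"
  proof (rule integral_mono')
    have "integrable lborel (\<lambda>r. r ^ k * indicator {0..t} r)"
      using borel_integrable_compact[of "{0..t}" "\<lambda>r. r ^ k"] continuous_on_power[OF continuous_on_id, of "{0..t}" k]
      by (simp add: mult.commute)
    thus "integrable lborel (\<lambda>r. M * K * (r ^ k * indicator {0..t} r))" by (rule integrable_mult_right)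
    fix r :: real
    show "\<bar>indicator {0<..<t} r * (A (t - r) * g r)\<bar> \<le> M * K * (r ^ k * indicator {0..t} r)"
    proof (cases "r \<in> {0..t}")
      case True
      have "\<bar>A (t - r) * g r\<bar> \<le> M * (K * r ^ k)"
        unfolding abs_mult using True M Ab[of "t - r"] gb[of r] by (intro mult_mono) auto
      moreover have "\<bar>indicator {0<..<t} r * (A (t - r) * g r)\<bar> \<le> \<bar>A (t - r) * g r\<bar>" by (simp add: indicator_def)
      ultimately show ?thesis using True by simp
    qed (auto simp: indicator_def)
    show "0 \<le> M * K * (r ^ k * indicator {0..t} r)"
    proof (cases "r \<in> {0..t}")
      case True
      have "0 \<le> K * r ^ k" using gb[of r] True abs_ge_zero[of "g r"] by (meson atLeastAtMost_iff order_trans)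
      thus ?thesis using mult_nonneg_nonneg[OF M, of "K * r ^ k"] True by (simp add: mult.assoc)
    qed simp
  qed
  also have "\<dots> = M * K * t ^ Suc k / Suc k"
    using integral_power[OF t, of k] by simp
  finally show ?thesis .
qed

primrec volterra_iter :: "(real \<Rightarrow> real) \<Rightarrow> nat \<Rightarrow> real \<Rightarrow> real" where
  "volterra_iter A 0 = (\<lambda>t. 1)"
| "volterra_iter A (Suc k) = volterra A (volterra_iter A k)"

text \<open>The solution of \<open>z + \<mu> A * z = 1\<close> as a Neumann series.\<close>

definition volterra_sol :: "(real \<Rightarrow> real) \<Rightarrow> real \<Rightarrow> real \<Rightarrow> real" where
  "volterra_sol A \<mu> t = (\<Sum>k. (- \<mu>) ^ k * volterra_iter A k t)"

section \<open>The Neumann series for a bounded continuous kernel\<close>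

locale volterra_kernel =
  fixes A :: "real \<Rightarrow> real" and M :: real
  assumes A_cont: "continuous_on UNIV A" and A_bound: "\<And>t. \<bar>A t\<bar> \<le> M"
begin

lemma M_nonneg: "M \<ge> 0"
  using A_bound[of 0] abs_ge_zero order_trans by blast

lemma A_measurable[measurable]: "A \<in> borel_measurable borel"
  using A_cont by (rule borel_measurable_continuous_onI)

lemma volterra_iter_props:
  "continuous_on UNIV (volterra_iter A k) \<and> (\<forall>t\<ge>0. \<bar>volterra_iter A k t\<bar> \<le> M ^ k / fact k * t ^ k)"
proof (induction k)
  case (Suc k)
  have [measurable]: "volterra_iter A k \<in> borel_measurable borel"
    using Suc by (auto intro: borel_measurable_continuous_onI)
  have b: "\<exists>B. \<forall>r. 0 < r \<longrightarrow> r < T \<longrightarrow> \<bar>volterra_iter A k r\<bar> \<le> B" for T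
  proof (intro exI[of _ "M ^ k / fact k * T ^ k"] allI impI)
    fix r :: real assume r: "0 < r" "r < T"
    have "\<bar>volterra_iter A k r\<bar> \<le> M ^ k / fact k * r ^ k" using Suc r by simp
    also have "\<dots> \<le> M ^ k / fact k * T ^ k" using r M_nonneg by (intro mult_left_mono power_mono) auto
    finally show "\<bar>volterra_iter A k r\<bar> \<le> M ^ k / fact k * T ^ k" .
  qed
  have "continuous_on UNIV (volterra A (volterra_iter A k))"
    by (rule volterra_continuous[OF A_cont A_bound _ b]) measurable
  moreover have "\<bar>volterra A (volterra_iter A k) t\<bar> \<le> M ^ Suc k / fact (Suc k) * t ^ Suc k" if "t \<ge> 0" for t
    using volterra_power_bound[OF _ _ A_bound, where g="volterra_iter A k" and K="M ^ k / fact k" and k=k and t=t] Suc that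
    by (simp add: field_simps)
  ultimately show ?case by simp
qed simp

lemma volterra_iter_measurable[measurable]: "volterra_iter A k \<in> borel_measurable borel"
  using volterra_iter_props[of k] by (auto intro: borel_measurable_continuous_onI)

lemma volterra_iter_term_bound:
  assumes "t \<ge> 0" shows "\<bar>(- \<mu>) ^ k * volterra_iter A k t\<bar> \<le> (\<bar>\<mu>\<bar> * M * t) ^ k /\<^sub>R fact k"
proof -
  have "\<bar>\<mu>\<bar> ^ k * \<bar>volterra_iter A k t\<bar> \<le> \<bar>\<mu>\<bar> ^ k * (M ^ k / fact k * t ^ k)"
    using volterra_iter_props[of k] assms by (intro mult_left_mono) auto
  thus ?thesis by (simp add: abs_mult power_abs power_mult_distrib field_simps)
qed

lemma volterra_sol_summable:
  assumes "t \<ge> 0" shows "summable (\<lambda>k. norm ((- \<mu>) ^ k * volterra_iter A k t))"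
  by (rule summable_comparison_test'[OF summable_exp_generic[of "\<bar>\<mu>\<bar> * M * t"]])
     (use volterra_iter_term_bound[OF assms] in \<open>simp del: abs_mult\<close>)

lemma volterra_sol_bound:
  assumes "t \<ge> 0" shows "\<bar>volterra_sol A \<mu> t\<bar> \<le> exp (\<bar>\<mu>\<bar> * M * t)"
proof -
  have "\<bar>volterra_sol A \<mu> t\<bar> \<le> (\<Sum>k. \<bar>(- \<mu>) ^ k * volterra_iter A k t\<bar>)"
    unfolding volterra_sol_def by (rule summable_rabs) (use volterra_sol_summable[OF assms] in simp)
  also have "\<dots> \<le> (\<Sum>k. (\<bar>\<mu>\<bar> * M * t) ^ k /\<^sub>R fact k)"
    by (rule suminf_le[OF volterra_iter_term_bound[OF assms] _ summable_exp_generic])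
       (use volterra_sol_summable[OF assms, of \<mu>] in \<open>simp only: real_norm_def\<close>)
  also have "\<dots> = exp (\<bar>\<mu>\<bar> * M * t)" by (simp add: exp_def)
  finally show ?thesis .
qed

text \<open>Joint measurability in frequency and time, which is inherited from the partial sums and
  is required when Fubini's theorem is applied to the candidate solution.\<close>

lemma volterra_sol_measurable[measurable]: "(\<lambda>(\<mu>, t). volterra_sol A \<mu> t) \<in> borel_measurable (borel \<Otimes>\<^sub>M borel)"
  unfolding volterra_sol_def by measurable

lemma volterra_sol_measurable2[measurable (raw)]:
  assumes [measurable]: "f \<in> borel_measurable N" "g \<in> borel_measurable N"
  shows "(\<lambda>x. volterra_sol A (f x) (g x)) \<in> borel_measurable N"
  using measurable_compose[OF measurable_Pair[OF assms] volterra_sol_measurable] by simp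

text \<open>Integration of the Neumann series term by term: on (0, t) the k-th term is dominated by
  the exponential series of |\<mu>| M t, so sum and integral may be exchanged.\<close>

lemma volterra_sol_eq:
  assumes "t \<ge> 0"
  shows "volterra_sol A \<mu> t = 1 - \<mu> * volterra A (volterra_sol A \<mu>) t"
proof -
  let ?f = "\<lambda>k r. indicator {0<..<t} r * (A (t - r) * ((- \<mu>) ^ k * volterra_iter A k r))"
  let ?e = "\<lambda>k. M * ((\<bar>\<mu>\<bar> * M * t) ^ k /\<^sub>R fact k)"
  have fb: "\<bar>?f k r\<bar> \<le> ?e k * indicator {0<..<t} r" for k r
  proof (cases "r \<in> {0<..<t}")
    case True
    have "\<bar>(- \<mu>) ^ k * volterra_iter A k r\<bar> \<le> (\<bar>\<mu>\<bar> * M * r) ^ k /\<^sub>R fact k"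
      using True by (intro volterra_iter_term_bound) auto
    also have "\<dots> \<le> (\<bar>\<mu>\<bar> * M * t) ^ k /\<^sub>R fact k"
      using True M_nonneg by (intro scaleR_left_mono power_mono mult_left_mono) auto
    finally have "\<bar>A (t - r)\<bar> * \<bar>(- \<mu>) ^ k * volterra_iter A k r\<bar> \<le> ?e k"
      by (intro mult_mono A_bound) (auto intro: M_nonneg)
    thus ?thesis using True by (simp add: abs_mult)
  qed simp
  have ie: "integrable lborel (\<lambda>r. ?e k * indicator {0<..<t} r)" for k
    by (intro integrable_mult_right integrable_indicator_Ioo)
  have i: "integrable lborel (?f k)" for k
    by (rule Bochner_Integration.integrable_bound[OF ie[of k]]) (use fb in \<open>auto intro!: AE_I2 intro: order_trans[OF _ abs_ge_self]\<close>)
  have sume: "summable ?e" by (intro summable_mult summable_exp_generic)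
  have s1: "AE r in lborel. summable (\<lambda>k. norm (?f k r))"
  proof (intro AE_I2)
    fix r
    have "summable (\<lambda>k. ?e k * indicator {0<..<t} r)" by (intro summable_mult2 sume)
    thus "summable (\<lambda>k. norm (?f k r))"
      by (rule summable_comparison_test') (use fb in \<open>simp add: real_norm_def\<close>)
  qed
  have s2: "summable (\<lambda>k. LINT r|lborel. norm (?f k r))"
  proof (rule summable_comparison_test'[of "\<lambda>k. ?e k * t"])
    show "summable (\<lambda>k. ?e k * t)" by (intro summable_mult2 sume)
    fix k
    have "(LINT r|lborel. norm (?f k r)) \<le> (LINT r|lborel. ?e k * indicator {0<..<t} r)"
      by (rule integral_mono'[OF ie]) (use fb order_trans[OF abs_ge_zero fb] in \<open>auto simp: real_norm_def\<close>)
    also have "\<dots> = ?e k * t" using assms by simp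
    finally show "norm (LINT r|lborel. norm (?f k r)) \<le> ?e k * t" by simp
  qed
  have "(LINT r|lborel. (\<Sum>k. ?f k r)) = (\<Sum>k. LINT r|lborel. ?f k r)"
    by (rule integral_suminf[OF i s1 s2])
  moreover have "(\<Sum>k. ?f k r) = indicator {0<..<t} r * (A (t - r) * volterra_sol A \<mu> r)" for r
  proof (cases "r \<in> {0<..<t}")
    case True
    thus ?thesis unfolding volterra_sol_def
      using suminf_mult[OF summable_norm_cancel[OF volterra_sol_summable[of r \<mu>]], of "A (t - r)"] by simp
  qed simp
  moreover have "(LINT r|lborel. ?f k r) = (- \<mu>) ^ k * volterra_iter A (Suc k) t" for k
  proof -
    have "(LINT r|lborel. ?f k r) = (LINT r|lborel. (- \<mu>) ^ k * (indicator {0<..<t} r * (A (t - r) * volterra_iter A k r)))"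
      by (intro Bochner_Integration.integral_cong refl) (simp only: mult_ac)
    thus ?thesis by (simp add: volterra_def)
  qed
  ultimately have V: "volterra A (volterra_sol A \<mu>) t = (\<Sum>k. (- \<mu>) ^ k * volterra_iter A (Suc k) t)"
    by (simp add: volterra_def)
  have "summable (\<lambda>k. (- \<mu>) ^ k * volterra_iter A k t)" by (rule summable_norm_cancel[OF volterra_sol_summable[OF assms]])
  hence "volterra_sol A \<mu> t = 1 + (\<Sum>k. (- \<mu>) ^ Suc k * volterra_iter A (Suc k) t)"
    unfolding volterra_sol_def by (subst suminf_split_head) simp_all
  also have "(\<Sum>k. (- \<mu>) ^ Suc k * volterra_iter A (Suc k) t) = - \<mu> * (\<Sum>k. (- \<mu>) ^ k * volterra_iter A (Suc k) t)"
  \<comment> \<open>Summability of the shifted series is obtained by cancelling one factor -\<mu>;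
    for \<open>\<mu> = 0\<close> both sides vanish.\<close>
  proof (cases "\<mu> = 0")
    case False
    have "summable (\<lambda>k. (- \<mu>) ^ Suc k * volterra_iter A (Suc k) t)"
      using \<open>summable (\<lambda>k. (- \<mu>) ^ k * volterra_iter A k t)\<close> by (subst summable_Suc_iff)
    hence "summable (\<lambda>k. (- 1 / \<mu>) * ((- \<mu>) ^ Suc k * volterra_iter A (Suc k) t))" by (rule summable_mult)
    hence "summable (\<lambda>k. (- \<mu>) ^ k * volterra_iter A (Suc k) t)" using False by (simp add: mult.assoc[symmetric])
    from suminf_mult[OF this, of "- \<mu>"] show ?thesis by (simp add: mult.assoc)
  qed simp
  finally show ?thesis by (simp add: V)
qed

lemma volterra_sol_loc_bounded: "\<exists>B. \<forall>r. 0 < r \<longrightarrow> r < T \<longrightarrow> \<bar>volterra_sol A \<mu> r\<bar> \<le> B"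
proof (intro exI[of _ "exp (\<bar>\<mu>\<bar> * M * T)"] allI impI)
  fix r :: real assume r: "0 < r" "r < T"
  have "\<bar>volterra_sol A \<mu> r\<bar> \<le> exp (\<bar>\<mu>\<bar> * M * r)" using r by (intro volterra_sol_bound) simp
  also have "\<dots> \<le> exp (\<bar>\<mu>\<bar> * M * T)" using r M_nonneg by (auto intro!: mult_left_mono)
  finally show "\<bar>volterra_sol A \<mu> r\<bar> \<le> exp (\<bar>\<mu>\<bar> * M * T)" .
qed

lemma volterra_sol_continuous: "continuous_on {0..} (volterra_sol A \<mu>)"
proof -
  have "continuous_on UNIV (volterra A (volterra_sol A \<mu>))"
    by (rule volterra_continuous[OF A_cont A_bound _ volterra_sol_loc_bounded]) measurable
  hence "continuous_on {0..} (\<lambda>t. 1 - \<mu> * volterra A (volterra_sol A \<mu>) t)"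
    by (intro continuous_intros) (auto intro: continuous_on_subset)
  thus ?thesis by (rule continuous_on_eq) (simp add: volterra_sol_eq)
qed

text \<open>The substitution r = \<sigma> / l makes the iterate a convolution on the fixed interval
  (0, \<tau>) with the kernel A(\<sigma> / l), which tends to the constant \<open>Ainf\<close>. The
  k-fold iterated integral of that constant is (Ainf \<tau>)^k / k!.\<close>

lemma volterra_iter_scaled_tendsto:
  assumes lim: "(A \<longlongrightarrow> Ainf) at_top" and l: "\<And>n. l n > 0" "l \<longlonglongrightarrow> 0" and \<tau>: "\<tau> \<ge> 0"
  shows "(\<lambda>n. l n ^ k * volterra_iter A k (\<tau> / l n)) \<longlonglongrightarrow> (Ainf * \<tau>) ^ k / fact k"
  using \<tau>
proof (induction k arbitrary: \<tau>)
  case (Suc k)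
  have eq: "l n ^ Suc k * volterra_iter A (Suc k) (\<tau> / l n) =
     (LINT \<sigma>|lborel. indicator {0<..<\<tau>} \<sigma> * (A ((\<tau> - \<sigma>) / l n) * (l n ^ k * volterra_iter A k (\<sigma> / l n))))" for n
  proof -
    have "volterra_iter A (Suc k) (\<tau> / l n) =
       (1 / l n) * (LINT \<sigma>|lborel. indicator {0<..<\<tau> / l n} (0 + 1 / l n * \<sigma>) * (A (\<tau> / l n - (0 + 1 / l n * \<sigma>)) * volterra_iter A k (0 + 1 / l n * \<sigma>)))"
      unfolding volterra_iter.simps volterra_def
      using l(1)[of n] by (subst lborel_integral_real_affine[of "1 / l n" _ 0]) auto
    also have "\<dots> = (1 / l n) * (LINT \<sigma>|lborel. indicator {0<..<\<tau>} \<sigma> * (A ((\<tau> - \<sigma>) / l n) * volterra_iter A k (\<sigma> / l n)))"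
    proof -
      have "indicator {0<..<\<tau> / l n} (0 + 1 / l n * \<sigma>) = (indicator {0<..<\<tau>} \<sigma> :: real)" for \<sigma>
        using l(1)[of n] by (simp add: indicator_def zero_less_divide_iff divide_less_cancel)
      moreover have "\<tau> / l n - (0 + 1 / l n * \<sigma>) = (\<tau> - \<sigma>) / l n" "0 + 1 / l n * \<sigma> = \<sigma> / l n" for \<sigma>
        by (simp_all add: diff_divide_distrib)
      ultimately show ?thesis by (simp only:)
    qed
    finally have "l n ^ Suc k * volterra_iter A (Suc k) (\<tau> / l n) =
       l n ^ k * (LINT \<sigma>|lborel. indicator {0<..<\<tau>} \<sigma> * (A ((\<tau> - \<sigma>) / l n) * volterra_iter A k (\<sigma> / l n)))"
      using l(1)[of n] by simp
    also have "\<dots> = (LINT \<sigma>|lborel. l n ^ k * (indicator {0<..<\<tau>} \<sigma> * (A ((\<tau> - \<sigma>) / l n) * volterra_iter A k (\<sigma> / l n))))"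
      by (rule integral_mult_right_zero[symmetric])
    finally show ?thesis by (simp only: mult_ac)
  qed
  have "(\<lambda>n. l n ^ Suc k * volterra_iter A (Suc k) (\<tau> / l n)) \<longlonglongrightarrow>
     (LINT \<sigma>|lborel. indicator {0<..<\<tau>} \<sigma> * (Ainf * ((Ainf * \<sigma>) ^ k / fact k)))"
    unfolding eq
  proof (rule integral_dominated_convergence[where w="\<lambda>\<sigma>. M * (M ^ k / fact k * \<tau> ^ k) * indicator {0<..<\<tau>} \<sigma>"])
    show "integrable lborel (\<lambda>\<sigma>. M * (M ^ k / fact k * \<tau> ^ k) * indicator {0<..<\<tau>} \<sigma>)"
      by (intro integrable_mult_right integrable_indicator_Ioo)
    show "AE \<sigma> in lborel. (\<lambda>n. indicator {0<..<\<tau>} \<sigma> * (A ((\<tau> - \<sigma>) / l n) * (l n ^ k * volterra_iter A k (\<sigma> / l n)))) \<longlonglongrightarrow> indicator {0<..<\<tau>} \<sigma> * (Ainf * ((Ainf * \<sigma>) ^ k / fact k))"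
    proof (intro AE_I2)
      fix \<sigma>
      show "(\<lambda>n. indicator {0<..<\<tau>} \<sigma> * (A ((\<tau> - \<sigma>) / l n) * (l n ^ k * volterra_iter A k (\<sigma> / l n)))) \<longlonglongrightarrow> indicator {0<..<\<tau>} \<sigma> * (Ainf * ((Ainf * \<sigma>) ^ k / fact k))"
      proof (cases "\<sigma> \<in> {0<..<\<tau>}")
        case True
        have "filterlim l (at_right 0) sequentially"
          by (rule tendsto_imp_filterlim_at_right[OF l(2)]) (use l(1) in simp)
        hence "filterlim (\<lambda>n. inverse (l n)) at_top sequentially"
          by (rule filterlim_compose[OF filterlim_inverse_at_top_right])
        hence "filterlim (\<lambda>n. (\<tau> - \<sigma>) * inverse (l n)) at_top sequentially"
          using True by (intro filterlim_tendsto_pos_mult_at_top[OF tendsto_const]) auto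
        hence "(\<lambda>n. A ((\<tau> - \<sigma>) * inverse (l n))) \<longlonglongrightarrow> Ainf" by (rule filterlim_compose[OF lim])
        hence "(\<lambda>n. A ((\<tau> - \<sigma>) / l n)) \<longlonglongrightarrow> Ainf" by (simp add: divide_inverse)
        thus ?thesis using Suc.IH[of \<sigma>] True by (intro tendsto_intros) auto
      qed simp
    qed
    show "AE \<sigma> in lborel. norm (indicator {0<..<\<tau>} \<sigma> * (A ((\<tau> - \<sigma>) / l n) * (l n ^ k * volterra_iter A k (\<sigma> / l n)))) \<le> M * (M ^ k / fact k * \<tau> ^ k) * indicator {0<..<\<tau>} \<sigma>" for n
    proof (intro AE_I2)
      fix \<sigma>
      show "norm (indicator {0<..<\<tau>} \<sigma> * (A ((\<tau> - \<sigma>) / l n) * (l n ^ k * volterra_iter A k (\<sigma> / l n)))) \<le> M * (M ^ k / fact k * \<tau> ^ k) * indicator {0<..<\<tau>} \<sigma>"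
      proof (cases "\<sigma> \<in> {0<..<\<tau>}")
        case True
        have "\<bar>volterra_iter A k (\<sigma> / l n)\<bar> \<le> M ^ k / fact k * (\<sigma> / l n) ^ k"
          using volterra_iter_props[of k] True l(1)[of n] by (auto simp: less_imp_le)
        hence "l n ^ k * \<bar>volterra_iter A k (\<sigma> / l n)\<bar> \<le> l n ^ k * (M ^ k / fact k * (\<sigma> / l n) ^ k)"
          using l(1)[of n] by (intro mult_left_mono) auto
        also have "\<dots> = M ^ k / fact k * \<sigma> ^ k" using l(1)[of n] by (simp add: power_divide)
        also have "\<dots> \<le> M ^ k / fact k * \<tau> ^ k" using True M_nonneg by (intro mult_left_mono power_mono) auto
        finally have v: "l n ^ k * \<bar>volterra_iter A k (\<sigma> / l n)\<bar> \<le> M ^ k / fact k * \<tau> ^ k" .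
        have "\<bar>A ((\<tau> - \<sigma>) / l n)\<bar> * (l n ^ k * \<bar>volterra_iter A k (\<sigma> / l n)\<bar>) \<le> M * (M ^ k / fact k * \<tau> ^ k)"
          by (rule mult_mono[OF A_bound v M_nonneg]) (use l(1)[of n] in simp)
        thus ?thesis using True l(1)[of n] by (simp add: abs_mult power_abs)
      qed simp
    qed
  qed measurable
  also have "(LINT \<sigma>|lborel. indicator {0<..<\<tau>} \<sigma> * (Ainf * ((Ainf * \<sigma>) ^ k / fact k))) =
      (LINT \<sigma>|lborel. Ainf ^ Suc k / fact k * (\<sigma> ^ k * indicator {0..\<tau>} \<sigma>))"
  proof (rule integral_cong_AE)
    show "AE \<sigma> in lborel. indicator {0<..<\<tau>} \<sigma> * (Ainf * ((Ainf * \<sigma>) ^ k / fact k)) = Ainf ^ Suc k / fact k * (\<sigma> ^ k * indicator {0..\<tau>} \<sigma>)"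
      using AE_lborel_singleton[of 0] AE_lborel_singleton[of \<tau>]
      by eventually_elim (auto simp: indicator_def power_mult_distrib)
  qed measurable
  also have "\<dots> = Ainf ^ Suc k / fact k * (\<tau> ^ Suc k / Suc k)"
    using integral_power[OF Suc.prems, of k] by simp
  also have "\<dots> = (Ainf * \<tau>) ^ Suc k / fact (Suc k)" by (simp add: power_mult_distrib field_simps)
  finally show ?case .
qed simp

text \<open>Tannery's theorem: the terms of the Neumann series converge individually, and after
  scaling their majorants (M \<tau>)^k / k! do not depend on \<open>n\<close>.\<close>

lemma volterra_sol_scaled_tendsto:
  assumes lim: "(A \<longlongrightarrow> Ainf) at_top" and l: "\<And>n. l n > 0" "l \<longlonglongrightarrow> 0" and \<tau>: "\<tau> \<ge> 0"
  shows "(\<lambda>n. volterra_sol A (l n) (\<tau> / l n)) \<longlonglongrightarrow> exp (- Ainf * \<tau>)"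
proof -
  let ?a = "\<lambda>k n. (- l n) ^ k * volterra_iter A k (\<tau> / l n)"
  have b: "norm (?a k n) \<le> (M * \<tau>) ^ k /\<^sub>R fact k" for k n
    using volterra_iter_term_bound[of "\<tau> / l n" "l n" k] l(1)[of n] \<tau> by (simp add: less_imp_le)
  have t: "(\<lambda>n. ?a k n) \<longlonglongrightarrow> (- Ainf * \<tau>) ^ k /\<^sub>R fact k" for k
  proof -
    have "(\<lambda>n. (- 1) ^ k * (l n ^ k * volterra_iter A k (\<tau> / l n))) \<longlonglongrightarrow> (- 1) ^ k * ((Ainf * \<tau>) ^ k / fact k)"
      by (intro tendsto_intros volterra_iter_scaled_tendsto lim l \<tau>)
    moreover have "(- 1) ^ k * (l n ^ k * volterra_iter A k (\<tau> / l n)) = ?a k n" for n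
      by (subst power_minus[of "l n"]) simp
    moreover have "(- 1) ^ k * ((Ainf * \<tau>) ^ k / fact k) = (- Ainf * \<tau>) ^ k /\<^sub>R fact k"
      by (subst mult_minus_left, subst power_minus[of "Ainf * \<tau>"]) (simp add: divide_inverse)
    ultimately show ?thesis by simp
  qed
  have "(\<lambda>n. \<Sum>k. ?a k n) \<longlonglongrightarrow> (\<Sum>k. (- Ainf * \<tau>) ^ k /\<^sub>R fact k)"
  proof -
    have "\<forall>\<^sub>F (k, n) in sequentially \<times>\<^sub>F sequentially. norm (?a k n) \<le> (M * \<tau>) ^ k /\<^sub>R fact k"
      by (intro always_eventually) (use b in auto)
    from tannerys_theorem[where a="?a", OF t this summable_exp_generic sequentially_bot] show ?thesis by blast
  qed
  thus ?thesis unfolding volterra_sol_def by (simp add: exp_def)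
qed

end

section \<open>Laplace transforms of convolutions\<close>

lemma laplace_volterra:
  fixes f g :: "real \<Rightarrow> real" and \<zeta> :: complex
  assumes f: "integrable lborel (\<lambda>t. exp (- \<zeta> * of_real t) * of_real (indicator {0<..} t * f t))"
    and g: "integrable lborel (\<lambda>t. exp (- \<zeta> * of_real t) * of_real (indicator {0<..} t * g t))"
  shows "(LINT t|lborel. exp (- \<zeta> * of_real t) * of_real (indicator {0<..} t * volterra f g t)) =
     (LINT t|lborel. exp (- \<zeta> * of_real t) * of_real (indicator {0<..} t * f t)) * (LINT t|lborel. exp (- \<zeta> * of_real t) * of_real (indicator {0<..} t * g t))"
proof -
  have "(LINT r|lborel. (exp (- \<zeta> * of_real (t - r)) * of_real (indicator {0<..} (t - r) * f (t - r))) * (exp (- \<zeta> * of_real r) * of_real (indicator {0<..} r * g r))) =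
     exp (- \<zeta> * of_real t) * of_real (indicator {0<..} t * volterra f g t)" for t
  proof -
    have "(exp (- \<zeta> * of_real (t - r)) * of_real (indicator {0<..} (t - r) * f (t - r))) * (exp (- \<zeta> * of_real r) * of_real (indicator {0<..} r * g r)) =
      (exp (- \<zeta> * of_real t) * of_real (indicator {0<..} t)) * of_real (indicator {0<..<t} r * (f (t - r) * g r))" for r
    proof -
      have "exp (- \<zeta> * of_real (t - r)) * exp (- \<zeta> * of_real r) = exp (- \<zeta> * of_real t)"
        unfolding exp_add[symmetric] by (simp add: algebra_simps)
      thus ?thesis by (auto simp: indicator_def mult_ac)
    qed
    note pt = this
    show ?thesis unfolding pt integral_mult_right_zero integral_complex_of_real volterra_def by simp
  qed
  thus ?thesis using integral_convolution[OF f g] by simp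
qed

lemma
  assumes "Re \<zeta> > 0"
  shows integrable_exp_halfline_complex: "integrable lborel (\<lambda>t. exp (- \<zeta> * of_real t) * of_real (indicator {0<..} t))"
    and integral_exp_halfline_complex: "(LINT t|lborel. exp (- \<zeta> * of_real t) * of_real (indicator {0<..} t)) = 1 / \<zeta>"
proof -
  have \<zeta>: "\<zeta> \<noteq> 0" using assms by auto
  show i: "integrable lborel (\<lambda>t. exp (- \<zeta> * of_real t) * of_real (indicator {0<..} t))"
    by (rule Bochner_Integration.integrable_bound[OF integrable_exp_halfline[OF assms]]) (auto simp: norm_mult indicator_def)
  have v: "(LINT t|lborel. indicator {0..real n} t *\<^sub>R exp (- \<zeta> * of_real t)) = (1 - exp (- \<zeta> * of_real (real n))) / \<zeta>" for n
  proof -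
    have "(LINT t|lborel. indicator {0..real n} t *\<^sub>R exp (- \<zeta> * of_real t)) = (- exp (- \<zeta> * of_real (real n)) / \<zeta>) - (- exp (- \<zeta> * of_real 0) / \<zeta>)"
    proof (rule integral_FTC_Icc)
      show "((\<lambda>t. - exp (- \<zeta> * of_real t) / \<zeta>) has_vector_derivative exp (- \<zeta> * of_real t)) (at t within {0..real n})" for t
        using \<zeta> by (auto intro!: derivative_eq_intros has_vector_derivative_real_field)
    qed (auto intro!: continuous_intros)
    thus ?thesis using \<zeta> by (simp add: field_simps)
  qed
  have L: "(\<lambda>n. LINT t|lborel. indicator {- real n..real n} t *\<^sub>R (exp (- \<zeta> * of_real t) * of_real (indicator {0<..} t))) \<longlonglongrightarrow> (LINT t|lborel. exp (- \<zeta> * of_real t) * of_real (indicator {0<..} t))"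
    by (rule integral_truncated_LIMSEQ[OF i])
  have eq: "(LINT t|lborel. indicator {- real n..real n} t *\<^sub>R (exp (- \<zeta> * of_real t) * of_real (indicator {0<..} t))) = (1 - exp (- \<zeta> * of_real (real n))) / \<zeta>" for n
    unfolding v[symmetric]
    by (rule integral_cong_AE) (use AE_lborel_singleton[of 0] in \<open>auto simp: indicator_def elim!: eventually_mono\<close>)
  have "(\<lambda>n. (1 - exp (- \<zeta> * of_real (real n))) / \<zeta>) \<longlonglongrightarrow> (1 - 0) / \<zeta>"
  proof (intro tendsto_intros \<zeta>)
    show "(\<lambda>n. exp (- \<zeta> * of_real (real n))) \<longlonglongrightarrow> 0"
    proof (rule tendsto_norm_zero_cancel)
      have "(\<lambda>n. exp (- Re \<zeta> * real n)) \<longlonglongrightarrow> 0" using assms by real_asymp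
      thus "(\<lambda>n. cmod (exp (- \<zeta> * of_real (real n)))) \<longlonglongrightarrow> 0" by simp
    qed
  qed
  from LIMSEQ_unique[OF L[unfolded eq] this]
  show "(LINT t|lborel. exp (- \<zeta> * of_real t) * of_real (indicator {0<..} t)) = 1 / \<zeta>" by simp
qed

section \<open>The memory kernel, its primitive, and the decay of single frequencies\<close>

locale memory =
  fixes a0 Ainf :: real and a :: "real \<Rightarrow> real"
  assumes a_meas: "set_borel_measurable lborel {0<..} a"
    and a_bdd: "\<And>\<epsilon>. \<epsilon> > 0 \<Longrightarrow> bounded (a ` {\<epsilon>..})"
    and a_int: "set_integrable lborel {0<..<1} a"
    and A_lim': "((\<lambda>T. a0 + (LINT r:{0<..T}|lborel. a r)) \<longlongrightarrow> Ainf) at_top"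
begin

definition A :: "real \<Rightarrow> real" where "A t = a0 + (LINT r:{0<..t}|lborel. a r)"

lemma A_lim: "(A \<longlongrightarrow> Ainf) at_top"
  using A_lim' by (simp add: A_def[abs_def])

lemma a_measurable[measurable]: "(\<lambda>t. indicator {0<..} t * a t) \<in> borel_measurable borel"
  using a_meas by (simp add: set_borel_measurable_def)

lemma a_bound: obtains B where "B \<ge> 0" "\<And>t. t \<ge> 1 \<Longrightarrow> \<bar>a t\<bar> \<le> B"
proof -
  obtain B where "\<forall>y\<in>a ` {1..}. norm y \<le> B" using a_bdd[of 1] by (auto simp: bounded_iff)
  hence B: "\<bar>a t\<bar> \<le> B" if "t \<ge> 1" for t using that by auto
  moreover have "B \<ge> 0" using B[of 1] by simp
  ultimately show ?thesis using that by blast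
qed

text \<open>The two hypotheses on the kernel meet here: below time 1 the kernel is integrable and
  the weight bounded, beyond time 1 the kernel is bounded and the weight integrable.\<close>

lemma a_integrable_weighted:
  assumes [measurable]: "w \<in> borel_measurable borel" and w: "\<And>t. t > 0 \<Longrightarrow> \<bar>w t\<bar> \<le> 1"
    and iw: "integrable lborel (\<lambda>t. indicator {0<..} t * w t)"
  shows "integrable lborel (\<lambda>t. indicator {0<..} t * (w t * a t))"
proof -
  obtain B where B: "B \<ge> 0" "\<And>t. t \<ge> 1 \<Longrightarrow> \<bar>a t\<bar> \<le> B" using a_bound by blast
  have m: "(\<lambda>t. indicator {0<..} t * (w t * a t)) = (\<lambda>t. w t * (indicator {0<..} t * a t))" by (simp add: fun_eq_iff)
  have i1: "integrable lborel (\<lambda>t. \<bar>indicator {0<..<1} t * a t\<bar>)" using a_int by (simp add: set_integrable_def)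
  have i2: "integrable lborel (\<lambda>t. B * \<bar>indicator {0<..} t * w t\<bar>)" using iw by (intro integrable_mult_right integrable_abs)
  show ?thesis
  proof (rule Bochner_Integration.integrable_bound[OF Bochner_Integration.integrable_add[OF i1 i2]])
    show "(\<lambda>t. indicator {0<..} t * (w t * a t)) \<in> borel_measurable lborel" unfolding m by measurable
    show "AE t in lborel. norm (indicator {0<..} t * (w t * a t)) \<le> norm (\<bar>indicator {0<..<1} t * a t\<bar> + B * \<bar>indicator {0<..} t * w t\<bar>)"
    proof (intro AE_I2)
      fix t :: real
      consider "t \<le> 0" | "0 < t" "t < 1" | "t \<ge> 1" by linarith
      thus "norm (indicator {0<..} t * (w t * a t)) \<le> norm (\<bar>indicator {0<..<1} t * a t\<bar> + B * \<bar>indicator {0<..} t * w t\<bar>)"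
      proof cases
        case 2
        have "\<bar>w t\<bar> * \<bar>a t\<bar> \<le> 1 * \<bar>a t\<bar>" using w[of t] 2 by (intro mult_right_mono) auto
        moreover have "0 \<le> B * \<bar>w t\<bar>" using B by simp
        ultimately show ?thesis using 2 by (simp add: abs_mult)
      next
        case 3
        have "\<bar>w t\<bar> * \<bar>a t\<bar> \<le> \<bar>w t\<bar> * B" using B(2)[OF 3] by (intro mult_left_mono) auto
        thus ?thesis using 3 B(1) by (simp add: abs_mult mult.commute)
      qed simp
    qed
  qed
qed

lemma a_integrable_Ioc: "integrable lborel (\<lambda>t. indicator {0<..T} t * a t)"
proof -
  have "integrable lborel (\<lambda>t. indicator {0<..} t * (indicator {0<..T} t * a t))"
  proof (rule a_integrable_weighted)
    have "integrable lborel (indicator {0<..T} :: real \<Rightarrow> real)" by (cases "0 \<le> T") auto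
    moreover have "(\<lambda>t. indicator {0<..} t * indicator {0<..T} t) = (indicator {0<..T} :: real \<Rightarrow> real)"
      by (auto simp: indicator_def fun_eq_iff)
    ultimately show "integrable lborel (\<lambda>t. indicator {0<..} t * indicator {0<..T} t :: real)" by simp
  qed (auto simp: indicator_def)
  thus ?thesis by (rule back_subst[of "integrable lborel"]) (auto simp: indicator_def fun_eq_iff)
qed

lemma a_integrable_exp:
  assumes "x > 0" shows "set_integrable lborel {0<..} (\<lambda>t. exp (- x * t) * a t)"
  using a_integrable_weighted[of "\<lambda>t. exp (- x * t)"] integrable_exp_halfline[OF assms] assms
  by (simp add: set_integrable_def)

lemma a_laplace_integrable:
  assumes "Re \<zeta> > 0"
  shows "integrable lborel (\<lambda>t. exp (- \<zeta> * of_real t) * of_real (indicator {0<..} t * a t))"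
proof (rule Bochner_Integration.integrable_bound[OF a_integrable_exp[OF assms, unfolded set_integrable_def]])
  show "(\<lambda>t. exp (- \<zeta> * of_real t) * of_real (indicator {0<..} t * a t)) \<in> borel_measurable lborel" by measurable
qed (auto simp: norm_mult indicator_def)

lemma A_eq: "A t = a0 + (LINT r|lborel. indicator {0<..t} r * a r)"
  by (simp add: A_def set_lebesgue_integral_def)

lemma A_continuous: "continuous_on UNIV A"
proof (rule continuous_at_imp_continuous_on, intro ballI)
  fix t :: real
  show "isCont A t"
    unfolding continuous_at_sequentially comp_def
  proof (intro allI impI)
    fix X :: "nat \<Rightarrow> real" assume X: "X \<longlonglongrightarrow> t"
    have "Bseq X" using X by (intro convergent_imp_Bseq convergentI)
    then obtain K where K: "\<And>n. norm (X n) \<le> K" by (auto simp: Bseq_def)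
    have T: "X n \<le> K" for n using K[of n] by simp
    have [measurable]: "(\<lambda>r. indicator {0<..s} r * a r) \<in> borel_measurable borel" for s
      using a_integrable_Ioc[of s] by auto
    have "(\<lambda>n. LINT r|lborel. indicator {0<..X n} r * a r) \<longlonglongrightarrow> (LINT r|lborel. indicator {0<..t} r * a r)"
    proof (rule integral_dominated_convergence[where w="\<lambda>r. \<bar>indicator {0<..K} r * a r\<bar>"])
      show "integrable lborel (\<lambda>r. \<bar>indicator {0<..K} r * a r\<bar>)" by (intro integrable_abs a_integrable_Ioc)
      show "AE r in lborel. (\<lambda>n. indicator {0<..X n} r * a r) \<longlonglongrightarrow> indicator {0<..t} r * a r"
      proof (rule AE_mp[OF AE_lborel_singleton[of t]], intro AE_I2 impI tendsto_mult tendsto_const)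
        fix r :: real assume "r \<noteq> t"
        show "(\<lambda>n. indicator {0<..X n} r :: real) \<longlonglongrightarrow> indicator {0<..t} r"
        proof (cases "r < t")
          case True
          hence "\<forall>\<^sub>F n in sequentially. r < X n" using X by (rule order_tendstoD(1)[rotated])
          thus ?thesis using True by (intro tendsto_eventually) (auto elim!: eventually_mono simp: indicator_def)
        next
          case False
          hence "\<forall>\<^sub>F n in sequentially. X n < r" using X \<open>r \<noteq> t\<close> by (intro order_tendstoD(2)) auto
          thus ?thesis using False \<open>r \<noteq> t\<close> by (intro tendsto_eventually) (auto elim!: eventually_mono simp: indicator_def)
        qed
      qed
      show "AE r in lborel. norm (indicator {0<..X n} r * a r) \<le> \<bar>indicator {0<..K} r * a r\<bar>" for n
        using T[of n] by (intro AE_I2) (auto simp: indicator_def)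
    qed measurable
    thus "(\<lambda>n. A (X n)) \<longlonglongrightarrow> A t" unfolding A_eq by (intro tendsto_intros)
  qed
qed

lemma A_bounded: "\<exists>M. \<forall>t. \<bar>A t\<bar> \<le> M"
proof -
  have "\<forall>\<^sub>F t in at_top. dist (A t) Ainf < 1" by (rule tendstoD[OF A_lim]) simp
  then obtain T where T: "\<And>t. t \<ge> T \<Longrightarrow> dist (A t) Ainf < 1" by (auto simp: eventually_at_top_linorder)
  have "bounded (A ` {0..T})"
    by (intro compact_imp_bounded compact_continuous_image continuous_on_subset[OF A_continuous]) auto
  then obtain B where "\<forall>y\<in>A ` {0..T}. norm y \<le> B" unfolding bounded_iff by blast
  hence B: "\<bar>A t\<bar> \<le> B" if "0 \<le> t" "t \<le> T" for t using that by auto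
  show ?thesis
  proof (intro exI[of _ "max B (max (\<bar>Ainf\<bar> + 1) \<bar>a0\<bar>)"] allI)
    fix t
    consider "t < 0" | "0 \<le> t" "t \<le> T" | "t \<ge> T" by linarith
    thus "\<bar>A t\<bar> \<le> max B (max (\<bar>Ainf\<bar> + 1) \<bar>a0\<bar>)"
    proof cases
      case 1
      hence "A t = a0" by (simp add: A_eq)
      thus ?thesis by simp
    next
      case 2 thus ?thesis using B[of t] by simp
    next
      case 3 thus ?thesis using T[of t] by (simp add: dist_real_def)
    qed
  qed
qed

lemma volterra_kernel_ex: "\<exists>M. volterra_kernel A M"
  using A_bounded A_continuous by (auto simp: volterra_kernel_def)

lemma A_measurable[measurable]: "A \<in> borel_measurable borel"
  using A_continuous by (rule borel_measurable_continuous_onI)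

lemma A_laplace_integrable:
  assumes "Re \<zeta> > 0"
  shows "integrable lborel (\<lambda>t. exp (- \<zeta> * of_real t) * of_real (indicator {0<..} t * A t))"
proof -
  obtain M where M: "\<And>t. \<bar>A t\<bar> \<le> M" using A_bounded by blast
  have "integrable lborel (\<lambda>t. (exp (- \<zeta> * of_real t) * of_real (indicator {0<..} t)) * of_real (A t))"
    by (rule integrable_mult_bounded[OF integrable_exp_halfline_complex[OF assms], of _ M]) (use M in auto)
  thus ?thesis by (simp add: mult.assoc)
qed

lemma laplace_eq: "laplace a \<zeta> = (LINT t|lborel. exp (- \<zeta> * of_real t) * of_real (indicator {0<..} t * a t))"
  unfolding laplace_def set_lebesgue_integral_def
  by (intro Bochner_Integration.integral_cong refl) (simp add: scaleR_conv_of_real mult_ac)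

text \<open>The primitive A - a0 is the convolution of \<open>a\<close> with the constant 1, whose
  transform is 1 / \<zeta>.\<close>

lemma A_laplace:
  assumes \<zeta>: "Re \<zeta> > 0"
  shows "(LINT t|lborel. exp (- \<zeta> * of_real t) * of_real (indicator {0<..} t * A t)) = (of_real a0 + laplace a \<zeta>) / \<zeta>"
proof -
  have V: "volterra (\<lambda>_. 1) a t = A t - a0" for t
  proof -
    have "(\<lambda>r. indicator {0<..<t} r * a r) = (\<lambda>r. indicator {..<t} r * (indicator {0<..} r * a r))"
      by (auto simp: indicator_def fun_eq_iff)
    hence m: "(\<lambda>r. indicator {0<..<t} r * a r) \<in> borel_measurable lborel" by simp
    have "AE r in lborel. indicator {0<..<t} r * a r = indicator {0<..t} r * a r"
      using AE_lborel_singleton[of t] by eventually_elim (auto simp: indicator_def)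
    hence "(LINT r|lborel. indicator {0<..<t} r * a r) = (LINT r|lborel. indicator {0<..t} r * a r)"
      using m borel_measurable_integrable[OF a_integrable_Ioc[of t]] by (intro integral_cong_AE)
    thus ?thesis by (simp add: volterra_def A_eq)
  qed
  have i1: "integrable lborel (\<lambda>t. exp (- \<zeta> * of_real t) * of_real (indicator {0<..} t * 1))"
    using integrable_exp_halfline_complex[OF \<zeta>] by simp
  have e1: "(LINT t|lborel. exp (- \<zeta> * of_real t) * of_real (indicator {0<..} t * (A t - a0))) = 1 / \<zeta> * laplace a \<zeta>"
    using laplace_volterra[OF i1 a_laplace_integrable[OF \<zeta>]] integral_exp_halfline_complex[OF \<zeta>]
    by (simp add: V laplace_eq)
  have e2: "(LINT t|lborel. exp (- \<zeta> * of_real t) * of_real (indicator {0<..} t * (A t - a0))) =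
     (LINT t|lborel. exp (- \<zeta> * of_real t) * of_real (indicator {0<..} t * A t)) - (LINT t|lborel. of_real a0 * (exp (- \<zeta> * of_real t) * of_real (indicator {0<..} t)))"
  proof -
    have "(LINT t|lborel. exp (- \<zeta> * of_real t) * of_real (indicator {0<..} t * (A t - a0))) =
       (LINT t|lborel. exp (- \<zeta> * of_real t) * of_real (indicator {0<..} t * A t) - of_real a0 * (exp (- \<zeta> * of_real t) * of_real (indicator {0<..} t)))"
      by (intro Bochner_Integration.integral_cong refl) (simp add: algebra_simps)
    thus ?thesis
      by (simp only: Bochner_Integration.integral_diff[OF A_laplace_integrable[OF \<zeta>] integrable_mult_right[OF integrable_exp_halfline_complex[OF \<zeta>]]])
  qed
  have e3: "(LINT t|lborel. of_real a0 * (exp (- \<zeta> * of_real t) * of_real (indicator {0<..} t))) = of_real a0 * (1 / \<zeta>)"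
    by (simp only: integral_mult_right_zero integral_exp_halfline_complex[OF \<zeta>])
  have "(LINT t|lborel. exp (- \<zeta> * of_real t) * of_real (indicator {0<..} t * A t)) =
     (LINT t|lborel. exp (- \<zeta> * of_real t) * of_real (indicator {0<..} t * (A t - a0))) + of_real a0 * (1 / \<zeta>)"
    unfolding e2 e3 by (simp only: diff_add_cancel)
  also have "\<dots> = (of_real a0 + laplace a \<zeta>) / \<zeta>"
    unfolding e1 by (simp add: add_divide_distrib)
  finally show ?thesis .
qed

text \<open>An Abelian theorem. The kernel may be only conditionally integrable at infinity, so F 0
  cannot be read off an integral. Instead x times the transform of A at x is the integral of exp(-s)
  A(s / x), which tends to the limit of A as x tends to 0, while F is continuous at 0.\<close>

lemma laplace_at_zero:
  assumes ext: "laplace_extension \<alpha> a F" and \<alpha>: "\<alpha> > 0"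
  shows "of_real a0 + F 0 = of_real Ainf"
proof -
  have cont: "continuous_on {z. Re z \<ge> - \<alpha>} F" and lap: "\<And>z. Re z > 0 \<Longrightarrow> F z = laplace a z"
    using ext by (auto simp: laplace_extension_def)
  obtain M where M: "\<And>t. \<bar>A t\<bar> \<le> M" using A_bounded by blast
  define x where "x n = inverse (real (Suc n))" for n
  have x: "x n > 0" for n by (simp add: x_def)
  have xl: "x \<longlonglongrightarrow> 0" unfolding x_def by (rule LIMSEQ_inverse_real_of_nat)
  have eq: "of_real a0 + F (of_real (x n)) = of_real (LINT s|lborel. exp (- 1 * s) * (indicator {0<..} s * A (s / x n)))" for n
  proof -
    have "of_real a0 + F (of_real (x n)) = of_real (x n) * (LINT t|lborel. exp (- of_real (x n) * of_real t) * of_real (indicator {0<..} t * A t))"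
      using A_laplace[of "of_real (x n)"] x[of n] lap[of "of_real (x n)"] by simp
    also have "(LINT t|lborel. exp (- of_real (x n) * of_real t) * of_real (indicator {0<..} t * A t)) =
       complex_of_real (LINT t|lborel. exp (- x n * t) * (indicator {0<..} t * A t))"
      by (subst integral_complex_of_real[symmetric]) (simp add: exp_of_real[symmetric] del: exp_of_real)
    also have "(LINT t|lborel. exp (- x n * t) * (indicator {0<..} t * A t)) = (1 / x n) * (LINT s|lborel. exp (- 1 * s) * (indicator {0<..} s * A (s / x n)))"
      using x[of n] by (subst lborel_integral_real_affine[of "1 / x n" _ 0]) (auto simp: indicator_def zero_less_divide_iff)
    finally show ?thesis using x[of n] less_imp_neq[OF x[of n]] by simp
  qed
  have "(\<lambda>n. LINT s|lborel. exp (- 1 * s) * (indicator {0<..} s * A (s / x n))) \<longlonglongrightarrow> (LINT s|lborel. exp (- 1 * s) * (indicator {0<..} s * Ainf))"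
  proof (rule integral_dominated_convergence[where w="\<lambda>s. M * (indicator {0<..} s * exp (- 1 * s))"])
    show "integrable lborel (\<lambda>s. M * (indicator {0<..} s * exp (- 1 * s)))"
      by (intro integrable_mult_right integrable_exp_halfline) simp
    show "AE s in lborel. (\<lambda>n. exp (- 1 * s) * (indicator {0<..} s * A (s / x n))) \<longlonglongrightarrow> exp (- 1 * s) * (indicator {0<..} s * Ainf)"
    proof (intro AE_I2)
      fix s :: real
      show "(\<lambda>n. exp (- 1 * s) * (indicator {0<..} s * A (s / x n))) \<longlonglongrightarrow> exp (- 1 * s) * (indicator {0<..} s * Ainf)"
      proof (cases "s > 0")
        case True
        have "filterlim (\<lambda>n. s * real (Suc n)) at_top sequentially"
          using True by (intro filterlim_tendsto_pos_mult_at_top[OF tendsto_const] filterlim_compose[OF filterlim_real_sequentially filterlim_Suc]) auto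
        hence "(\<lambda>n. A (s * real (Suc n))) \<longlonglongrightarrow> Ainf" by (rule filterlim_compose[OF A_lim])
        thus ?thesis using True by (auto intro!: tendsto_intros simp: x_def divide_inverse simp del: of_nat_Suc)
      qed simp
    qed
    show "AE s in lborel. norm (exp (- 1 * s) * (indicator {0<..} s * A (s / x n))) \<le> M * (indicator {0<..} s * exp (- 1 * s))" for n
      using M by (intro AE_I2) (auto simp: abs_mult indicator_def mult.commute[of M] intro!: mult_left_mono)
  qed measurable
  also have "(LINT s|lborel. exp (- 1 * s) * (indicator {0<..} (s::real) * Ainf)) = Ainf"
  proof -
    have "complex_of_real (LINT s|lborel. exp (- 1 * s) * indicator {0<..} (s::real)) = 1"
      using integral_exp_halfline_complex[of 1]
      by (subst integral_complex_of_real[symmetric]) (simp add: exp_of_real[symmetric] del: exp_of_real)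
    hence "(LINT s|lborel. exp (- 1 * s) * indicator {0<..} (s::real)) = 1" by (simp only: of_real_eq_1_iff)
    moreover have "(LINT s|lborel. exp (- 1 * s) * (indicator {0<..} (s::real) * Ainf)) = (LINT s|lborel. exp (- 1 * s) * indicator {0<..} s) * Ainf"
      by (subst integral_mult_left_zero[symmetric]) (simp only: mult.assoc)
    ultimately show ?thesis by simp
  qed
  finally have "(\<lambda>n. of_real a0 + F (of_real (x n))) \<longlonglongrightarrow> of_real Ainf"
    unfolding eq by (rule tendsto_of_real)
  moreover have "(\<lambda>n. of_real a0 + F (of_real (x n))) \<longlonglongrightarrow> of_real a0 + F 0"
  proof (intro tendsto_intros continuous_on_tendsto_compose[OF cont])
    show "(\<lambda>n. complex_of_real (x n)) \<longlonglongrightarrow> 0" using tendsto_of_real[OF xl] by simp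
    show "\<forall>\<^sub>F n in sequentially. complex_of_real (x n) \<in> {z. - \<alpha> \<le> Re z}"
      using x \<alpha> by (intro always_eventually allI) (simp add: less_imp_le order_trans[of _ 0])
  qed (use \<alpha> in simp)
  ultimately show ?thesis using LIMSEQ_unique by blast
qed

text \<open>The transform of the Volterra equation, solved for Z. It is available only to the right
  of \<open>\<mu> * M\<close>, the growth rate given by the Neumann series; the passage to small Re
  \<zeta> is made later by shifting contours.\<close>

lemma volterra_sol_laplace:
  assumes M: "\<And>t. \<bar>A t\<bar> \<le> M" and \<mu>: "\<mu> \<ge> 0" and \<zeta>: "Re \<zeta> > \<mu> * M"
  shows "(LINT t|lborel. exp (- \<zeta> * of_real t) * of_real (indicator {0<..} t * volterra_sol A \<mu> t)) = 1 / (\<zeta> + of_real \<mu> * (of_real a0 + laplace a \<zeta>))"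
proof -
  interpret volterra_kernel A M using M A_continuous by (simp add: volterra_kernel_def)
  let ?z = "volterra_sol A \<mu>"
  have \<zeta>0: "Re \<zeta> > 0" using \<zeta> \<mu> M_nonneg mult_nonneg_nonneg[of \<mu> M] by linarith
  hence \<zeta>nz: "\<zeta> \<noteq> 0" by auto
  have iz: "integrable lborel (\<lambda>t. exp (- \<zeta> * of_real t) * of_real (indicator {0<..} t * ?z t))"
  proof (rule Bochner_Integration.integrable_bound[OF integrable_exp_halfline[of "Re \<zeta> - \<mu> * M"]])
    show "AE t in lborel. norm (exp (- \<zeta> * of_real t) * of_real (indicator {0<..} t * ?z t)) \<le> norm (indicator {0<..} t * exp (- (Re \<zeta> - \<mu> * M) * t))"
    proof (intro AE_I2)
      fix t :: real
      show "norm (exp (- \<zeta> * of_real t) * of_real (indicator {0<..} t * ?z t)) \<le> norm (indicator {0<..} t * exp (- (Re \<zeta> - \<mu> * M) * t))"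
      proof (cases "t > 0")
        case True
        have "exp (- Re \<zeta> * t) * \<bar>?z t\<bar> \<le> exp (- Re \<zeta> * t) * exp (\<mu> * M * t)"
          using volterra_sol_bound[of t \<mu>] True \<mu> by (intro mult_left_mono) auto
        also have "\<dots> = exp (- (Re \<zeta> - \<mu> * M) * t)" by (simp add: algebra_simps flip: exp_add)
        finally show ?thesis using True by (simp add: norm_mult)
      qed simp
    qed
  qed (use \<zeta> in auto)
  let ?Z = "LINT t|lborel. exp (- \<zeta> * of_real t) * of_real (indicator {0<..} t * ?z t)"
  let ?A = "LINT t|lborel. exp (- \<zeta> * of_real t) * of_real (indicator {0<..} t * A t)"
  have iV: "integrable lborel (\<lambda>t. exp (- \<zeta> * of_real t) * of_real (indicator {0<..} t * (\<mu> * volterra A ?z t)))"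
  proof -
    have "integrable lborel (\<lambda>t. exp (- \<zeta> * of_real t) * of_real (indicator {0<..} t) - exp (- \<zeta> * of_real t) * of_real (indicator {0<..} t * ?z t))"
      by (intro Bochner_Integration.integrable_diff iz integrable_exp_halfline_complex[OF \<zeta>0])
    moreover have "exp (- \<zeta> * of_real t) * of_real (indicator {0<..} t) - exp (- \<zeta> * of_real t) * of_real (indicator {0<..} t * ?z t) =
       exp (- \<zeta> * of_real t) * of_real (indicator {0<..} t * (\<mu> * volterra A ?z t))" for t
      by (cases "t > 0") (simp_all add: volterra_sol_eq[of t \<mu>] algebra_simps)
    ultimately show ?thesis by simp
  qed
  have "?Z = (LINT t|lborel. exp (- \<zeta> * of_real t) * of_real (indicator {0<..} t) - exp (- \<zeta> * of_real t) * of_real (indicator {0<..} t * (\<mu> * volterra A ?z t)))"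
  proof (intro Bochner_Integration.integral_cong refl)
    fix t :: real
    show "exp (- \<zeta> * of_real t) * of_real (indicator {0<..} t * ?z t) =
      exp (- \<zeta> * of_real t) * of_real (indicator {0<..} t) - exp (- \<zeta> * of_real t) * of_real (indicator {0<..} t * (\<mu> * volterra A ?z t))"
      by (cases "t > 0") (simp_all add: volterra_sol_eq[of t \<mu>] algebra_simps)
  qed
  also have "\<dots> = 1 / \<zeta> - (LINT t|lborel. exp (- \<zeta> * of_real t) * of_real (indicator {0<..} t * (\<mu> * volterra A ?z t)))"
    by (subst Bochner_Integration.integral_diff[OF integrable_exp_halfline_complex[OF \<zeta>0] iV]) (simp only: integral_exp_halfline_complex[OF \<zeta>0])
  also have "(LINT t|lborel. exp (- \<zeta> * of_real t) * of_real (indicator {0<..} t * (\<mu> * volterra A ?z t))) =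
     (LINT t|lborel. of_real \<mu> * (exp (- \<zeta> * of_real t) * of_real (indicator {0<..} t * volterra A ?z t)))"
    by (intro Bochner_Integration.integral_cong refl) (simp only: of_real_mult mult_ac)
  also have "\<dots> = of_real \<mu> * (?A * ?Z)"
    by (simp only: integral_mult_right_zero laplace_volterra[OF A_laplace_integrable[OF \<zeta>0] iz])
  finally have "?Z = 1 / \<zeta> - of_real \<mu> * (?A * ?Z)" .
  moreover have "Z = 1 / (\<zeta> + m * X)" if Z: "Z = 1 / \<zeta> - m * (X / \<zeta> * Z)" for Z m X :: complex
  proof -
    have "\<zeta> * Z = \<zeta> * (1 / \<zeta> - m * (X / \<zeta> * Z))" using Z by (rule arg_cong)
    also have "\<dots> = 1 - m * (X * Z)" using \<zeta>nz by (simp add: right_diff_distrib)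
    finally have "Z * (\<zeta> + m * X) = 1" by (simp add: distrib_left mult_ac)
    thus ?thesis by (metis mult_zero_right nonzero_eq_divide_eq zero_neq_one)
  qed
  ultimately show ?thesis unfolding A_laplace[OF \<zeta>0] by blast
qed

text \<open>In the rescaled time s = m t the transform of z becomes the resolvent of \<kappa> p(m
  z). The constants \<open>c\<close>, \<open>C\<close> and \<open>K\<close> are fixed before
  \<open>\<mu>\<close> is, because the symbol estimates are the same for all admissible
  \<open>\<kappa>\<close> and \<open>m\<close>.\<close>

theorem volterra_sol_decay:
  assumes a0: "a0 \<ge> 0" and ext: "laplace_extension \<alpha> a F" and \<alpha>: "\<alpha> > 0" and Ainf: "Ainf > 0"
    and cond: "(a0 > 0 \<and> (\<forall>\<omega>::real. a0 + Re (F (\<i> * of_real \<omega>)) > 0)) \<or>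
         (\<forall>\<omega>::real. Re (F (- of_real \<alpha> + \<i> * of_real \<omega>)) \<ge> 0)"
    and N: "N \<ge> 1"
  shows "\<exists>K. \<forall>\<mu>>0. \<forall>t>0. (min \<mu> 1 * t) ^ N * \<bar>volterra_sol A \<mu> t\<bar> \<le> K"
proof -
  obtain M where M: "\<And>t. \<bar>A t\<bar> \<le> M" using A_bounded by blast
  interpret volterra_kernel A M using M A_continuous by (simp add: volterra_kernel_def)
  have lap: "\<And>z. Re z > 0 \<Longrightarrow> F z = laplace a z" using ext by (auto simp: laplace_extension_def)
  obtain c C where c: "0 < c" "c \<le> 1" and sym: "\<And>\<kappa> m. \<kappa> \<ge> 1 \<Longrightarrow> 0 < m \<Longrightarrow> m \<le> 1 \<Longrightarrow>
    resolvent_symbol c C (\<lambda>z. of_real \<kappa> * (of_real a0 + F (of_real m * z)))"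
    using resolvent_symbol_family[OF a0 ext \<alpha> a_integrable_exp laplace_at_zero[OF ext \<alpha>] Ainf cond] by blast
  obtain K where K: "\<And>P x. resolvent_symbol c C P \<Longrightarrow> 0 < x \<Longrightarrow> x \<le> 1 \<Longrightarrow>
    (LINT \<omega>|lborel. cmod ((deriv ^^ N) (resolvent P) (Complex x \<omega>))) \<le> K"
    using resolvent_deriv_L1_bound[OF c N, of C] by blast
  show ?thesis
  proof (intro exI[of _ "exp 1 * K"] allI impI)
    fix \<mu> t :: real assume \<mu>: "0 < \<mu>" and t: "0 < t"
    define m where "m = min \<mu> 1"
    define \<kappa> where "\<kappa> = \<mu> / m"
    have m: "0 < m" "m \<le> 1" "m \<le> \<mu>" using \<mu> by (auto simp: m_def)
    have \<kappa>: "\<kappa> \<ge> 1" using m by (simp add: \<kappa>_def)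
    define f where "f s = complex_of_real (volterra_sol A \<mu> (s / m))" for s
    have "(m * t) ^ N * cmod (f (m * t)) \<le> exp 1 * K"
    proof (rule resolvent_decay[OF sym[OF \<kappa> m(1,2)] c N, where M=1 and ?x0.0="\<mu> * M / m" and f=f])
      show "continuous_on {0<..} f"
        unfolding f_def using m
        by (intro continuous_intros continuous_on_compose2[OF volterra_sol_continuous]) auto
      show "cmod (f s) \<le> 1 * exp (\<mu> * M / m * s)" if "s > 0" for s
        using volterra_sol_bound[of "s / m" \<mu>] that m \<mu> by (simp add: f_def)
      show "0 \<le> \<mu> * M / m" using \<mu> m M_nonneg by simp
      show "(LINT t|lborel. exp (- z * of_real t) * (indicator {0<..} t * f t)) = resolvent (\<lambda>z. of_real \<kappa> * (of_real a0 + F (of_real m * z))) z"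
        if z: "Re z > \<mu> * M / m" for z
      proof -
        have mz: "Re (of_real m * z) > \<mu> * M" using z m by (simp add: field_simps)
        hence mz0: "Re (of_real m * z) > 0" using \<mu> M_nonneg mult_nonneg_nonneg[of \<mu> M] by linarith
        have "(LINT t|lborel. exp (- z * of_real t) * (indicator {0<..} t * f t)) =
          m *\<^sub>R (LINT t|lborel. exp (- z * of_real (0 + m * t)) * (indicator {0<..} (0 + m * t) * f (0 + m * t)))"
          using m by (subst lborel_integral_real_affine[of m _ 0]) auto
        also have "(LINT t|lborel. exp (- z * of_real (0 + m * t)) * (indicator {0<..} (0 + m * t) * f (0 + m * t))) =
          (LINT t|lborel. exp (- (of_real m * z) * of_real t) * of_real (indicator {0<..} t * volterra_sol A \<mu> t))"
          using m by (intro Bochner_Integration.integral_cong refl) (auto simp: f_def indicator_def zero_less_mult_iff mult_ac)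
        also have "\<dots> = 1 / (of_real m * z + of_real \<mu> * (of_real a0 + laplace a (of_real m * z)))"
          by (rule volterra_sol_laplace[OF M _ mz]) (use \<mu> in simp)
        also have "of_real m * z + of_real \<mu> * (of_real a0 + laplace a (of_real m * z)) = of_real m * (z + of_real \<kappa> * (of_real a0 + F (of_real m * z)))"
          unfolding lap[OF mz0] using m by (simp add: \<kappa>_def field_simps)
        finally show ?thesis using m by (simp add: resolvent_def scaleR_conv_of_real)
      qed
      show "(LINT \<omega>|lborel. cmod ((deriv ^^ N) (resolvent (\<lambda>z. of_real \<kappa> * (of_real a0 + F (of_real m * z)))) (Complex x \<omega>))) \<le> K"
        if "0 < x" "x \<le> 1" for x
        by (rule K[OF sym[OF \<kappa> m(1,2)] that])
    qed (use m t in simp)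
    thus "(min \<mu> 1 * t) ^ N * \<bar>volterra_sol A \<mu> t\<bar> \<le> exp 1 * K"
      using m by (simp add: f_def m_def)
  qed
qed

end

section \<open>Smooth functions\<close>

lemma directional_deriv_eq:
  assumes "(f has_derivative D) (at x)" shows "directional_deriv v f x = D v"
  using frechet_derivative_at[OF assms] by (simp add: directional_deriv_def)

lemma differentiable_has_derivative:
  assumes "f differentiable (at x)" shows "(f has_derivative (\<lambda>v. directional_deriv v f x)) (at x)"
  using assms by (simp add: directional_deriv_def frechet_derivative_works)

lemma times_cont_diff_SucI:
  assumes "\<And>x. (f has_derivative (\<lambda>v. D v x)) (at x)" "\<And>v. times_cont_diff k (D v)"
  shows "times_cont_diff (Suc k) f"
proof -
  have "directional_deriv v f = D v" for v using directional_deriv_eq[OF assms(1)] by (simp add: fun_eq_iff)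
  thus ?thesis using assms by (auto simp: differentiable_def)
qed

lemma times_cont_diff_SucD:
  assumes "times_cont_diff (Suc k) f"
  shows "(f has_derivative (\<lambda>v. directional_deriv v f x)) (at x)" "times_cont_diff k (directional_deriv v f)"
  using assms by (auto intro: differentiable_has_derivative)

lemma times_cont_diff_mono1: "times_cont_diff (Suc k) f \<Longrightarrow> times_cont_diff k f"
proof (induction k arbitrary: f)
  case 0
  thus ?case by (auto intro!: continuous_at_imp_continuous_on differentiable_imp_continuous_within)
next
  case (Suc k)
  hence "\<And>v. times_cont_diff (Suc k) (directional_deriv v f)" by simp
  hence "\<And>v. times_cont_diff k (directional_deriv v f)" using Suc.IH by blast
  thus ?case using Suc.prems by simp
qed

lemma times_cont_diff_const[simp]: "times_cont_diff k (\<lambda>x. c)"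
proof (induction k arbitrary: c)
  case (Suc k) thus ?case by (intro times_cont_diff_SucI[where D="\<lambda>v x. 0"]) auto
qed simp

lemma times_cont_diff_bounded_linear:
  assumes "bounded_linear L" shows "times_cont_diff k L"
proof (cases k)
  case 0 thus ?thesis using assms by (simp add: linear_continuous_on)
next
  case (Suc n)
  show ?thesis unfolding Suc
    by (rule times_cont_diff_SucI[where D="\<lambda>v x. L v"]) (auto intro: bounded_linear_imp_has_derivative assms)
qed

lemma times_cont_diff_add:
  assumes "times_cont_diff k f" "times_cont_diff k g" shows "times_cont_diff k (\<lambda>x. f x + g x)"
  using assms
proof (induction k arbitrary: f g)
  case 0 thus ?case by (auto intro: continuous_intros)
next
  case (Suc k)
  show ?case
    by (rule times_cont_diff_SucI[where D="\<lambda>v x. directional_deriv v f x + directional_deriv v g x"])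
       (auto intro!: has_derivative_add times_cont_diff_SucD(1)[OF Suc.prems(1)] times_cont_diff_SucD(1)[OF Suc.prems(2)]
          Suc.IH times_cont_diff_SucD(2)[OF Suc.prems(1)] times_cont_diff_SucD(2)[OF Suc.prems(2)])
qed

lemma times_cont_diff_mult:
  fixes f g :: "'a::euclidean_space \<Rightarrow> 'b::real_normed_algebra"
  assumes "times_cont_diff k f" "times_cont_diff k g" shows "times_cont_diff k (\<lambda>x. f x * g x)"
  using assms
proof (induction k arbitrary: f g)
  case 0 thus ?case by (auto intro: continuous_intros)
next
  case (Suc k)
  show ?case
    by (rule times_cont_diff_SucI[where D="\<lambda>v x. f x * directional_deriv v g x + directional_deriv v f x * g x"])
       (auto intro!: has_derivative_mult times_cont_diff_SucD(1)[OF Suc.prems(1)] times_cont_diff_SucD(1)[OF Suc.prems(2)]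
          times_cont_diff_add Suc.IH times_cont_diff_SucD(2)[OF Suc.prems(1)] times_cont_diff_SucD(2)[OF Suc.prems(2)]
          times_cont_diff_mono1[OF Suc.prems(1)] times_cont_diff_mono1[OF Suc.prems(2)])
qed

lemma times_cont_diff_linear_comp:
  assumes L: "bounded_linear L" and "times_cont_diff k f" shows "times_cont_diff k (\<lambda>x. f (L x))"
  using assms(2)
proof (induction k arbitrary: f)
  case 0 thus ?case
    using linear_continuous_on[OF L, of UNIV] by (auto intro: continuous_on_compose2)
next
  case (Suc k)
  show ?case
  proof (rule times_cont_diff_SucI[where D="\<lambda>v x. directional_deriv (L v) f (L x)"])
    show "((\<lambda>x. f (L x)) has_derivative (\<lambda>v. directional_deriv (L v) f (L x))) (at x)" for x
      using has_derivative_compose[OF bounded_linear_imp_has_derivative[OF L] times_cont_diff_SucD(1)[OF Suc.prems]] .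
    show "times_cont_diff k (\<lambda>x. directional_deriv (L v) f (L x))" for v
      by (rule Suc.IH[OF times_cont_diff_SucD(2)[OF Suc.prems]])
  qed
qed

text \<open>The induction varies only the outer function: the derivative of the composite is a
  directional derivative of \<open>g\<close> times the derivative of \<open>h\<close> composed with
  the same \<open>g\<close>.\<close>

lemma times_cont_diff_comp_real:
  fixes h :: "real \<Rightarrow> real" and g :: "'a::euclidean_space \<Rightarrow> real"
  assumes "times_cont_diff k h" "times_cont_diff k g" shows "times_cont_diff k (\<lambda>x. h (g x))"
  using assms
proof (induction k arbitrary: h)
  case 0 thus ?case by (auto intro: continuous_on_compose2)
next
  case (Suc k)
  show ?case
  proof (rule times_cont_diff_SucI[where D="\<lambda>v x. directional_deriv v g x * directional_deriv 1 h (g x)"])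
    fix x
    have lin: "directional_deriv v h y = v * directional_deriv 1 h y" for v y
      using linear_scale[OF has_derivative_linear[OF times_cont_diff_SucD(1)[OF Suc.prems(1), of y]], of v 1] by simp
    show "((\<lambda>x. h (g x)) has_derivative (\<lambda>v. directional_deriv v g x * directional_deriv 1 h (g x))) (at x)"
      by (rule has_derivative_eq_rhs[OF has_derivative_compose[OF times_cont_diff_SucD(1)[OF Suc.prems(2)] times_cont_diff_SucD(1)[OF Suc.prems(1)]]])
         (rule ext, rule lin)
    show "times_cont_diff k (\<lambda>x. directional_deriv v g x * directional_deriv 1 h (g x))" for v
      by (rule times_cont_diff_mult[OF times_cont_diff_SucD(2)[OF Suc.prems(2)]
          Suc.IH[OF times_cont_diff_SucD(2)[OF Suc.prems(1)] times_cont_diff_mono1[OF Suc.prems(2)]]])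
  qed
qed

lemma times_cont_diff_of_real:
  assumes "times_cont_diff k f" shows "times_cont_diff k (\<lambda>x. complex_of_real (f x))"
  using assms
proof (induction k arbitrary: f)
  case 0 thus ?case by (auto intro: continuous_intros)
next
  case (Suc k)
  show ?case
    by (rule times_cont_diff_SucI[where D="\<lambda>v x. complex_of_real (directional_deriv v f x)"])
       (auto intro!: Suc.IH times_cont_diff_SucD(2)[OF Suc.prems] has_derivative_of_real times_cont_diff_SucD(1)[OF Suc.prems])
qed

lemma times_cont_diff_real_deriv:
  fixes f :: "real \<Rightarrow> real"
  assumes "\<And>x. (f has_field_derivative f' x) (at x)" "times_cont_diff k f'"
  shows "times_cont_diff (Suc k) f"
proof (rule times_cont_diff_SucI[where D="\<lambda>v x. v * f' x"])
  show "(f has_derivative (\<lambda>v. v * f' x)) (at x)" for x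
    using assms(1)[of x] unfolding has_field_derivative_def by (rule has_derivative_eq_rhs) (simp add: mult.commute fun_eq_iff)
  show "times_cont_diff k (\<lambda>x. v * f' x)" for v by (intro times_cont_diff_mult assms(2)) simp
qed

section \<open>Bump functions\<close>

text \<open>Powers of 1/x are included because the family is then closed under differentiation up to
  linear combinations, and smoothness follows by one induction with \<open>k\<close>
  arbitrary.\<close>

definition flat :: "nat \<Rightarrow> real \<Rightarrow> real" where
  "flat k x = (if x > 0 then (1 / x) ^ k * exp (- (1 / x)) else 0)"

lemma flat_tendsto_0: "(flat k \<longlongrightarrow> 0) (at_right 0)"
proof -
  have "((\<lambda>y. y ^ k / exp y) \<longlongrightarrow> 0) (at_top :: real filter)" by (rule tendsto_power_div_exp_0)
  hence "((\<lambda>x. inverse x ^ k / exp (inverse x)) \<longlongrightarrow> 0) (at_right (0::real))"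
    by (rule filterlim_compose[OF _ filterlim_inverse_at_top_right])
  moreover have "\<forall>\<^sub>F x in at_right 0. flat k x = inverse x ^ k / exp (inverse x)"
    using eventually_at_right_less[of 0] by eventually_elim (simp add: flat_def exp_minus divide_inverse)
  ultimately show ?thesis by (simp add: tendsto_cong)
qed

lemma flat_has_derivative: "(flat k has_field_derivative (flat (k + 2) x - real k * flat (k + 1) x)) (at x)"
proof -
  consider "x > 0" | "x < 0" | "x = 0" by linarith
  thus ?thesis
  proof cases
    case 1
    have "((\<lambda>x. (1 / x) ^ k * exp (- (1 / x))) has_field_derivative (flat (k + 2) x - real k * flat (k + 1) x)) (at x)"
    proof -
      have d1: "((\<lambda>x. 1 / x) has_field_derivative - ((1 / x)\<^sup>2)) (at x)"
        using 1 by (auto intro!: derivative_eq_intros simp: power2_eq_square)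
      have d2: "((\<lambda>x. (1 / x) ^ k) has_field_derivative - (real k * (1 / x) ^ (k + 1))) (at x)"
      proof (rule DERIV_cong[OF DERIV_power[OF d1, of k]])
        show "real k * (- ((1 / x)\<^sup>2) * (1 / x) ^ (k - Suc 0)) = - (real k * (1 / x) ^ (k + 1))"
          by (cases k) (simp_all add: power2_eq_square)
      qed
      have d3: "((\<lambda>x. exp (- (1 / x))) has_field_derivative exp (- (1 / x)) * (- (- ((1 / x)\<^sup>2)))) (at x)"
        by (rule DERIV_chain2[OF DERIV_exp DERIV_minus[OF d1]])
      show ?thesis
      proof (rule DERIV_cong[OF DERIV_mult[OF d2 d3]])
        show "- (real k * (1 / x) ^ (k + 1)) * exp (- (1 / x)) + exp (- (1 / x)) * (- (- ((1 / x)\<^sup>2))) * (1 / x) ^ k = flat (k + 2) x - real k * flat (k + 1) x"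
        proof -
          define u e where "u = 1 / x" and "e = exp (- (1 / x))"
          have "flat m x = u ^ m * e" for m using 1 by (simp add: flat_def u_def e_def)
          thus ?thesis
            unfolding e_def[symmetric] unfolding u_def[symmetric] by (simp add: power_add power2_eq_square algebra_simps)
        qed
      qed
    qed
    thus ?thesis
      by (rule has_field_derivative_transform_within_open[of _ _ _ "{0<..}"]) (use 1 in \<open>auto simp: flat_def\<close>)
  next
    case 2
    have "((\<lambda>x. 0) has_field_derivative (flat (k + 2) x - real k * flat (k + 1) x)) (at x)"
      using 2 by (simp add: flat_def)
    thus ?thesis
      by (rule has_field_derivative_transform_within_open[of _ _ _ "{..<0}"]) (use 2 in \<open>auto simp: flat_def\<close>)
  next
    case 3
    \<comment> \<open>At the origin the difference quotient vanishes on the left and equals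
      \<open>flat (k + 1)\<close> on the right, which tends to 0.\<close>
    have "((\<lambda>h. (flat k (0 + h) - flat k 0) / h) \<longlongrightarrow> 0) (at 0)"
    proof (rule filterlim_split_at)
      have "\<forall>\<^sub>F h in at_left 0. (flat k (0 + h) - flat k 0) / h = (0::real)"
        by (rule eventually_at_leftI[of "-1"]) (auto simp: flat_def)
      thus "((\<lambda>h. (flat k (0 + h) - flat k 0) / h) \<longlongrightarrow> 0) (at_left 0)" by (rule tendsto_eventually)
      have "\<forall>\<^sub>F h in at_right 0. flat (k + 1) h = (flat k (0 + h) - flat k 0) / h"
        using eventually_at_right_less[of 0] by eventually_elim (simp add: flat_def)
      with flat_tendsto_0[of "k + 1"] show "((\<lambda>h. (flat k (0 + h) - flat k 0) / h) \<longlongrightarrow> 0) (at_right 0)"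
        by (rule Lim_transform_eventually)
    qed
    thus ?thesis using 3 by (simp add: DERIV_def flat_def)
  qed
qed

lemma times_cont_diff_flat: "times_cont_diff n (flat k)"
proof (induction n arbitrary: k)
  case 0
  have "isCont (flat k) x" for x by (rule DERIV_isCont[OF flat_has_derivative])
  thus ?case by (auto intro: continuous_at_imp_continuous_on)
next
  case (Suc n)
  have "times_cont_diff n (\<lambda>x. flat (k + 2) x + (- real k) * flat (k + 1) x)"
    by (intro times_cont_diff_add times_cont_diff_mult Suc.IH times_cont_diff_const)
  thus ?case by (intro times_cont_diff_real_deriv[OF flat_has_derivative]) simp
qed

lemma flat_nonneg: "flat k x \<ge> 0" and flat_pos: "x > 0 \<Longrightarrow> flat k x > 0" and flat_zero: "x \<le> 0 \<Longrightarrow> flat k x = 0"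
  and flat_le_1: "flat 0 x \<le> 1"
  by (auto simp: flat_def)

definition bump :: "real \<Rightarrow> real" where "bump t = flat 0 (t * (1 - t))"

lemma times_cont_diff_bump: "times_cont_diff n bump"
proof -
  have "times_cont_diff n (\<lambda>t::real. t * (1 + (-1) * t))"
    by (intro times_cont_diff_mult times_cont_diff_add times_cont_diff_const times_cont_diff_bounded_linear bounded_linear_ident)
  from times_cont_diff_comp_real[OF times_cont_diff_flat this, of 0] show ?thesis
    by (simp add: bump_def[abs_def])
qed

lemma bump_continuous: "continuous_on A bump"
  using times_cont_diff_bump[of 0] by (auto intro: continuous_on_subset)

lemma bump_measurable[measurable]: "bump \<in> borel_measurable borel"
  by (rule borel_measurable_continuous_onI[OF bump_continuous])

lemma bump_nonneg: "bump t \<ge> 0" by (simp add: bump_def flat_nonneg)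

lemma bump_le_1: "bump t \<le> 1" by (simp add: bump_def flat_le_1)

lemma bump_zero: "t \<le> 0 \<or> t \<ge> 1 \<Longrightarrow> bump t = 0"
  unfolding bump_def by (intro flat_zero) (auto simp: mult_le_0_iff)

lemma bump_int: "integrable lborel bump"
proof (rule Bochner_Integration.integrable_bound[of _ "indicator {0..1::real}"])
  show "AE x in lborel. norm (bump x) \<le> norm (indicator {0..1::real} x :: real)"
    using bump_nonneg bump_le_1 bump_zero by (intro AE_I2) (auto simp: indicator_def not_le)
qed auto

lemma bump_integral_pos: "(LINT t|lborel. bump t) > 0"
proof -
  have "(LINT t|lborel. bump t) \<noteq> 0"
  proof
    assume "(LINT t|lborel. bump t) = 0"
    hence "AE t in lborel. bump t = 0" using integral_nonneg_eq_0_iff_AE[OF bump_int] bump_nonneg by simp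
    \<comment> \<open>Any interval of positive length inside (0, 1) would do; there the bump is
      strictly positive.\<close>
    hence "AE t in lborel. t \<notin> {1/4..3/4::real}"
    proof eventually_elim
      case (elim t)
      show ?case
      proof
        assume "t \<in> {1/4..3/4}"
        hence "t * (1 - t) > 0" by (intro mult_pos_pos) auto
        from flat_pos[OF this, of 0] elim show False by (simp add: bump_def)
      qed
    qed
    hence "emeasure lborel {1/4..3/4::real} = 0" by (subst AE_iff_measurable[symmetric, of _ lborel]) auto
    thus False by simp
  qed
  moreover have "(LINT t|lborel. bump t) \<ge> 0" by (rule integral_nonneg_AE) (simp add: bump_nonneg)
  ultimately show ?thesis by simp
qed

text \<open>The support [0, 1] lies on one side of the origin, so a copy shifted to b > 0 and scaled
  by \<epsilon> lives in [b, b + \<epsilon>] and never reaches nonpositive times.\<close>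

definition mollifier :: "real \<Rightarrow> real" where "mollifier t = bump t / (LINT t|lborel. bump t)"

lemma mollifier_nonneg: "mollifier t \<ge> 0"
  using bump_nonneg bump_integral_pos by (simp add: mollifier_def)

lemma mollifier_continuous: "continuous_on A mollifier"
  unfolding mollifier_def by (intro continuous_intros bump_continuous) (use bump_integral_pos in auto)

lemma mollifier_zero: "t \<le> 0 \<or> t \<ge> 1 \<Longrightarrow> mollifier t = 0"
  by (auto simp: mollifier_def bump_zero)

lemma mollifier_int: "integrable lborel mollifier" and mollifier_integral: "(LINT t|lborel. mollifier t) = 1"
  using bump_int bump_integral_pos by (auto simp: mollifier_def[abs_def])

lemma times_cont_diff_mollifier: "times_cont_diff n mollifier"
  unfolding mollifier_def[abs_def] divide_inverse by (intro times_cont_diff_mult times_cont_diff_bump times_cont_diff_const)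

definition smooth_step :: "real \<Rightarrow> real" where "smooth_step t = (LINT s|lborel. indicator {0..t} s * mollifier s)"

lemma smooth_step_0: "t \<le> 0 \<Longrightarrow> smooth_step t = 0"
proof -
  assume t: "t \<le> 0"
  have "indicator {0..t} s * mollifier s = 0" for s
    using t mollifier_zero[of s] by (auto simp: indicator_def)
  hence "(\<lambda>s. indicator {0..t} s * mollifier s) = (\<lambda>s. 0)" by (rule ext)
  thus ?thesis unfolding smooth_step_def by (simp only: Bochner_Integration.integral_zero)
qed

lemma smooth_step_1: "t \<ge> 1 \<Longrightarrow> smooth_step t = 1"
proof -
  assume t: "t \<ge> 1"
  have "indicator {0..t} s * mollifier s = mollifier s" for s
  proof (cases "s < 0 \<or> s > t")
    case True
    hence "mollifier s = 0" using t by (intro mollifier_zero) auto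
    thus ?thesis by simp
  qed auto
  hence "(\<lambda>s. indicator {0..t} s * mollifier s) = mollifier" by (rule ext)
  thus ?thesis unfolding smooth_step_def by (simp only: mollifier_integral)
qed

lemma smooth_step_bounds: "0 \<le> smooth_step t" "smooth_step t \<le> 1"
proof -
  show "0 \<le> smooth_step t" unfolding smooth_step_def by (rule integral_nonneg_AE) (simp add: mollifier_nonneg)
  have "smooth_step t \<le> (LINT s|lborel. mollifier s)"
    unfolding smooth_step_def
    by (rule integral_mono'[OF mollifier_int]) (use mollifier_nonneg in \<open>auto simp: indicator_def\<close>)
  thus "smooth_step t \<le> 1" by (simp add: mollifier_integral)
qed

lemma smooth_step_has_derivative: "(smooth_step has_field_derivative mollifier t) (at t)"
proof -
  \<comment> \<open>The lower limit is moved from 0 to -1, where the mollifier vanishes, so that 0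
    becomes an interior point and the fundamental theorem gives a two-sided derivative
    there.\<close>
  have eq: "smooth_step t = integral {-1..t} mollifier" if "t \<ge> -1" for t
  proof -
    have "smooth_step t = (LINT s|lborel. indicator {-1..t} s *\<^sub>R mollifier s)"
      unfolding smooth_step_def by (intro Bochner_Integration.integral_cong refl) (use mollifier_zero in \<open>auto simp: indicator_def\<close>)
    also have "\<dots> = integral {-1..t} mollifier"
      using set_borel_integral_eq_integral(2)[of "{-1..t}" mollifier] borel_integrable_atLeastAtMost'[OF mollifier_continuous, of "-1" t]
      by (simp add: set_lebesgue_integral_def)
    finally show ?thesis .
  qed
  show ?thesis
  proof (cases "t > -1")
    case True
    have "((\<lambda>u. integral {-1..u} mollifier) has_real_derivative mollifier t) (at t within {-1..t + 1})"
      by (rule integral_has_real_derivative[OF mollifier_continuous]) (use True in auto)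
    hence "((\<lambda>u. integral {-1..u} mollifier) has_real_derivative mollifier t) (at t)"
      using True by (simp add: at_within_Icc_at)
    thus ?thesis
      by (rule has_field_derivative_transform_within_open[of _ _ _ "{-1<..}"]) (use True eq in auto)
  next
    case False
    hence "((\<lambda>u. 0) has_real_derivative mollifier t) (at t)" by (simp add: mollifier_zero)
    thus ?thesis
      by (rule has_field_derivative_transform_within_open[of _ _ _ "{..<0}"]) (use False smooth_step_0 in auto)
  qed
qed

lemma times_cont_diff_smooth_step: "times_cont_diff n smooth_step"
proof -
  have "times_cont_diff (Suc n) smooth_step"
    by (rule times_cont_diff_real_deriv[OF smooth_step_has_derivative times_cont_diff_mollifier])
  thus ?thesis by (rule times_cont_diff_mono1)
qed

text \<open>For c < d and \<epsilon> > 0, a smooth approximation of the indicator of (c, d] whose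
  time derivative is a difference of two approximate point masses, at \<open>c\<close> and at
  \<open>d\<close>. Tested with it, the equation turns into an increment over the interval.\<close>

definition time_cutoff :: "real \<Rightarrow> real \<Rightarrow> real \<Rightarrow> real \<Rightarrow> real" where
  "time_cutoff c d \<epsilon> t = smooth_step ((t - c) / \<epsilon>) - smooth_step ((t - d) / \<epsilon>)"

lemma times_cont_diff_time_cutoff: "times_cont_diff n (time_cutoff c d \<epsilon>)"
proof -
  have 1: "times_cont_diff n (\<lambda>t::real. t * (1 / \<epsilon>) + (- b / \<epsilon>))" for b
    by (intro times_cont_diff_add times_cont_diff_const times_cont_diff_mult times_cont_diff_bounded_linear bounded_linear_ident)
  have "times_cont_diff n (\<lambda>t. smooth_step (t * (1 / \<epsilon>) + (- c / \<epsilon>)) + (-1) * smooth_step (t * (1 / \<epsilon>) + (- d / \<epsilon>)))"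
    by (intro times_cont_diff_add times_cont_diff_mult times_cont_diff_const times_cont_diff_comp_real[OF times_cont_diff_smooth_step 1])
  thus ?thesis by (simp add: time_cutoff_def[abs_def] diff_divide_distrib)
qed

lemma time_cutoff_has_derivative:
  "(time_cutoff c d \<epsilon> has_field_derivative (mollifier ((t - c) / \<epsilon>) - mollifier ((t - d) / \<epsilon>)) / \<epsilon>) (at t)"
proof -
  have "((\<lambda>t. smooth_step ((t - b) / \<epsilon>)) has_field_derivative mollifier ((t - b) / \<epsilon>) * (1 / \<epsilon>)) (at t)" for b
    by (rule DERIV_chain2[OF smooth_step_has_derivative])
       (cases "\<epsilon> = 0", simp_all, auto intro!: derivative_eq_intros)
  from DERIV_diff[OF this[of c] this[of d]] show ?thesis
    by (simp add: time_cutoff_def[abs_def] diff_divide_distrib)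
qed

section \<open>Test functions\<close>

lemma norm_weight_bounded_support:
  fixes \<kappa> :: "'a::euclidean_space \<Rightarrow> complex"
  assumes supp: "\<And>\<xi>. norm \<xi> > M \<Longrightarrow> \<kappa> \<xi> = 0"
  shows "cmod (- \<i> * of_real (v \<bullet> \<xi>) * \<kappa> \<xi>) \<le> norm v * \<bar>M\<bar> * cmod (\<kappa> \<xi>)"
proof (cases "norm \<xi> > M")
  case False
  have "\<bar>v \<bullet> \<xi>\<bar> \<le> norm v * norm \<xi>" by (rule Cauchy_Schwarz_ineq2)
  also have "\<dots> \<le> norm v * \<bar>M\<bar>" using False by (intro mult_left_mono) auto
  finally have "\<bar>v \<bullet> \<xi>\<bar> * cmod (\<kappa> \<xi>) \<le> norm v * \<bar>M\<bar> * cmod (\<kappa> \<xi>)" by (rule mult_right_mono) simp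
  thus ?thesis by (simp add: norm_mult)
qed (simp add: supp)

lemma integrable_weight_bounded_support:
  fixes \<kappa> :: "'a::euclidean_space \<Rightarrow> complex"
  assumes \<kappa>: "integrable lborel \<kappa>" and supp: "\<And>\<xi>. norm \<xi> > M \<Longrightarrow> \<kappa> \<xi> = 0"
  shows "integrable lborel (\<lambda>\<xi>. - \<i> * of_real (v \<bullet> \<xi>) * \<kappa> \<xi>)"
proof (rule Bochner_Integration.integrable_bound[of _ "\<lambda>\<xi>. norm v * \<bar>M\<bar> * cmod (\<kappa> \<xi>)"])
  show "AE \<xi> in lborel. norm (- \<i> * of_real (v \<bullet> \<xi>) * \<kappa> \<xi>) \<le> norm (norm v * \<bar>M\<bar> * cmod (\<kappa> \<xi>))"
    using norm_weight_bounded_support[of M \<kappa> v, OF supp] by (intro AE_I2) (simp only: real_norm_def abs_of_nonneg mult_nonneg_nonneg norm_ge_zero abs_ge_zero)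
qed (use \<kappa> in auto)

text \<open>On the support of \<open>\<kappa>\<close> the weight v \<bullet> \<xi> is bounded by |M|
  times the norm of \<open>v\<close>. Second-order Taylor expansion of the exponential therefore
  leaves an error quadratic in y - x, with a constant that involves only the L1 norm of
  \<open>\<kappa>\<close>.\<close>

lemma fourier_bounded_support_has_derivative:
  fixes \<kappa> :: "'a::euclidean_space \<Rightarrow> complex"
  assumes \<kappa>: "integrable lborel \<kappa>" and supp: "\<And>\<xi>. norm \<xi> > M \<Longrightarrow> \<kappa> \<xi> = 0"
  shows "(fourier \<kappa> has_derivative (\<lambda>v. fourier (\<lambda>\<xi>. - \<i> * of_real (v \<bullet> \<xi>) * \<kappa> \<xi>) x)) (at x)"
proof -
  have [measurable]: "\<kappa> \<in> borel_measurable borel" using \<kappa> by auto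
  have iv: "integrable lborel (\<lambda>\<xi>. - \<i> * of_real (v \<bullet> \<xi>) * \<kappa> \<xi>)" for v
    by (rule integrable_weight_bounded_support[OF assms])
  define B where "B = M\<^sup>2 * (LINT \<xi>|lborel. cmod (\<kappa> \<xi>))"
  let ?D = "\<lambda>v. fourier (\<lambda>\<xi>. - \<i> * of_real (v \<bullet> \<xi>) * \<kappa> \<xi>) x"
  let ?r = "\<lambda>y \<xi>. (exp (- \<i> * of_real (\<xi> \<bullet> y)) * \<kappa> \<xi> - exp (- \<i> * of_real (\<xi> \<bullet> x)) * \<kappa> \<xi>) - exp (- \<i> * of_real (\<xi> \<bullet> x)) * (- \<i> * of_real ((y - x) \<bullet> \<xi>) * \<kappa> \<xi>)"
  have bl: "bounded_linear (\<lambda>v. ?D v)"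
  proof (rule bounded_linear_intro[where K="\<bar>M\<bar> * (LINT \<xi>|lborel. cmod (\<kappa> \<xi>))"])
    fix v w and r :: real
    show "fourier (\<lambda>\<xi>. - \<i> * of_real ((v + w) \<bullet> \<xi>) * \<kappa> \<xi>) x = ?D v + fourier (\<lambda>\<xi>. - \<i> * of_real (w \<bullet> \<xi>) * \<kappa> \<xi>) x"
      unfolding fourier_def
      by (subst Bochner_Integration.integral_add[symmetric, OF integrable_fourier[OF iv] integrable_fourier[OF iv]])
         (simp add: inner_add_left algebra_simps)
    show "fourier (\<lambda>\<xi>. - \<i> * of_real ((r *\<^sub>R v) \<bullet> \<xi>) * \<kappa> \<xi>) x = r *\<^sub>R ?D v"
      unfolding fourier_def scaleR_conv_of_real
      by (subst integral_mult_right_zero[symmetric]) (simp add: mult_ac)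
    have "norm (?D v) \<le> (LINT \<xi>|lborel. norm v * \<bar>M\<bar> * cmod (\<kappa> \<xi>))"
    proof (rule order_trans[OF norm_fourier_le integral_mono'])
      show "integrable lborel (\<lambda>\<xi>. norm v * \<bar>M\<bar> * cmod (\<kappa> \<xi>))" using \<kappa> by auto
      show "cmod (- \<i> * of_real (v \<bullet> \<xi>) * \<kappa> \<xi>) \<le> norm v * \<bar>M\<bar> * cmod (\<kappa> \<xi>)" for \<xi>
        by (rule norm_weight_bounded_support[OF supp])
    qed simp
    thus "norm (?D v) \<le> norm v * (\<bar>M\<bar> * (LINT \<xi>|lborel. cmod (\<kappa> \<xi>)))" by (simp add: mult.assoc)
  qed
  have est: "norm (fourier \<kappa> y - fourier \<kappa> x - fourier (\<lambda>\<xi>. - \<i> * of_real ((y - x) \<bullet> \<xi>) * \<kappa> \<xi>) x) \<le> B * (norm (y - x))\<^sup>2" for y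
  proof -
    have eq: "fourier \<kappa> y - fourier \<kappa> x - fourier (\<lambda>\<xi>. - \<i> * of_real ((y - x) \<bullet> \<xi>) * \<kappa> \<xi>) x =
      (LINT \<xi>|lborel. ?r y \<xi>)"
      unfolding fourier_def
      by (subst Bochner_Integration.integral_diff, intro Bochner_Integration.integrable_diff integrable_fourier \<kappa>, intro integrable_fourier iv,
          subst Bochner_Integration.integral_diff, (intro integrable_fourier \<kappa>)+, simp)
    have "(LINT \<xi>|lborel. norm (?r y \<xi>)) \<le> (LINT \<xi>|lborel. (norm (y - x))\<^sup>2 * (M\<^sup>2 * cmod (\<kappa> \<xi>)))"
    proof (rule integral_mono')
      show "integrable lborel (\<lambda>\<xi>. (norm (y - x))\<^sup>2 * (M\<^sup>2 * cmod (\<kappa> \<xi>)))" by (intro integrable_mult_right integrable_norm \<kappa>)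
      fix \<xi>
      define a where "a = - ((y - x) \<bullet> \<xi>)"
      have "?r y \<xi> =
         exp (- \<i> * of_real (\<xi> \<bullet> x)) * \<kappa> \<xi> * (exp (\<i> * of_real a) - (1 + \<i> * of_real a))"
      proof -
        have "\<xi> \<bullet> y = \<xi> \<bullet> x + - a" unfolding a_def by (simp add: inner_diff_left inner_commute[of \<xi>])
        hence "- \<i> * of_real (\<xi> \<bullet> y) = - \<i> * of_real (\<xi> \<bullet> x) + \<i> * of_real a"
          by (simp only: of_real_add of_real_minus) (simp add: algebra_simps)
        hence E: "exp (- \<i> * of_real (\<xi> \<bullet> y)) = exp (- \<i> * of_real (\<xi> \<bullet> x)) * exp (\<i> * of_real a)" by (simp only: exp_add)
        have r: "complex_of_real ((y - x) \<bullet> \<xi>) = - of_real a" by (simp add: a_def)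
        have alg: "X * Y * k - X * k - X * (- \<i> * (- s) * k) = X * k * (Y - (1 + \<i> * s))" for X Y k s :: complex
          by (simp add: algebra_simps)
        show ?thesis unfolding E r by (rule alg)
      qed
      hence "norm (?r y \<xi>) =
         cmod (\<kappa> \<xi>) * cmod (exp (\<i> * of_real a) - (1 + \<i> * of_real a))" by (simp add: norm_mult)
      also have "\<dots> \<le> cmod (\<kappa> \<xi>) * a\<^sup>2"
        using Taylor_exp[of "\<i> * of_real a" 1] by (intro mult_left_mono) (simp_all add: norm_mult power2_eq_square)
      also have "\<dots> \<le> (norm (y - x))\<^sup>2 * (M\<^sup>2 * cmod (\<kappa> \<xi>))"
      proof (cases "norm \<xi> > M")
        case False
        have "\<bar>a\<bar> \<le> norm (y - x) * norm \<xi>" unfolding a_def abs_minus_cancel by (rule Cauchy_Schwarz_ineq2)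
        hence "a\<^sup>2 \<le> (norm (y - x) * norm \<xi>)\<^sup>2" by (metis abs_ge_zero power2_abs power_mono)
        also have "\<dots> \<le> (norm (y - x))\<^sup>2 * M\<^sup>2" unfolding power_mult_distrib using False by (intro mult_left_mono power_mono) auto
        finally show ?thesis by (simp add: mult_right_mono mult.commute[of "cmod _"] flip: mult.assoc)
      qed (simp add: supp)
      finally show "norm (?r y \<xi>) \<le> (norm (y - x))\<^sup>2 * (M\<^sup>2 * cmod (\<kappa> \<xi>))" .
    qed simp
    also have "\<dots> = B * (norm (y - x))\<^sup>2" by (simp add: B_def)
    finally show ?thesis unfolding eq by (rule order_trans[OF integral_norm_bound])
  qed
  show ?thesis
    unfolding has_derivative_def
  proof (intro conjI bl)
    show "((\<lambda>y. (fourier \<kappa> y - fourier \<kappa> (Lim (at x) (\<lambda>x. x)) - fourier (\<lambda>\<xi>. - \<i> * of_real ((y - Lim (at x) (\<lambda>x. x)) \<bullet> \<xi>) * \<kappa> \<xi>) x) /\<^sub>R norm (y - Lim (at x) (\<lambda>x. x))) \<longlongrightarrow> 0) (at x)"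
    proof (rule Lim_null_comparison)
      have L: "Lim (at x) (\<lambda>x. x) = x" by (simp add: tendsto_Lim)
      show "\<forall>\<^sub>F y in at x. norm ((fourier \<kappa> y - fourier \<kappa> (Lim (at x) (\<lambda>x. x)) - fourier (\<lambda>\<xi>. - \<i> * of_real ((y - Lim (at x) (\<lambda>x. x)) \<bullet> \<xi>) * \<kappa> \<xi>) x) /\<^sub>R norm (y - Lim (at x) (\<lambda>x. x))) \<le> B * norm (y - x)"
        unfolding L using eventually_neq_at_within[of x]
      proof eventually_elim
        case (elim y)
        have "norm ((fourier \<kappa> y - fourier \<kappa> x - fourier (\<lambda>\<xi>. - \<i> * of_real ((y - x) \<bullet> \<xi>) * \<kappa> \<xi>) x) /\<^sub>R norm (y - x)) \<le> (B * (norm (y - x))\<^sup>2) / norm (y - x)"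
          using divide_right_mono[OF est[of y], of "norm (y - x)"] by (simp add: divide_inverse mult.commute)
        also have "\<dots> = B * norm (y - x)" using elim by (simp add: power2_eq_square)
        finally show ?case .
      qed
      have "((\<lambda>y. B * norm (y - x)) \<longlongrightarrow> B * norm (x - x)) (at x)" by (intro tendsto_intros)
      thus "((\<lambda>y. B * norm (y - x)) \<longlongrightarrow> 0) (at x)" by simp
    qed
  qed
qed

lemma times_cont_diff_fourier:
  fixes \<kappa> :: "'a::euclidean_space \<Rightarrow> complex"
  assumes "integrable lborel \<kappa>" "\<And>\<xi>. norm \<xi> > M \<Longrightarrow> \<kappa> \<xi> = 0"
  shows "times_cont_diff k (fourier \<kappa>)"
  using assms
proof (induction k arbitrary: \<kappa>)
  case 0 thus ?case by (simp add: continuous_fourier)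
next
  case (Suc k)
  show ?case
    by (rule times_cont_diff_SucI[OF fourier_bounded_support_has_derivative[OF Suc.prems]], assumption,
        rule Suc.IH, rule integrable_weight_bounded_support[OF Suc.prems], assumption, simp add: Suc.prems(2))
qed

text \<open>The factor \<open>exp 1\<close> makes the value at the origin equal to 1, so that
  dilations of the cutoff tend to 1 pointwise.\<close>

definition space_cutoff :: "'a::euclidean_space \<Rightarrow> complex" where
  "space_cutoff x = of_real (exp 1 * flat 0 (1 - (norm x)\<^sup>2))"

lemma times_cont_diff_space_cutoff: "times_cont_diff k (space_cutoff :: 'a::euclidean_space \<Rightarrow> complex)"
proof -
  have sums: "times_cont_diff k (\<lambda>x::'a. \<Sum>b\<in>B. f b x)" if "finite B" "\<And>b. b \<in> B \<Longrightarrow> times_cont_diff k (f b)" for B :: "'a set" and f :: "'a \<Rightarrow> 'a \<Rightarrow> real"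
    using that by (induction B rule: finite_induct) (auto intro: times_cont_diff_add)
  have "times_cont_diff k (\<lambda>x::'a. 1 + (-1) * (\<Sum>b\<in>Basis. (x \<bullet> b) * (x \<bullet> b)))"
    by (intro times_cont_diff_add times_cont_diff_const times_cont_diff_mult sums finite_Basis times_cont_diff_bounded_linear bounded_linear_inner_left)
  moreover have "(norm x)\<^sup>2 = (\<Sum>b\<in>Basis. (x \<bullet> b) * (x \<bullet> b))" for x :: 'a
    by (subst norm_sq_Basis) (simp add: power2_eq_square)
  ultimately have "times_cont_diff k (\<lambda>x::'a. 1 - (norm x)\<^sup>2)" by simp
  from times_cont_diff_comp_real[OF times_cont_diff_flat this]
  show ?thesis
    unfolding space_cutoff_def[abs_def] by (intro times_cont_diff_of_real times_cont_diff_mult times_cont_diff_const)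
qed

lemma space_cutoff_zero: "norm x \<ge> 1 \<Longrightarrow> space_cutoff x = 0"
  by (simp add: space_cutoff_def flat_zero one_le_power)

lemma space_cutoff_0: "space_cutoff 0 = 1"
  by (simp add: space_cutoff_def flat_def flip: exp_add of_real_mult)

section \<open>Distributional solutions on the Fourier side\<close>

lemma integrable_on_indicator_Icc:
  assumes "continuous_on {a..b} (f :: real \<Rightarrow> complex)"
  shows "integrable lborel (\<lambda>t. indicator {a..b} t *\<^sub>R f t)"
  using borel_integrable_compact[of "{a..b}" f] assms by simp

lemma mollifier_shift:
  fixes v :: "real \<Rightarrow> complex"
  assumes v: "continuous_on {0..} v" and b: "b > 0" and e: "\<epsilon> > 0"
  shows "integrable lborel (\<lambda>s. of_real (mollifier s) * v (b + \<epsilon> * s))"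
    and "integrable lborel (\<lambda>t. indicator {0<..} t *\<^sub>R (of_real (mollifier ((t - b) / \<epsilon>) / \<epsilon>) * v t))"
    and "(LINT t|lborel. indicator {0<..} t *\<^sub>R (of_real (mollifier ((t - b) / \<epsilon>) / \<epsilon>) * v t)) = (LINT s|lborel. of_real (mollifier s) * v (b + \<epsilon> * s))"
proof -
let ?h = "\<lambda>t. indicator {0<..} t *\<^sub>R (of_real (mollifier ((t - b) / \<epsilon>) / \<epsilon>) * v t)"
  have "continuous_on {0..1} (\<lambda>s. of_real (mollifier s) * v (b + \<epsilon> * s))"
    using b e by (intro continuous_intros mollifier_continuous continuous_on_compose2[OF v]) auto
  hence "integrable lborel (\<lambda>s. indicator {0..1} s *\<^sub>R (of_real (mollifier s) * v (b + \<epsilon> * s)))"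
    by (rule integrable_on_indicator_Icc)
  moreover have "indicator {0..1} s *\<^sub>R (of_real (mollifier s) * v (b + \<epsilon> * s)) = of_real (mollifier s) * v (b + \<epsilon> * s)" for s
    using mollifier_zero[of s] by (cases "s \<in> {0..1}") auto
  ultimately show i: "integrable lborel (\<lambda>s. of_real (mollifier s) * v (b + \<epsilon> * s))" by (simp only:)
  have eq: "?h t =
     of_real (1 / \<epsilon>) * (of_real (mollifier (- b / \<epsilon> + (1 / \<epsilon>) * t)) * v (b + \<epsilon> * (- b / \<epsilon> + (1 / \<epsilon>) * t)))" for t
  proof -
    have 1: "(t - b) / \<epsilon> = - b / \<epsilon> + (1 / \<epsilon>) * t" by (simp add: diff_divide_distrib)
    have 2: "b + \<epsilon> * (- b / \<epsilon> + (1 / \<epsilon>) * t) = t" using e by (simp add: field_simps)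
    show ?thesis
    proof (cases "t > 0")
      case True thus ?thesis unfolding 1 2 by (simp add: divide_inverse mult_ac)
    next
      case False
      hence "- b / \<epsilon> + (1 / \<epsilon>) * t \<le> 0" using b e unfolding 1[symmetric] by (simp add: divide_le_0_iff)
      hence "mollifier (- b / \<epsilon> + (1 / \<epsilon>) * t) = 0" by (intro mollifier_zero) simp
      thus ?thesis using False by simp
    qed
  qed
  show "integrable lborel (\<lambda>t. ?h t)"
    unfolding eq by (intro integrable_mult_right lborel_integrable_real_affine[OF i]) (use e in auto)
  show "(LINT t|lborel. ?h t) = (LINT s|lborel. of_real (mollifier s) * v (b + \<epsilon> * s))"
    unfolding eq integral_mult_right_zero
    using e by (subst (2) lborel_integral_real_affine[of "1 / \<epsilon>" _ "- b / \<epsilon>"]) (auto simp: scaleR_conv_of_real)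
qed

lemma mollifier_tendsto:
  fixes v :: "real \<Rightarrow> complex"
  assumes v: "continuous_on {0..} v" and b: "b > 0"
  shows "(\<lambda>n. LINT s|lborel. of_real (mollifier s) * v (b + inverse (real (Suc n)) * s)) \<longlonglongrightarrow> v b"
proof -
let ?h = "\<lambda>n s. of_real (mollifier s) * v (b + inverse (real (Suc n)) * s)"
  have "bounded (v ` {0..b + 1})"
    by (intro compact_imp_bounded compact_continuous_image continuous_on_subset[OF v]) auto
  then obtain B where "\<forall>y\<in>v ` {0..b + 1}. norm y \<le> B" unfolding bounded_iff by blast
  hence B: "cmod (v t) \<le> B" if "0 \<le> t" "t \<le> b + 1" for t using that by auto
  have "(\<lambda>n. LINT s|lborel. ?h n s) \<longlonglongrightarrow> (LINT s|lborel. of_real (mollifier s) * v b)"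
  proof (rule integral_dominated_convergence[where w="\<lambda>s. B * mollifier s"])
    show "integrable lborel (\<lambda>s. B * mollifier s)" by (intro integrable_mult_right mollifier_int)
    show "(\<lambda>s. of_real (mollifier s) * v b) \<in> borel_measurable lborel"
      using mollifier_int by (intro borel_measurable_times) auto
    show "(\<lambda>s. ?h n s) \<in> borel_measurable lborel" for n
      by (rule borel_measurable_integrable[OF mollifier_shift(1)[OF v b]]) simp
    show "AE s in lborel. (\<lambda>n. ?h n s) \<longlonglongrightarrow> of_real (mollifier s) * v b"
    proof (intro AE_I2 tendsto_mult tendsto_const)
      fix s :: real
      have "isCont v b" using continuous_on_interior[OF v, of b] b by simp
      moreover have "(\<lambda>n. b + inverse (real (Suc n)) * s) \<longlonglongrightarrow> b + 0 * s"
        by (intro tendsto_intros LIMSEQ_inverse_real_of_nat)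
      ultimately show "(\<lambda>n. v (b + inverse (real (Suc n)) * s)) \<longlonglongrightarrow> v b" by (intro isCont_tendsto_compose[of b v]) auto
    qed
    show "AE s in lborel. norm (?h n s) \<le> B * mollifier s" for n
    proof (intro AE_I2)
      fix s :: real
      show "norm (?h n s) \<le> B * mollifier s"
      proof (cases "s \<in> {0<..<1}")
        case True
        have "inverse (real (Suc n)) * s \<le> 1 * 1" using True by (intro mult_mono) (auto simp: inverse_le_1_iff)
        moreover have "0 \<le> inverse (real (Suc n)) * s" using True by (intro mult_nonneg_nonneg) auto
        ultimately have "cmod (v (b + inverse (real (Suc n)) * s)) \<le> B" using b by (intro B) auto
        thus ?thesis using mollifier_nonneg[of s] by (simp add: norm_mult mult.commute[of B] mult_left_mono)
      next
        case False
        hence "mollifier s = 0" by (intro mollifier_zero) auto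
        thus ?thesis by simp
      qed
    qed
  qed
  also have "(LINT s|lborel. of_real (mollifier s) * v b) = v b"
    by (simp add: mollifier_integral)
  finally show ?thesis .
qed

lemma time_cutoff_bounds: "\<bar>time_cutoff c d \<epsilon> t\<bar> \<le> 1"
  using smooth_step_bounds[of "(t - c) / \<epsilon>"] smooth_step_bounds[of "(t - d) / \<epsilon>"] by (simp add: time_cutoff_def)

lemma time_cutoff_left: "t \<le> c \<Longrightarrow> c \<le> d \<Longrightarrow> \<epsilon> > 0 \<Longrightarrow> time_cutoff c d \<epsilon> t = 0"
  by (simp add: time_cutoff_def smooth_step_0 divide_le_0_iff)

lemma time_cutoff_right: "t \<ge> d + \<epsilon> \<Longrightarrow> c \<le> d \<Longrightarrow> \<epsilon> > 0 \<Longrightarrow> time_cutoff c d \<epsilon> t = 0"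
  by (simp add: time_cutoff_def smooth_step_1 le_divide_eq)

lemma time_cutoff_tendsto:
  assumes "c < d" shows "(\<lambda>n. time_cutoff c d (inverse (real (Suc n))) t) \<longlonglongrightarrow> indicator {c<..d} t"
proof (rule tendsto_eventually)
  have small: "\<forall>\<^sub>F n in sequentially. inverse (real (Suc n)) < x" if "x > 0" for x :: real
    using order_tendstoD(2)[OF LIMSEQ_inverse_real_of_nat that] .
  consider "t \<le> c" | "c < t" "t \<le> d" | "t > d" by linarith
  thus "\<forall>\<^sub>F n in sequentially. time_cutoff c d (inverse (real (Suc n))) t = indicator {c<..d} t"
  proof cases
    case 1
    thus ?thesis using assms by (intro always_eventually allI) (simp add: time_cutoff_left)
  next
    case 2
    have "\<forall>\<^sub>F n in sequentially. inverse (real (Suc n)) < t - c" using 2 by (intro small) simp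
    thus ?thesis
    proof eventually_elim
      case (elim n)
      have "smooth_step ((t - c) / inverse (real (Suc n))) = 1"
        using elim by (intro smooth_step_1) (simp only: le_divide_eq inverse_positive_iff_positive of_nat_0_less_iff, simp)
      moreover have "smooth_step ((t - d) / inverse (real (Suc n))) = 0"
        using 2 by (intro smooth_step_0 divide_nonpos_pos) auto
      ultimately show ?case using 2 by (simp add: time_cutoff_def)
    qed
  next
    case 3
    have "\<forall>\<^sub>F n in sequentially. inverse (real (Suc n)) < t - d" using 3 by (intro small) simp
    thus ?thesis
    proof eventually_elim
      case (elim n)
      hence "time_cutoff c d (inverse (real (Suc n))) t = 0" using assms by (intro time_cutoff_right) auto
      thus ?case using 3 by simp
    qed
  qed
qed

section \<open>From the weak form in time to an integrated equation\<close>

context memory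
begin

definition memory_rhs :: "(real \<Rightarrow> complex) \<Rightarrow> real \<Rightarrow> complex" where
  "memory_rhs k t = of_real a0 * k t + (LINT r:{0<..<t}|lborel. of_real (a (t - r)) * k r)"

text \<open>Fubini: integrating over t first, for fixed r, turns \<open>a\<close> into its
  primitive, and together with the instantaneous term \<open>a0\<close> this gives A(T - r). The
  equation thereby loses the possibly singular kernel and keeps a bounded continuous one.\<close>

lemma memory_rhs_integral:
  fixes k :: "real \<Rightarrow> complex"
  assumes k: "continuous_on {0..} k" and T: "T > 0"
  shows "integrable lborel (\<lambda>t. indicator {0<..<T} t *\<^sub>R memory_rhs k t)"
    and "(LINT t|lborel. indicator {0<..<T} t *\<^sub>R memory_rhs k t) = (LINT r|lborel. indicator {0<..<T} r *\<^sub>R (of_real (A (T - r)) * k r))"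
proof -
  define kk where "kk r = indicator {0<..<T} r *\<^sub>R k r" for r
  define aa where "aa s = complex_of_real (indicator {0<..T} s * a s)" for s
  have ik: "integrable lborel kk"
  proof (rule Bochner_Integration.integrable_bound)
    show "integrable lborel (\<lambda>r. indicator {0..T} r *\<^sub>R k r)"
      by (intro integrable_on_indicator_Icc continuous_on_subset[OF k]) auto
    show "kk \<in> borel_measurable lborel" unfolding kk_def[abs_def]
      by (simp, rule borel_measurable_continuous_on_indicator) (auto intro: continuous_on_subset[OF k])
    show "AE r in lborel. norm (kk r) \<le> norm (indicator {0..T} r *\<^sub>R k r)"
      by (intro AE_I2) (auto simp: kk_def indicator_def)
  qed
  have ia: "integrable lborel aa"
    unfolding aa_def[abs_def] using a_integrable_Ioc[of T] by (simp only: complex_of_real_integrable_eq)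
  define h where "h r t = indicator {..<T} t *\<^sub>R (aa (t - r) * kk r)" for r t
  have ih: "integrable (lborel \<Otimes>\<^sub>M lborel) (\<lambda>(r, t). h r t)"
  proof (rule Bochner_Integration.integrable_bound[OF integrable_convolution_pair[OF ia ik]])
    have [measurable]: "aa \<in> borel_measurable borel" "kk \<in> borel_measurable borel" using ia ik by auto
    show "(\<lambda>(r, t). h r t) \<in> borel_measurable (lborel \<Otimes>\<^sub>M lborel)" unfolding h_def by measurable
    show "AE x in lborel \<Otimes>\<^sub>M lborel. norm (case x of (r, t) \<Rightarrow> h r t) \<le> norm (case x of (r, t) \<Rightarrow> aa (t - r) * kk r)"
      by (intro AE_I2) (auto simp: h_def indicator_def)
  qed
  have ht: "(LINT r|lborel. h r t) = indicator {0<..<T} t *\<^sub>R (LINT r:{0<..<t}|lborel. of_real (a (t - r)) * k r)" for t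
  proof -
    have "h r t = indicator {0<..<T} t *\<^sub>R (indicator {0<..<t} r *\<^sub>R (of_real (a (t - r)) * k r))" for r
      by (auto simp: h_def aa_def kk_def indicator_def)
    thus ?thesis by (simp only: set_lebesgue_integral_def integral_scaleR_right)
  qed
  have hr: "(LINT t|lborel. h r t) = kk r * of_real (A (T - r) - a0)" for r
  proof (cases "r \<in> {0<..<T}")
    case True
    have "(LINT t|lborel. h r t) = (LINT s|lborel. h r (r + 1 * s))"
      using lborel_integral_real_affine[of 1 "h r" r] by simp
    also have "\<dots> = (LINT s|lborel. kk r * of_real (indicator {0<..T - r} s * a s))"
    proof (rule integral_cong_AE)
      have [measurable]: "aa \<in> borel_measurable borel" using ia by auto
      show "(\<lambda>s. h r (r + 1 * s)) \<in> borel_measurable lborel" unfolding h_def by measurable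
      have [measurable]: "(\<lambda>s. indicator {0<..T - r} s * a s) \<in> borel_measurable lborel"
        using borel_measurable_integrable[OF a_integrable_Ioc[of "T - r"]] .
      show "(\<lambda>s. kk r * of_real (indicator {0<..T - r} s * a s)) \<in> borel_measurable lborel" by measurable
      show "AE s in lborel. h r (r + 1 * s) = kk r * of_real (indicator {0<..T - r} s * a s)"
        using AE_lborel_singleton[of "T - r"]
        by eventually_elim (use True in \<open>auto simp: h_def aa_def indicator_def\<close>)
    qed
    also have "\<dots> = kk r * of_real (A (T - r) - a0)"
      unfolding integral_mult_right_zero integral_complex_of_real A_eq by simp
    finally show ?thesis .
  qed (simp add: h_def kk_def)
  have im: "integrable lborel (\<lambda>t. indicator {0<..<T} t *\<^sub>R (LINT r:{0<..<t}|lborel. of_real (a (t - r)) * k r))"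
    using lborel_pair.integrable_snd[OF ih] unfolding ht .
  have split: "indicator {0<..<T} t *\<^sub>R memory_rhs k t = of_real a0 * kk t + indicator {0<..<T} t *\<^sub>R (LINT r:{0<..<t}|lborel. of_real (a (t - r)) * k r)" for t
    by (simp add: memory_rhs_def kk_def scaleR_add_right)
  show "integrable lborel (\<lambda>t. indicator {0<..<T} t *\<^sub>R memory_rhs k t)"
    unfolding split by (intro Bochner_Integration.integrable_add integrable_mult_right ik im)
  have ir: "integrable lborel (\<lambda>r. kk r * of_real (A (T - r) - a0))"
    using lborel_pair.integrable_fst[OF ih] unfolding hr .
  have "(LINT t|lborel. indicator {0<..<T} t *\<^sub>R memory_rhs k t) = (LINT r|lborel. of_real a0 * kk r) + (LINT r|lborel. kk r * of_real (A (T - r) - a0))"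
    unfolding split
    by (subst Bochner_Integration.integral_add[OF integrable_mult_right[OF ik] im])
       (simp only: ht[symmetric] lborel_pair.Fubini_integral[OF ih] hr)
  also have "\<dots> = (LINT r|lborel. of_real a0 * kk r + kk r * of_real (A (T - r) - a0))"
    by (rule Bochner_Integration.integral_add[OF integrable_mult_right[OF ik] ir, symmetric])
  also have "\<dots> = (LINT r|lborel. indicator {0<..<T} r *\<^sub>R (of_real (A (T - r)) * k r))"
    by (intro Bochner_Integration.integral_cong refl) (simp add: kk_def algebra_simps scaleR_conv_of_real)
  finally show "(LINT t|lborel. indicator {0<..<T} t *\<^sub>R memory_rhs k t) = (LINT r|lborel. indicator {0<..<T} r *\<^sub>R (of_real (A (T - r)) * k r))" .
qed

text \<open>As the width \<epsilon> shrinks, the mollified point masses give the increment of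
  \<open>v\<close> over (c, d] and the cutoff becomes an indicator. Test functions live at positive
  times, so the initial value enters only in a second limit, c to 0, by continuity of
  \<open>v\<close> at 0.\<close>

lemma weak_memory_equation:
  fixes v k :: "real \<Rightarrow> complex"
  assumes v: "continuous_on {0..} v" and k: "continuous_on {0..} k"
    and weak: "\<And>c d \<epsilon>. 0 < c \<Longrightarrow> c < d \<Longrightarrow> 0 < \<epsilon> \<Longrightarrow>
      - (LINT t:{0<..}|lborel. of_real ((mollifier ((t - c) / \<epsilon>) - mollifier ((t - d) / \<epsilon>)) / \<epsilon>) * v t) =
      (LINT t:{0<..}|lborel. of_real (time_cutoff c d \<epsilon> t) * memory_rhs k t)"
    and d: "d > 0"
  shows "v d - v 0 = (LINT r|lborel. indicator {0<..<d} r *\<^sub>R (of_real (A (d - r)) * k r))"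
proof -
  let ?q = "memory_rhs k"
  let ?e = "\<lambda>n. inverse (real (Suc n))"
  note iq = memory_rhs_integral(1)[OF k]
  have iq2: "integrable lborel (\<lambda>t. indicator {c<..d} t *\<^sub>R ?q t)" if "0 \<le> c" for c d
  proof (rule Bochner_Integration.integrable_bound[OF iq[of "\<bar>d\<bar> + 1"]])
    define G where "G = (\<lambda>t. indicator {0<..<\<bar>d\<bar> + 1} t *\<^sub>R ?q t)"
    have [measurable]: "G \<in> borel_measurable borel" using iq[of "\<bar>d\<bar> + 1"] by (auto simp: G_def)
    have "(\<lambda>t. indicator {c<..d} t *\<^sub>R ?q t) = (\<lambda>t. indicator {c<..d} t *\<^sub>R G t)"
      using that by (auto simp: indicator_def fun_eq_iff G_def)
    thus "(\<lambda>t. indicator {c<..d} t *\<^sub>R ?q t) \<in> borel_measurable lborel" by simp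
    show "AE t in lborel. norm (indicator {c<..d} t *\<^sub>R ?q t) \<le> norm (indicator {0<..<\<bar>d\<bar> + 1} t *\<^sub>R ?q t)"
      using that by (intro AE_I2) (auto simp: indicator_def)
  qed simp
  have step: "v d - v c = (LINT t|lborel. indicator {c<..d} t *\<^sub>R ?q t)" if c: "0 < c" "c < d" for c d
  proof -
  let ?h = "\<lambda>n t. indicator {0<..} t *\<^sub>R (of_real (time_cutoff c d (?e n) t) * ?q t)"
    have "(\<lambda>n. LINT t|lborel. ?h n t) \<longlonglongrightarrow> (LINT t|lborel. indicator {c<..d} t *\<^sub>R ?q t)"
    proof (rule integral_dominated_convergence[where w="\<lambda>t. norm (indicator {0<..<d + 2} t *\<^sub>R ?q t)"])
      have d2: "d + 2 > 0" using c by simp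
      have [measurable]: "(\<lambda>t. indicator {0<..<d + 2} t *\<^sub>R ?q t) \<in> borel_measurable borel" using iq[OF d2] by auto
      show "integrable lborel (\<lambda>t. norm (indicator {0<..<d + 2} t *\<^sub>R ?q t))" by (intro integrable_norm iq d2)
      show "(\<lambda>t. indicator {c<..d} t *\<^sub>R ?q t) \<in> borel_measurable lborel" using iq2[of c d] c by auto
      have [measurable]: "time_cutoff c d (?e n) \<in> borel_measurable borel" for n
        by (rule borel_measurable_continuous_onI) (use times_cont_diff_time_cutoff[of 0] in simp)
      \<comment> \<open>The widths are at most 1, so all cutoffs vanish from d + 1 on and one
        majorant serves for every \<open>n\<close>.\<close>
      have supp: "time_cutoff c d (?e n) t = 0" if "t \<ge> d + 2" for n t
        using c that by (intro time_cutoff_right) (auto intro: order_trans[of _ "d + 1"] simp: inverse_le_1_iff)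
      define G where "G = (\<lambda>t. indicator {0<..<d + 2} t *\<^sub>R ?q t)"
      have [measurable]: "G \<in> borel_measurable borel" using iq[OF d2] by (auto simp: G_def)
      have "(\<lambda>t. ?h n t) = (\<lambda>t. of_real (time_cutoff c d (?e n) t) * G t)" for n
        using supp[of _ n] by (auto simp: indicator_def fun_eq_iff not_less G_def)
      moreover have "(\<lambda>t. of_real (time_cutoff c d (?e n) t) * G t) \<in> borel_measurable lborel" for n by measurable
      ultimately show "(\<lambda>t. ?h n t) \<in> borel_measurable lborel" for n by (simp only:)
      show "AE t in lborel. (\<lambda>n. ?h n t) \<longlonglongrightarrow> indicator {c<..d} t *\<^sub>R ?q t"
      proof (intro AE_I2)
        fix t :: real
        have "(\<lambda>n. ?h n t) \<longlonglongrightarrow> indicator {0<..} t *\<^sub>R (of_real (indicator {c<..d} t) * ?q t)"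
          by (intro tendsto_intros time_cutoff_tendsto c)
        moreover have "indicator {0<..} t *\<^sub>R (of_real (indicator {c<..d} t) * ?q t) = indicator {c<..d} t *\<^sub>R ?q t"
          using c by (auto simp: indicator_def)
        ultimately show "(\<lambda>n. ?h n t) \<longlonglongrightarrow> indicator {c<..d} t *\<^sub>R ?q t" by simp
      qed
      show "AE t in lborel. norm (?h n t) \<le> norm (indicator {0<..<d + 2} t *\<^sub>R ?q t)" for n
      proof (intro AE_I2)
        fix t
        have "\<bar>time_cutoff c d (?e n) t\<bar> * cmod (?q t) \<le> 1 * cmod (?q t)"
          by (intro mult_right_mono time_cutoff_bounds) simp
        thus "norm (?h n t) \<le> norm (indicator {0<..<d + 2} t *\<^sub>R ?q t)"
          using supp[of t n] by (cases "t \<ge> d + 2") (auto simp: indicator_def norm_mult)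
      qed
    qed
    moreover have "(\<lambda>n. LINT t|lborel. ?h n t) \<longlonglongrightarrow> - (v c - v d)"
    proof -
      have "(LINT t|lborel. ?h n t) =
        - ((LINT s|lborel. of_real (mollifier s) * v (c + ?e n * s)) - (LINT s|lborel. of_real (mollifier s) * v (d + ?e n * s)))" for n
      proof -
        have e: "?e n > 0" by simp
        have d0: "d > 0" using c by simp
        have "(LINT t|lborel. ?h n t) =
          - (LINT t|lborel. indicator {0<..} t *\<^sub>R (of_real ((mollifier ((t - c) / ?e n) - mollifier ((t - d) / ?e n)) / ?e n) * v t))"
          using weak[OF c e] unfolding set_lebesgue_integral_def by (rule sym)
        also have "(LINT t|lborel. indicator {0<..} t *\<^sub>R (of_real ((mollifier ((t - c) / ?e n) - mollifier ((t - d) / ?e n)) / ?e n) * v t)) =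
          (LINT t|lborel. indicator {0<..} t *\<^sub>R (of_real (mollifier ((t - c) / ?e n) / ?e n) * v t) - indicator {0<..} t *\<^sub>R (of_real (mollifier ((t - d) / ?e n) / ?e n) * v t))"
          by (intro Bochner_Integration.integral_cong refl) (simp only: diff_divide_distrib of_real_diff left_diff_distrib scaleR_diff_right)
        also have "\<dots> = (LINT s|lborel. of_real (mollifier s) * v (c + ?e n * s)) - (LINT s|lborel. of_real (mollifier s) * v (d + ?e n * s))"
          unfolding Bochner_Integration.integral_diff[OF mollifier_shift(2)[OF v c(1) e] mollifier_shift(2)[OF v d0 e]]
            mollifier_shift(3)[OF v c(1) e] mollifier_shift(3)[OF v d0 e] ..
        finally show ?thesis .
      qed
      thus ?thesis using c by (simp only:) (intro tendsto_intros mollifier_tendsto v, auto)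
    qed
    ultimately have "(LINT t|lborel. indicator {c<..d} t *\<^sub>R ?q t) = - (v c - v d)" by (rule LIMSEQ_unique)
    thus ?thesis by simp
  qed
  \<comment> \<open>The double successor keeps \<open>X n\<close> strictly below \<open>d\<close>,
    already for n = 0.\<close>
  define X where "X n = d * inverse (real (Suc (Suc n)))" for n
  have X: "0 < X n" "X n < d" for n using d by (auto simp: X_def field_simps intro!: add_pos_nonneg)
  have Xl: "X \<longlonglongrightarrow> 0"
  proof -
    have "(\<lambda>n. d * inverse (real (Suc (Suc n)))) \<longlonglongrightarrow> d * 0"
      by (intro tendsto_intros LIMSEQ_Suc[OF LIMSEQ_inverse_real_of_nat])
    thus ?thesis by (simp add: X_def[abs_def])
  qed
  have l1: "(\<lambda>n. v d - v (X n)) \<longlonglongrightarrow> v d - v 0"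
    using X by (intro tendsto_intros continuous_on_tendsto_compose[OF v Xl] always_eventually allI) (auto intro: less_imp_le)
  have l2: "(\<lambda>n. LINT t|lborel. indicator {X n<..d} t *\<^sub>R ?q t) \<longlonglongrightarrow> (LINT t|lborel. indicator {0<..d} t *\<^sub>R ?q t)"
  proof (rule integral_dominated_convergence[where w="\<lambda>t. norm (indicator {0<..d} t *\<^sub>R ?q t)"])
    show "integrable lborel (\<lambda>t. norm (indicator {0<..d} t *\<^sub>R ?q t))" by (intro integrable_norm iq2) simp
    show "(\<lambda>t. indicator {0<..d} t *\<^sub>R ?q t) \<in> borel_measurable lborel" using iq2[of 0 d] by auto
    show "(\<lambda>t. indicator {X n<..d} t *\<^sub>R ?q t) \<in> borel_measurable lborel" for n using iq2[of "X n" d] X(1)[of n] by auto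
    show "AE t in lborel. (\<lambda>n. indicator {X n<..d} t *\<^sub>R ?q t) \<longlonglongrightarrow> indicator {0<..d} t *\<^sub>R ?q t"
    proof (intro AE_I2 tendsto_eventually)
      fix t :: real
      show "\<forall>\<^sub>F n in sequentially. indicator {X n<..d} t *\<^sub>R ?q t = indicator {0<..d} t *\<^sub>R ?q t"
      proof (cases "t > 0")
        case True
        show ?thesis by (rule eventually_mono[OF order_tendstoD(2)[OF Xl True]]) (use True in \<open>auto simp: indicator_def\<close>)
      next
        case False
        thus ?thesis using X(1) by (intro always_eventually allI) (auto simp: indicator_def intro: order.strict_trans)
      qed
    qed
    show "AE t in lborel. norm (indicator {X n<..d} t *\<^sub>R ?q t) \<le> norm (indicator {0<..d} t *\<^sub>R ?q t)" for n
      using X(1)[of n] by (intro AE_I2) (auto simp: indicator_def)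
  qed
  have "v d - v 0 = (LINT t|lborel. indicator {0<..d} t *\<^sub>R ?q t)"
    by (rule LIMSEQ_unique[OF l1]) (simp only: step[OF X] l2)
  also have "\<dots> = (LINT t|lborel. indicator {0<..<d} t *\<^sub>R ?q t)"
  proof (rule integral_cong_AE)
    show "(\<lambda>t. indicator {0<..d} t *\<^sub>R ?q t) \<in> borel_measurable lborel" using iq2[of 0 d] by auto
    show "(\<lambda>t. indicator {0<..<d} t *\<^sub>R ?q t) \<in> borel_measurable lborel" using iq[OF d] by auto
    show "AE t in lborel. indicator {0<..d} t *\<^sub>R ?q t = indicator {0<..<d} t *\<^sub>R ?q t"
      using AE_lborel_singleton[of d] by eventually_elim (auto simp: indicator_def)
  qed
  also have "\<dots> = (LINT r|lborel. indicator {0<..<d} r *\<^sub>R (of_real (A (d - r)) * k r))"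
    by (rule memory_rhs_integral(2)[OF k d])
  finally show ?thesis .
qed

end

section \<open>Compact support, product rules for the Laplacian, and L2 estimates\<close>

lemma compact_support_integrable:
  fixes h :: "'a::euclidean_space \<Rightarrow> complex"
  assumes c: "continuous_on UNIV h" and z: "\<And>x. norm x > R \<Longrightarrow> h x = 0"
  shows "integrable lborel h" and "square_integrable h" and "\<exists>B. \<forall>x. cmod (h x) \<le> B"
proof -
  have "integrable lborel (\<lambda>x. indicator (cball 0 R) x *\<^sub>R h x)"
    by (intro borel_integrable_compact compact_cball continuous_on_subset[OF c]) auto
  moreover have "indicator (cball 0 R) x *\<^sub>R h x = h x" for x using z[of x] by (auto simp: indicator_def not_le)
  ultimately show i: "integrable lborel h" by (simp only:)
  have "integrable lborel (\<lambda>x. indicator (cball 0 R) x *\<^sub>R (cmod (h x))\<^sup>2)"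
    by (intro borel_integrable_compact compact_cball continuous_on_subset[OF c] continuous_intros) auto
  moreover have "indicator (cball 0 R) x *\<^sub>R (cmod (h x))\<^sup>2 = (cmod (h x))\<^sup>2" for x using z[of x] by (auto simp: indicator_def not_le)
  ultimately have "integrable lborel (\<lambda>x. (cmod (h x))\<^sup>2)" by (simp only:)
  thus "square_integrable h" using i unfolding square_integrable_def by auto
  have "bounded (h ` cball 0 R)" by (intro compact_imp_bounded compact_continuous_image continuous_on_subset[OF c]) auto
  then obtain B where B: "\<forall>y\<in>h ` cball 0 R. norm y \<le> B" unfolding bounded_iff by blast
  have "cmod (h x) \<le> max B 0" for x
  proof (cases "norm x > R")
    case True thus ?thesis by (simp add: z)
  next
    case False thus ?thesis using B by (auto simp: le_max_iff_disj)
  qed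
  thus "\<exists>B. \<forall>x. cmod (h x) \<le> B" by blast
qed

lemma directional_deriv_support:
  assumes z: "\<And>x. norm x > R \<Longrightarrow> f x = 0" and x: "norm x > R"
  shows "directional_deriv v f x = 0"
proof -
  have "((\<lambda>x. 0) has_derivative (\<lambda>v. 0)) (at x)" by simp
  hence "(f has_derivative (\<lambda>v. 0)) (at x)"
  proof (rule has_derivative_transform_within_open)
    show "open {x. norm x > R}" by (intro open_Collect_less continuous_intros)
    show "x \<in> {x. norm x > R}" using x by simp
    show "\<And>x. x \<in> {x. norm x > R} \<Longrightarrow> 0 = f x" using z by simp
  qed
  from directional_deriv_eq[OF this] show ?thesis .
qed

lemma directional_deriv_mult:
  fixes f g :: "'a::euclidean_space \<Rightarrow> complex"
  assumes "times_cont_diff (Suc 0) f" "times_cont_diff (Suc 0) g"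
  shows "directional_deriv v (\<lambda>x. f x * g x) = (\<lambda>x. f x * directional_deriv v g x + directional_deriv v f x * g x)"
proof
  fix x
  show "directional_deriv v (\<lambda>x. f x * g x) x = f x * directional_deriv v g x + directional_deriv v f x * g x"
    using directional_deriv_eq[OF has_derivative_mult[OF times_cont_diff_SucD(1)[OF assms(1), of x] times_cont_diff_SucD(1)[OF assms(2), of x]], of v] .
qed

lemma directional_deriv_add:
  fixes f g :: "'a::euclidean_space \<Rightarrow> complex"
  assumes "times_cont_diff (Suc 0) f" "times_cont_diff (Suc 0) g"
  shows "directional_deriv v (\<lambda>x. f x + g x) = (\<lambda>x. directional_deriv v f x + directional_deriv v g x)"
proof
  fix x
  show "directional_deriv v (\<lambda>x. f x + g x) x = directional_deriv v f x + directional_deriv v g x"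
    using directional_deriv_eq[OF has_derivative_add[OF times_cont_diff_SucD(1)[OF assms(1), of x] times_cont_diff_SucD(1)[OF assms(2), of x]], of v] .
qed

lemma directional_deriv_scaled:
  fixes f :: "'a::euclidean_space \<Rightarrow> complex"
  assumes "times_cont_diff (Suc 0) f"
  shows "directional_deriv v (\<lambda>x. f (c *\<^sub>R x)) = (\<lambda>x. of_real c * directional_deriv v f (c *\<^sub>R x))"
proof
  fix x :: 'a
  have L: "((\<lambda>x. c *\<^sub>R x) has_derivative (\<lambda>x. c *\<^sub>R x)) (at x)" by (intro derivative_intros)
  have "directional_deriv v (\<lambda>x. f (c *\<^sub>R x)) x = directional_deriv (c *\<^sub>R v) f (c *\<^sub>R x)"
    by (rule directional_deriv_eq[OF has_derivative_compose[OF L times_cont_diff_SucD(1)[OF assms]]])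
  also have "\<dots> = c *\<^sub>R directional_deriv v f (c *\<^sub>R x)"
    by (rule linear_scale[OF has_derivative_linear[OF times_cont_diff_SucD(1)[OF assms]]])
  finally show "directional_deriv v (\<lambda>x. f (c *\<^sub>R x)) x = of_real c * directional_deriv v f (c *\<^sub>R x)"
    by (simp add: scaleR_conv_of_real)
qed

lemma directional_deriv_cmult:
  fixes f :: "'a::euclidean_space \<Rightarrow> complex"
  assumes "times_cont_diff (Suc 0) f"
  shows "directional_deriv v (\<lambda>x. c * f x) = (\<lambda>x. c * directional_deriv v f x)"
  using directional_deriv_eq[OF has_derivative_mult_right[OF times_cont_diff_SucD(1)[OF assms]]] by (intro ext)

lemma times_cont_diff_Suc_0:
  assumes "times_cont_diff 2 f" shows "times_cont_diff (Suc 0) f" "times_cont_diff (Suc 0) (directional_deriv v f)" "continuous_on UNIV f"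
proof -
  from assms have *: "times_cont_diff (Suc (Suc 0)) f" by (simp only: numeral_2_eq_2)
  show "times_cont_diff (Suc 0) f" by (rule times_cont_diff_mono1[OF *])
  from times_cont_diff_mono1[OF this] show "continuous_on UNIV f" by simp
  show "times_cont_diff (Suc 0) (directional_deriv v f)" by (rule times_cont_diff_SucD(2)[OF *])
qed

lemma continuous_directional_deriv:
  assumes "times_cont_diff (Suc 0) f" shows "continuous_on UNIV (directional_deriv v f)"
  using times_cont_diff_SucD(2)[OF assms] by simp

lemma laplacian_cmult:
  assumes f: "times_cont_diff 2 f" shows "laplacian (\<lambda>x. c * f x) = (\<lambda>x. c * laplacian f x)"
  unfolding laplacian_def directional_deriv_cmult[OF times_cont_diff_Suc_0(1)[OF f]] directional_deriv_cmult[OF times_cont_diff_Suc_0(2)[OF f]] sum_distrib_left ..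

lemma laplacian_support:
  assumes z: "\<And>x. norm x > R \<Longrightarrow> f x = 0" and x: "norm x > R"
  shows "laplacian f x = 0"
  unfolding laplacian_def by (intro sum.neutral ballI directional_deriv_support[of R] z x)

lemma continuous_laplacian:
  assumes "times_cont_diff 2 f" shows "continuous_on UNIV (laplacian f)"
  unfolding laplacian_def[abs_def] by (intro continuous_on_sum continuous_directional_deriv times_cont_diff_Suc_0(2)[OF assms])

lemma laplacian_mult:
  fixes f g :: "'a::euclidean_space \<Rightarrow> complex"
  assumes f: "times_cont_diff 2 f" and g: "times_cont_diff 2 g"
  shows "laplacian (\<lambda>x. f x * g x) x = f x * laplacian g x +
    (\<Sum>b\<in>Basis. 2 * directional_deriv b f x * directional_deriv b g x + directional_deriv b (directional_deriv b f) x * g x)"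
proof -
  note f' = times_cont_diff_Suc_0[OF f] and g' = times_cont_diff_Suc_0[OF g]
  have "directional_deriv b (directional_deriv b (\<lambda>x. f x * g x)) x = f x * directional_deriv b (directional_deriv b g) x +
     (2 * directional_deriv b f x * directional_deriv b g x + directional_deriv b (directional_deriv b f) x * g x)" for b
    unfolding directional_deriv_mult[OF f'(1) g'(1)]
    by (subst directional_deriv_add[OF times_cont_diff_mult[OF f'(1) g'(2)] times_cont_diff_mult[OF f'(2) g'(1)]])
       (simp only: directional_deriv_mult[OF f'(1) g'(2)] directional_deriv_mult[OF f'(2) g'(1)], simp add: algebra_simps)
  thus ?thesis unfolding laplacian_def by (simp only: sum.distrib sum_distrib_left)
qed

lemma l2norm_mono:
  assumes g: "square_integrable g" and f: "f \<in> borel_measurable borel" and le: "\<And>x. cmod (f x) \<le> cmod (g x)"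
  shows "l2norm f \<le> l2norm g"
proof -
  have "square_integrable f" by (rule square_integrable_bound[OF g f, of 1]) (simp add: le)
  thus ?thesis unfolding l2norm_def using g
    by (intro real_sqrt_le_mono integral_mono power_mono le) (auto simp: square_integrable_def)
qed

lemma l2norm_Cauchy_Schwarz_abs:
  assumes f: "square_integrable f" and g: "square_integrable g"
  shows "(LINT x|lborel. cmod (f x * g x)) \<le> l2norm f * l2norm g"
proof -
  have [measurable]: "f \<in> borel_measurable borel" "g \<in> borel_measurable borel"
    using f g by (auto intro: square_integrable_measurable)
  have sq: "square_integrable (\<lambda>x. complex_of_real (cmod (f x)))" "square_integrable (\<lambda>x. complex_of_real (cmod (g x)))"
    using f g by (auto simp: square_integrable_def)
  have "(LINT x|lborel. complex_of_real (cmod (f x)) * complex_of_real (cmod (g x))) = of_real (LINT x|lborel. cmod (f x * g x))"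
    by (simp add: norm_mult flip: of_real_mult integral_complex_of_real)
  moreover have "0 \<le> (LINT x|lborel. cmod (f x * g x))" by simp
  ultimately show ?thesis
    using l2norm_Cauchy_Schwarz[OF sq] by (simp add: l2norm_def)
qed

lemma l2norm_triangle:
  assumes f: "square_integrable f" and g: "square_integrable g"
  shows "l2norm f \<le> l2norm (\<lambda>x. f x - g x) + l2norm g"
proof (rule power2_le_imp_le)
  define h where "h = (\<lambda>x. f x - g x)"
  have h: "square_integrable h" unfolding h_def by (rule square_integrable_diff[OF f g])
  have if2: "integrable lborel (\<lambda>x. (cmod (f x))\<^sup>2)" and ih: "integrable lborel (\<lambda>x. (cmod (h x))\<^sup>2)" and ig: "integrable lborel (\<lambda>x. (cmod (g x))\<^sup>2)"
    using f g h by (auto simp: square_integrable_def)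
  have ihg: "integrable lborel (\<lambda>x. cmod (h x * g x))" by (intro integrable_norm square_integrable_mult h g)
  have "(l2norm f)\<^sup>2 \<le> (LINT x|lborel. (cmod (h x))\<^sup>2 + (2 * cmod (h x * g x) + (cmod (g x))\<^sup>2))"
    unfolding l2norm_sq
  proof (rule integral_mono[OF if2])
    show "integrable lborel (\<lambda>x. (cmod (h x))\<^sup>2 + (2 * cmod (h x * g x) + (cmod (g x))\<^sup>2))"
      by (intro Bochner_Integration.integrable_add integrable_mult_right ih ig ihg)
    fix x
    have "cmod (f x) \<le> cmod (h x) + cmod (g x)" using norm_triangle_ineq[of "h x" "g x"] by (simp add: h_def)
    hence "(cmod (f x))\<^sup>2 \<le> (cmod (h x) + cmod (g x))\<^sup>2" by (rule power_mono) simp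
    thus "(cmod (f x))\<^sup>2 \<le> (cmod (h x))\<^sup>2 + (2 * cmod (h x * g x) + (cmod (g x))\<^sup>2)"
      by (simp add: power2_sum norm_mult)
  qed
  also have "\<dots> = (l2norm h)\<^sup>2 + (2 * (LINT x|lborel. cmod (h x * g x)) + (l2norm g)\<^sup>2)"
    unfolding l2norm_sq using ih ig ihg by (simp add: Bochner_Integration.integral_add)
  also have "(LINT x|lborel. cmod (h x * g x)) \<le> l2norm h * l2norm g" by (rule l2norm_Cauchy_Schwarz_abs[OF h g])
  finally show "(l2norm f)\<^sup>2 \<le> (l2norm (\<lambda>x. f x - g x) + l2norm g)\<^sup>2"
    unfolding h_def[symmetric] power2_sum by linarith
qed simp

lemma pairing_diff:
  assumes "square_integrable f" "square_integrable g" "square_integrable h"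
  shows "pairing (\<lambda>x. f x - g x) h = pairing f h - pairing g h"
  unfolding pairing_def left_diff_distrib
  by (intro Bochner_Integration.integral_diff square_integrable_mult assms)

lemma pairing_cmult: "pairing f (\<lambda>x. c * g x) = c * pairing f g"
  unfolding pairing_def mult.left_commute[of _ c] by simp

lemma pairing_bound:
  assumes f: "square_integrable f" and g: "square_integrable g"
  shows "cmod (pairing f g) \<le> l2norm f * l2norm g"
  unfolding pairing_def by (rule l2norm_Cauchy_Schwarz[OF f g])

section \<open>Cutting off a band-limited test function\<close>

text \<open>The Fourier transform of a density with bounded support is smooth but in general not
  compactly supported, hence not admissible in the weak form. A dilated cutoff repairs this at the
  price of a limit.\<close>

definition cut :: "nat \<Rightarrow> ('a::euclidean_space \<Rightarrow> complex) \<Rightarrow> 'a \<Rightarrow> complex" where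
  "cut n \<psi> x = space_cutoff (inverse (real (Suc n)) *\<^sub>R x) * \<psi> x"

lemma times_cont_diff_cut: "times_cont_diff k \<psi> \<Longrightarrow> times_cont_diff k (cut n \<psi>)"
  unfolding cut_def[abs_def]
  by (intro times_cont_diff_mult times_cont_diff_linear_comp[OF bounded_linear_scaleR_right] times_cont_diff_space_cutoff)

lemma cut_zero: "norm x > real (Suc n) \<Longrightarrow> cut n \<psi> x = 0"
  unfolding cut_def by (subst space_cutoff_zero) (auto simp: field_simps)

lemma scaled_tendsto:
  fixes h :: "'a::euclidean_space \<Rightarrow> complex"
  assumes "continuous_on UNIV h"
  shows "(\<lambda>n. h (inverse (real (Suc n)) *\<^sub>R x)) \<longlonglongrightarrow> h 0"
proof -
  have "(\<lambda>n. inverse (real (Suc n)) *\<^sub>R x) \<longlonglongrightarrow> 0 *\<^sub>R x" by (intro tendsto_intros LIMSEQ_inverse_real_of_nat)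
  thus ?thesis using continuous_on_tendsto_compose[OF assms, of "\<lambda>n. inverse (real (Suc n)) *\<^sub>R x" 0] by simp
qed

lemma cut_tendsto: "(\<lambda>n. cut n \<psi> x) \<longlonglongrightarrow> \<psi> x"
proof -
  have "(\<lambda>n. cut n \<psi> x) \<longlonglongrightarrow> space_cutoff (0::'a) * \<psi> x" unfolding cut_def
    using times_cont_diff_space_cutoff[of 0] by (intro tendsto_mult tendsto_const scaled_tendsto) simp
  thus ?thesis by (simp add: space_cutoff_0)
qed

lemma space_cutoff_bounds:
  obtains C where "C > 0" "\<And>x::'a::euclidean_space. cmod (space_cutoff x) \<le> C"
    "\<And>x b. b \<in> Basis \<Longrightarrow> cmod (directional_deriv b (space_cutoff :: 'a \<Rightarrow> complex) x) \<le> C"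
    "\<And>x b. b \<in> Basis \<Longrightarrow> cmod (directional_deriv b (directional_deriv b (space_cutoff :: 'a \<Rightarrow> complex)) x) \<le> C"
proof -
  let ?e = "space_cutoff :: 'a \<Rightarrow> complex"
  have z: "\<And>x. norm x > 1 \<Longrightarrow> ?e x = 0" by (simp add: space_cutoff_zero)
  note e = times_cont_diff_Suc_0[OF times_cont_diff_space_cutoff]
  have br: "bounded (range h)" if "\<exists>B. \<forall>x. cmod (h x) \<le> B" for h :: "'a \<Rightarrow> complex"
    using that by (auto simp: bounded_iff)
  have "bounded (range ?e \<union> ((\<Union>b\<in>Basis. range (directional_deriv b ?e)) \<union> (\<Union>b\<in>Basis. range (directional_deriv b (directional_deriv b ?e)))))"
    unfolding bounded_Un
    by (intro conjI bounded_UN finite_Basis ballI br compact_support_integrable(3)[of _ 1] e continuous_directional_deriv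
        directional_deriv_support[of 1] z)
  then obtain C where "C > 0" "\<forall>y\<in>range ?e \<union> ((\<Union>b\<in>Basis. range (directional_deriv b ?e)) \<union> (\<Union>b\<in>Basis. range (directional_deriv b (directional_deriv b ?e)))). norm y \<le> C"
    unfolding bounded_pos by blast
  thus ?thesis by (intro that[of C]) (assumption, blast, blast, blast)
qed

text \<open>Each derivative that falls on the dilated cutoff brings a factor 1 / (n + 1), so only
  the Laplacian of \<open>\<psi>\<close> survives in the limit. As these factors are at most 1, the
  majorant is uniform in \<open>n\<close>; it consists of functions that are square integrable when
  \<open>\<psi>\<close> is band-limited.\<close>

lemma laplacian_cut:
  fixes \<psi> :: "'a::euclidean_space \<Rightarrow> complex"
  assumes \<psi>: "times_cont_diff 2 \<psi>"
  shows "(\<lambda>n. laplacian (cut n \<psi>) x) \<longlonglongrightarrow> laplacian \<psi> x"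
    and "\<exists>C>0. \<forall>n x. cmod (cut n \<psi> x) \<le> C * cmod (\<psi> x) \<and>
      cmod (laplacian (cut n \<psi>) x) \<le> C * (cmod (laplacian \<psi> x) + (\<Sum>b\<in>Basis. 2 * cmod (directional_deriv b \<psi> x) + cmod (\<psi> x)))"
proof -
  let ?e = "space_cutoff :: 'a \<Rightarrow> complex"
  let ?r = "\<lambda>n. inverse (real (Suc n))"
  let ?w = "\<lambda>x. cmod (laplacian \<psi> x) + (\<Sum>b\<in>Basis. 2 * cmod (directional_deriv b \<psi> x) + cmod (\<psi> x))"
  note e = times_cont_diff_Suc_0[OF times_cont_diff_space_cutoff[where 'a='a]]
  have s2: "times_cont_diff 2 (\<lambda>x. ?e (?r n *\<^sub>R x))" for n
    by (intro times_cont_diff_linear_comp[OF bounded_linear_scaleR_right] times_cont_diff_space_cutoff)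
  have s1: "times_cont_diff (Suc 0) (\<lambda>x. directional_deriv b ?e (?r n *\<^sub>R x))" for n b
    by (intro times_cont_diff_linear_comp[OF bounded_linear_scaleR_right] e)
  have eq: "laplacian (cut n \<psi>) x = ?e (?r n *\<^sub>R x) * laplacian \<psi> x +
    (\<Sum>b\<in>Basis. 2 * (of_real (?r n) * directional_deriv b ?e (?r n *\<^sub>R x)) * directional_deriv b \<psi> x +
       of_real (?r n) * (of_real (?r n) * directional_deriv b (directional_deriv b ?e) (?r n *\<^sub>R x)) * \<psi> x)" for n x
    unfolding cut_def[abs_def] laplacian_mult[OF s2 \<psi>] directional_deriv_scaled[OF e(1)] directional_deriv_cmult[OF s1] directional_deriv_scaled[OF e(2)] ..
  have "(\<lambda>n. laplacian (cut n \<psi>) x) \<longlonglongrightarrow> ?e 0 * laplacian \<psi> x +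
    (\<Sum>b\<in>Basis. 2 * (of_real 0 * directional_deriv b ?e 0) * directional_deriv b \<psi> x +
       of_real 0 * (of_real 0 * directional_deriv b (directional_deriv b ?e) 0) * \<psi> x)"
    unfolding eq
    by (intro tendsto_add tendsto_mult tendsto_sum tendsto_const tendsto_of_real LIMSEQ_inverse_real_of_nat scaled_tendsto e continuous_directional_deriv)
  thus "(\<lambda>n. laplacian (cut n \<psi>) x) \<longlonglongrightarrow> laplacian \<psi> x" by (simp add: space_cutoff_0)
  obtain C where C: "C > 0" "\<And>x::'a. cmod (?e x) \<le> C" "\<And>x b. b \<in> Basis \<Longrightarrow> cmod (directional_deriv b ?e x) \<le> C"
    "\<And>x b. b \<in> Basis \<Longrightarrow> cmod (directional_deriv b (directional_deriv b ?e) x) \<le> C"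
    using space_cutoff_bounds[where 'a='a] by blast
  have r: "0 \<le> ?r n" "?r n \<le> 1" for n by (auto simp: inverse_le_1_iff)
  have "cmod (laplacian (cut n \<psi>) x) \<le> C * (?w x)" for n x
  proof -
    have b: "cmod (2 * (of_real (?r n) * directional_deriv b ?e (?r n *\<^sub>R x)) * directional_deriv b \<psi> x +
       of_real (?r n) * (of_real (?r n) * directional_deriv b (directional_deriv b ?e) (?r n *\<^sub>R x)) * \<psi> x)
      \<le> C * (2 * cmod (directional_deriv b \<psi> x) + cmod (\<psi> x))" if "b \<in> Basis" for b
    proof -
      have 1: "?r n * cmod (directional_deriv b ?e (?r n *\<^sub>R x)) \<le> 1 * C"
        using C(1) by (intro mult_mono C r that) auto
      have 2: "?r n * (?r n * cmod (directional_deriv b (directional_deriv b ?e) (?r n *\<^sub>R x))) \<le> 1 * (1 * C)"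
        using C(1) by (intro mult_mono C r that mult_nonneg_nonneg) auto
      have "cmod (2 * (of_real (?r n) * directional_deriv b ?e (?r n *\<^sub>R x)) * directional_deriv b \<psi> x) \<le> C * (2 * cmod (directional_deriv b \<psi> x))"
        using mult_right_mono[OF 1, of "2 * cmod (directional_deriv b \<psi> x)"] r(1)[of n] by (simp only: norm_mult norm_of_real abs_of_nonneg norm_numeral) (simp only: ac_simps mult_1, simp)
      moreover have "cmod (of_real (?r n) * (of_real (?r n) * directional_deriv b (directional_deriv b ?e) (?r n *\<^sub>R x)) * \<psi> x) \<le> C * cmod (\<psi> x)"
        using mult_right_mono[OF 2, of "cmod (\<psi> x)"] r(1)[of n] by (simp only: norm_mult norm_of_real abs_of_nonneg mult_1) simp
      ultimately show ?thesis unfolding distrib_left by (rule norm_triangle_mono)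
    qed
    show ?thesis unfolding eq distrib_left sum_distrib_left
    proof (rule norm_triangle_mono)
      show "cmod (?e (?r n *\<^sub>R x) * laplacian \<psi> x) \<le> C * cmod (laplacian \<psi> x)"
        unfolding norm_mult by (intro mult_right_mono C) simp
    qed (use b in \<open>intro sum_norm_le, simp only: distrib_left\<close>)
  qed
  moreover have "cmod (cut n \<psi> x) \<le> C * cmod (\<psi> x)" for n x
    unfolding cut_def norm_mult by (intro mult_right_mono C) simp
  ultimately show "\<exists>C>0. \<forall>n x. cmod (cut n \<psi> x) \<le> C * cmod (\<psi> x) \<and>
      cmod (laplacian (cut n \<psi>) x) \<le> C * (?w x)"
    using C(1) by blast
qed

lemma square_integrable_cmult:
  assumes f: "square_integrable f" and g: "g \<in> borel_measurable borel" and b: "\<And>x. cmod (f x) \<noteq> 0 \<Longrightarrow> cmod (g x) \<le> C"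
  shows "square_integrable (\<lambda>x. g x * f x)"
proof (rule square_integrable_bound[OF f, of _ C])
  show "(\<lambda>x. g x * f x) \<in> borel_measurable borel"
    using g square_integrable_measurable[OF f] by measurable
  have "cmod (g x * f x) \<le> C * cmod (f x)" for x
    using b[of x] by (cases "f x = 0") (auto simp: norm_mult intro: mult_right_mono)
  thus "AE x in lborel. cmod (g x * f x) \<le> C * cmod (f x)" by simp
qed

lemma square_integrable_add:
  assumes f: "square_integrable f" and g: "square_integrable g"
  shows "square_integrable (\<lambda>x. f x + g x)"
  using square_integrable_diff[OF f square_integrable_cmult[OF g, of "\<lambda>x. - 1" 1]] by simp

lemma square_integrable_sum:
  assumes "finite B" "\<And>b. b \<in> B \<Longrightarrow> square_integrable (f b)"
  shows "square_integrable (\<lambda>x. \<Sum>b\<in>B. f b x)"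
  using assms
proof (induction B rule: finite_induct)
  case empty thus ?case by (simp add: square_integrable_def)
next
  case (insert b B) thus ?case by (simp add: square_integrable_add)
qed

lemma square_integrable_cmod: "square_integrable f \<Longrightarrow> square_integrable (\<lambda>x. complex_of_real (cmod (f x)))"
  by (auto simp: square_integrable_def)

lemma pairing_LIMSEQ:
  assumes f: "square_integrable f" and w: "square_integrable w"
    and m: "\<And>n. g n \<in> borel_measurable borel" "h \<in> borel_measurable borel"
    and b: "\<And>n x. cmod (g n x) \<le> cmod (w x)" and l: "\<And>x. (\<lambda>n. g n x) \<longlonglongrightarrow> h x"
  shows "(\<lambda>n. pairing f (g n)) \<longlonglongrightarrow> pairing f h"
  unfolding pairing_def
proof (rule integral_dominated_convergence[where w="\<lambda>x. cmod (f x * w x)"])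
  have [measurable]: "f \<in> borel_measurable borel" using f by (rule square_integrable_measurable)
  note [measurable] = m
  show "(\<lambda>x. f x * h x) \<in> borel_measurable lborel" "\<And>n. (\<lambda>x. f x * g n x) \<in> borel_measurable lborel" by measurable
  show "integrable lborel (\<lambda>x. cmod (f x * w x))" by (intro integrable_norm square_integrable_mult f w)
  show "AE x in lborel. (\<lambda>n. f x * g n x) \<longlonglongrightarrow> f x * h x" by (intro AE_I2 tendsto_mult tendsto_const l)
  show "AE x in lborel. norm (f x * g n x) \<le> cmod (f x * w x)" for n
    unfolding norm_mult by (intro AE_I2 mult_left_mono b) simp
qed

text \<open>The function \<open>\<kappa>\<close> lives on the frequency side and
  \<open>fourier \<kappa>\<close> is the band-limited function. On such densities multiplication by
  |\<xi>|^2, that is, the Laplacian up to sign, is a bounded operator.\<close>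

definition band_limited :: "real \<Rightarrow> ('a::euclidean_space \<Rightarrow> complex) \<Rightarrow> bool" where
  "band_limited R \<kappa> \<longleftrightarrow> square_integrable \<kappa> \<and> (\<forall>\<xi>. norm \<xi> > R \<longrightarrow> \<kappa> \<xi> = 0)"

lemma band_limitedD:
  fixes \<kappa> :: "'a::euclidean_space \<Rightarrow> complex"
  assumes "band_limited R \<kappa>"
  shows "square_integrable \<kappa>" "norm \<xi> > R \<Longrightarrow> \<kappa> \<xi> = 0" "integrable lborel \<kappa>"
proof -
  show s: "square_integrable \<kappa>" "norm \<xi> > R \<Longrightarrow> \<kappa> \<xi> = 0" using assms by (auto simp: band_limited_def)
  have "indicator (ball 0 (R + 1)) \<xi> * \<kappa> \<xi> = \<kappa> \<xi>" for \<xi> :: 'a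
    using assms by (auto simp: band_limited_def indicator_def)
  with integrable_bounded_support[OF s(1), of "R + 1"] show "integrable lborel \<kappa>" by (simp only:)
qed

lemma band_limited_mult:
  assumes \<kappa>: "band_limited R \<kappa>" and g: "g \<in> borel_measurable borel" and b: "\<And>\<xi>. norm \<xi> \<le> R \<Longrightarrow> cmod (g \<xi>) \<le> C"
  shows "band_limited R (\<lambda>\<xi>. g \<xi> * \<kappa> \<xi>)" "l2norm (\<lambda>\<xi>. g \<xi> * \<kappa> \<xi>) \<le> \<bar>C\<bar> * l2norm \<kappa>"
proof -
  have b': "cmod (g x) \<le> C" if "cmod (\<kappa> x) \<noteq> 0" for x
    using that b[of x] band_limitedD(2)[OF \<kappa>, of x] by fastforce
  have s: "square_integrable (\<lambda>\<xi>. g \<xi> * \<kappa> \<xi>)"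
    using square_integrable_cmult[OF band_limitedD(1)[OF \<kappa>] g b'] by simp
  thus "band_limited R (\<lambda>\<xi>. g \<xi> * \<kappa> \<xi>)" using \<kappa> by (auto simp: band_limited_def)
  have "(l2norm (\<lambda>\<xi>. g \<xi> * \<kappa> \<xi>))\<^sup>2 \<le> (LINT \<xi>|lborel. \<bar>C\<bar>\<^sup>2 * (cmod (\<kappa> \<xi>))\<^sup>2)"
    unfolding l2norm_sq
  proof (rule integral_mono)
    show "integrable lborel (\<lambda>\<xi>. (cmod (g \<xi> * \<kappa> \<xi>))\<^sup>2)" using s by (simp add: square_integrable_def)
    show "integrable lborel (\<lambda>\<xi>. \<bar>C\<bar>\<^sup>2 * (cmod (\<kappa> \<xi>))\<^sup>2)" using band_limitedD(1)[OF \<kappa>] by (simp add: square_integrable_def)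
    fix \<xi>
    have "cmod (g \<xi>) * cmod (\<kappa> \<xi>) \<le> \<bar>C\<bar> * cmod (\<kappa> \<xi>)"
      using b'[of \<xi>] by (cases "\<kappa> \<xi> = 0") (auto intro!: mult_right_mono)
    hence "(cmod (g \<xi>) * cmod (\<kappa> \<xi>))\<^sup>2 \<le> (\<bar>C\<bar> * cmod (\<kappa> \<xi>))\<^sup>2" by (rule power_mono) simp
    thus "(cmod (g \<xi> * \<kappa> \<xi>))\<^sup>2 \<le> \<bar>C\<bar>\<^sup>2 * (cmod (\<kappa> \<xi>))\<^sup>2" by (simp only: norm_mult power_mult_distrib)
  qed
  also have "\<dots> = (\<bar>C\<bar> * l2norm \<kappa>)\<^sup>2" by (simp only: integral_mult_right_zero power_mult_distrib l2norm_sq)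
  finally show "l2norm (\<lambda>\<xi>. g \<xi> * \<kappa> \<xi>) \<le> \<bar>C\<bar> * l2norm \<kappa>" by (rule power2_le_imp_le) simp
qed

lemma laplacian_fourier:
  fixes \<kappa> :: "'a::euclidean_space \<Rightarrow> complex"
  assumes \<kappa>: "band_limited R \<kappa>"
  shows "times_cont_diff k (fourier \<kappa>)"
    and "square_integrable (directional_deriv v (fourier \<kappa>))"
    and "laplacian (fourier \<kappa>) = fourier (\<lambda>\<xi>. - of_real ((norm \<xi>)\<^sup>2) * \<kappa> \<xi>)"
    and "band_limited R (\<lambda>\<xi>. - of_real ((norm \<xi>)\<^sup>2) * \<kappa> \<xi>)"
proof -
  show "times_cont_diff k (fourier \<kappa>)" by (rule times_cont_diff_fourier[OF band_limitedD(3,2)[OF \<kappa>]])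
  have w: "band_limited R (\<lambda>\<xi>. - \<i> * of_real (v \<bullet> \<xi>) * g \<xi>)" if "band_limited R g" for v :: 'a and g
  proof (rule band_limited_mult(1)[OF that, of _ "norm v * R"])
    fix \<xi> :: 'a assume "norm \<xi> \<le> R"
    have "\<bar>v \<bullet> \<xi>\<bar> \<le> norm v * norm \<xi>" by (rule Cauchy_Schwarz_ineq2)
    also have "\<dots> \<le> norm v * R" using \<open>norm \<xi> \<le> R\<close> by (intro mult_left_mono) auto
    finally show "cmod (- \<i> * of_real (v \<bullet> \<xi>)) \<le> norm v * R" by (simp add: norm_mult)
  qed measurable
  have d: "directional_deriv v (fourier g) = fourier (\<lambda>\<xi>. - \<i> * of_real (v \<bullet> \<xi>) * g \<xi>)" if "band_limited R g" for v :: 'a and g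
    by (rule ext, rule directional_deriv_eq[OF fourier_bounded_support_has_derivative[OF band_limitedD(3,2)[OF that]]])
  show "square_integrable (directional_deriv v (fourier \<kappa>))"
    unfolding d[OF \<kappa>] by (rule square_integrable_fourier[OF band_limitedD(3,1)[OF w[OF \<kappa>]]])
  show "laplacian (fourier \<kappa>) = fourier (\<lambda>\<xi>. - of_real ((norm \<xi>)\<^sup>2) * \<kappa> \<xi>)"
  proof
    fix x :: 'a
    have "laplacian (fourier \<kappa>) x = (\<Sum>b\<in>Basis. fourier (\<lambda>\<xi>. - \<i> * of_real (b \<bullet> \<xi>) * (- \<i> * of_real (b \<bullet> \<xi>) * \<kappa> \<xi>)) x)"
      unfolding laplacian_def d[OF \<kappa>] d[OF w[OF \<kappa>]] ..
    also have "\<dots> = (LINT \<xi>|lborel. (\<Sum>b\<in>Basis. exp (- \<i> * of_real (\<xi> \<bullet> x)) * (- \<i> * of_real (b \<bullet> \<xi>) * (- \<i> * of_real (b \<bullet> \<xi>) * \<kappa> \<xi>))))"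
      unfolding fourier_def by (rule Bochner_Integration.integral_sum[symmetric]) (intro integrable_fourier band_limitedD(3)[OF w] w \<kappa>)
    also have "\<dots> = fourier (\<lambda>\<xi>. - of_real ((norm \<xi>)\<^sup>2) * \<kappa> \<xi>) x"
      unfolding fourier_def
    proof (rule Bochner_Integration.integral_cong[OF refl])
      fix \<xi> :: 'a
      have s: "(\<Sum>b\<in>Basis. exp (- \<i> * of_real (\<xi> \<bullet> x)) * (- \<i> * of_real (b \<bullet> \<xi>) * (- \<i> * of_real (b \<bullet> \<xi>) * \<kappa> \<xi>))) =
        (\<Sum>b\<in>Basis. exp (- \<i> * of_real (\<xi> \<bullet> x)) * (- \<kappa> \<xi>) * of_real ((\<xi> \<bullet> b)\<^sup>2))"
        by (intro sum.cong refl) (simp add: power2_eq_square inner_commute algebra_simps)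
      show "(\<Sum>b\<in>Basis. exp (- \<i> * of_real (\<xi> \<bullet> x)) * (- \<i> * of_real (b \<bullet> \<xi>) * (- \<i> * of_real (b \<bullet> \<xi>) * \<kappa> \<xi>))) =
        exp (- \<i> * of_real (\<xi> \<bullet> x)) * (- of_real ((norm \<xi>)\<^sup>2) * \<kappa> \<xi>)"
        unfolding s unfolding sum_distrib_left[symmetric] of_real_sum[symmetric] norm_sq_Basis[symmetric] by (simp add: mult_ac)
    qed
    finally show "laplacian (fourier \<kappa>) x = fourier (\<lambda>\<xi>. - of_real ((norm \<xi>)\<^sup>2) * \<kappa> \<xi>) x" .
  qed
  show "band_limited R (\<lambda>\<xi>. - of_real ((norm \<xi>)\<^sup>2) * \<kappa> \<xi>)"
  proof (rule band_limited_mult(1)[OF \<kappa>, of _ "R\<^sup>2"])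
    fix \<xi> :: 'a assume "norm \<xi> \<le> R"
    hence "(norm \<xi>)\<^sup>2 \<le> R\<^sup>2" by (intro power_mono) auto
    thus "cmod (- of_real ((norm \<xi>)\<^sup>2)) \<le> R\<^sup>2" by (simp add: norm_power)
  qed measurable
qed

section \<open>The Fourier transform of a solution\<close>

text \<open>Of the continuity into the Sobolev space only L2 continuity of the transforms is
  retained; it is all that the representation of the solution relies on.\<close>

locale fourier_solution = memory a0 Ainf a for a0 Ainf a +
  fixes u F :: "real \<Rightarrow> 'a::euclidean_space \<Rightarrow> complex"
  assumes F: "t \<ge> 0 \<Longrightarrow> is_fourier_L2 (u t) (F t)"
    and F_cont: "t\<^sub>0 \<ge> 0 \<Longrightarrow> ((\<lambda>t. l2norm (\<lambda>\<xi>. F t \<xi> - F t\<^sub>0 \<xi>)) \<longlongrightarrow> 0) (at t\<^sub>0 within {0..})"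
    and weak: "test_function \<phi> \<Longrightarrow>
        - (LINT t:{0<..}|lborel. pairing (u t) (\<lambda>x. vector_derivative (\<lambda>\<tau>. \<phi> (\<tau>, x)) (at t))) =
        (LINT t:{0<..}|lborel.
           of_real a0 * pairing (u t) (laplacian (\<lambda>x. \<phi> (t, x))) +
           (LINT r:{0<..<t}|lborel.
              of_real (a (t - r)) * pairing (u r) (laplacian (\<lambda>x. \<phi> (t, x)))))"
begin

lemma sq: "t \<ge> 0 \<Longrightarrow> square_integrable (u t)" "t \<ge> 0 \<Longrightarrow> square_integrable (F t)"
  using F[of t] by (auto simp: is_fourier_L2_def)

text \<open>All continuity in time comes from this one comparison with the L2 distance of
  transforms.\<close>

lemma continuous_controlled:
  fixes P :: "real \<Rightarrow> 'b::real_normed_vector"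
  assumes le: "\<And>t t\<^sub>0. t \<ge> 0 \<Longrightarrow> t\<^sub>0 \<ge> 0 \<Longrightarrow> norm (P t - P t\<^sub>0) \<le> l2norm (\<lambda>\<xi>. F t \<xi> - F t\<^sub>0 \<xi>) * c"
  shows "continuous_on {0..} P"
  unfolding continuous_on_def
proof
  fix t\<^sub>0 :: real assume t0: "t\<^sub>0 \<in> {0..}"
  have "((\<lambda>t. P t - P t\<^sub>0) \<longlongrightarrow> 0) (at t\<^sub>0 within {0..})"
  proof (rule Lim_null_comparison)
    show "\<forall>\<^sub>F t in at t\<^sub>0 within {0..}. norm (P t - P t\<^sub>0) \<le> l2norm (\<lambda>\<xi>. F t \<xi> - F t\<^sub>0 \<xi>) * c"
      unfolding eventually_at using t0 by (intro exI[of _ 1]) (auto intro: le)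
    show "((\<lambda>t. l2norm (\<lambda>\<xi>. F t \<xi> - F t\<^sub>0 \<xi>) * c) \<longlongrightarrow> 0) (at t\<^sub>0 within {0..})"
      using tendsto_mult_right[OF F_cont, of "t\<^sub>0" c] t0 by simp
  qed
  thus "(P \<longlongrightarrow> P t\<^sub>0) (at t\<^sub>0 within {0..})" by (rule LIM_zero_cancel)
qed

lemma pairing_u_continuous:
  assumes h: "integrable lborel h" "square_integrable h" and b: "\<And>y. cmod (h y) \<le> B" and c: "continuous_on UNIV h"
  shows "continuous_on {0..} (\<lambda>t. pairing (u t) h)"
proof (rule continuous_controlled)
  fix t t\<^sub>0 :: real assume t: "t \<ge> 0" "t\<^sub>0 \<ge> 0"
  show "norm (pairing (u t) h - pairing (u t\<^sub>0) h) \<le> l2norm (\<lambda>\<xi>. F t \<xi> - F t\<^sub>0 \<xi>) * l2norm h"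
    unfolding pairing_diff[OF sq(1)[OF t(1)] sq(1)[OF t(2)] h(2), symmetric]
    by (rule is_fourier_L2_pairing_bound[OF is_fourier_L2_diff[OF F[OF t(1)] F[OF t(2)]] h b c])
qed

lemma pairing_F_continuous:
  assumes h: "square_integrable h" shows "continuous_on {0..} (\<lambda>t. pairing (F t) h)"
proof (rule continuous_controlled)
  fix t t\<^sub>0 :: real assume t: "t \<ge> 0" "t\<^sub>0 \<ge> 0"
  show "norm (pairing (F t) h - pairing (F t\<^sub>0) h) \<le> l2norm (\<lambda>\<xi>. F t \<xi> - F t\<^sub>0 \<xi>) * l2norm h"
    unfolding pairing_diff[OF sq(2)[OF t(1)] sq(2)[OF t(2)] h, symmetric]
    by (intro pairing_bound square_integrable_diff sq t h)
qed

lemma l2norm_F_continuous: "continuous_on {0..} (\<lambda>t. l2norm (F t))"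
proof (rule continuous_controlled[where c=1])
  fix t t\<^sub>0 :: real assume t: "t \<ge> 0" "t\<^sub>0 \<ge> 0"
  have "l2norm (\<lambda>\<xi>. F t\<^sub>0 \<xi> - F t \<xi>) = l2norm (\<lambda>\<xi>. F t \<xi> - F t\<^sub>0 \<xi>)"
    unfolding l2norm_def norm_minus_commute[of "F t\<^sub>0 _"] ..
  thus "norm (l2norm (F t) - l2norm (F t\<^sub>0)) \<le> l2norm (\<lambda>\<xi>. F t \<xi> - F t\<^sub>0 \<xi>) * 1"
    using l2norm_triangle[OF sq(2)[OF t(1)] sq(2)[OF t(2)]] l2norm_triangle[OF sq(2)[OF t(2)] sq(2)[OF t(1)]] by simp
qed

lemma l2norm_F_bounded: "\<exists>S. \<forall>t\<in>{0..T}. l2norm (F t) \<le> S"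
proof -
  have "bounded ((\<lambda>t. l2norm (F t)) ` {0..T})"
    by (intro compact_imp_bounded compact_continuous_image continuous_on_subset[OF l2norm_F_continuous]) auto
  thus ?thesis unfolding bounded_iff by (auto simp: abs_le_iff)
qed

text \<open>The test function is the product of a time cutoff with \<open>\<Psi>\<close>. The weak
  form then factors into a scalar equation for the pairings of \<open>u t\<close> with
  \<open>\<Psi>\<close> and with its Laplacian, where the integrated version applies.\<close>

lemma pairing_compact_support:
  fixes \<Psi> :: "'a \<Rightarrow> complex"
  assumes \<Psi>: "\<And>k. times_cont_diff k \<Psi>" and z: "\<And>x. norm x > R \<Longrightarrow> \<Psi> x = 0" and d: "d > 0"
  shows "pairing (u d) \<Psi> - pairing (u 0) \<Psi> =
    (LINT r|lborel. indicator {0<..<d} r *\<^sub>R (of_real (A (d - r)) * pairing (u r) (laplacian \<Psi>)))"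
proof (rule weak_memory_equation[where v="\<lambda>t. pairing (u t) \<Psi>" and k="\<lambda>t. pairing (u t) (laplacian \<Psi>)", OF _ _ _ d])
  have c\<Psi>: "continuous_on UNIV \<Psi>" using \<Psi>[of 0] by simp
  have cL: "continuous_on UNIV (laplacian \<Psi>)" by (rule continuous_laplacian[OF \<Psi>])
  have zL: "laplacian \<Psi> x = 0" if "norm x > R" for x by (rule laplacian_support[of R, OF z that])
  obtain B1 where B1: "\<forall>x. cmod (\<Psi> x) \<le> B1" using compact_support_integrable(3)[OF c\<Psi> z] by blast
  obtain B2 where B2: "\<forall>x. cmod (laplacian \<Psi> x) \<le> B2" using compact_support_integrable(3)[OF cL zL] by blast
  show "continuous_on {0..} (\<lambda>t. pairing (u t) \<Psi>)"
    by (rule pairing_u_continuous[OF compact_support_integrable(1,2)[OF c\<Psi> z] _ c\<Psi>]) (use B1 in auto)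
  show "continuous_on {0..} (\<lambda>t. pairing (u t) (laplacian \<Psi>))"
    by (rule pairing_u_continuous[OF compact_support_integrable(1,2)[OF cL zL] _ cL]) (use B2 in auto)
  fix c d \<epsilon> :: real assume c: "0 < c" "c < d" "0 < \<epsilon>"
  define \<phi> where "\<phi> p = complex_of_real (time_cutoff c d \<epsilon> (fst p)) * \<Psi> (snd p)" for p :: "real \<times> 'a"
  have tf: "test_function \<phi>"
    unfolding test_function_def smooth_def
  proof (intro conjI allI exI)
    show "times_cont_diff k \<phi>" for k unfolding \<phi>_def[abs_def]
      by (intro times_cont_diff_mult times_cont_diff_of_real times_cont_diff_linear_comp[OF bounded_linear_fst]
          times_cont_diff_linear_comp[OF bounded_linear_snd] times_cont_diff_time_cutoff \<Psi>)
    show "compact ({c..d + \<epsilon>} \<times> cball (0::'a) R)" by (intro compact_Times) auto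
    show "{c..d + \<epsilon>} \<times> cball (0::'a) R \<subseteq> {0<..} \<times> UNIV" using c by auto
    fix p :: "real \<times> 'a"
    show "p \<notin> {c..d + \<epsilon>} \<times> cball (0::'a) R \<longrightarrow> \<phi> p = 0"
    proof
      assume "p \<notin> {c..d + \<epsilon>} \<times> cball (0::'a) R"
      then consider "fst p < c" | "fst p > d + \<epsilon>" | "norm (snd p) > R" by (cases p) fastforce
      thus "\<phi> p = 0"
        by cases (use c in \<open>auto simp: \<phi>_def z time_cutoff_left time_cutoff_right\<close>)
    qed
  qed
  have vd: "vector_derivative (\<lambda>\<tau>. \<phi> (\<tau>, x)) (at t) = of_real ((mollifier ((t - c) / \<epsilon>) - mollifier ((t - d) / \<epsilon>)) / \<epsilon>) * \<Psi> x" for t x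
    unfolding \<phi>_def fst_conv snd_conv
    by (rule vector_derivative_at)
       (intro has_vector_derivative_mult_left has_vector_derivative_of_real has_real_derivative_iff_has_vector_derivative[THEN iffD1] time_cutoff_has_derivative)
  have lp: "laplacian (\<lambda>x. \<phi> (t, x)) = (\<lambda>x. of_real (time_cutoff c d \<epsilon> t) * laplacian \<Psi> x)" for t
    unfolding \<phi>_def fst_conv snd_conv by (rule laplacian_cmult[OF \<Psi>])
  have "of_real a0 * (of_real (time_cutoff c d \<epsilon> t) * pairing (u t) (laplacian \<Psi>)) +
     (LINT r:{0<..<t}|lborel. of_real (a (t - r)) * (of_real (time_cutoff c d \<epsilon> t) * pairing (u r) (laplacian \<Psi>))) =
     of_real (time_cutoff c d \<epsilon> t) * memory_rhs (\<lambda>t. pairing (u t) (laplacian \<Psi>)) t" for t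
    unfolding memory_rhs_def distrib_left
    by (simp only: mult.left_commute[of _ "of_real (time_cutoff c d \<epsilon> t)"] set_integral_mult_right)
  thus "- (LINT t:{0<..}|lborel. of_real ((mollifier ((t - c) / \<epsilon>) - mollifier ((t - d) / \<epsilon>)) / \<epsilon>) * pairing (u t) \<Psi>) =
      (LINT t:{0<..}|lborel. of_real (time_cutoff c d \<epsilon> t) * memory_rhs (\<lambda>t. pairing (u t) (laplacian \<Psi>)) t)"
    using weak[OF tf] unfolding vd lp pairing_cmult by simp
qed

end

section \<open>Uniqueness on bounded frequencies\<close>

context fourier_solution
begin

text \<open>The compactly supported case for the cut-off transforms, with the cutoff removed. In the
  time integral the pairings are dominated uniformly in \<open>n\<close>: the transforms of the
  solution are bounded in L2 on [0, d], and the Laplacians of the cut functions lie below the fixed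
  square integrable \<open>w\<close>. The multiplication formula then moves both pairings to the
  Fourier side.\<close>

lemma pairing_band_limited:
  fixes \<kappa> :: "'a \<Rightarrow> complex"
  assumes \<kappa>: "band_limited R \<kappa>" and d: "d > 0"
  shows "pairing (F d) \<kappa> - pairing (F 0) \<kappa> =
    (LINT r|lborel. indicator {0<..<d} r *\<^sub>R (of_real (A (d - r)) * pairing (F r) (\<lambda>\<xi>. - of_real ((norm \<xi>)\<^sup>2) * \<kappa> \<xi>)))"
proof -
  define \<psi> where "\<psi> = fourier \<kappa>"
  let ?h = "\<lambda>n r. indicator {0<..<d} r *\<^sub>R (of_real (A (d - r)) * pairing (u r) (laplacian (cut n \<psi>)))"
  define \<kappa>2 where "\<kappa>2 = (\<lambda>\<xi>. - of_real ((norm \<xi>)\<^sup>2) * \<kappa> \<xi>)"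
  have \<psi>: "times_cont_diff k \<psi>" for k unfolding \<psi>_def by (rule laplacian_fourier(1)[OF \<kappa>])
  have L\<psi>: "laplacian \<psi> = fourier \<kappa>2" unfolding \<psi>_def \<kappa>2_def by (rule laplacian_fourier(3)[OF \<kappa>])
  have \<kappa>2: "band_limited R \<kappa>2" unfolding \<kappa>2_def by (rule laplacian_fourier(4)[OF \<kappa>])
  have s\<psi>: "square_integrable \<psi>" unfolding \<psi>_def by (rule square_integrable_fourier[OF band_limitedD(3,1)[OF \<kappa>]])
  have sL: "square_integrable (laplacian \<psi>)" unfolding L\<psi> by (rule square_integrable_fourier[OF band_limitedD(3,1)[OF \<kappa>2]])
  have sD: "square_integrable (directional_deriv b \<psi>)" for b unfolding \<psi>_def by (rule laplacian_fourier(2)[OF \<kappa>])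
  obtain C where C: "C > 0" "\<And>n x. cmod (cut n \<psi> x) \<le> C * cmod (\<psi> x)"
     "\<And>n x. cmod (laplacian (cut n \<psi>) x) \<le> C * (cmod (laplacian \<psi> x) + (\<Sum>b\<in>Basis. 2 * cmod (directional_deriv b \<psi> x) + cmod (\<psi> x)))"
    using laplacian_cut(2)[OF \<psi>[of 2]] by blast
  define w where "w x = complex_of_real C * (complex_of_real (cmod (laplacian \<psi> x)) +
     (\<Sum>b\<in>Basis. 2 * complex_of_real (cmod (directional_deriv b \<psi> x)) + complex_of_real (cmod (\<psi> x))))" for x
  have sw: "square_integrable w" unfolding w_def
    by (intro square_integrable_cmult[where C="C"] square_integrable_cmult[where C="2"] square_integrable_add square_integrable_sum finite_Basis square_integrable_cmod sL sD s\<psi>)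
       (use C(1) in auto)
  have w: "cmod (laplacian (cut n \<psi>) x) \<le> cmod (w x)" for n x
  proof -
    have "w x = of_real (C * (cmod (laplacian \<psi> x) + (\<Sum>b\<in>Basis. 2 * cmod (directional_deriv b \<psi> x) + cmod (\<psi> x))))"
      by (simp add: w_def)
    hence "cmod (w x) = \<bar>C * (cmod (laplacian \<psi> x) + (\<Sum>b\<in>Basis. 2 * cmod (directional_deriv b \<psi> x) + cmod (\<psi> x)))\<bar>"
      by (simp only: norm_of_real)
    thus ?thesis using C(3)[of n x] abs_ge_self order_trans by metis
  qed
  have m1: "cut n \<psi> \<in> borel_measurable borel" for n
    using times_cont_diff_cut[OF \<psi>[of 0]] by (auto intro: borel_measurable_continuous_onI)
  have cL: "continuous_on UNIV (laplacian (cut n \<psi>))" for n by (rule continuous_laplacian[OF times_cont_diff_cut[OF \<psi>]])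
  hence m2: "laplacian (cut n \<psi>) \<in> borel_measurable borel" for n by (auto intro: borel_measurable_continuous_onI)
  have lim1: "(\<lambda>n. pairing (u t) (cut n \<psi>)) \<longlonglongrightarrow> pairing (F t) \<kappa>" if t: "t \<ge> 0" for t
  proof -
    have "(\<lambda>n. pairing (u t) (cut n \<psi>)) \<longlonglongrightarrow> pairing (u t) \<psi>"
    proof (rule pairing_LIMSEQ[OF sq(1)[OF t] square_integrable_cmult[OF s\<psi>, of "\<lambda>x. of_real C" C] m1 square_integrable_measurable[OF s\<psi>] _ cut_tendsto])
      show "cmod (cut n \<psi> x) \<le> cmod (complex_of_real C * \<psi> x)" for n x using C(1,2) by (simp add: norm_mult)
    qed (use C(1) in auto)
    thus ?thesis unfolding \<psi>_def pairing_fourier[OF F[OF t] band_limitedD(3,1)[OF \<kappa>]] .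
  qed
  have lim2: "(\<lambda>n. pairing (u t) (laplacian (cut n \<psi>))) \<longlonglongrightarrow> pairing (F t) \<kappa>2" if t: "t \<ge> 0" for t
  proof -
    have "(\<lambda>n. pairing (u t) (laplacian (cut n \<psi>))) \<longlonglongrightarrow> pairing (u t) (laplacian \<psi>)"
      by (rule pairing_LIMSEQ[OF sq(1)[OF t] sw m2 square_integrable_measurable[OF sL] w laplacian_cut(1)[OF \<psi>]])
    thus ?thesis unfolding L\<psi> pairing_fourier[OF F[OF t] band_limitedD(3,1)[OF \<kappa>2]] .
  qed
  obtain M where M: "\<And>t. \<bar>A t\<bar> \<le> M" using A_bounded by blast
  obtain S where S: "\<And>t. t \<in> {0..d} \<Longrightarrow> l2norm (F t) \<le> S" using l2norm_F_bounded[of d] by blast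
  have zL: "laplacian (cut n \<psi>) x = 0" if "norm x > real (Suc n)" for n x
    by (rule laplacian_support[of "real (Suc n)", OF cut_zero that])
  have bk: "cmod (pairing (u r) (laplacian (cut n \<psi>))) \<le> S * l2norm w" if r: "r \<in> {0..d}" for n r
  proof -
    obtain B where B: "\<forall>x. cmod (laplacian (cut n \<psi>) x) \<le> B"
      using compact_support_integrable(3)[OF cL zL] by blast
    have "cmod (pairing (u r) (laplacian (cut n \<psi>))) \<le> l2norm (F r) * l2norm (laplacian (cut n \<psi>))"
      using r B by (intro is_fourier_L2_pairing_bound[OF F compact_support_integrable(1,2)[OF cL zL] _ cL, where B=B]) auto
    also have "\<dots> \<le> S * l2norm w"
      by (intro mult_mono S r l2norm_mono[OF sw m2 w]) (use order_trans[OF l2norm_nonneg S[OF r]] in auto)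
    finally show ?thesis .
  qed
  have ck: "continuous_on {0..} (\<lambda>r. pairing (u r) (laplacian (cut n \<psi>)))" for n
  proof -
    obtain B where "\<forall>x. cmod (laplacian (cut n \<psi>) x) \<le> B"
      using compact_support_integrable(3)[OF cL zL] by blast
    thus ?thesis by (intro pairing_u_continuous[OF compact_support_integrable(1,2)[OF cL zL] _ cL, where B=B]) auto
  qed
  have mm: "(\<lambda>r. indicator {0<..<d} r *\<^sub>R (of_real (A (d - r)) * k r)) \<in> borel_measurable lborel"
    if k: "continuous_on {0..} k" for k :: "real \<Rightarrow> complex"
    unfolding measurable_lborel2
    by (rule borel_measurable_continuous_on_indicator)
       (auto intro!: continuous_intros continuous_on_compose2[OF A_continuous] continuous_on_subset[OF k])
  have "(\<lambda>n. LINT r|lborel. ?h n r) \<longlonglongrightarrow>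
     (LINT r|lborel. indicator {0<..<d} r *\<^sub>R (of_real (A (d - r)) * pairing (F r) \<kappa>2))"
  proof (rule integral_dominated_convergence[where w="\<lambda>r. M * (S * l2norm w) * indicator {0<..<d} r"])
    show "integrable lborel (\<lambda>r. M * (S * l2norm w) * indicator {0<..<d} r)" by (intro integrable_mult_right integrable_indicator_Ioo)
    show "(\<lambda>r. indicator {0<..<d} r *\<^sub>R (of_real (A (d - r)) * pairing (F r) \<kappa>2)) \<in> borel_measurable lborel"
      by (intro mm pairing_F_continuous band_limitedD(1)[OF \<kappa>2])
    show "\<And>n. (\<lambda>r. ?h n r) \<in> borel_measurable lborel"
      by (intro mm ck)
    show "AE r in lborel. (\<lambda>n. ?h n r) \<longlonglongrightarrow>
       indicator {0<..<d} r *\<^sub>R (of_real (A (d - r)) * pairing (F r) \<kappa>2)"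
    proof (intro AE_I2)
      fix r :: real
      show "(\<lambda>n. ?h n r) \<longlonglongrightarrow>
        indicator {0<..<d} r *\<^sub>R (of_real (A (d - r)) * pairing (F r) \<kappa>2)"
      proof (cases "r \<in> {0<..<d}")
        case True
        show ?thesis by (intro tendsto_scaleR tendsto_mult tendsto_const lim2) (use True in auto)
      qed simp
    qed
    show "AE r in lborel. norm (?h n r) \<le> M * (S * l2norm w) * indicator {0<..<d} r" for n
    proof (intro AE_I2)
      fix r :: real
      show "norm (?h n r) \<le> M * (S * l2norm w) * indicator {0<..<d} r"
      proof (cases "r \<in> {0<..<d}")
        case True
        have "\<bar>A (d - r)\<bar> * cmod (pairing (u r) (laplacian (cut n \<psi>))) \<le> M * (S * l2norm w)"
          using True by (intro mult_mono M bk order_trans[OF abs_ge_zero M]) auto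
        thus ?thesis using True by (simp add: norm_mult)
      qed simp
    qed
  qed
  moreover have "(\<lambda>n. LINT r|lborel. ?h n r) \<longlonglongrightarrow>
     pairing (F d) \<kappa> - pairing (F 0) \<kappa>"
  proof -
    have "(LINT r|lborel. ?h n r) =
      pairing (u d) (cut n \<psi>) - pairing (u 0) (cut n \<psi>)" for n
      by (rule pairing_compact_support[where R="real (Suc n)", OF _ _ d, symmetric]) (rule times_cont_diff_cut[OF \<psi>], erule cut_zero)
    thus ?thesis using d by (simp only:) (intro tendsto_diff lim1, auto)
  qed
  ultimately show ?thesis unfolding \<kappa>2_def[symmetric] by (rule LIMSEQ_unique[symmetric])
qed

text \<open>The tested difference between the transform of the solution and the candidate. Working
  with pairings instead of values at single frequencies avoids any joint measurability of
  \<open>F t \<xi>\<close> in time and frequency.\<close>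

definition defect :: "real \<Rightarrow> ('a \<Rightarrow> complex) \<Rightarrow> complex" where
  "defect t \<kappa> = pairing (F t) \<kappa> - pairing (F 0) (\<lambda>\<xi>. of_real (volterra_sol A ((norm \<xi>)\<^sup>2) t) * \<kappa> \<xi>)"

lemma volterra_sol_band_bound:
  assumes "volterra_kernel A M" "0 \<le> t" "t \<le> T" "norm \<xi> \<le> R"
  shows "\<bar>volterra_sol A ((norm \<xi>)\<^sup>2) t\<bar> \<le> exp (R\<^sup>2 * M * T)"
proof -
  interpret V: volterra_kernel A M by fact
  have "\<bar>volterra_sol A ((norm \<xi>)\<^sup>2) t\<bar> \<le> exp (\<bar>(norm \<xi>)\<^sup>2\<bar> * M * t)" by (rule V.volterra_sol_bound[OF assms(2)])
  also have "\<dots> \<le> exp (R\<^sup>2 * M * T)" unfolding exp_le_cancel_iff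
    using assms V.M_nonneg by (intro mult_mono mult_nonneg_nonneg) (auto intro: power_mono)
  finally show ?thesis .
qed

text \<open>The candidate satisfies the same integrated equation: the Volterra equation holds at
  each frequency, and Fubini carries it to the pairing, since on the band the candidate is bounded
  uniformly up to time \<open>t\<close>.\<close>

lemma volterra_pairing:
  fixes \<kappa> :: "'a \<Rightarrow> complex"
  assumes \<kappa>: "band_limited R \<kappa>" and t: "t > 0"
    and \<kappa>2_def: "\<kappa>2 = (\<lambda>\<xi>. - of_real ((norm \<xi>)\<^sup>2) * \<kappa> \<xi>)"
  shows "pairing (F 0) (\<lambda>\<xi>. of_real (volterra_sol A ((norm \<xi>)\<^sup>2) t) * \<kappa> \<xi>) - pairing (F 0) \<kappa> =
    (LINT r|lborel. indicator {0<..<t} r *\<^sub>R (of_real (A (t - r)) * pairing (F 0) (\<lambda>\<xi>. of_real (volterra_sol A ((norm \<xi>)\<^sup>2) r) * \<kappa>2 \<xi>)))"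
    and "integrable lborel (\<lambda>r. indicator {0<..<t} r *\<^sub>R (of_real (A (t - r)) * pairing (F 0) (\<lambda>\<xi>. of_real (volterra_sol A ((norm \<xi>)\<^sup>2) r) * \<kappa>2 \<xi>)))"
proof -
  obtain M where VM: "volterra_kernel A M" using volterra_kernel_ex by blast
  interpret V: volterra_kernel A M by fact
  define z where "z \<xi> r = volterra_sol A ((norm \<xi>)\<^sup>2) r" for \<xi> :: 'a and r
  have \<kappa>2: "band_limited R \<kappa>2" unfolding \<kappa>2_def by (rule laplacian_fourier(4)[OF \<kappa>])
  have zb: "\<bar>z \<xi> r\<bar> \<le> exp (R\<^sup>2 * M * t)" if "norm \<xi> \<le> R" "0 \<le> r" "r \<le> t" for \<xi> r
    unfolding z_def by (rule volterra_sol_band_bound[OF VM that(2,3,1)])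
  have sF: "square_integrable (F 0)" by (rule sq) simp
  have [measurable]: "F 0 \<in> borel_measurable borel" "\<kappa>2 \<in> borel_measurable borel"
    using sF \<kappa>2 by (auto intro: square_integrable_measurable band_limitedD)
  define g where "g \<xi> = F 0 \<xi> * \<kappa>2 \<xi>" for \<xi>
  let ?m = "\<lambda>r \<xi>. complex_of_real (M * exp (R\<^sup>2 * M * t) * indicator {0<..<t} r) * g \<xi>"
  have ig: "integrable lborel g" unfolding g_def by (rule square_integrable_mult[OF sF band_limitedD(1)[OF \<kappa>2]])
  define h where "h r \<xi> = indicator {0<..<t} r *\<^sub>R (of_real (A (t - r)) * (of_real (z \<xi> r) * g \<xi>))" for r \<xi>
  have ih: "integrable (lborel \<Otimes>\<^sub>M lborel) (\<lambda>(r, \<xi>). h r \<xi>)"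
  proof (rule Bochner_Integration.integrable_bound)
    show "integrable (lborel \<Otimes>\<^sub>M lborel) (\<lambda>(r, \<xi>). ?m r \<xi>)"
    proof (rule lborel_pair.Fubini_integrable)
      have [measurable]: "g \<in> borel_measurable borel" using ig by auto
      show "(\<lambda>(r, \<xi>). ?m r \<xi>) \<in> borel_measurable (lborel \<Otimes>\<^sub>M lborel)" by measurable
      show "integrable lborel (\<lambda>r. LINT \<xi>|lborel. cmod (case (r, \<xi>) of (r, \<xi>) \<Rightarrow> ?m r \<xi>))"
        unfolding prod.case norm_mult norm_of_real integral_mult_right_zero
        by (intro integrable_mult_left integrable_abs integrable_mult_right integrable_indicator_Ioo)
      show "AE r in lborel. integrable lborel (\<lambda>\<xi>. case (r, \<xi>) of (r, \<xi>) \<Rightarrow> ?m r \<xi>)"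
        unfolding prod.case by (intro AE_I2 integrable_mult_right ig)
    qed
    have [measurable]: "g \<in> borel_measurable borel" using ig by auto
    show "(\<lambda>(r, \<xi>). h r \<xi>) \<in> borel_measurable (lborel \<Otimes>\<^sub>M lborel)" unfolding h_def z_def by measurable
    show "AE p in lborel \<Otimes>\<^sub>M lborel. norm (case p of (r, \<xi>) \<Rightarrow> h r \<xi>) \<le> norm (case p of (r, \<xi>) \<Rightarrow> ?m r \<xi>)"
    proof (intro AE_I2)
      fix p :: "real \<times> 'a"
      obtain r \<xi> where p: "p = (r, \<xi>)" by (cases p)
      show "norm (case p of (r, \<xi>) \<Rightarrow> h r \<xi>) \<le> norm (case p of (r, \<xi>) \<Rightarrow> ?m r \<xi>)"
      proof (cases "r \<in> {0<..<t} \<and> norm \<xi> \<le> R")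
        case True
        have "\<bar>A (t - r)\<bar> * \<bar>z \<xi> r\<bar> \<le> M * exp (R\<^sup>2 * M * t)" using True V.M_nonneg by (intro mult_mono V.A_bound zb) auto
        hence "\<bar>A (t - r)\<bar> * \<bar>z \<xi> r\<bar> * cmod (g \<xi>) \<le> M * exp (R\<^sup>2 * M * t) * cmod (g \<xi>)" by (rule mult_right_mono) simp
        thus ?thesis using True V.M_nonneg by (simp add: p h_def norm_mult abs_mult mult.assoc)
      next
        case False
        hence "h r \<xi> = 0" using band_limitedD(2)[OF \<kappa>2, of \<xi>] by (auto simp: h_def g_def)
        thus ?thesis by (simp add: p)
      qed
    qed
  qed
  have h\<xi>: "(LINT \<xi>|lborel. h r \<xi>) = indicator {0<..<t} r *\<^sub>R (of_real (A (t - r)) * pairing (F 0) (\<lambda>\<xi>. of_real (z \<xi> r) * \<kappa>2 \<xi>))" for r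
  proof -
    have "h r \<xi> = of_real (indicator {0<..<t} r * A (t - r)) * (F 0 \<xi> * (of_real (z \<xi> r) * \<kappa>2 \<xi>))" for \<xi>
      by (simp add: h_def g_def scaleR_conv_of_real mult_ac)
    thus ?thesis by (simp only: integral_mult_right_zero pairing_def) (simp add: scaleR_conv_of_real)
  qed
  have hr: "(LINT r|lborel. h r \<xi>) = F 0 \<xi> * (of_real (z \<xi> t) * \<kappa> \<xi>) - F 0 \<xi> * \<kappa> \<xi>" for \<xi>
  proof -
    have "(LINT r|lborel. h r \<xi>) = (LINT r|lborel. of_real (indicator {0<..<t} r * (A (t - r) * z \<xi> r)) * g \<xi>)"
      unfolding h_def by (intro Bochner_Integration.integral_cong refl) (simp add: scaleR_conv_of_real mult_ac)
    also have "\<dots> = of_real (volterra A (volterra_sol A ((norm \<xi>)\<^sup>2)) t) * g \<xi>"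
      unfolding integral_mult_left_zero integral_complex_of_real volterra_def z_def ..
    also have "\<dots> = of_real (z \<xi> t - 1) * (F 0 \<xi> * \<kappa> \<xi>)"
      using V.volterra_sol_eq[of t "(norm \<xi>)\<^sup>2"] t by (simp add: z_def g_def \<kappa>2_def mult_ac)
    finally show ?thesis by (simp add: algebra_simps)
  qed
  have bz: "band_limited R (\<lambda>\<xi>. of_real (z \<xi> t) * \<kappa> \<xi>)"
    by (rule band_limited_mult(1)[OF \<kappa>, of _ "exp (R\<^sup>2 * M * t)"]) (unfold z_def, measurable, use zb t in \<open>auto simp: z_def\<close>)
  have "pairing (F 0) (\<lambda>\<xi>. of_real (z \<xi> t) * \<kappa> \<xi>) - pairing (F 0) \<kappa> = (LINT \<xi>|lborel. LINT r|lborel. h r \<xi>)"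
    unfolding hr pairing_def
    by (intro Bochner_Integration.integral_diff[symmetric] square_integrable_mult sF band_limitedD(1)[OF bz] band_limitedD(1)[OF \<kappa>])
  also have "\<dots> = (LINT r|lborel. LINT \<xi>|lborel. h r \<xi>)" by (rule lborel_pair.Fubini_integral[OF ih])
  finally show "pairing (F 0) (\<lambda>\<xi>. of_real (volterra_sol A ((norm \<xi>)\<^sup>2) t) * \<kappa> \<xi>) - pairing (F 0) \<kappa> =
    (LINT r|lborel. indicator {0<..<t} r *\<^sub>R (of_real (A (t - r)) * pairing (F 0) (\<lambda>\<xi>. of_real (volterra_sol A ((norm \<xi>)\<^sup>2) r) * \<kappa>2 \<xi>)))"
    unfolding h\<xi> z_def .
  show "integrable lborel (\<lambda>r. indicator {0<..<t} r *\<^sub>R (of_real (A (t - r)) * pairing (F 0) (\<lambda>\<xi>. of_real (volterra_sol A ((norm \<xi>)\<^sup>2) r) * \<kappa>2 \<xi>)))"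
    using lborel_pair.integrable_fst[OF ih] unfolding h\<xi> z_def .
qed

text \<open>Subtracting the equations of the solution and the candidate cancels the initial data and
  leaves a homogeneous equation, at the cost of replacing \<open>\<kappa>\<close> by its product
  with -|\<xi>|^2.\<close>

lemma defect_equation:
  fixes \<kappa> :: "'a \<Rightarrow> complex"
  assumes \<kappa>: "band_limited R \<kappa>" and t: "t > 0"
    and \<kappa>2_def: "\<kappa>2 = (\<lambda>\<xi>. - of_real ((norm \<xi>)\<^sup>2) * \<kappa> \<xi>)"
  shows "integrable lborel (\<lambda>r. indicator {0<..<t} r *\<^sub>R (of_real (A (t - r)) * defect r \<kappa>2))"
    and "defect t \<kappa> = (LINT r|lborel. indicator {0<..<t} r *\<^sub>R (of_real (A (t - r)) * defect r \<kappa>2))"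
proof -
  let ?f = "\<lambda>r. indicator {0<..<t} r *\<^sub>R (of_real (A (t - r)) * pairing (F r) \<kappa>2)"
  let ?g = "\<lambda>r. indicator {0<..<t} r *\<^sub>R (of_real (A (t - r)) * pairing (F 0) (\<lambda>\<xi>. of_real (volterra_sol A ((norm \<xi>)\<^sup>2) r) * \<kappa>2 \<xi>))"
  have \<kappa>2: "band_limited R \<kappa>2" unfolding \<kappa>2_def by (rule laplacian_fourier(4)[OF \<kappa>])
  have c: "continuous_on {0..t} (\<lambda>r. of_real (A (t - r)) * pairing (F r) \<kappa>2)"
    by (auto intro!: continuous_intros continuous_on_compose2[OF A_continuous]
        continuous_on_subset[OF pairing_F_continuous[OF band_limitedD(1)[OF \<kappa>2]]])
  have i: "integrable lborel ?f"
  proof (rule Bochner_Integration.integrable_bound[OF integrable_on_indicator_Icc[OF c]])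
    show "?f \<in> borel_measurable lborel"
      unfolding measurable_lborel2 by (rule borel_measurable_continuous_on_indicator) (auto intro: continuous_on_subset[OF c])
  qed (auto intro!: AE_I2 simp: indicator_def)
  have eq: "indicator {0<..<t} r *\<^sub>R (of_real (A (t - r)) * defect r \<kappa>2) = ?f r - ?g r" for r
    unfolding defect_def by (simp add: algebra_simps)
  show "integrable lborel (\<lambda>r. indicator {0<..<t} r *\<^sub>R (of_real (A (t - r)) * defect r \<kappa>2))"
    unfolding eq by (rule Bochner_Integration.integrable_diff[OF i volterra_pairing(2)[OF \<kappa> t \<kappa>2_def]])
  have "defect t \<kappa> = (pairing (F t) \<kappa> - pairing (F 0) \<kappa>) - (pairing (F 0) (\<lambda>\<xi>. of_real (volterra_sol A ((norm \<xi>)\<^sup>2) t) * \<kappa> \<xi>) - pairing (F 0) \<kappa>)"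
    by (simp add: defect_def)
  also have "\<dots> = (LINT r|lborel. ?f r - ?g r)"
    unfolding pairing_band_limited[OF \<kappa> t, folded \<kappa>2_def] volterra_pairing(1)[OF \<kappa> t \<kappa>2_def]
    by (rule Bochner_Integration.integral_diff[symmetric, OF i volterra_pairing(2)[OF \<kappa> t \<kappa>2_def]])
  finally show "defect t \<kappa> = (LINT r|lborel. indicator {0<..<t} r *\<^sub>R (of_real (A (t - r)) * defect r \<kappa>2))"
    unfolding eq .
qed

text \<open>Gronwall's argument by iteration. The equation for \<open>\<kappa>\<close> refers to
  another density, so the induction runs over all densities in the band at once. One application
  costs at most R^2 in the L2 norm and M in the kernel, and integration in time gains t / (j + 1).
  Since \<open>S\<close> and \<open>C\<close> do not depend on \<open>j\<close>, the factorial
  drives the bound to 0.\<close>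

lemma defect_bound:
  fixes R T :: real
  obtains S C where "S \<ge> 0" "C \<ge> 0" "\<And>j t \<kappa>. 0 \<le> t \<Longrightarrow> t \<le> T \<Longrightarrow> band_limited R \<kappa> \<Longrightarrow> cmod (defect t \<kappa>) \<le> S * (C * t) ^ j / fact j * l2norm \<kappa>"
proof -
  obtain M where VM: "volterra_kernel A M" using volterra_kernel_ex by blast
  interpret V: volterra_kernel A M by fact
  obtain S0 where S0: "\<And>t. t \<in> {0..T} \<Longrightarrow> l2norm (F t) \<le> S0" using l2norm_F_bounded[of T] by blast
  define S where "S = max S0 0 + l2norm (F 0) * exp (R\<^sup>2 * M * T)"
  have S: "S \<ge> 0" by (simp add: S_def)
  define C where "C = M * R\<^sup>2"
  have C: "C \<ge> 0" using V.M_nonneg by (simp add: C_def)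
  have "cmod (defect t \<kappa>) \<le> S * (C * t) ^ j / fact j * l2norm \<kappa>" if "0 \<le> t" "t \<le> T" "band_limited R \<kappa>" for j t \<kappa>
    using that
  proof (induction j arbitrary: t \<kappa>)
    case 0
    note s\<kappa> = band_limitedD(1)[OF 0(3)]
    have m: "(\<lambda>\<xi>::'a. complex_of_real (volterra_sol A ((norm \<xi>)\<^sup>2) t)) \<in> borel_measurable borel" by measurable
    have z: "cmod (complex_of_real (volterra_sol A ((norm \<xi>)\<^sup>2) t)) \<le> exp (R\<^sup>2 * M * T)" if "norm \<xi> \<le> R" for \<xi> :: 'a
      unfolding norm_of_real by (rule volterra_sol_band_bound[OF VM 0(1,2) that])
    have F0: "square_integrable (F 0)" by (rule sq) simp
    have bl: "band_limited R (\<lambda>\<xi>. of_real (volterra_sol A ((norm \<xi>)\<^sup>2) t) * \<kappa> \<xi>)"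
      by (rule band_limited_mult(1)[OF 0(3) m]) (rule z)
    have "l2norm (\<lambda>\<xi>. of_real (volterra_sol A ((norm \<xi>)\<^sup>2) t) * \<kappa> \<xi>) \<le> \<bar>exp (R\<^sup>2 * M * T)\<bar> * l2norm \<kappa>"
      by (rule band_limited_mult(2)[OF 0(3) m]) (rule z)
    hence "cmod (pairing (F 0) (\<lambda>\<xi>. of_real (volterra_sol A ((norm \<xi>)\<^sup>2) t) * \<kappa> \<xi>)) \<le> l2norm (F 0) * (\<bar>exp (R\<^sup>2 * M * T)\<bar> * l2norm \<kappa>)"
      by (intro order_trans[OF pairing_bound[OF F0 band_limitedD(1)[OF bl]]] mult_left_mono l2norm_nonneg)
    moreover have "cmod (pairing (F t) \<kappa>) \<le> max S0 0 * l2norm \<kappa>"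
      by (rule order_trans[OF pairing_bound[OF sq(2)[OF 0(1)] s\<kappa>]]) (use S0[of t] 0 in \<open>intro mult_right_mono, auto\<close>)
    ultimately have "cmod (defect t \<kappa>) \<le> max S0 0 * l2norm \<kappa> + l2norm (F 0) * (\<bar>exp (R\<^sup>2 * M * T)\<bar> * l2norm \<kappa>)"
      unfolding defect_def by (intro order_trans[OF norm_triangle_ineq4] add_mono)
    thus ?case by (simp add: S_def algebra_simps)
  next
    case (Suc j)
    define \<kappa>2 where "\<kappa>2 = (\<lambda>\<xi>. - of_real ((norm \<xi>)\<^sup>2) * \<kappa> \<xi>)"
    have \<kappa>2: "band_limited R \<kappa>2" unfolding \<kappa>2_def by (rule laplacian_fourier(4)[OF Suc.prems(3)])
    have l2: "l2norm \<kappa>2 \<le> R\<^sup>2 * l2norm \<kappa>"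
    proof -
      have "cmod (- of_real ((norm \<xi>)\<^sup>2)) \<le> R\<^sup>2" if "norm \<xi> \<le> R" for \<xi> :: 'a
        using power_mono[OF that, of 2] by (simp add: norm_power)
      from band_limited_mult(2)[OF Suc.prems(3) _ this] show ?thesis unfolding \<kappa>2_def by simp
    qed
    show ?case
    proof (cases "t = 0")
      \<comment> \<open>The integrated equation is stated for positive times; at time 0 the
        candidate factor is 1 and the defect vanishes identically.\<close>
      case True
      have "pairing (F 0) (\<lambda>\<xi>. of_real (volterra_sol A ((norm \<xi>)\<^sup>2) 0) * \<kappa> \<xi>) = pairing (F 0) \<kappa>"
        using V.volterra_sol_eq[of 0] by (simp add: volterra_def)
      thus ?thesis using True by (simp add: defect_def)
    next
      case False
      hence t: "t > 0" using Suc.prems by simp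
      define K where "K = M * (S * C ^ j / fact j * (R\<^sup>2 * l2norm \<kappa>))"
      have K: "K \<ge> 0" using V.M_nonneg S C by (simp add: K_def)
      have "cmod (defect t \<kappa>) \<le> (LINT r|lborel. K * (r ^ j * indicator {0..t} r))"
        unfolding defect_equation(2)[OF Suc.prems(3) t \<kappa>2_def]
      proof (rule order_trans[OF integral_norm_bound integral_mono])
        show "integrable lborel (\<lambda>r. norm (indicator {0<..<t} r *\<^sub>R (of_real (A (t - r)) * defect r \<kappa>2)))"
          by (rule integrable_norm[OF defect_equation(1)[OF Suc.prems(3) t \<kappa>2_def]])
        have "integrable lborel (\<lambda>r. indicator {0..t} r *\<^sub>R r ^ j)"
          by (intro borel_integrable_compact continuous_intros) auto
        thus "integrable lborel (\<lambda>r. K * (r ^ j * indicator {0..t} r))" by (simp add: mult.commute)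
        fix r :: real
        show "norm (indicator {0<..<t} r *\<^sub>R (of_real (A (t - r)) * defect r \<kappa>2)) \<le> K * (r ^ j * indicator {0..t} r)"
        proof (cases "r \<in> {0<..<t}")
          case True
          have "\<bar>A (t - r)\<bar> * cmod (defect r \<kappa>2) \<le> M * (S * (C * r) ^ j / fact j * l2norm \<kappa>2)"
            using True Suc.prems V.M_nonneg by (intro mult_mono V.A_bound Suc.IH \<kappa>2) auto
          also have "\<dots> \<le> M * (S * (C * r) ^ j / fact j * (R\<^sup>2 * l2norm \<kappa>))"
            using True S C V.M_nonneg by (intro mult_left_mono l2) auto
          also have "\<dots> = K * r ^ j" by (simp add: K_def power_mult_distrib)
          finally show ?thesis using True by (simp add: norm_mult)
        next
          case False
          thus ?thesis using K by (auto simp: indicator_def)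
        qed
      qed
      also have "\<dots> = K * (t ^ Suc j / Suc j)"
        using t integral_power[of 0 t j] by simp
      also have "\<dots> = S * (C * t) ^ Suc j / fact (Suc j) * l2norm \<kappa>"
        by (simp add: K_def C_def power_mult_distrib field_simps)
      finally show ?thesis .
    qed
  qed
  thus ?thesis using S C that by blast
qed

lemma defect_eq_0:
  fixes \<kappa> :: "'a \<Rightarrow> complex"
  assumes \<kappa>: "band_limited R \<kappa>" and t: "t \<ge> 0"
  shows "defect t \<kappa> = 0"
proof -
  obtain S C where SC: "\<And>j. cmod (defect t \<kappa>) \<le> S * (C * t) ^ j / fact j * l2norm \<kappa>"
    using defect_bound[of t R] \<kappa> t by (metis order_refl)
  have "(\<lambda>j. S * ((C * t) ^ j /\<^sub>R fact j) * l2norm \<kappa>) \<longlonglongrightarrow> S * 0 * l2norm \<kappa>"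
    by (intro tendsto_intros summable_LIMSEQ_zero[OF summable_exp_generic])
  hence "(\<lambda>j. S * (C * t) ^ j / fact j * l2norm \<kappa>) \<longlonglongrightarrow> 0" by (simp add: divide_inverse mult_ac)
  from LIMSEQ_le_const[OF this, of "cmod (defect t \<kappa>)"] have "cmod (defect t \<kappa>) \<le> 0" using SC by blast
  thus ?thesis by simp
qed

theorem fourier_solution_eq:
  assumes t: "t \<ge> 0"
  shows "AE \<xi> in lborel. F t \<xi> = of_real (volterra_sol A ((norm \<xi>)\<^sup>2) t) * F 0 \<xi>"
proof -
  obtain M where VM: "volterra_kernel A M" using volterra_kernel_ex by blast
  interpret V: volterra_kernel A M by fact
  have sF: "square_integrable (F t)" "square_integrable (F 0)" using t by (auto intro: sq)
  have [measurable]: "F t \<in> borel_measurable borel" "F 0 \<in> borel_measurable borel"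
    using sF by (auto intro: square_integrable_measurable)
  define z where "z \<xi> = complex_of_real (volterra_sol A ((norm \<xi>)\<^sup>2) t)" for \<xi> :: 'a
  have [measurable]: "z \<in> borel_measurable borel" unfolding z_def[abs_def] by measurable
  have "AE \<xi> in lborel. norm \<xi> < real n \<longrightarrow> F t \<xi> - z \<xi> * F 0 \<xi> = 0" for n :: nat
  proof -
    define B where "B = ball (0::'a) (real n)"
    have [measurable]: "B \<in> sets borel" unfolding B_def by simp
    have bF: "band_limited (real n) (\<lambda>\<xi>. indicator B \<xi> * F s \<xi>)" if "s \<ge> 0" for s
      using square_integrable_indicator[OF sq(2)[OF that]] by (auto simp: band_limited_def B_def indicator_def)
    have zb: "cmod (z \<xi>) \<le> exp ((real n)\<^sup>2 * M * t)" if "norm \<xi> \<le> real n" for \<xi>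
      unfolding z_def norm_of_real by (rule volterra_sol_band_bound[OF VM t order_refl that])
    define H where "H \<xi> = indicator B \<xi> * F t \<xi> - z \<xi> * (indicator B \<xi> * F 0 \<xi>)" for \<xi>
    have sH: "square_integrable H" unfolding H_def
      by (intro square_integrable_diff band_limitedD(1)[OF bF] band_limitedD(1)[OF band_limited_mult(1)[OF bF, where C="exp ((real n)\<^sup>2 * M * t)"]] t order_refl zb) measurable
    \<comment> \<open>Testing with the conjugate of the difference itself, restricted to a ball,
      makes the defect equal to the squared L2 norm of that difference.\<close>
    define \<kappa> where "\<kappa> \<xi> = cnj (H \<xi>)" for \<xi>
    have [measurable]: "H \<in> borel_measurable borel" using sH by (rule square_integrable_measurable)
    have [measurable]: "\<kappa> \<in> borel_measurable borel" 
      unfolding \<kappa>_def[abs_def] by (rule borel_measurable_continuous_on[where f=cnj]) (auto intro: continuous_intros)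
    have "square_integrable \<kappa>" using sH by (simp add: square_integrable_def) (simp add: \<kappa>_def)
    hence b\<kappa>: "band_limited (real n) \<kappa>" by (auto simp: band_limited_def \<kappa>_def H_def B_def indicator_def)
    have i1: "integrable lborel (\<lambda>\<xi>. F t \<xi> * \<kappa> \<xi>)" by (rule square_integrable_mult[OF sF(1) band_limitedD(1)[OF b\<kappa>]])
    have i2: "integrable lborel (\<lambda>\<xi>. F 0 \<xi> * (z \<xi> * \<kappa> \<xi>))"
      by (rule square_integrable_mult[OF sF(2) band_limitedD(1)[OF band_limited_mult(1)[OF b\<kappa>]]]) (measurable, rule zb)
    have "0 = defect t \<kappa>" using defect_eq_0[OF b\<kappa> t] by simp
    also have "\<dots> = (LINT \<xi>|lborel. F t \<xi> * \<kappa> \<xi> - F 0 \<xi> * (z \<xi> * \<kappa> \<xi>))"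
      unfolding defect_def pairing_def z_def[symmetric] by (rule Bochner_Integration.integral_diff[symmetric, OF i1 i2])
    also have "\<dots> = (LINT \<xi>|lborel. complex_of_real ((cmod (H \<xi>))\<^sup>2))"
    proof (rule Bochner_Integration.integral_cong[OF refl])
      fix \<xi>
      have "F t \<xi> * \<kappa> \<xi> - F 0 \<xi> * (z \<xi> * \<kappa> \<xi>) = H \<xi> * \<kappa> \<xi>"
        by (cases "\<xi> \<in> B") (auto simp: H_def \<kappa>_def algebra_simps)
      thus "F t \<xi> * \<kappa> \<xi> - F 0 \<xi> * (z \<xi> * \<kappa> \<xi>) = complex_of_real ((cmod (H \<xi>))\<^sup>2)"
        by (simp only: \<kappa>_def complex_norm_square)
    qed
    finally have "(LINT \<xi>|lborel. (cmod (H \<xi>))\<^sup>2) = 0" unfolding integral_complex_of_real by simp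
    hence "AE \<xi> in lborel. (cmod (H \<xi>))\<^sup>2 = 0"
      using sH by (subst (asm) integral_nonneg_eq_0_iff_AE) (auto simp: square_integrable_def)
    thus ?thesis by eventually_elim (auto simp: H_def B_def indicator_def)
  qed
  hence "AE \<xi> in lborel. \<forall>n::nat. norm \<xi> < real n \<longrightarrow> F t \<xi> - z \<xi> * F 0 \<xi> = 0"
    by (intro AE_all_countable[THEN iffD2] allI)
  thus ?thesis
  proof eventually_elim
    case (elim \<xi>)
    obtain n :: nat where "norm \<xi> < real n" using reals_Archimedean2 by blast
    with elim have "F t \<xi> - z \<xi> * F 0 \<xi> = 0" by blast
    thus ?case by (simp add: z_def)
  qed
qed

end

section \<open>Convergence to the heat profile\<close>

lemma sobolev_integrable:
  assumes f: "f \<in> sobolev s" and F: "is_fourier_L2 f F"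
  shows "integrable lborel (\<lambda>\<xi>. (1 + (norm \<xi>)\<^sup>2) powr s * (cmod (F \<xi>))\<^sup>2)"
proof -
  obtain G where G: "is_fourier_L2 f G" "integrable lborel (\<lambda>\<xi>. (1 + (norm \<xi>)\<^sup>2) powr s * (cmod (G \<xi>))\<^sup>2)"
    using f by (auto simp: sobolev_def)
  have [measurable]: "G \<in> borel_measurable borel" "F \<in> borel_measurable borel"
    using G F by (auto simp: is_fourier_L2_def square_integrable_measurable)
  have "AE \<xi> in lborel. G \<xi> = F \<xi>" by (rule is_fourier_L2_unique[OF G(1) F]) simp
  hence ae: "AE \<xi> in lborel. (1 + (norm \<xi>)\<^sup>2) powr s * (cmod (G \<xi>))\<^sup>2 = (1 + (norm \<xi>)\<^sup>2) powr s * (cmod (F \<xi>))\<^sup>2"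
    by eventually_elim simp
  have m: "(\<lambda>\<xi>. (1 + (norm \<xi>)\<^sup>2) powr s * (cmod (G \<xi>))\<^sup>2) \<in> borel_measurable lborel"
    "(\<lambda>\<xi>. (1 + (norm \<xi>)\<^sup>2) powr s * (cmod (F \<xi>))\<^sup>2) \<in> borel_measurable lborel" by measurable
  show ?thesis using G(2) integrable_cong_AE[OF m ae] by blast
qed

text \<open>For s \<ge> 0 the Sobolev weight is at least 1, so continuity into the Sobolev space
  implies L2 continuity of the transforms.\<close>

lemma l2norm_le_sobolev_norm:
  assumes f: "f \<in> sobolev s" "is_fourier_L2 f F" and g: "g \<in> sobolev s" "is_fourier_L2 g G" and s: "s \<ge> 0"
  shows "l2norm (\<lambda>\<xi>. F \<xi> - G \<xi>) \<le> sobolev_norm s (\<lambda>x. f x - g x)"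
  unfolding sobolev_norm_eq[OF is_fourier_L2_diff[OF f(2) g(2)]] l2norm_def
proof (intro real_sqrt_le_mono integral_mono)
let ?h = "\<lambda>\<xi>. (1 + (norm \<xi>)\<^sup>2) powr s * (cmod (F \<xi> - G \<xi>))\<^sup>2"
let ?g = "\<lambda>\<xi>. (1 + (norm \<xi>)\<^sup>2) powr s * (cmod (G \<xi>))\<^sup>2"
let ?f = "\<lambda>\<xi>. (1 + (norm \<xi>)\<^sup>2) powr s * (cmod (F \<xi>))\<^sup>2"
  have FG: "square_integrable (\<lambda>\<xi>. F \<xi> - G \<xi>)" using is_fourier_L2_diff[OF f(2) g(2)] by (simp add: is_fourier_L2_def)
  show "integrable lborel (\<lambda>\<xi>. (cmod (F \<xi> - G \<xi>))\<^sup>2)" using FG by (simp add: square_integrable_def)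
  have [measurable]: "G \<in> borel_measurable borel" "F \<in> borel_measurable borel"
    using f g by (auto simp: is_fourier_L2_def square_integrable_measurable)
  show "integrable lborel (\<lambda>\<xi>. ?h \<xi>)"
  proof (rule Bochner_Integration.integrable_bound)
    show "integrable lborel (\<lambda>\<xi>. 2 * (?f \<xi>) + 2 * (?g \<xi>))"
      by (intro Bochner_Integration.integrable_add integrable_mult_right sobolev_integrable[OF f] sobolev_integrable[OF g])
    show "AE \<xi> in lborel. norm (?h \<xi>) \<le>
      norm (2 * (?f \<xi>) + 2 * (?g \<xi>))"
    proof (intro AE_I2)
      fix \<xi> :: 'a
      have "?h \<xi> \<le> (1 + (norm \<xi>)\<^sup>2) powr s * (2 * (cmod (F \<xi>))\<^sup>2 + 2 * (cmod (G \<xi>))\<^sup>2)"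
        by (intro mult_left_mono norm_diff_sq_le) simp
      thus "norm (?h \<xi>) \<le>
        norm (2 * (?f \<xi>) + 2 * (?g \<xi>))"
        by (simp add: algebra_simps)
    qed
  qed measurable
  fix \<xi> :: 'a
  have "1 \<le> (1 + (norm \<xi>)\<^sup>2) powr s" using s by (intro ge_one_powr_ge_zero) auto
  from mult_right_mono[OF this, of "(cmod (F \<xi> - G \<xi>))\<^sup>2"]
  show "(cmod (F \<xi> - G \<xi>))\<^sup>2 \<le> ?h \<xi>" by simp
qed

lemma heat_profile_fourier:
  fixes U :: complex
  assumes A: "A > 0" and t: "t > 0"
  shows "is_fourier_L2 (heat_profile A U t :: 'a::euclidean_space \<Rightarrow> complex) (\<lambda>\<xi>. U * of_real (exp (- A * t * (norm \<xi>)\<^sup>2)))"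
proof -
  define c where "c = 1 / (4 * A * t)"
  have c: "c > 0" using A t by (simp add: c_def)
  define k where "k = U * of_real ((4 * A * pi * t) powr (- real DIM('a) / 2))"
  let ?g = "\<lambda>x::'a. complex_of_real (exp (- c * (norm x)\<^sup>2))"
  have h: "heat_profile A U t = (\<lambda>x::'a. k * ?g x)"
    by (rule ext) (simp add: heat_profile_def k_def c_def)
  have i: "integrable lborel (\<lambda>x. k * ?g x)" by (intro integrable_mult_right integrable_gaussian_complex c)
  have "integrable lborel (\<lambda>x::'a. (cmod k)\<^sup>2 * exp (- (2 * c) * (norm x)\<^sup>2))"
    using c by (intro integrable_mult_right integrable_gaussian) simp
  moreover have "(cmod (k * ?g x))\<^sup>2 = (cmod k)\<^sup>2 * exp (- (2 * c) * (norm x)\<^sup>2)" for x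
    by (simp add: norm_mult power_mult_distrib exp_double[symmetric])
  ultimately have "square_integrable (\<lambda>x. k * ?g x)"
    using i unfolding square_integrable_def by (simp only: borel_measurable_integrable)
  from is_fourier_L2_fourier[OF i this]
  have "is_fourier_L2 (heat_profile A U t) (fourier (\<lambda>x. k * ?g x))" unfolding h .
  moreover have "fourier (\<lambda>x. k * ?g x) = (\<lambda>\<xi>. U * of_real (exp (- A * t * (norm \<xi>)\<^sup>2)))"
  proof
    fix \<xi> :: 'a
    have p: "sqrt (pi / c) = (4 * A * pi * t) powr (1 / 2)"
      using A t by (subst powr_half_sqrt) (auto simp: c_def field_simps)
    have "sqrt (pi / c) ^ DIM('a) = (4 * A * pi * t) powr (real DIM('a) / 2)"
      unfolding p using A t by (subst powr_realpow[symmetric]) (auto simp: powr_powr)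
    hence q: "(4 * A * pi * t) powr (- real DIM('a) / 2) * sqrt (pi / c) ^ DIM('a) = 1"
      using A t by (simp add: powr_add[symmetric])
    have e: "- (norm \<xi>)\<^sup>2 / (4 * c) = - A * t * (norm \<xi>)\<^sup>2" using A t by (simp add: c_def)
    have "fourier (\<lambda>x. k * ?g x) \<xi> = k * fourier ?g \<xi>"
      unfolding fourier_def mult.left_commute[of _ k] by simp
    also have "\<dots> = k * of_real (sqrt (pi / c) ^ DIM('a) * exp (- A * t * (norm \<xi>)\<^sup>2))"
      unfolding fourier_gaussian[OF c] e ..
    also have "\<dots> = U * of_real (((4 * A * pi * t) powr (- real DIM('a) / 2) * sqrt (pi / c) ^ DIM('a)) * exp (- A * t * (norm \<xi>)\<^sup>2))"
      unfolding k_def by (simp only: of_real_mult mult_ac)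
    finally show "fourier (\<lambda>x. k * ?g x) \<xi> = U * of_real (exp (- A * t * (norm \<xi>)\<^sup>2))" unfolding q by simp
  qed
  ultimately show ?thesis by simp
qed

text \<open>Each factor 1 + |x|^2 is bounded below by the one for a single coordinate, which reduces
  the claim to a product of one-dimensional integrals.\<close>

lemma integrable_inverse_norm_power:
  "integrable lborel (\<lambda>x::'a::euclidean_space. inverse ((1 + (norm x)\<^sup>2) ^ DIM('a)))"
proof -
  have "integrable lborel (\<lambda>x::real. complex_of_real (inverse (1 + x\<^sup>2)))"
    using integrable_inverse_1_plus_square
    unfolding complex_of_real_integrable_eq by (simp add: set_integrable_def)
  from integrable_prod_Basis[of "\<lambda>_ x. complex_of_real (inverse (1 + x\<^sup>2))", OF this]
  have "integrable lborel (\<lambda>x::'a. \<Prod>b\<in>Basis. complex_of_real (inverse (1 + (x \<bullet> b)\<^sup>2)))" .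
  hence i: "integrable lborel (\<lambda>x::'a. complex_of_real (\<Prod>b\<in>Basis. inverse (1 + (x \<bullet> b)\<^sup>2)))" by (simp only: of_real_prod)
  show ?thesis
  proof (rule Bochner_Integration.integrable_bound[OF i])
    show "AE x::'a in lborel. norm (inverse ((1 + (norm x)\<^sup>2) ^ DIM('a))) \<le> norm (complex_of_real (\<Prod>b\<in>Basis. inverse (1 + (x \<bullet> b)\<^sup>2)))"
    proof (intro AE_I2)
      fix x :: 'a
      have "(\<Prod>b\<in>(Basis::'a set). inverse (1 + (norm x)\<^sup>2)) \<le> (\<Prod>b\<in>Basis. inverse (1 + (x \<bullet> b)\<^sup>2))"
      proof (intro prod_mono conjI le_imp_inverse_le add_left_mono)
        fix b :: 'a assume "b \<in> Basis"
        hence "\<bar>x \<bullet> b\<bar> \<le> norm x" by (rule Basis_le_norm)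
        from power_mono[OF this, of 2] show "(x \<bullet> b)\<^sup>2 \<le> (norm x)\<^sup>2" by simp
      qed (auto intro: add_pos_nonneg)
      moreover have "0 \<le> (\<Prod>b\<in>(Basis::'a set). inverse (1 + (norm x)\<^sup>2))" by (intro prod_nonneg) auto
      ultimately show "norm (inverse ((1 + (norm x)\<^sup>2) ^ DIM('a))) \<le> norm (complex_of_real (\<Prod>b\<in>Basis. inverse (1 + (x \<bullet> b)\<^sup>2)))"
        unfolding norm_of_real by (simp add: power_inverse)
    qed
  qed measurable
qed

lemma powr_le_exp:
  assumes "s \<ge> 0" "c > (0::real)"
  obtains C where "C > 0" "\<And>x. x \<ge> 0 \<Longrightarrow> (1 + x) powr s \<le> C * exp (c * x)"
proof -
  \<comment> \<open>The tangent-line inequality ln y \<le> y - 1 is used at y = d (1 + x); the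
    choice of \<open>d\<close> makes s d \<le> c, and adding 1 to \<open>s\<close> keeps it
    meaningful for s = 0.\<close>
  define d where "d = c / (s + 1)"
  have d: "d > 0" using assms by (simp add: d_def)
  have "(1 + x) powr s \<le> exp (c + s * (- 1 - ln d)) * exp (c * x)" if x: "x \<ge> 0" for x
  proof -
    have "ln (d * (1 + x)) \<le> d * (1 + x) - 1" using d x by (intro ln_le_minus_one) auto
    moreover have "ln (d * (1 + x)) = ln d + ln (1 + x)" using d x by (intro ln_mult_pos) auto
    ultimately have "s * ln (1 + x) \<le> s * (d * (1 + x) + (- 1 - ln d))" using assms by (intro mult_left_mono) auto
    also have "s * d * (1 + x) \<le> c * (1 + x)"
      using assms x by (intro mult_right_mono) (auto simp: d_def field_simps)
    hence "s * (d * (1 + x) + (- 1 - ln d)) \<le> c * (1 + x) + s * (- 1 - ln d)" by (simp add: algebra_simps)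
    finally show ?thesis using x by (simp add: powr_def exp_add[symmetric] algebra_simps)
  qed
  thus ?thesis by (intro that[of "exp (c + s * (- 1 - ln d))"]) auto
qed

section \<open>The scaling limit of the error\<close>

context memory
begin

lemma volterra_sol_scaled_tendsto_at_top:
  assumes \<tau>: "\<tau> \<ge> 0"
  shows "((\<lambda>t. volterra_sol A (\<tau> / t) t) \<longlongrightarrow> exp (- Ainf * \<tau>)) at_top"
proof -
  obtain M where VM: "volterra_kernel A M" using volterra_kernel_ex by blast
  interpret V: volterra_kernel A M by fact
  show ?thesis
  proof (cases "\<tau> = 0")
    case True
    have "\<forall>\<^sub>F t in at_top. volterra_sol A (\<tau> / t) t = exp (- Ainf * \<tau>)"
      using eventually_ge_at_top[of "0::real"] by eventually_elim (simp add: True V.volterra_sol_eq)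
    thus ?thesis by (rule tendsto_eventually)
  next
    case False
    with \<tau> have \<tau>0: "\<tau> > 0" by simp
    show ?thesis
    proof (rule tendsto_at_topI_sequentially)
      fix X :: "nat \<Rightarrow> real" assume X: "filterlim X at_top sequentially"
      \<comment> \<open>The sequential limit asks for positive scales at every index; the
        modification changes only finitely many terms.\<close>
      define Y where "Y n = max 1 (X n)" for n
      have Y1: "Y n > 0" for n by (simp add: Y_def)
      have Y: "filterlim Y at_top sequentially"
        by (rule filterlim_at_top_mono[OF X]) (simp add: Y_def)
      have eq: "\<tau> / (\<tau> / Y n) = Y n" for n using \<tau>0 Y1[of n] by simp
      have "(\<lambda>n. volterra_sol A (\<tau> / Y n) (\<tau> / (\<tau> / Y n))) \<longlonglongrightarrow> exp (- Ainf * \<tau>)"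
      proof (rule V.volterra_sol_scaled_tendsto[OF A_lim])
        show "\<tau> / Y n > 0" for n using \<tau>0 Y1[of n] by simp
        show "(\<lambda>n. \<tau> / Y n) \<longlonglongrightarrow> 0" by (rule real_tendsto_divide_at_top[OF tendsto_const Y])
        show "\<tau> \<ge> 0" by fact
      qed
      hence "(\<lambda>n. volterra_sol A (\<tau> / Y n) (Y n)) \<longlonglongrightarrow> exp (- Ainf * \<tau>)" unfolding eq .
      moreover have "\<forall>\<^sub>F n in sequentially. volterra_sol A (\<tau> / Y n) (Y n) = volterra_sol A (\<tau> / X n) (X n)"
        using filterlim_at_top[THEN iffD1, OF X, rule_format, of 1] by eventually_elim (simp add: Y_def max_def)
      ultimately show "(\<lambda>n. volterra_sol A (\<tau> / X n) (X n)) \<longlonglongrightarrow> exp (- Ainf * \<tau>)"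
        by (rule Lim_transform_eventually)
    qed
  qed
qed

text \<open>The error is split at |\<xi>| = 1. Inside, t^(n/2) is the reciprocal Jacobian of \<xi> =
  \<eta> / sqrt t, and the rescaled integrand tends to 0 because both multipliers have the same
  Gaussian limit and G is continuous at 0. There min (|\<xi>|^2) 1 times t is |\<eta>|^2, so the
  decay hypothesis gives a majorant that does not depend on t. Outside the unit ball it gives |z|
  \<le> K / t^n, and the square t^(-2n) outweighs t^(n/2).\<close>

lemma scaled_error_tendsto_0:
  fixes G :: "'a::euclidean_space \<Rightarrow> complex" and s :: real
  assumes G: "continuous_on UNIV G" and B: "\<And>\<xi>. cmod (G \<xi>) \<le> B"
    and wG: "integrable lborel (\<lambda>\<xi>. (1 + (norm \<xi>)\<^sup>2) powr s * (cmod (G \<xi>))\<^sup>2)"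
    and s: "s \<ge> 0" and Ainf: "Ainf > 0"
    and K: "\<And>\<mu> t. \<mu> > 0 \<Longrightarrow> t > 0 \<Longrightarrow> (min \<mu> 1 * t) ^ DIM('a) * \<bar>volterra_sol A \<mu> t\<bar> \<le> K"
  shows "((\<lambda>t. t powr (real DIM('a) / 2) * (LINT \<xi>|lborel. (1 + (norm \<xi>)\<^sup>2) powr s *
      (cmod (of_real (volterra_sol A ((norm \<xi>)\<^sup>2) t) * G \<xi> - G 0 * of_real (exp (- Ainf * t * (norm \<xi>)\<^sup>2))))\<^sup>2)) \<longlongrightarrow> 0) at_top"
proof -
  let ?N = "DIM('a)"
  obtain M where VM: "volterra_kernel A M" using volterra_kernel_ex by blast
  interpret V: volterra_kernel A M by fact
  have [measurable]: "G \<in> borel_measurable borel" using G by (rule borel_measurable_continuous_onI)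
  have B0: "B \<ge> 0" using order_trans[OF norm_ge_zero B[of 0]] .
  have "\<bar>volterra_sol A 1 1\<bar> \<le> K" using K[of 1 1] by simp
  hence K0: "K \<ge> 0" by linarith
  define z where "z \<xi> t = volterra_sol A ((norm \<xi>)\<^sup>2) t" for \<xi> :: 'a and t
  define g where "g \<xi> t = exp (- Ainf * t * (norm \<xi>)\<^sup>2)" for \<xi> :: 'a and t
  define w where "w \<xi> = (1 + (norm \<xi>)\<^sup>2) powr s" for \<xi> :: 'a
  define e where "e t \<xi> = w \<xi> * (cmod (of_real (z \<xi> t) * G \<xi> - G 0 * of_real (g \<xi> t)))\<^sup>2" for t \<xi>
  have [measurable]: "w \<in> borel_measurable borel" "(\<lambda>\<xi>. z \<xi> t) \<in> borel_measurable borel" "(\<lambda>\<xi>. g \<xi> t) \<in> borel_measurable borel" for t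
    unfolding w_def z_def g_def by measurable
  have [measurable]: "e t \<in> borel_measurable borel" for t unfolding e_def by measurable
  have w0: "w \<xi> \<ge> 0" for \<xi> by (simp add: w_def)
  have e0: "e t \<xi> \<ge> 0" for t \<xi> by (simp add: e_def w_def)
  have e_le: "e t \<xi> \<le> w \<xi> * (2 * (\<bar>z \<xi> t\<bar> * cmod (G \<xi>))\<^sup>2 + 2 * (B * g \<xi> t)\<^sup>2)" for t \<xi>
  proof -
    have "(cmod (of_real (z \<xi> t) * G \<xi> - G 0 * of_real (g \<xi> t)))\<^sup>2 \<le> 2 * (\<bar>z \<xi> t\<bar> * cmod (G \<xi>))\<^sup>2 + 2 * (cmod (G 0) * g \<xi> t)\<^sup>2"
      using norm_diff_sq_le[of "of_real (z \<xi> t) * G \<xi>" "G 0 * of_real (g \<xi> t)"] by (simp add: norm_mult g_def)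
    also have "\<dots> \<le> 2 * (\<bar>z \<xi> t\<bar> * cmod (G \<xi>))\<^sup>2 + 2 * (B * g \<xi> t)\<^sup>2"
      by (intro add_left_mono mult_left_mono power_mono mult_right_mono B) (auto simp: g_def)
    finally show ?thesis unfolding e_def by (intro mult_left_mono w0)
  qed

  define low where "low t \<xi> = indicator (cball 0 1) \<xi> * e t \<xi>" for t \<xi>
  have [measurable]: "cball (0::'a) 1 \<in> sets borel" by (intro borel_closed closed_cball)
  have [measurable]: "low t \<in> borel_measurable borel" for t unfolding low_def by measurable
  have w2: "w \<xi> \<le> 2 powr s" if "norm \<xi> \<le> 1" for \<xi>
    unfolding w_def using power_mono[OF that, of 2] s by (intro powr_mono2) auto
  \<comment> \<open>This bound grows with t and only serves to make \<open>low t\<close>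
    integrable.\<close>
  have low_le: "low t \<xi> \<le> 2 powr s * (2 * (exp (M * t) * B)\<^sup>2 + 2 * B\<^sup>2) * indicator (cball 0 1) \<xi>" if t: "t \<ge> 0" for t \<xi>
  proof (cases "norm \<xi> \<le> 1")
    case True
    have "\<bar>z \<xi> t\<bar> \<le> exp (1\<^sup>2 * M * t)" unfolding z_def
    proof -
      have "\<bar>volterra_sol A ((norm \<xi>)\<^sup>2) t\<bar> \<le> exp (\<bar>(norm \<xi>)\<^sup>2\<bar> * M * t)" by (rule V.volterra_sol_bound[OF t])
      also have "\<dots> \<le> exp (1\<^sup>2 * M * t)" unfolding exp_le_cancel_iff
        using t V.M_nonneg power_mono[OF True, of 2] by (intro mult_right_mono) auto
      finally show "\<bar>volterra_sol A ((norm \<xi>)\<^sup>2) t\<bar> \<le> exp (1\<^sup>2 * M * t)" .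
    qed
    hence 1: "\<bar>z \<xi> t\<bar> * cmod (G \<xi>) \<le> exp (M * t) * B" using B[of \<xi>] by (intro mult_mono) auto
    have 2: "B * g \<xi> t \<le> B" using B0 Ainf t by (simp add: g_def mult_left_le)
    have "e t \<xi> \<le> w \<xi> * (2 * (\<bar>z \<xi> t\<bar> * cmod (G \<xi>))\<^sup>2 + 2 * (B * g \<xi> t)\<^sup>2)" by (rule e_le)
    also have "\<dots> \<le> 2 powr s * (2 * (exp (M * t) * B)\<^sup>2 + 2 * B\<^sup>2)"
      using B0 by (intro mult_mono w2 True add_mono mult_left_mono power_mono 1 2) (auto simp: g_def)
    finally show ?thesis using True by (simp add: low_def)
  qed (simp add: low_def)
  have low0: "low t \<xi> \<ge> 0" for t \<xi> using e0 by (simp add: low_def)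
  have ilow: "integrable lborel (low t)" if t: "t \<ge> 0" for t
  proof (rule Bochner_Integration.integrable_bound)
    show "integrable lborel (\<lambda>\<xi>::'a. 2 powr s * (2 * (exp (M * t) * B)\<^sup>2 + 2 * B\<^sup>2) * indicator (cball 0 1) \<xi>)"
      using borel_integrable_compact[of "cball (0::'a) 1" "\<lambda>_. 1::real"] by (intro integrable_mult_right) auto
    show "AE \<xi> in lborel. norm (low t \<xi>) \<le> norm (2 powr s * (2 * (exp (M * t) * B)\<^sup>2 + 2 * B\<^sup>2) * indicator (cball (0::'a) 1) \<xi>)"
      using low_le[OF t] low0[of t] by (intro AE_I2) (simp add: order_trans[OF _ abs_ge_self])
  qed simp

  \<comment> \<open>Half of the Gaussian exponent is sacrificed to absorb the Sobolev weight; the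
    other half keeps the bound integrable.\<close>
  obtain C where C: "C > 0" "\<And>x. x \<ge> 0 \<Longrightarrow> (1 + x) powr s \<le> C * exp (Ainf / 2 * x)"
    using powr_le_exp[OF s, of "Ainf / 2"] Ainf by auto
  define high where "high t \<xi> = 2 * (K / t ^ ?N)\<^sup>2 * (w \<xi> * (cmod (G \<xi>))\<^sup>2) + 2 * B\<^sup>2 * C * exp (- Ainf * t) * exp (- (Ainf / 2) * (norm \<xi>)\<^sup>2)" for t and \<xi> :: 'a
  have igauss: "integrable lborel (\<lambda>\<xi>::'a. exp (- (Ainf / 2) * (norm \<xi>)\<^sup>2))" by (rule integrable_gaussian) (use Ainf in simp)
  have iwG: "integrable lborel (\<lambda>\<xi>. w \<xi> * (cmod (G \<xi>))\<^sup>2)" using wG unfolding w_def .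
  have ihigh: "integrable lborel (high t)" for t
    unfolding high_def by (intro Bochner_Integration.integrable_add integrable_mult_right igauss iwG)
  have high0: "high t \<xi> \<ge> 0" for t \<xi> using w0[of \<xi>] C(1) by (simp add: high_def)
  have e_high: "e t \<xi> \<le> low t \<xi> + high t \<xi>" if t: "t \<ge> 1" for t \<xi>
  proof (cases "norm \<xi> \<le> 1")
    case True thus ?thesis using high0 by (simp add: low_def)
  next
    case False
    hence x1: "1 \<le> (norm \<xi>)\<^sup>2" by (simp add: one_le_power)
    have "t ^ ?N * \<bar>z \<xi> t\<bar> \<le> K" using K[of "(norm \<xi>)\<^sup>2" t] t order.strict_trans2[OF zero_less_one x1] unfolding z_def min_absorb2[OF x1] mult_1 by linarith
    hence zK: "\<bar>z \<xi> t\<bar> \<le> K / t ^ ?N" using t by (simp add: field_simps)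
    \<comment> \<open>As t and |\<xi>|^2 are at least 1, their sum is at most twice their product.
      This splits the Gaussian into a factor decaying in t and one decaying in \<xi>.\<close>
    have "1 * t \<le> (norm \<xi>)\<^sup>2 * t" "1 * (norm \<xi>)\<^sup>2 \<le> t * (norm \<xi>)\<^sup>2" using mult_right_mono[OF x1, of t] mult_right_mono[OF t, of "(norm \<xi>)\<^sup>2"] t by auto
    hence "t + (norm \<xi>)\<^sup>2 \<le> 2 * (t * (norm \<xi>)\<^sup>2)" by (simp add: mult.commute)
    hence "Ainf * (t + (norm \<xi>)\<^sup>2) \<le> Ainf * (2 * (t * (norm \<xi>)\<^sup>2))" using Ainf by (intro mult_left_mono) auto
    hence g2: "(g \<xi> t)\<^sup>2 \<le> exp (- Ainf * t) * exp (- Ainf * (norm \<xi>)\<^sup>2)"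
      unfolding g_def exp_double[symmetric] exp_add[symmetric] exp_le_cancel_iff by (simp add: algebra_simps)
    have "w \<xi> * (g \<xi> t)\<^sup>2 \<le> (C * exp (Ainf / 2 * (norm \<xi>)\<^sup>2)) * (exp (- Ainf * t) * exp (- Ainf * (norm \<xi>)\<^sup>2))"
      unfolding w_def using C by (intro mult_mono g2 C(2)) auto
    also have "\<dots> = C * exp (- Ainf * t) * (exp (Ainf / 2 * (norm \<xi>)\<^sup>2) * exp (- Ainf * (norm \<xi>)\<^sup>2))" by (simp only: mult_ac)
    also have "exp (Ainf / 2 * (norm \<xi>)\<^sup>2) * exp (- Ainf * (norm \<xi>)\<^sup>2) = exp (- (Ainf / 2) * (norm \<xi>)\<^sup>2)"
      unfolding exp_add[symmetric] by (simp add: field_simps)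
    finally have wg: "w \<xi> * (g \<xi> t)\<^sup>2 \<le> C * exp (- Ainf * t) * exp (- (Ainf / 2) * (norm \<xi>)\<^sup>2)" .
    have zz: "\<bar>z \<xi> t\<bar>\<^sup>2 \<le> (K / t ^ ?N)\<^sup>2" by (rule power_mono[OF zK]) simp
    have "e t \<xi> \<le> w \<xi> * (2 * (\<bar>z \<xi> t\<bar> * cmod (G \<xi>))\<^sup>2 + 2 * (B * g \<xi> t)\<^sup>2)" by (rule e_le)
    also have "\<dots> = 2 * \<bar>z \<xi> t\<bar>\<^sup>2 * (w \<xi> * (cmod (G \<xi>))\<^sup>2) + 2 * B\<^sup>2 * (w \<xi> * (g \<xi> t)\<^sup>2)"
      by (simp only: power_mult_distrib distrib_left mult_ac)
    also have "\<dots> \<le> 2 * (K / t ^ ?N)\<^sup>2 * (w \<xi> * (cmod (G \<xi>))\<^sup>2) + 2 * B\<^sup>2 * (C * exp (- Ainf * t) * exp (- (Ainf / 2) * (norm \<xi>)\<^sup>2))"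
      using w0[of \<xi>] by (intro add_mono mult_right_mono mult_left_mono zz wg) auto
    finally show ?thesis using low0[of t \<xi>] by (simp add: high_def mult_ac)
  qed
  have E_le: "(LINT \<xi>|lborel. e t \<xi>) \<le> (LINT \<xi>|lborel. low t \<xi>) + (LINT \<xi>|lborel. high t \<xi>)" if t: "t \<ge> 1" for t
  proof -
    have il: "integrable lborel (low t)" using t by (intro ilow) simp
    have "(LINT \<xi>|lborel. e t \<xi>) \<le> (LINT \<xi>|lborel. low t \<xi> + high t \<xi>)"
      by (intro integral_mono' Bochner_Integration.integrable_add il ihigh e_high t add_nonneg_nonneg low0 high0)
    thus ?thesis by (simp only: Bochner_Integration.integral_add[OF il ihigh])
  qed

  have lim_high: "((\<lambda>t. t powr (real ?N / 2) * (LINT \<xi>|lborel. high t \<xi>)) \<longlongrightarrow> 0) at_top"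
  proof -
    define I1 where "I1 = 2 * K\<^sup>2 * (LINT \<xi>|lborel. w \<xi> * (cmod (G \<xi>))\<^sup>2)"
    define I2 where "I2 = 2 * B\<^sup>2 * C * (LINT \<xi>::'a|lborel. exp (- (Ainf / 2) * (norm \<xi>)\<^sup>2))"
    have eq: "(LINT \<xi>|lborel. high t \<xi>) = (1 / t ^ ?N)\<^sup>2 * I1 + exp (- Ainf * t) * I2" for t
      unfolding high_def
      by (subst Bochner_Integration.integral_add[OF integrable_mult_right[OF iwG] integrable_mult_right[OF igauss]])
         (simp add: I1_def I2_def power_divide)
    have n0: "real ?N > 0" by simp
    have 1: "((\<lambda>t::real. t powr (real ?N / 2) * (1 / t ^ ?N)\<^sup>2) \<longlongrightarrow> 0) at_top"
    proof (rule Lim_transform_eventually)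
      show "((\<lambda>t::real. t powr (- (3 / 2 * real ?N))) \<longlongrightarrow> 0) at_top"
        by (rule tendsto_neg_powr[OF _ filterlim_ident]) (use n0 in simp)
      show "\<forall>\<^sub>F t::real in at_top. t powr (- (3 / 2 * real ?N)) = t powr (real ?N / 2) * (1 / t ^ ?N)\<^sup>2"
        using eventually_gt_at_top[of 0]
      proof eventually_elim
        case (elim t)
        have "(1 / t ^ ?N)\<^sup>2 = t powr (- real ?N) * t powr (- real ?N)"
          using elim by (simp add: powr_minus powr_realpow power2_eq_square divide_inverse)
        thus ?case by (simp add: powr_add[symmetric])
      qed
    qed
    have 2: "((\<lambda>t::real. t powr (real ?N / 2) * exp (- Ainf * t)) \<longlongrightarrow> 0) at_top"
      using Ainf n0 by real_asymp
    have "((\<lambda>t. t powr (real ?N / 2) * (1 / t ^ ?N)\<^sup>2 * I1 + t powr (real ?N / 2) * exp (- Ainf * t) * I2) \<longlongrightarrow> 0 * I1 + 0 * I2) at_top"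
      by (intro tendsto_add tendsto_mult 1 2 tendsto_const)
    thus ?thesis unfolding eq by (simp add: distrib_left mult_ac)
  qed

  have lim_low: "((\<lambda>t. t powr (real ?N / 2) * (LINT \<xi>|lborel. low t \<xi>)) \<longlongrightarrow> 0) at_top"
  proof (rule Lim_transform_eventually)
    let ?h = "\<lambda>t \<eta>. low t ((1 / sqrt t) *\<^sub>R \<eta>)"
    let ?l = "\<lambda>t \<eta>. w ((1 / sqrt t) *\<^sub>R \<eta>) * (cmod (of_real (volterra_sol A ((norm \<eta>)\<^sup>2 / t) t) * G ((1 / sqrt t) *\<^sub>R \<eta>) - G 0 * of_real (exp (- Ainf * (norm \<eta>)\<^sup>2))))\<^sup>2"
    \<comment> \<open>Two regimes of |\<eta>|^2: up to 1 the Neumann bound gives exp M, beyond 1 the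
      decay hypothesis gives K. In both, 1 + |\<eta>|^2 is at most 2 or at most 2 |\<eta>|^2, whence
      the power of 2.\<close>
    define C0 where "C0 = 2 ^ ?N * (K + exp M)"
    have C00: "C0 \<ge> 0" using K0 by (simp add: C0_def)
    let ?p = "\<lambda>\<eta>::'a. inverse ((1 + (norm \<eta>)\<^sup>2) ^ ?N)"
    let ?W = "\<lambda>\<eta>::'a. 2 powr s * (2 * (C0 * B)\<^sup>2 * ?p \<eta> + 2 * B\<^sup>2 * exp (- (2 * Ainf) * (norm \<eta>)\<^sup>2))"
    have W0: "?W \<eta> \<ge> 0" for \<eta> :: 'a by simp
    have nsq: "(norm ((1 / sqrt t) *\<^sub>R \<eta>))\<^sup>2 = (norm \<eta>)\<^sup>2 / t" if "t > 0" for t and \<eta> :: 'a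
      using that by (simp add: power_mult_distrib power_divide)
    have "((\<lambda>t. LINT \<eta>|lborel. ?h t \<eta>) \<longlongrightarrow> (LINT \<eta>::'a|lborel. 0)) at_top"
    proof (rule integral_dominated_convergence_at_top[where w="?W"])
      show "(\<lambda>\<eta>::'a. 0::real) \<in> borel_measurable lborel" by simp
      show "(\<lambda>\<eta>. ?h t \<eta>) \<in> borel_measurable lborel" for t by measurable
      show "integrable lborel ?W"
        by (intro integrable_mult_right Bochner_Integration.integrable_add integrable_inverse_norm_power integrable_gaussian) (use Ainf in simp)
      show "AE \<eta> in lborel. ((\<lambda>t. ?h t \<eta>) \<longlongrightarrow> 0) at_top"
      proof (intro AE_I2)
        fix \<eta> :: 'a
        have st: "((\<lambda>t::real. (1 / sqrt t) *\<^sub>R \<eta>) \<longlongrightarrow> 0) at_top"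
        proof -
          have "((\<lambda>t::real. 1 / sqrt t) \<longlongrightarrow> 0) at_top" by real_asymp
          from tendsto_scaleR[OF this tendsto_const[of \<eta>]] show ?thesis by simp
        qed
        have Gt: "((\<lambda>t. G ((1 / sqrt t) *\<^sub>R \<eta>)) \<longlongrightarrow> G 0) at_top"
          by (rule continuous_on_tendsto_compose[OF G st]) auto
        have wt: "((\<lambda>t. w ((1 / sqrt t) *\<^sub>R \<eta>)) \<longlongrightarrow> w 0) at_top"
        proof (rule continuous_on_tendsto_compose[OF _ st])
          show "continuous_on UNIV w" unfolding w_def
            by (intro continuous_intros) (auto simp: add_nonneg_eq_0_iff)
        qed auto
        have zt: "((\<lambda>t. volterra_sol A ((norm \<eta>)\<^sup>2 / t) t) \<longlongrightarrow> exp (- Ainf * (norm \<eta>)\<^sup>2)) at_top"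
          by (rule volterra_sol_scaled_tendsto_at_top) simp
        have "((\<lambda>t. ?l t \<eta>)
           \<longlongrightarrow> w 0 * (cmod (of_real (exp (- Ainf * (norm \<eta>)\<^sup>2)) * G 0 - G 0 * of_real (exp (- Ainf * (norm \<eta>)\<^sup>2))))\<^sup>2) at_top"
          by (intro tendsto_mult tendsto_power tendsto_norm tendsto_diff tendsto_of_real tendsto_const wt Gt zt)
        hence l0: "((\<lambda>t. ?l t \<eta>) \<longlongrightarrow> 0) at_top"
          by (simp add: mult.commute)
        show "((\<lambda>t. ?h t \<eta>) \<longlongrightarrow> 0) at_top"
        proof (rule Lim_null_comparison[OF _ l0])
          show "\<forall>\<^sub>F t in at_top. norm (?h t \<eta>) \<le> ?l t \<eta>"
            using eventually_gt_at_top[of 0]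
          proof eventually_elim
            case (elim t)
            have zz: "z ((1 / sqrt t) *\<^sub>R \<eta>) t = volterra_sol A ((norm \<eta>)\<^sup>2 / t) t" unfolding z_def nsq[OF elim] ..
            have gg: "g ((1 / sqrt t) *\<^sub>R \<eta>) t = exp (- Ainf * (norm \<eta>)\<^sup>2)" unfolding g_def nsq[OF elim] using elim by simp
            have "norm (?h t \<eta>) \<le> e t ((1 / sqrt t) *\<^sub>R \<eta>)"
              using e0[of t "(1 / sqrt t) *\<^sub>R \<eta>"] by (simp add: low_def indicator_def)
            thus ?case unfolding e_def zz gg .
          qed
        qed
      qed
      show "\<forall>\<^sub>F t in at_top. AE \<eta> in lborel. norm (?h t \<eta>) \<le> ?W \<eta>"
        using eventually_ge_at_top[of 1]
      proof eventually_elim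
        case (elim t)
        hence t: "t > 0" by simp
        show ?case
        proof (intro AE_I2)
          fix \<eta> :: 'a
          define \<xi> where "\<xi> = (1 / sqrt t) *\<^sub>R \<eta>"
          define x where "x = (norm \<eta>)\<^sup>2"
          have x0: "x \<ge> 0" by (simp add: x_def)
          have \<xi>x: "(norm \<xi>)\<^sup>2 = x / t" unfolding \<xi>_def x_def by (rule nsq[OF t])
          show "norm (?h t \<eta>) \<le> ?W \<eta>"
          proof (cases "norm \<xi> \<le> 1")
            case False
            hence "?h t \<eta> = 0" by (simp add: low_def \<xi>_def)
            thus ?thesis using W0[of \<eta>] by (simp only: norm_zero)
          next
            case True
            hence xt: "x / t \<le> 1" using power_mono[OF True, of 2] \<xi>x by simp
            have zb: "\<bar>z \<xi> t\<bar> \<le> C0 * inverse ((1 + x) ^ ?N)"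
            proof -
              have "(1 + x) ^ ?N * \<bar>z \<xi> t\<bar> \<le> C0"
              proof (cases "x \<le> 1")
                case True
                have "\<bar>z \<xi> t\<bar> \<le> exp (\<bar>x / t\<bar> * M * t)" unfolding z_def \<xi>x by (rule V.volterra_sol_bound) (use t in simp)
                also have "\<dots> = exp (x * M)" using t x0 by simp
                also have "\<dots> \<le> exp M" using True V.M_nonneg by (simp add: mult_left_le_one_le x0)
                finally have "(1 + x) ^ ?N * \<bar>z \<xi> t\<bar> \<le> 2 ^ ?N * exp M"
                  using True x0 by (intro mult_mono power_mono) auto
                also have "\<dots> \<le> C0" using K0 by (simp add: C0_def)
                finally show ?thesis .
              next
                case False
                have "(min (x / t) 1 * t) ^ ?N * \<bar>volterra_sol A (x / t) t\<bar> \<le> K" using False t by (intro K) auto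
                moreover have "min (x / t) 1 * t = x" using xt t by (simp add: min_def)
                ultimately have k: "x ^ ?N * \<bar>z \<xi> t\<bar> \<le> K" by (simp only: z_def \<xi>x)
                have "(1 + x) ^ ?N * \<bar>z \<xi> t\<bar> \<le> (2 * x) ^ ?N * \<bar>z \<xi> t\<bar>"
                  using False by (intro mult_right_mono power_mono) auto
                also have "\<dots> = 2 ^ ?N * (x ^ ?N * \<bar>z \<xi> t\<bar>)" by (simp add: power_mult_distrib)
                also have "\<dots> \<le> 2 ^ ?N * K" by (intro mult_left_mono k) simp
                also have "\<dots> \<le> C0" by (simp add: C0_def)
                finally show ?thesis .
              qed
              moreover have "(1 + x) ^ ?N > 0" using x0 by (intro zero_less_power) auto
              ultimately show ?thesis by (simp add: field_simps)
            qed
            have q: "inverse ((1 + x) ^ ?N) \<le> 1" "0 \<le> inverse ((1 + x) ^ ?N)" using x0 by (auto simp: inverse_le_1_iff one_le_power)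
            have "(\<bar>z \<xi> t\<bar> * cmod (G \<xi>))\<^sup>2 \<le> (C0 * inverse ((1 + x) ^ ?N) * B)\<^sup>2"
              using C00 q by (intro power_mono mult_mono zb B) auto
            also have "\<dots> = (C0 * B)\<^sup>2 * (inverse ((1 + x) ^ ?N))\<^sup>2" by (simp only: power_mult_distrib mult_ac)
            \<comment> \<open>One of the two powers is dropped, as the first power is already
              integrable.\<close>
            also have "\<dots> \<le> (C0 * B)\<^sup>2 * inverse ((1 + x) ^ ?N)"
              using q by (intro mult_left_mono) (auto simp: power2_eq_square mult_left_le)
            finally have p1: "(\<bar>z \<xi> t\<bar> * cmod (G \<xi>))\<^sup>2 \<le> (C0 * B)\<^sup>2 * inverse ((1 + x) ^ ?N)" .
            have gx: "g \<xi> t = exp (- Ainf * x)" unfolding g_def \<xi>x using t by simp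
            have p2: "(B * g \<xi> t)\<^sup>2 = B\<^sup>2 * exp (- (2 * Ainf) * x)"
              unfolding gx power_mult_distrib exp_double[symmetric] by (simp add: mult_ac)
            have "norm (?h t \<eta>) = e t \<xi>" using True e0[of t \<xi>] by (simp add: low_def \<xi>_def)
            also have "\<dots> \<le> w \<xi> * (2 * (\<bar>z \<xi> t\<bar> * cmod (G \<xi>))\<^sup>2 + 2 * (B * g \<xi> t)\<^sup>2)" by (rule e_le)
            also have "\<dots> \<le> 2 powr s * (2 * ((C0 * B)\<^sup>2 * inverse ((1 + x) ^ ?N)) + 2 * (B\<^sup>2 * exp (- (2 * Ainf) * x)))"
              unfolding p2 by (intro mult_mono w2 True add_mono mult_left_mono p1) auto
            finally show ?thesis unfolding x_def by (simp only: mult.assoc)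
          qed
        qed
      qed
    qed
    thus "((\<lambda>t. LINT \<eta>|lborel. ?h t \<eta>) \<longlongrightarrow> 0) at_top" by simp
    show "\<forall>\<^sub>F t in at_top. (LINT \<eta>|lborel. ?h t \<eta>) = t powr (real ?N / 2) * (LINT \<xi>|lborel. low t \<xi>)"
      using eventually_gt_at_top[of 0]
    proof eventually_elim
      case (elim t)
      have "t powr (real ?N / 2) = (t powr (1 / 2)) powr real ?N" by (simp add: powr_powr)
      also have "\<dots> = sqrt t ^ ?N" using elim by (simp add: powr_half_sqrt powr_realpow)
      finally have "t powr (real ?N / 2) * \<bar>1 / sqrt t\<bar> ^ ?N = 1"
        using elim by (simp add: power_mult_distrib[symmetric])
      thus ?case
        using lborel_integral_affine[of "1 / sqrt t" "low t" 0] elim by (simp flip: mult.assoc)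
    qed
  qed

  show ?thesis
  proof (rule tendsto_sandwich)
    show "((\<lambda>t. 0) \<longlongrightarrow> (0::real)) at_top" by simp
    show "((\<lambda>t. t powr (real ?N / 2) * (LINT \<xi>|lborel. low t \<xi>) + t powr (real ?N / 2) * (LINT \<xi>|lborel. high t \<xi>)) \<longlongrightarrow> 0) at_top"
      using tendsto_add[OF lim_low lim_high] by simp
    show "\<forall>\<^sub>F t in at_top. 0 \<le> t powr (real ?N / 2) * (LINT \<xi>|lborel. (1 + (norm \<xi>)\<^sup>2) powr s *
      (cmod (of_real (volterra_sol A ((norm \<xi>)\<^sup>2) t) * G \<xi> - G 0 * of_real (exp (- Ainf * t * (norm \<xi>)\<^sup>2))))\<^sup>2)"
      by (intro always_eventually allI mult_nonneg_nonneg integral_nonneg_AE) auto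
    show "\<forall>\<^sub>F t in at_top. t powr (real ?N / 2) * (LINT \<xi>|lborel. (1 + (norm \<xi>)\<^sup>2) powr s *
      (cmod (of_real (volterra_sol A ((norm \<xi>)\<^sup>2) t) * G \<xi> - G 0 * of_real (exp (- Ainf * t * (norm \<xi>)\<^sup>2))))\<^sup>2)
      \<le> t powr (real ?N / 2) * (LINT \<xi>|lborel. low t \<xi>) + t powr (real ?N / 2) * (LINT \<xi>|lborel. high t \<xi>)"
      using eventually_ge_at_top[of 1]
    proof eventually_elim
      case (elim t)
      show ?case unfolding distrib_left[symmetric]
        by (rule mult_left_mono[OF E_le[OF elim, unfolded e_def w_def z_def g_def]]) simp
    qed
  qed
qed

end

theorem corollary5p2:
  fixes a :: "real \<Rightarrow> real" and a\<^sub>0 A_inf s \<alpha> :: real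
    and u\<^sub>0 :: "real ^ 'n \<Rightarrow> complex" and u :: "real \<Rightarrow> real ^ 'n \<Rightarrow> complex"
    and a_ext :: "complex \<Rightarrow> complex"
  assumes "a\<^sub>0 \<ge> 0"
    and "set_borel_measurable lborel {0<..} a"
    and "\<And>\<epsilon>. \<epsilon> > 0 \<Longrightarrow> bounded (a ` {\<epsilon>..})"
    and "set_integrable lborel {0<..<1} a"
    and "((\<lambda>T. a\<^sub>0 + (LINT r:{0<..T}|lborel. a r)) \<longlongrightarrow> A_inf) at_top"
    and "0 < A_inf"
    and "s \<ge> 0"
    and "integrable lborel u\<^sub>0"
    and "u\<^sub>0 \<in> sobolev s"
    and "\<alpha> > 0"
    and "laplace_extension \<alpha> a a_ext"
    and "(a\<^sub>0 > 0 \<and> (\<forall>\<omega>::real. a\<^sub>0 + Re (a_ext (\<i> * of_real \<omega>)) > 0)) \<or>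
         (\<forall>\<omega>::real. Re (a_ext (- of_real \<alpha> + \<i> * of_real \<omega>)) \<ge> 0)"
    and "continuous_into_sobolev s u"
    and "distributional_solution a\<^sub>0 a u\<^sub>0 u"
  shows "(\<lambda>t. sobolev_norm s (\<lambda>x. u t x - heat_profile A_inf (LINT y|lborel. u\<^sub>0 y) t x))
           \<in> o(\<lambda>t. t powr (- real CARD('n) / 4))"
proof -
  interpret memory a\<^sub>0 A_inf a
    using assms(2-5) by unfold_locales auto
  define F where "F t = (SOME F. is_fourier_L2 (u t) F)" for t
  have us: "u t \<in> sobolev s" if "t \<ge> 0" for t
    using assms(13) that by (simp add: continuous_into_sobolev_def)
  have F: "is_fourier_L2 (u t) (F t)" if "t \<ge> 0" for t
    unfolding F_def using us[OF that] by (auto simp: sobolev_def intro: someI[of "is_fourier_L2 (u t)"])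
  interpret fourier_solution a\<^sub>0 A_inf a u F
  proof
    show "is_fourier_L2 (u t) (F t)" if "t \<ge> 0" for t by (rule F[OF that])
    fix t\<^sub>0 :: real assume t0: "t\<^sub>0 \<ge> 0"
    show "((\<lambda>t. l2norm (\<lambda>\<xi>. F t \<xi> - F t\<^sub>0 \<xi>)) \<longlongrightarrow> 0) (at t\<^sub>0 within {0..})"
    proof (rule Lim_null_comparison)
      show "((\<lambda>t. sobolev_norm s (\<lambda>x. u t x - u t\<^sub>0 x)) \<longlongrightarrow> 0) (at t\<^sub>0 within {0..})"
        using assms(13) t0 by (simp add: continuous_into_sobolev_def)
      show "\<forall>\<^sub>F t in at t\<^sub>0 within {0..}. norm (l2norm (\<lambda>\<xi>. F t \<xi> - F t\<^sub>0 \<xi>)) \<le> sobolev_norm s (\<lambda>x. u t x - u t\<^sub>0 x)"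
        unfolding eventually_at using t0
        by (intro exI[of _ 1]) (auto intro!: l2norm_le_sobolev_norm us F assms)
    qed
  next
    fix \<phi> :: "real \<times> (real ^ 'n) \<Rightarrow> complex" assume "test_function \<phi>"
    thus "- (LINT t:{0<..}|lborel. pairing (u t) (\<lambda>x. vector_derivative (\<lambda>\<tau>. \<phi> (\<tau>, x)) (at t))) =
        (LINT t:{0<..}|lborel.
           of_real a\<^sub>0 * pairing (u t) (laplacian (\<lambda>x. \<phi> (t, x))) +
           (LINT r:{0<..<t}|lborel.
              of_real (a (t - r)) * pairing (u r) (laplacian (\<lambda>x. \<phi> (t, x)))))"
      using assms(14) by (simp add: distributional_solution_def)
  qed
  have sq0: "square_integrable u\<^sub>0" using assms(9) by (auto simp: sobolev_def is_fourier_L2_def)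
  have F0': "is_fourier_L2 u\<^sub>0 (fourier u\<^sub>0)" by (rule is_fourier_L2_fourier[OF assms(8) sq0])
  \<comment> \<open>Since \<open>u\<^sub>0\<close> is integrable, its transform has the continuous
    version \<open>fourier u\<^sub>0\<close>, whose value at 0 is the total mass. The version
    \<open>F 0\<close> agrees with it almost everywhere.\<close>
  have F0: "AE \<xi> in lborel. F 0 \<xi> = fourier u\<^sub>0 \<xi>"
    by (rule is_fourier_L2_unique[OF F F0']) (use assms(14) in \<open>auto simp: distributional_solution_def\<close>)
  have U0: "fourier u\<^sub>0 0 = (LINT y|lborel. u\<^sub>0 y)" by (simp add: fourier_def)
  obtain K where K: "\<And>\<mu> t. \<mu> > 0 \<Longrightarrow> t > 0 \<Longrightarrow> (min \<mu> 1 * t) ^ CARD('n) * \<bar>volterra_sol A \<mu> t\<bar> \<le> K"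
    using volterra_sol_decay[OF assms(1,11,10,6,12), of "CARD('n)"] by (auto simp: Suc_le_eq)
  \<comment> \<open>\<open>E t\<close> is the square of the norm to be estimated, so its rate
    t^(-n/2) becomes t^(-n/4) after taking roots.\<close>
  define E where "E t = (LINT \<xi>::real^'n|lborel. (1 + (norm \<xi>)\<^sup>2) powr s *
      (cmod (of_real (volterra_sol A ((norm \<xi>)\<^sup>2) t) * fourier u\<^sub>0 \<xi> - fourier u\<^sub>0 0 * of_real (exp (- A_inf * t * (norm \<xi>)\<^sup>2))))\<^sup>2)" for t
  have E: "((\<lambda>t. t powr (real CARD('n) / 2) * E t) \<longlongrightarrow> 0) at_top"
    unfolding E_def
    using scaled_error_tendsto_0[OF continuous_fourier[OF assms(8)] norm_fourier_le sobolev_integrable[OF assms(9) F0'] assms(7,6), of K] K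
    by simp
  obtain M where VM: "volterra_kernel A M" using volterra_kernel_ex by blast
  interpret V: volterra_kernel A M by fact
  have norm_eq: "sobolev_norm s (\<lambda>x. u t x - heat_profile A_inf (LINT y|lborel. u\<^sub>0 y) t x) = sqrt (E t)" if t: "t > 0" for t
  proof -
  let ?f = "\<lambda>\<xi>. (1 + (norm \<xi>)\<^sup>2) powr s * (cmod (F t \<xi> - fourier u\<^sub>0 0 * of_real (exp (- A_inf * t * (norm \<xi>)\<^sup>2))))\<^sup>2"
    have fd: "is_fourier_L2 (\<lambda>x. u t x - heat_profile A_inf (fourier u\<^sub>0 0) t x) (\<lambda>\<xi>. F t \<xi> - fourier u\<^sub>0 0 * of_real (exp (- A_inf * t * (norm \<xi>)\<^sup>2)))"
      using t by (intro is_fourier_L2_diff F heat_profile_fourier assms(6)) auto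
    have [measurable]: "F t \<in> borel_measurable borel" "fourier u\<^sub>0 \<in> borel_measurable borel"
      using sq(2)[of t] t assms(8) by (auto intro: square_integrable_measurable borel_measurable_fourier)
    have "AE \<xi> in lborel. F t \<xi> = of_real (volterra_sol A ((norm \<xi>)\<^sup>2) t) * F 0 \<xi>"
      by (rule fourier_solution_eq) (use t in simp)
    with F0 have "AE \<xi> in lborel. ?f \<xi> =
        (1 + (norm \<xi>)\<^sup>2) powr s * (cmod (of_real (volterra_sol A ((norm \<xi>)\<^sup>2) t) * fourier u\<^sub>0 \<xi> - fourier u\<^sub>0 0 * of_real (exp (- A_inf * t * (norm \<xi>)\<^sup>2))))\<^sup>2"
      by eventually_elim (simp only:)
    hence "(LINT \<xi>|lborel. ?f \<xi>) = E t"
      unfolding E_def by (rule integral_cong_AE[rotated 2]) measurable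
    thus ?thesis unfolding U0[symmetric] sobolev_norm_eq[OF fd] by simp
  qed
  show ?thesis
  proof (rule smalloI_tendsto)
    have "((\<lambda>t. sqrt (t powr (real CARD('n) / 2) * E t)) \<longlongrightarrow> sqrt 0) at_top" by (intro tendsto_real_sqrt E)
    hence l: "((\<lambda>t. sqrt (t powr (real CARD('n) / 2) * E t)) \<longlongrightarrow> 0) at_top" by simp
    show "((\<lambda>t. sobolev_norm s (\<lambda>x. u t x - heat_profile A_inf (LINT y|lborel. u\<^sub>0 y) t x) / t powr (- real CARD('n) / 4)) \<longlongrightarrow> 0) at_top"
    proof (rule Lim_transform_eventually[OF l])
      show "\<forall>\<^sub>F t in at_top. sqrt (t powr (real CARD('n) / 2) * E t) =
        sobolev_norm s (\<lambda>x. u t x - heat_profile A_inf (LINT y|lborel. u\<^sub>0 y) t x) / t powr (- real CARD('n) / 4)"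
        using eventually_gt_at_top[of 0]
      proof eventually_elim
        case (elim t)
        have "(t powr (real CARD('n) / 2)) powr (1 / 2) = t powr (real CARD('n) / 4)" by (simp only: powr_powr) simp
        hence h: "sqrt (t powr (real CARD('n) / 2)) = t powr (real CARD('n) / 4)"
          by (simp only: powr_half_sqrt[OF powr_ge_zero])
        have q: "t powr (- real CARD('n) / 4) = inverse (t powr (real CARD('n) / 4))"
          using powr_minus[of t "real CARD('n) / 4"] by (simp only: minus_divide_left)
        show ?case
          unfolding norm_eq[OF elim] real_sqrt_mult h q unfolding divide_inverse inverse_inverse_eq by (rule mult.commute)
      qed
    qed
    show "\<forall>\<^sub>F t::real in at_top. t powr (- real CARD('n) / 4) \<noteq> 0"
      using eventually_gt_at_top[of 0] by eventually_elim simp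
  qed
qed

end
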